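(* For every integer $r\geq 2$ there exists $M_r$ such that the following holds. Let $T$ be an Erdős–Sós tree on $t\geq M_r$ vertices and let $\mathcal{T}$ be the $(r-2)$-expansion of $T$. Then there exists $n_0$ such that for all $n\geq n_0$, the balanced blowup $\mathcal{K}^{(r)}_{t+r-3}(n)$ is (up to isomorphism) the unique $\mathrm{Ext}(\mathcal{T})$-free $r$-graph on $n$ vertices with the maximum number of edges.
   Context: An $r$-graph is an $r$-uniform hypergraph; an $r$-graph $\mathcal{G}$ is $\mathcal{F}$-free if it contains no (not necessarily induced) subgraph isomorphic to $\mathcal{F}$. A tree $T$ on $k$ vertices is an Erdős–Sós tree if every simple graph with average degree greater than $k-2$ contains $T$ as a subgraph. The $(r-2)$-expansion of a graph $G$ is the $r$-graph obtained by adding $r-2$ new vertices to $G$ and enlarging every edge of $G$ by these same $r-2$ vertices. A pair of vertices of an $r$-graph $\mathcal{G}$ is covered if it is contained in some edge of $\mathcal{G}$, and uncovered otherwise. The extension $\mathrm{Ext}(\mathcal{G})$ is obtained from $\mathcal{G}$ by adding, for every uncovered pair $P$, $r-2$ new vertices $v^P_1,\dots,v^P_{r-2}$ (distinct for different pairs) and the edge $P\cup\{v^P_1,\dots,v^P_{r-2}\}$. The balanced blowup $\mathcal{K}^{(r)}_p(n)$ is the $r$-graph on $n$ vertices with a partition $(P_1,\dots,P_p)$ of its vertex set with $|P_i|\in\{\lfloor n/p\rfloor,\lceil n/p\rceil\}$, in which an $r$-set is an edge iff it contains at most one vertex of each $P_i$. *)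

theory Defs
  imports Complex_Main "HOL-Library.Disjoint_Sets"
begin

record 'a hypergraph =
  verts :: "'a set"
  edges :: "'a set set"

definition r_graph :: "nat \<Rightarrow> 'a hypergraph \<Rightarrow> bool" where
  "r_graph r G \<longleftrightarrow> finite (verts G) \<and> (\<forall>e\<in>edges G. e \<subseteq> verts G \<and> card e = r)"

abbreviation simple_graph :: "'a hypergraph \<Rightarrow> bool" where
  "simple_graph \<equiv> r_graph 2"

definition isomorphic :: "'a hypergraph \<Rightarrow> 'b hypergraph \<Rightarrow> bool" where
  "isomorphic G H \<longleftrightarrow>
     (\<exists>f. bij_betw f (verts G) (verts H) \<and> edges H = (\<lambda>e. f ` e) ` edges G)"

definition subgraph :: "'a hypergraph \<Rightarrow> 'a hypergraph \<Rightarrow> bool" where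
  "subgraph H G \<longleftrightarrow>
     verts H \<subseteq> verts G \<and> edges H \<subseteq> edges G \<and> (\<forall>e\<in>edges H. e \<subseteq> verts H)"

definition contains_copy :: "'a hypergraph \<Rightarrow> 'b hypergraph \<Rightarrow> bool" where
  "contains_copy G F \<longleftrightarrow> (\<exists>H. subgraph H G \<and> isomorphic F H)"

definition free_of :: "'b hypergraph \<Rightarrow> 'a hypergraph \<Rightarrow> bool" where
  "free_of F G \<longleftrightarrow> \<not> contains_copy G F"


definition degree :: "'a hypergraph \<Rightarrow> 'a \<Rightarrow> nat" where
  "degree G v = card {e \<in> edges G. v \<in> e}"

definition average_degree :: "'a hypergraph \<Rightarrow> real" where
  "average_degree G = (\<Sum>v\<in>verts G. real (degree G v)) / real (card (verts G))"

definition connected_graph :: "'a hypergraph \<Rightarrow> bool" where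
  "connected_graph G \<longleftrightarrow> verts G \<noteq> {} \<and>
     (\<forall>u\<in>verts G. \<forall>v\<in>verts G. (u, v) \<in> {(x, y). {x, y} \<in> edges G}\<^sup>*)"

text \<open>A cycle is given by the list of its pairwise distinct vertices in cyclic order.\<close>
definition is_cycle :: "'a hypergraph \<Rightarrow> 'a list \<Rightarrow> bool" where
  "is_cycle G c \<longleftrightarrow> 3 \<le> length c \<and> distinct c \<and>
     (\<forall>i<length c. {c ! i, c ! (Suc i mod length c)} \<in> edges G)"

definition is_tree :: "'a hypergraph \<Rightarrow> bool" where
  "is_tree T \<longleftrightarrow> simple_graph T \<and> connected_graph T \<and> (\<nexists>c. is_cycle T c)"

text \<open>All graphs here are finite, so quantifying over graphs with vertices in
  \<^typ>\<open>nat\<close> covers every simple graph up to isomorphism.  The graph is required to be nonempty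
  so that its average degree is meaningful, and \<open>k - 2\<close> is taken in the reals.\<close>
definition erdos_sos_tree :: "'a hypergraph \<Rightarrow> bool" where
  "erdos_sos_tree T \<longleftrightarrow> is_tree T \<and>
     (\<forall>G :: nat hypergraph. simple_graph G \<and> verts G \<noteq> {} \<and>
        average_degree G > real (card (verts T)) - 2 \<longrightarrow> contains_copy G T)"


text \<open>The \<open>(r - 2)\<close>-expansion; the new vertices are \<open>Inr 0, \<dots>, Inr (r - 3)\<close>.\<close>
definition expansion :: "nat \<Rightarrow> 'a hypergraph \<Rightarrow> ('a + nat) hypergraph" where
  "expansion r G =
     \<lparr>verts = Inl ` verts G \<union> Inr ` {..<r - 2},
      edges = (\<lambda>e. Inl ` e \<union> Inr ` {..<r - 2}) ` edges G\<rparr>"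

definition uncovered_pairs :: "'a hypergraph \<Rightarrow> 'a set set" where
  "uncovered_pairs G =
     {P. P \<subseteq> verts G \<and> card P = 2 \<and> \<not> (\<exists>e\<in>edges G. P \<subseteq> e)}"

text \<open>The new vertices attached to an uncovered pair \<open>P\<close> are \<open>Inr (P, 0), \<dots>, Inr (P, r - 3)\<close>.\<close>
definition Ext :: "nat \<Rightarrow> 'a hypergraph \<Rightarrow> ('a + 'a set \<times> nat) hypergraph" where
  "Ext r G =
     \<lparr>verts = Inl ` verts G \<union> Inr ` (uncovered_pairs G \<times> {..<r - 2}),
      edges = (\<lambda>e. Inl ` e) ` edges G \<union>
              (\<lambda>P. Inl ` P \<union> Inr ` ({P} \<times> {..<r - 2})) ` uncovered_pairs G\<rparr>"


definition balanced_blowup :: "nat \<Rightarrow> nat \<Rightarrow> nat \<Rightarrow> 'a hypergraph \<Rightarrow> bool" where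
  "balanced_blowup r p n K \<longleftrightarrow> finite (verts K) \<and> card (verts K) = n \<and>
     (\<exists>P :: nat \<Rightarrow> 'a set.
        disjoint_family_on P {1..p} \<and> (\<Union>i\<in>{1..p}. P i) = verts K \<and>
        (\<forall>i\<in>{1..p}. int (card (P i)) \<in> {\<lfloor>real n / real p\<rfloor>, \<lceil>real n / real p\<rceil>}) \<and>
        edges K = {e. e \<subseteq> verts K \<and> card e = r \<and> (\<forall>i\<in>{1..p}. card (e \<inter> P i) \<le> 1)})"

text \<open>The competitors \<open>H\<close> have the same vertex type as \<open>G\<close>; over an infinite type every finite
  hypergraph is represented up to isomorphism.\<close>
definition extremal :: "nat \<Rightarrow> 'b hypergraph \<Rightarrow> nat \<Rightarrow> 'a hypergraph \<Rightarrow> bool" where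
  "extremal r F n G \<longleftrightarrow>
     r_graph r G \<and> card (verts G) = n \<and> free_of F G \<and>
     (\<forall>H :: 'a hypergraph. r_graph r H \<and> card (verts H) = n \<and> free_of F H \<longrightarrow>
        card (edges H) \<le> card (edges G))"

text \<open>Being a balanced blowup is a predicate; it is satisfiable for all \<open>n\<close> as soon as \<open>p\<close> is
  positive.\<close>
lemma balanced_blowup_exists:
  assumes "0 < p"
  shows "\<exists>K :: nat hypergraph. balanced_blowup r p n K"
proof -
  define P where "P i = {v \<in> {..<n}. Suc (v mod p) = i}" for i
  define K where "K = \<lparr>verts = {..<n},
    edges = {e. e \<subseteq> {..<n} \<and> card e = r \<and> (\<forall>i\<in>{1..p}. card (e \<inter> P i) \<le> 1)}\<rparr>"
  have card_P: "int (card (P i)) \<in> {\<lfloor>real n / real p\<rfloor>, \<lceil>real n / real p\<rceil>}" if "i \<in> {1..p}" for i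
  proof -
    define j where "j = i - 1"
    have j: "j < p" "i = Suc j" using that by (auto simp: j_def)
    define m where "m = n div p + (if j < n mod p then 1 else 0)"
    have lt: "k * p + j < n \<longleftrightarrow> k < m" for k
    proof -
      have n: "n = (n div p) * p + n mod p" by simp
      have less: "n mod p < p" using assms by simp
      consider "k < n div p" | "k = n div p" | "n div p < k" by linarith
      then show ?thesis
      proof cases
        case 1
        then have "Suc k * p \<le> (n div p) * p" by (intro mult_le_mono1) simp
        then have "k * p + p \<le> (n div p) * p" by simp
        then have "k * p + j < n" using j(1) n by linarith
        then show ?thesis using 1 by (simp add: m_def)
      next
        case 2
        have "(n div p) * p + j < n \<longleftrightarrow> j < n mod p" using n by linarith
        then show ?thesis using 2 by (auto simp: m_def)
      next
        case 3
        then have "Suc (n div p) * p \<le> k * p" by (intro mult_le_mono1) simp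
        then have "(n div p) * p + p \<le> k * p" by simp
        then have "\<not> k * p + j < n" using n less by linarith
        then show ?thesis using 3 by (simp add: m_def)
      qed
    qed
    have "P i = (\<lambda>k. k * p + j) ` {..<m}"
    proof (intro equalityI subsetI)
      fix v assume "v \<in> P i"
      then have v: "v < n" "v mod p = j" by (auto simp: P_def j)
      have eq: "(v div p) * p + j = v"
        using div_mult_mod_eq[of v p] unfolding v(2) .
      have "v div p < m"
        using lt[of "v div p"] v(1) unfolding eq by blast
      then show "v \<in> (\<lambda>k. k * p + j) ` {..<m}"
        by (intro image_eqI[of _ _ "v div p"]) (simp_all only: eq lessThan_iff)
    next
      fix v assume "v \<in> (\<lambda>k. k * p + j) ` {..<m}"
      then obtain k where k: "v = k * p + j" "k < m" by blast
      have "v < n" using lt[of k] k by blast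
      moreover have "v mod p = j" using j(1) by (simp add: k(1))
      ultimately show "v \<in> P i" by (simp add: P_def j(2))
    qed
    then have m: "card (P i) = m"
      using assms by (simp add: card_image inj_on_def)
    have fl: "\<lfloor>real n / real p\<rfloor> = int (n div p)"
      by (simp add: floor_divide_of_nat_eq)
    have "\<lceil>real n / real p\<rceil> = int (n div p) + 1" if "0 < n mod p"
    proof -
      have "real n = real (n div p) * real p + real (n mod p)"
        unfolding of_nat_mult[symmetric] of_nat_add[symmetric] div_mult_mod_eq ..
      then have "real n / real p = real (n div p) + real (n mod p) / real p"
        using assms by (simp add: field_simps)
      moreover have "0 < real (n mod p) / real p" "real (n mod p) / real p < 1"
        using that assms by simp_all
      ultimately show ?thesis by (intro ceiling_unique) simp_all
    qed
    then show ?thesis by (auto simp: m m_def fl)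
  qed
  have "disjoint_family_on P {1..p}"
    by (auto simp: disjoint_family_on_def P_def)
  moreover have "(\<Union>i\<in>{1..p}. P i) = verts K"
    using assms by (auto simp: P_def K_def Suc_le_eq)
  moreover have "edges K = {e. e \<subseteq> verts K \<and> card e = r \<and> (\<forall>i\<in>{1..p}. card (e \<inter> P i) \<le> 1)}"
    "finite (verts K)" "card (verts K) = n"
    by (simp_all add: K_def)
  ultimately have "balanced_blowup r p n K"
    unfolding balanced_blowup_def using card_P by blast
  then show ?thesis by blast
qed

end

theory Submission
  imports Defs "HOL-Analysis.Analysis"
begin

text \<open>
  Write \<open>t\<close> for the number of vertices of the tree and \<open>p = t + r - 3\<close>.  Call a hypergraph
  \<open>kfree\<close> if it has no copy of the expansion whose vertices corresponding to the tree are pairwise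
  covered.

  Density.  A maximizer of the Lagrangian with minimal support covers all pairs of its support, so
  for \<open>kfree\<close> hypergraphs one may forbid the expansion itself.  Links of expansion-free hypergraphs
  are expansion-free of smaller uniformity, and for uniformity two the tree is forbidden, so the
  Erdos--Sos property bounds the number of edges.  Carrying a cap on the largest weight through this
  induction shows that the complete hypergraph on \<open>p\<close> vertices is optimal once \<open>t\<close> is large
  compared with \<open>r\<^sup>2\<close>.

  Stability.  Delete vertices of small degree and replace a vertex by a twin of a vertex that it is
  not covered with, as long as possible.  In the terminal hypergraph equality of links is the
  relation of not being covered, and the link of a vertex in a largest twin class is nearly extremal, so it is
  nearly complete \<open>(p - 1)\<close>-partite by induction on the uniformity.  The colouring survives when the
  steps are undone, because an approximately \<open>p\<close>-coloured hypergraph of nearly optimal minimum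
  degree is exactly \<open>p\<close>-colourable: an edge violating the colouring would allow a greedy
  embedding of the expansion with all the edges of the extension.

  Exactness.  Removing the edges over pairs that lie in few edges makes an extension-free hypergraph
  \<open>kfree\<close> at small cost.  Deleting a vertex of too small degree from a hypergraph with as many edges
  as the balanced blowup increases the surplus over the balanced blowup by at least one; hence the
  process stops early, where the previous two steps give a \<open>p\<close>-colouring and thereby a surplus of at
  most zero.  So no vertex was deleted, and the hypergraph is a complete \<open>p\<close>-partite one, whose
  parts must be balanced.
\<close>

section \<open>Lagrangian polynomials of uniform hypergraphs\<close>

text \<open>The core of a copy, the tree with its \<open>r - 2\<close> new vertices, has
  \<open>pp r + 1\<close> vertices, one more than there are parts. So a transversal of a nearly
  complete coloured hypergraph misses exactly one vertex of it. A leaf takes the extra vertex, since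
  only one tree edge then leaves the transversal; every contradiction with a wrong colour arises in
  this way. The Lagrangian cannot be bounded by induction on links alone: if all weights are tiny,
  the loss \<open>s - b\<close> in passing to a link is too small and the constant comes out too
  large. In that range the Erdos--Sos edge count helps, and the cap on the weights makes it
  applicable. The condition \<open>4 * r\<^sup>2 + 4 \<le> t\<close> makes the resulting bound
  \<open>phi\<close> increasing in the cap. Freeness of the extension does not suit symmetrization,
  because a copy may use two twins as new vertices of different added edges. In the configuration
  forbidden by \<open>kfree\<close> all vertices are pairwise covered, so it never contains two
  uncovered twins. Robust pairs, whose edges are not all hit by few vertices, lead back from
  \<open>kfree\<close> to the extension.\<close>

definition kg :: "nat \<Rightarrow> 'a set \<Rightarrow> 'a set set \<Rightarrow> bool" where
  "kg k V E \<longleftrightarrow> finite V \<and> (\<forall>e\<in>E. e \<subseteq> V \<and> card e = k)"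

definition link :: "'a set set \<Rightarrow> 'a \<Rightarrow> 'a set set" where
  "link E v = {f. v \<notin> f \<and> insert v f \<in> E}"

definition lag :: "'a set set \<Rightarrow> ('a \<Rightarrow> real) \<Rightarrow> real" where
  "lag E x = (\<Sum>e\<in>E. \<Prod>v\<in>e. x v)"

definition cov :: "'a set set \<Rightarrow> 'a \<Rightarrow> 'a \<Rightarrow> bool" where
  "cov E u v \<longleftrightarrow> (\<exists>e\<in>E. u \<in> e \<and> v \<in> e)"

lemma kg_finite: "kg k V E \<Longrightarrow> finite E"
  unfolding kg_def by (meson Pow_iff finite_Pow_iff finite_subset subsetI)

lemma kg_finite_edge: "kg k V E \<Longrightarrow> e \<in> E \<Longrightarrow> finite e"
  unfolding kg_def by (meson finite_subset)

lemma kg_edge_subset: "kg k V E \<Longrightarrow> e \<in> E \<Longrightarrow> e \<subseteq> V"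
  and kg_edge_card: "kg k V E \<Longrightarrow> e \<in> E \<Longrightarrow> card e = k"
  and kg_finite_verts: "kg k V E \<Longrightarrow> finite V"
  by (simp_all add: kg_def)

lemma kg_subset: "kg k V E \<Longrightarrow> E' \<subseteq> E \<Longrightarrow> kg k V E'"
  unfolding kg_def by blast

lemma kg_restrict: "kg k V E \<Longrightarrow> U \<subseteq> V \<Longrightarrow> kg k U {e\<in>E. e \<subseteq> U}"
  unfolding kg_def by (auto intro: finite_subset)

lemma kg_link: "kg (Suc k) V E \<Longrightarrow> kg k (V - {v}) (link E v)"
proof -
  assume kg: "kg (Suc k) V E"
  have "f \<subseteq> V - {v} \<and> card f = k" if "f \<in> link E v" for f
  proof -
    have e: "insert v f \<subseteq> V" "card (insert v f) = Suc k" "v \<notin> f"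
      using that kg by (auto simp: kg_def link_def)
    then have "finite f" using kg by (meson finite_insert finite_subset kg_def)
    then show ?thesis using e by auto
  qed
  then show ?thesis using kg by (auto simp: kg_def)
qed

lemma link_finite_edge: "(\<And>e. e \<in> E \<Longrightarrow> finite e) \<Longrightarrow> f \<in> link E v \<Longrightarrow> finite f"
  unfolding link_def by (metis (mono_tags, lifting) finite_insert mem_Collect_eq)

lemma cov_sym: "cov E u v \<longleftrightarrow> cov E v u"
  unfolding cov_def by blast

lemma inj_insert_link: "inj_on (insert v) (link E v)"
  unfolding inj_on_def link_def by (auto simp: insert_ident)

lemma insert_link_image: "insert v ` link E v = {e\<in>E. v \<in> e}"
proof -
  have "e \<in> insert v ` link E v" if "e \<in> E" "v \<in> e" for e
    using that by (intro image_eqI[of _ _ "e - {v}"]) (auto simp: link_def insert_absorb)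
  then show ?thesis by (auto simp: link_def)
qed

lemma finite_link: "finite E \<Longrightarrow> finite (link E v)"
proof -
  assume "finite E"
  then have "finite (insert v ` link E v)" by (simp add: insert_link_image)
  then show ?thesis by (rule finite_imageD[OF _ inj_insert_link])
qed

lemma card_link: "card (link E v) = card {e\<in>E. v \<in> e}"
  using card_image[OF inj_insert_link, of v E] by (simp add: insert_link_image)

lemma lag_containing:
  assumes "\<And>e. e \<in> E \<Longrightarrow> finite e"
  shows "lag {e\<in>E. v \<in> e} x = x v * lag (link E v) x"
proof -
  have fin: "finite f" if "f \<in> link E v" for f
    using link_finite_edge[OF assms that] .
  have "lag {e\<in>E. v \<in> e} x = (\<Sum>f\<in>link E v. \<Prod>u\<in>insert v f. x u)"
    unfolding lag_def insert_link_image[symmetric]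
    by (subst sum.reindex[OF inj_insert_link]) simp
  also have "\<dots> = (\<Sum>f\<in>link E v. x v * (\<Prod>u\<in>f. x u))"
    by (rule sum.cong) (auto simp: fin link_def)
  finally show ?thesis by (simp add: lag_def sum_distrib_left)
qed

lemma lag_split:
  assumes "finite E" "\<And>e. e \<in> E \<Longrightarrow> finite e"
  shows "lag E x = lag {e\<in>E. v \<notin> e} x + x v * lag (link E v) x"
proof -
  have "lag E x = lag {e\<in>E. v \<notin> e} x + lag {e\<in>E. v \<in> e} x"
    unfolding lag_def
    by (subst sum.union_disjoint[symmetric]) (use assms in \<open>auto intro!: sum.cong\<close>)
  then show ?thesis using lag_containing[OF assms(2)] by simp
qed

lemma lag_cong: "(\<And>e v. e \<in> E \<Longrightarrow> v \<in> e \<Longrightarrow> x v = y v) \<Longrightarrow> lag E x = lag E y"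
  unfolding lag_def by (intro sum.cong prod.cong) auto

lemma lag_nonneg: "(\<And>e v. e \<in> E \<Longrightarrow> v \<in> e \<Longrightarrow> 0 \<le> x v) \<Longrightarrow> 0 \<le> lag E x"
  unfolding lag_def by (intro sum_nonneg prod_nonneg) auto

lemma lag_mono_set:
  assumes "finite E" "E' \<subseteq> E" "\<And>e v. e \<in> E \<Longrightarrow> v \<in> e \<Longrightarrow> 0 \<le> x v"
  shows "lag E' x \<le> lag E x"
  unfolding lag_def by (rule sum_mono2) (use assms in \<open>auto intro!: prod_nonneg\<close>)

lemma lag_scale: "kg k V E \<Longrightarrow> lag E (\<lambda>v. s * x v) = s ^ k * lag E x"
  unfolding lag_def kg_def by (simp add: prod.distrib sum_distrib_left)

lemma lag_const: "kg k V E \<Longrightarrow> lag E (\<lambda>v. s) = card E * s ^ k"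
  unfolding lag_def kg_def by simp

text \<open>With all other weights fixed, \<open>lag E\<close> has degree at most one in each of the
  weights of \<open>i\<close> and \<open>j\<close>; \<open>A\<close>, \<open>B\<close>,
  \<open>C\<close> and the second link supply the four coefficients. They depend on \<open>x\<close>
  outside \<open>{i, j}\<close> only, so one choice serves every \<open>y\<close> at once.\<close>

lemma lag_two:
  assumes "finite E" "\<And>e. e \<in> E \<Longrightarrow> finite e" "i \<noteq> j"
  obtains A B C where
    "\<And>y. (\<And>v. v \<noteq> i \<Longrightarrow> v \<noteq> j \<Longrightarrow> y v = x v) \<Longrightarrow>
       lag E y = A + y j * B + y i * C + y i * y j * lag (link (link E i) j) x \<and>
       lag (link E i) y = C + y j * lag (link (link E i) j) x \<and>
       lag (link E j) y = B + y i * lag (link (link E i) j) x"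
proof -
  define A where "A = lag {e\<in>E. i \<notin> e \<and> j \<notin> e} x"
  define B where "B = lag {f\<in>link E j. i \<notin> f} x"
  define C where "C = lag {f\<in>link E i. j \<notin> f} x"
  define D where "D = lag (link (link E i) j) x"
  have fl: "finite f" if "f \<in> link E v" for f v
    using link_finite_edge[OF assms(2) that] .
  have "lag E y = A + y j * B + y i * C + y i * y j * D \<and>
       lag (link E i) y = C + y j * D \<and> lag (link E j) y = B + y i * D"
    if y: "\<And>v. v \<noteq> i \<Longrightarrow> v \<noteq> j \<Longrightarrow> y v = x v" for y
  proof -
    have com: "link (link E j) i = link (link E i) j"
      using assms(3) by (auto simp: link_def insert_commute)
    have D: "lag (link (link E i) j) y = D"
      unfolding D_def by (rule lag_cong, rule y) (auto simp: link_def)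
    then have D': "lag (link (link E j) i) y = D" by (simp add: com)
    have C: "lag {f\<in>link E i. j \<notin> f} y = C" unfolding C_def
      by (rule lag_cong, rule y) (auto simp: link_def)
    have B: "lag {f\<in>link E j. i \<notin> f} y = B" unfolding B_def
      by (rule lag_cong, rule y) (auto simp: link_def)
    have A: "lag {e\<in>E. i \<notin> e \<and> j \<notin> e} y = A" unfolding A_def
      by (rule lag_cong, rule y) auto
    have li: "lag (link E i) y = C + y j * D"
      using lag_split[of "link E i" y j] finite_link[OF assms(1)] fl C D by simp
    have lj: "lag (link E j) y = B + y i * D"
      using lag_split[of "link E j" y i] finite_link[OF assms(1)] fl B D' by simp
    have e: "{e \<in> {e \<in> E. i \<notin> e}. j \<notin> e} = {e\<in>E. i \<notin> e \<and> j \<notin> e}"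
      "link {e \<in> E. i \<notin> e} j = {f\<in>link E j. i \<notin> f}"
      using assms(3) by (auto simp: link_def)
    have "lag {e\<in>E. i \<notin> e} y = A + y j * B"
      using lag_split[of "{e\<in>E. i \<notin> e}" y j] assms(1,2) A B unfolding e by simp
    then have "lag E y = A + y j * B + y i * C + y i * y j * D"
      using lag_split[of E y i] assms(1,2) li by (simp add: algebra_simps)
    then show ?thesis using li lj by simp
  qed
  then show ?thesis using that unfolding D_def by blast
qed

text \<open>An exact second-order Taylor expansion, as the polynomial is multilinear. The quadratic
  term vanishes when \<open>i\<close> and \<open>j\<close> are uncovered; otherwise its coefficient
  is a second link and harmless for small \<open>s\<close>.\<close>

lemma lag_shift:
  assumes "finite E" "\<And>e. e \<in> E \<Longrightarrow> finite e" "i \<noteq> j"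
  shows "lag E (x(i := x i - s, j := x j + s)) =
    lag E x + s * (lag (link E j) x - lag (link E i) x) - s\<^sup>2 * lag (link (link E i) j) x"
proof -
  obtain A B C where *: "\<And>y. (\<And>v. v \<noteq> i \<Longrightarrow> v \<noteq> j \<Longrightarrow> y v = x v) \<Longrightarrow>
       lag E y = A + y j * B + y i * C + y i * y j * lag (link (link E i) j) x \<and>
       lag (link E i) y = C + y j * lag (link (link E i) j) x \<and>
       lag (link E j) y = B + y i * lag (link (link E i) j) x"
    using lag_two[OF assms] by metis
  show ?thesis
    using *[of x] *[of "x(i := x i - s, j := x j + s)"] assms(3)
    by (simp add: algebra_simps power2_eq_square)
qed

text \<open>Euler's identity for homogeneous polynomials: \<open>lag (link E v) x\<close> is the
  partial derivative at \<open>v\<close>.\<close>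

lemma lag_euler:
  assumes "kg k V E"
  shows "(\<Sum>v\<in>V. x v * lag (link E v) x) = k * lag E x"
proof -
  have fV: "finite V" using assms by (simp add: kg_def)
  note fE = kg_finite[OF assms]
  have "x v * lag (link E v) x = lag {e\<in>E. v \<in> e} x" for v
    using lag_containing[of E v x] kg_finite_edge[OF assms] by simp
  then have "(\<Sum>v\<in>V. x v * lag (link E v) x) = (\<Sum>v\<in>V. lag {e\<in>E. v \<in> e} x)"
    by simp
  also have "\<dots> = (\<Sum>v\<in>V. \<Sum>e\<in>E. if v \<in> e then (\<Prod>u\<in>e. x u) else 0)"
    unfolding lag_def sum.inter_filter[OF fE] ..
  also have "\<dots> = (\<Sum>e\<in>E. \<Sum>v\<in>V. if v \<in> e then (\<Prod>u\<in>e. x u) else 0)"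
    by (rule sum.swap)
  also have "\<dots> = (\<Sum>e\<in>E. k * (\<Prod>u\<in>e. x u))"
  proof (rule sum.cong[OF refl])
    fix e assume "e \<in> E"
    then have "{v\<in>V. v \<in> e} = e" "card e = k" using assms by (auto simp: kg_def)
    then show "(\<Sum>v\<in>V. if v \<in> e then (\<Prod>u\<in>e. x u) else 0) = k * (\<Prod>u\<in>e. x u)"
      using fV by (simp add: sum.inter_filter[symmetric])
  qed
  finally show ?thesis by (simp add: lag_def sum_distrib_left)
qed

text \<open>The handshake identity, which is \<open>lag_euler\<close> at the all-one
  weights.\<close>

lemma sum_card_link:
  assumes "kg k V E"
  shows "(\<Sum>v\<in>V. card (link E v)) = k * card E"
proof -
  have "real (\<Sum>v\<in>V. card (link E v)) = (\<Sum>v\<in>V. 1 * lag (link E v) (\<lambda>_. 1))"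
    by (simp add: lag_def)
  also have "\<dots> = real (k * card E)" by (subst lag_euler[OF assms]) (simp add: lag_def)
  finally show ?thesis by linarith
qed

section \<open>Maximizers of Lagrangians on capped simplices\<close>

definition wsimplex :: "'a set \<Rightarrow> real \<Rightarrow> real \<Rightarrow> ('a \<Rightarrow> real) set" where
  "wsimplex V a s = {x. (\<forall>i\<in>V. 0 \<le> x i \<and> x i \<le> a) \<and> (\<forall>i. i \<notin> V \<longrightarrow> x i = 0) \<and> sum x V = s}"

text \<open>Pinning the coordinates outside \<open>V\<close> to zero makes \<open>wsimplex\<close> a
  closed subset of a product of compact sets, hence compact as a set of total functions;
  \<open>lag E\<close> is a polynomial and so continuous on it.\<close>

lemma lag_maximizer:
  fixes E :: "'a set set"
  assumes "kg k V E" "z \<in> wsimplex V a s"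
  obtains x where "x \<in> wsimplex V a s" "\<And>y. y \<in> wsimplex V a s \<Longrightarrow> lag E y \<le> lag E x"
proof -
  define B where "B = PiE UNIV (\<lambda>i. if i \<in> V then {0..a} else {0::real})"
  have "compactin (product_topology (\<lambda>_. euclidean) UNIV) B"
    unfolding B_def by (subst compactin_PiE) (auto simp: compactin_euclidean_iff)
  then have cB: "compact B"
    by (simp add: euclidean_product_topology compactin_euclidean_iff)
  have cont_sum: "continuous_on UNIV (\<lambda>x::'a\<Rightarrow>real. sum x V)"
    by (intro continuous_intros continuous_on_product_coordinates)
  have "closed ((\<lambda>x::'a\<Rightarrow>real. sum x V) -` {s})"
    by (rule closed_vimage[OF _ cont_sum]) simp
  then have "compact (B \<inter> (\<lambda>x. sum x V) -` {s})"
    using cB by blast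
  moreover have "B \<inter> (\<lambda>x. sum x V) -` {s} = wsimplex V a s"
    by (auto simp: B_def wsimplex_def PiE_def Pi_def split: if_splits)
  ultimately have "compact (wsimplex V a s)" by simp
  moreover have "continuous_on (wsimplex V a s) (lag E)"
    unfolding lag_def
    by (intro continuous_intros continuous_on_subset[OF continuous_on_product_coordinates]) auto
  ultimately show ?thesis
    using continuous_attains_sup[of "wsimplex V a s" "lag E"] assms(2) that by blast
qed

text \<open>Among the vertices of largest weight take one with the largest derivative. A lighter
  vertex has room below the cap, so if its derivative were larger, a small shift towards it would
  increase \<open>lag E\<close>. Hence this derivative dominates all others and
  \<open>lag_euler\<close> gives the bound. That \<open>i\<close> has the largest weight matters
  later: its weight becomes the cap in the link.\<close>

lemma lag_KKT:
  assumes kg: "kg k V E" and x: "x \<in> wsimplex V a s"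
    and mx: "\<And>y. y \<in> wsimplex V a s \<Longrightarrow> lag E y \<le> lag E x" and V: "V \<noteq> {}"
  obtains i where "i \<in> V" "\<And>j. j \<in> V \<Longrightarrow> x j \<le> x i" "k * lag E x \<le> s * lag (link E i) x"
proof -
  have fV: "finite V" using kg by (simp add: kg_def)
  note fE = kg_finite[OF kg] and fe = kg_finite_edge[OF kg]
  have x0: "0 \<le> x j" "x j \<le> a" if "j \<in> V" for j using x that by (auto simp: wsimplex_def)
  define m where "m = Max (x ` V)"
  have mV: "x j \<le> m" if "j \<in> V" for j using that fV by (simp add: m_def)
  define I where "I = {i\<in>V. x i = m}"
  have "m \<in> x ` V" unfolding m_def using V fV by (intro Max_in) auto
  then have I: "finite I" "I \<noteq> {}" using fV by (auto simp: I_def)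
  define M where "M = Max ((\<lambda>i. lag (link E i) x) ` I)"
  have "M \<in> (\<lambda>i. lag (link E i) x) ` I" unfolding M_def using I by (intro Max_in) auto
  then obtain i where i: "i \<in> I" "lag (link E i) x = M" by auto
  have iV: "i \<in> V" "x i = m" using i by (auto simp: I_def)
  have le: "lag (link E j) x \<le> M" if j: "j \<in> V" for j
  proof (cases "j \<in> I")
    case True then show ?thesis using I by (simp add: M_def)
  next
    case False
    then have lt: "x j < x i" using mV[OF j] iV j by (auto simp: I_def)
    show ?thesis
    proof (rule ccontr)
      assume "\<not> ?thesis"
      then have g: "0 < lag (link E j) x - M" by simp
      define g where "g = lag (link E j) x - M"
      define D where "D = lag (link (link E i) j) x"
      have g0: "0 < g" using g by (simp add: g_def)
      have D0: "0 \<le> D" unfolding D_def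
      proof (rule lag_nonneg)
        fix e v assume "e \<in> link (link E i) j" "v \<in> e"
        then have "insert i (insert j e) \<in> E" by (simp add: link_def)
        then have "insert i (insert j e) \<subseteq> V" by (rule kg_edge_subset[OF kg])
        then show "0 \<le> x v" using \<open>v \<in> e\<close> x0 by blast
      qed
      \<comment> \<open>The first bound keeps both changed weights between zero and the cap; the
        second makes the linear gain exceed the quadratic loss.\<close>
      define d where "d = min ((x i - x j) / 2) (g / (2 * (D + 1)))"
      have d: "0 < d" "d \<le> (x i - x j) / 2" "d \<le> g / (2 * (D + 1))"
        using lt g D0 unfolding d_def g_def by (simp_all only: min.cobounded1 min.cobounded2 min_less_iff_conj) auto
      have "d * D \<le> d * (D + 1)" using d by simp
      also have "\<dots> \<le> g / 2" using d(3) D0 by (simp add: field_simps)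
      finally have "d * D < g" using g0 by simp
      then have pos: "0 < d * g - d\<^sup>2 * D" using d(1) by (simp add: power2_eq_square mult.assoc)
      have ij: "i \<noteq> j" using lt by auto
      define y where "y = x(i := x i - d, j := x j + d)"
      have "sum y V = s"
      proof -
        have "sum y V = (\<Sum>v\<in>V. x v + (if v = i then - d else 0) + (if v = j then d else 0))"
          using ij by (intro sum.cong) (auto simp: y_def)
        also have "\<dots> = sum x V" using fV iV j by (simp add: sum.distrib)
        finally show ?thesis using x by (simp add: wsimplex_def)
      qed
      moreover have "0 \<le> y v \<and> y v \<le> a" if "v \<in> V" for v
        using x0[OF that] x0[OF iV(1)] x0[OF j] d lt that by (auto simp: y_def)
      moreover have "y v = 0" if "v \<notin> V" for v
        using that iV j x by (auto simp: y_def wsimplex_def)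
      ultimately have "y \<in> wsimplex V a s" by (auto simp: wsimplex_def)
      then have "lag E y \<le> lag E x" by (rule mx)
      moreover have "lag E y = lag E x + d * g - d\<^sup>2 * D"
        unfolding y_def g_def D_def using lag_shift[OF fE fe ij] i by simp
      ultimately show False using pos by simp
    qed
  qed
  have "k * lag E x = (\<Sum>v\<in>V. x v * lag (link E v) x)" using lag_euler[OF kg] by simp
  also have "\<dots> \<le> (\<Sum>v\<in>V. x v * M)"
    by (intro sum_mono mult_left_mono le x0)
  also have "\<dots> = s * M" using x by (simp add: wsimplex_def sum_distrib_right[symmetric])
  finally show ?thesis using that[of i] iV mV i by simp
qed

definition ksets :: "'a set \<Rightarrow> nat \<Rightarrow> 'a set set" where
  "ksets V k = {e. e \<subseteq> V \<and> card e = k}"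

lemma kg_ksets: "finite V \<Longrightarrow> kg k V (ksets V k)"
  by (auto simp: kg_def ksets_def)

lemma link_ksets: "finite V \<Longrightarrow> v \<in> V \<Longrightarrow> link (ksets V (Suc k)) v = ksets (V - {v}) k"
proof -
  assume V: "finite V" "v \<in> V"
  have "card (insert v f) = Suc (card f)" if "f \<subseteq> V" "v \<notin> f" for f
    using that V(1) by (meson card_insert_disjoint finite_subset)
  then have "f \<subseteq> V \<Longrightarrow> v \<notin> f \<Longrightarrow> card (insert v f) = Suc k \<longleftrightarrow> card f = k" for f by simp
  then show ?thesis using V(2) unfolding link_def ksets_def by blast
qed

text \<open>Maclaurin's inequality; the induction works because the largest coordinate of a maximizer is
  at least the mean.\<close>
lemma lag_ksets_le:
  assumes "finite V" "card V = q" "0 < q" "\<And>v. v \<in> V \<Longrightarrow> 0 \<le> x v" "sum x V = s"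
  shows "lag (ksets V k) x \<le> (q choose k) * (s / q) ^ k"
  using assms
proof (induction k arbitrary: V q x s)
  case 0
  have "ksets V 0 = {{}}" using 0 by (auto simp: ksets_def finite_subset)
  then show ?case by (simp add: lag_def)
next
  case (Suc k)
  have s0: "0 \<le> s" using Suc.prems by (auto intro: sum_nonneg)
  define x' where "x' v = (if v \<in> V then x v else 0)" for v
  have xs: "x v \<le> s" if "v \<in> V" for v
    using member_le_sum[of v V x] Suc.prems that by auto
  have x': "x' \<in> wsimplex V s s"
    using Suc.prems xs by (auto simp: wsimplex_def x'_def)
  have kg: "kg (Suc k) V (ksets V (Suc k))" using Suc.prems kg_ksets by blast
  obtain y where y: "y \<in> wsimplex V s s" "\<And>z. z \<in> wsimplex V s s \<Longrightarrow> lag (ksets V (Suc k)) z \<le> lag (ksets V (Suc k)) y"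
    using lag_maximizer[OF kg x'] by metis
  have V: "V \<noteq> {}" using Suc.prems by auto
  obtain i where i: "i \<in> V" "\<And>j. j \<in> V \<Longrightarrow> y j \<le> y i"
    "Suc k * lag (ksets V (Suc k)) y \<le> s * lag (link (ksets V (Suc k)) i) y"
    using lag_KKT[OF kg y V] by metis
  have y0: "0 \<le> y v" if "v \<in> V" for v using that y by (auto simp: wsimplex_def)
  have ys: "sum y V = s" using y by (auto simp: wsimplex_def)
  have "s \<le> q * y i" using sum_bounded_above[of V y "y i"] i(2) ys Suc.prems(2) by simp
  then have yi: "s / q \<le> y i" using Suc.prems(3) by (simp add: field_simps)
  have lk: "link (ksets V (Suc k)) i = ksets (V - {i}) k" using Suc.prems(1) i(1) by (simp add: link_ksets)
  have rest: "sum y (V - {i}) = s - y i" using ys i(1) Suc.prems(1) by (simp add: sum_diff1)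
  have le: "lag (ksets (V - {i}) k) y \<le> ((q - 1) choose k) * (s / q) ^ k"
  proof (cases "q = 1")
    case True
    then obtain b where "V = {b}" using Suc.prems(2) card_1_singletonE by metis
    then have V0: "V - {i} = {}" using i(1) by blast
    have E0: "ksets (V - {i}) k = (if k = 0 then {{}} else {})"
      unfolding V0 ksets_def by auto
    show ?thesis unfolding E0 lag_def True using s0 by simp
  next
    case False
    then have q: "0 < q - 1" using Suc.prems by simp
    have "lag (ksets (V - {i}) k) y \<le> ((q - 1) choose k) * ((s - y i) / real (q - 1)) ^ k"
    proof (rule Suc.IH)
      show "card (V - {i}) = q - 1" using Suc.prems(1,2) i(1) by simp
      show "sum y (V - {i}) = s - y i" by (rule rest)
      show "finite (V - {i})" using Suc.prems(1) by simp
      show "0 \<le> y v" if "v \<in> V - {i}" for v using y0 that by blast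
    qed (rule q)
    also have "\<dots> \<le> ((q - 1) choose k) * (s / q) ^ k"
    proof -
      \<comment> \<open>The chosen weight is at least the mean, so the mean of the remaining weights
        is at most \<open>s / q\<close>.\<close>
      have "(s - y i) / real (q - 1) \<le> (s - s / q) / real (q - 1)"
        using yi by (intro divide_right_mono) auto
      also have "\<dots> = s / q" using q by (simp add: field_simps of_nat_diff)
      finally have 1: "(s - y i) / real (q - 1) \<le> s / q" .
      have "0 \<le> sum y (V - {i})" using y0 by (intro sum_nonneg) auto
      then have "0 \<le> (s - y i) / real (q - 1)" using rest by simp
      with 1 show ?thesis by (intro mult_left_mono power_mono) auto
    qed
    finally show ?thesis .
  qed
  have "Suc k * lag (ksets V (Suc k)) x' \<le> Suc k * lag (ksets V (Suc k)) y"
    using y(2)[OF x'] by simp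
  also have "\<dots> \<le> s * (((q - 1) choose k) * (s / q) ^ k)"
    using i(3) le s0 unfolding lk by (meson mult_left_mono order_trans)
  also have "\<dots> = (q * ((q - 1) choose k)) * (s / q) ^ Suc k"
    using Suc.prems(3) by simp
  also have "q * ((q - 1) choose k) = Suc k * (q choose Suc k)"
    using Suc_times_binomial[of k "q - 1"] Suc.prems(3) by simp
  finally have "lag (ksets V (Suc k)) x' \<le> (q choose Suc k) * (s / q) ^ Suc k"
    by (simp only: of_nat_mult mult.assoc mult_le_cancel_left_pos of_nat_0_less_iff zero_less_Suc)
  moreover have "lag (ksets V (Suc k)) x' = lag (ksets V (Suc k)) x"
    by (rule lag_cong) (auto simp: ksets_def x'_def)
  ultimately show ?case by simp
qed

lemma lag_le_power:
  assumes "kg k V E" "\<And>v. v \<in> V \<Longrightarrow> 0 \<le> x v"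
  shows "lag E x \<le> (sum x V) ^ k"
proof (cases "V = {}")
  case True
  then have "E \<subseteq> {{}}" using assms(1) unfolding kg_def by blast
  then consider "E = {}" | "E = {{}}" by blast
  then show ?thesis
  proof cases
    case 1
    then show ?thesis using True by (simp add: lag_def)
  next
    case 2
    then have "k = 0" using assms(1) by (simp add: kg_def)
    then show ?thesis by (simp add: 2 lag_def)
  qed
next
  case False
  have fV: "finite V" using assms by (simp add: kg_def)
  then have q: "0 < card V" using False by auto
  have "E \<subseteq> ksets V k" using assms by (auto simp: kg_def ksets_def)
  then have "lag E x \<le> lag (ksets V k) x"
    using kg_finite[OF kg_ksets[OF fV]] assms by (intro lag_mono_set) (auto simp: ksets_def)
  also have "\<dots> \<le> (card V choose k) * (sum x V / card V) ^ k"
    by (rule lag_ksets_le) (use fV q assms in auto)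
  also have "\<dots> \<le> card V ^ k * (sum x V / card V) ^ k"
  proof (rule mult_right_mono)
    show "real (card V choose k) \<le> real (card V ^ k)"
      by (cases "k \<le> card V") (simp_all add: binomial_le_pow binomial_eq_0)
    show "0 \<le> (sum x V / real (card V)) ^ k"
      using assms by (intro zero_le_power divide_nonneg_nonneg sum_nonneg) auto
  qed
  also have "\<dots> = (sum x V) ^ k" using q by (simp add: power_divide)
  finally show ?thesis .
qed

text \<open>Along a shift between two uncovered vertices \<open>lag E\<close> is linear, so all the
  weight of one of them can be moved to the other without loss. This shrinks the support, and a
  support that cannot be shrunk has no uncovered pair.\<close>

lemma lag_min_support:
  assumes kg: "kg k V E" and x: "\<And>v. v \<in> V \<Longrightarrow> 0 \<le> x v"
  shows "\<exists>y. (\<forall>v\<in>V. 0 \<le> y v) \<and> sum y V = sum x V \<and> lag E x \<le> lag E y \<and>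
    (\<forall>u\<in>V. \<forall>v\<in>V. u \<noteq> v \<longrightarrow> 0 < y u \<longrightarrow> 0 < y v \<longrightarrow> cov E u v)"
  using x
proof (induction "card {v\<in>V. 0 < x v}" arbitrary: x rule: less_induct)
  case less
  note fV = kg_finite_verts[OF kg]
  have step: ?case if uv: "u \<in> V" "v \<in> V" "u \<noteq> v" "0 < x u" "0 < x v" "\<not> cov E u v"
    and le: "lag (link E u) x \<le> lag (link E v) x" for u v
  proof -
    \<comment> \<open>Written as \<open>x u - x u\<close> so that \<open>lag_shift\<close> applies
      literally with the shift \<open>x u\<close>.\<close>
    define y where "y = x(u := x u - x u, v := x v + x u)"
    have "link (link E u) v = {}" using uv(6) unfolding link_def cov_def by blast
    then have "lag (link (link E u) v) x = 0" by (simp add: lag_def)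
    then have "lag E y = lag E x + x u * (lag (link E v) x - lag (link E u) x)"
      unfolding y_def using lag_shift[OF kg_finite[OF kg] kg_finite_edge[OF kg] uv(3), of x "x u"]
      by (simp only:)
    then have 1: "lag E x \<le> lag E y" using le uv(4) by simp
    have y0: "0 \<le> y w" if "w \<in> V" for w
      using less.prems[OF that] uv(4,5) by (auto simp: y_def)
    have "sum y V = (\<Sum>w\<in>V. x w + (if w = u then - x u else 0) + (if w = v then x u else 0))"
      using uv(3) by (intro sum.cong) (auto simp: y_def)
    also have "\<dots> = sum x V" using fV uv(1,2) by (simp add: sum.distrib)
    finally have 2: "sum y V = sum x V" .
    have "{w\<in>V. 0 < y w} \<subset> {w\<in>V. 0 < x w}"
    proof
      show "{w\<in>V. 0 < y w} \<subseteq> {w\<in>V. 0 < x w}" using uv(4,5) by (auto simp: y_def split: if_splits)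
      show "{w\<in>V. 0 < y w} \<noteq> {w\<in>V. 0 < x w}" using uv by (auto simp: y_def set_eq_iff)
    qed
    then have "card {w\<in>V. 0 < y w} < card {w\<in>V. 0 < x w}" using fV by (intro psubset_card_mono) auto
    from less.hyps[OF this y0] 1 2 show ?thesis by (metis order_trans)
  qed
  show ?case
  proof (cases "\<forall>u\<in>V. \<forall>v\<in>V. u \<noteq> v \<longrightarrow> 0 < x u \<longrightarrow> 0 < x v \<longrightarrow> cov E u v")
    case True
    then show ?thesis using less.prems by (intro exI[of _ x]) auto
  next
    case False
    then obtain u v where "u \<in> V" "v \<in> V" "u \<noteq> v" "0 < x u" "0 < x v" "\<not> cov E u v" by blast
    note uv = this
    show ?thesis
    proof (cases "lag (link E u) x \<le> lag (link E v) x")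
      case True
      show ?thesis by (rule step[OF uv True])
    next
      case False
      then have "lag (link E v) x \<le> lag (link E u) x" by simp
      then show ?thesis using step[of v u] uv cov_sym[of E u v] by simp
    qed
  qed
qed

lemma lag_min_support_obtain:
  assumes "kg k V E" "\<forall>v\<in>V. 0 \<le> x v"
  obtains y where "\<forall>v\<in>V. 0 \<le> y v" "sum y V = sum x V" "lag E x \<le> lag E y"
    "\<forall>u\<in>V. \<forall>v\<in>V. u \<noteq> v \<longrightarrow> 0 < y u \<longrightarrow> 0 < y v \<longrightarrow> cov E u v"
proof -
  have "\<exists>y. (\<forall>v\<in>V. 0 \<le> y v) \<and> sum y V = sum x V \<and> lag E x \<le> lag E y \<and>
    (\<forall>u\<in>V. \<forall>v\<in>V. u \<noteq> v \<longrightarrow> 0 < y u \<longrightarrow> 0 < y v \<longrightarrow> cov E u v)"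
    by (rule lag_min_support[OF assms(1)]) (rule bspec[OF assms(2)])
  then show ?thesis by (elim exE conjE) (rule that)
qed

lemma cov_mono: "cov E' u v \<Longrightarrow> E' \<subseteq> E \<Longrightarrow> cov E u v"
  unfolding cov_def by (simp add: subset_iff Bex_def) metis

section \<open>Trees and their expansions\<close>

locale estree =
  fixes T :: "nat hypergraph"
  assumes es: "erdos_sos_tree T" and t4: "4 \<le> card (verts T)"
begin

abbreviation VT :: "nat set" where "VT \<equiv> verts T"
abbreviation ET :: "nat set set" where "ET \<equiv> edges T"

definition t :: nat where "t = card VT"

text \<open>The number of parts of the extremal hypergraph in uniformity \<open>k\<close>; the core
  of a copy has one vertex more.\<close>

definition pp :: "nat \<Rightarrow> nat" where "pp k = t + k - 3"

text \<open>The maximum of the Lagrangian of the complete \<open>k\<close>-graph on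
  \<open>pp k\<close> vertices over weights of total one, attained at equal weights.\<close>

definition lam :: "nat \<Rightarrow> real" where "lam k = real (pp k choose k) / real (pp k) ^ k"

text \<open>A copy of the \<open>(k - 2)\<close>-expansion of \<open>T\<close>: the tree vertices are placed by \<open>\<phi>\<close>, and \<open>A\<close> is
  the set of the \<open>k - 2\<close> new vertices.\<close>
definition emb :: "nat \<Rightarrow> nat set set \<Rightarrow> (nat \<Rightarrow> nat) \<Rightarrow> nat set \<Rightarrow> bool" where
  "emb k E \<phi> A \<longleftrightarrow> inj_on \<phi> VT \<and> finite A \<and> card A = k - 2 \<and> A \<inter> \<phi> ` VT = {} \<and>
     (\<forall>e\<in>ET. \<phi> ` e \<union> A \<in> E)"

definition tfree :: "nat \<Rightarrow> nat set set \<Rightarrow> bool" where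
  "tfree k E \<longleftrightarrow> \<not> (\<exists>\<phi> A. emb k E \<phi> A)"

text \<open>Of the edges that the extension adds, only the fact that they cover pairs is kept. The
  new vertices in \<open>A\<close> are covered with everything automatically, see
  \<open>emb_cov\<close>.\<close>

definition kfree :: "nat \<Rightarrow> nat set set \<Rightarrow> bool" where
  "kfree k E \<longleftrightarrow>
     \<not> (\<exists>\<phi> A. emb k E \<phi> A \<and> (\<forall>x\<in>VT. \<forall>y\<in>VT. x \<noteq> y \<longrightarrow> cov E (\<phi> x) (\<phi> y)))"

text \<open>The solution of the recursion \<open>phi_rec\<close> with initial value
  \<open>(t - 2) / 2 * a * s\<close>, which is the bound of \<open>lag2_cap\<close> for graphs with
  weights capped by \<open>a\<close>. At the cap \<open>s / pp k\<close> it equals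
  \<open>lam k * s ^ k\<close>.\<close>

definition phi :: "nat \<Rightarrow> real \<Rightarrow> real \<Rightarrow> real" where
  "phi k a s = (real t - 2) / fact k * a * (\<Prod>j\<le>k - 2. s - real j * a)"

section \<open>Elementary facts on the tree and its embeddings\<close>

lemma t_ge: "4 \<le> t" using t4 by (simp add: t_def)

lemma finite_VT: "finite VT"
  using es by (simp add: erdos_sos_tree_def is_tree_def r_graph_def)

lemma ET_edge: "e \<in> ET \<Longrightarrow> e \<subseteq> VT" "e \<in> ET \<Longrightarrow> card e = 2"
  using es by (auto simp: erdos_sos_tree_def is_tree_def r_graph_def)

lemma ET_pair: "e \<in> ET \<Longrightarrow> \<exists>x y. e = {x, y} \<and> x \<noteq> y \<and> x \<in> VT \<and> y \<in> VT"
  using ET_edge[of e] by (metis card_2_iff insert_subset)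

lemma VT_incident:
  assumes "x \<in> VT"
  shows "\<exists>y\<in>VT. y \<noteq> x \<and> {x, y} \<in> ET"
proof -
  have "\<exists>u\<in>VT. u \<noteq> x"
  proof (rule ccontr)
    assume "\<not> ?thesis"
    then have "VT \<subseteq> {x}" by blast
    then have "card VT \<le> 1" by (metis card_mono card_1_singleton_iff finite.emptyI finite_insert One_nat_def)
    then show False using t4 by simp
  qed
  then obtain u where u: "u \<in> VT" "u \<noteq> x" by blast
  have "(x, u) \<in> {(x, y). {x, y} \<in> ET}\<^sup>*"
    using es assms u unfolding erdos_sos_tree_def is_tree_def connected_graph_def by blast
  then obtain y where y: "{x, y} \<in> ET"
    using u by (auto elim: converse_rtranclE)
  then have "y \<noteq> x" using ET_edge(2)[OF y] by auto
  then show ?thesis using y ET_edge(1)[OF y] by auto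
qed

lemma ET_ex: "\<exists>e. e \<in> ET"
proof -
  have "VT \<noteq> {}" using t4 by auto
  then show ?thesis using VT_incident by blast
qed

lemma emb_core:
  assumes "emb k E \<phi> A" "a \<in> \<phi> ` VT \<union> A"
  shows "\<exists>e\<in>ET. a \<in> \<phi> ` e \<union> A"
  using assms VT_incident ET_ex by blast

text \<open>Every tree vertex lies on a tree edge and every edge of the copy contains all of
  \<open>A\<close>; only pairs of tree vertices need the covering hypothesis.\<close>

lemma emb_cov:
  assumes "emb k E \<phi> A" "\<forall>x\<in>VT. \<forall>y\<in>VT. x \<noteq> y \<longrightarrow> cov E (\<phi> x) (\<phi> y)"
    "a \<in> \<phi> ` VT \<union> A" "b \<in> \<phi> ` VT \<union> A" "a \<noteq> b"
  shows "cov E a b"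
proof -
  have E: "\<phi> ` e \<union> A \<in> E" if "e \<in> ET" for e using assms(1) that by (simp add: emb_def)
  have *: "cov E c d" if c: "c \<in> A" "d \<in> \<phi> ` VT \<union> A" for c d
  proof -
    obtain e where "e \<in> ET" "d \<in> \<phi> ` e \<union> A" using emb_core[OF assms(1) c(2)] by blast
    then show ?thesis unfolding cov_def using E c(1) by blast
  qed
  show ?thesis
  proof (cases "a \<in> A \<or> b \<in> A")
    case True
    then show ?thesis using *[of a b] *[of b a] assms(3,4) cov_sym[of E a b] by auto
  next
    case False
    then obtain x y where "x \<in> VT" "y \<in> VT" "a = \<phi> x" "b = \<phi> y" using assms(3,4) by auto
    then show ?thesis using assms(2,5) by auto
  qed
qed

lemma emb_mono: "emb k E' \<phi> A \<Longrightarrow> E' \<subseteq> E \<Longrightarrow> emb k E \<phi> A"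
  unfolding emb_def by (simp add: subset_iff)

lemma tfree_subset: "tfree k E \<Longrightarrow> E' \<subseteq> E \<Longrightarrow> tfree k E'"
  unfolding tfree_def using emb_mono by metis

lemma kfree_subset: "kfree k E \<Longrightarrow> E' \<subseteq> E \<Longrightarrow> kfree k E'"
  unfolding kfree_def using emb_mono cov_mono by metis

text \<open>Adding \<open>v\<close> to the new vertices lifts a copy in a link by one uniformity.
  That \<open>v\<close> is not the image of a tree vertex holds because each tree vertex lies in
  some edge of the copy, and edges of the link avoid \<open>v\<close>.\<close>

lemma emb_link:
  assumes "2 \<le> k" "emb k (link E v) \<phi> A"
  shows "emb (Suc k) E \<phi> (insert v A)"
proof -
  have 1: "v \<notin> \<phi> ` e \<union> A" "insert v (\<phi> ` e \<union> A) \<in> E" if "e \<in> ET" for e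
    using assms(2) that by (auto simp: emb_def link_def)
  have "v \<notin> \<phi> ` VT" using 1(1) VT_incident by blast
  moreover have "v \<notin> A" using 1(1) ET_ex by blast
  ultimately show ?thesis using assms 1(2) by (auto simp: emb_def Suc_diff_le)
qed

lemma tfree_link: "2 \<le> k \<Longrightarrow> tfree (Suc k) E \<Longrightarrow> tfree k (link E v)"
  using emb_link unfolding tfree_def by metis

section \<open>Lagrangians of graphs without the tree\<close>

lemma es_edges:
  assumes "kg 2 U E" "tfree 2 E"
  shows "real (card E) \<le> (real t - 2) / 2 * card U"
proof (cases "U = {}")
  case True
  then have "E = {}" using assms(1) by (force simp: kg_def)
  then show ?thesis by (simp add: True)
next
  case False
  have fU: "finite U" using assms(1) by (rule kg_finite_verts)
  define G where "G = \<lparr>verts = U, edges = E\<rparr>"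
  have sg: "simple_graph G" using assms(1) by (simp add: G_def r_graph_def kg_def)
  have "\<not> contains_copy G T"
  proof
    assume "contains_copy G T"
    then obtain H f where H: "subgraph H G" "bij_betw f VT (verts H)" "edges H = (\<lambda>e. f ` e) ` ET"
      by (auto simp: contains_copy_def isomorphic_def)
    have "emb 2 E f {}"
      using H by (auto simp: emb_def bij_betw_def subgraph_def G_def)
    then show False using assms(2) by (auto simp: tfree_def)
  qed
  then have "\<not> average_degree G > real t - 2"
    using es sg False unfolding erdos_sos_tree_def t_def G_def by auto
  moreover have "average_degree G = 2 * card E / card U"
  proof -
    have "(\<Sum>v\<in>U. real (Defs.degree G v)) = real (\<Sum>v\<in>U. card (link E v))"
      by (simp add: Defs.degree_def G_def card_link)
    also have "\<dots> = 2 * card E" by (simp add: sum_card_link[OF assms(1)])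
    finally show ?thesis by (simp add: average_degree_def G_def)
  qed
  ultimately show ?thesis using False fU by (simp add: field_simps card_gt_0_iff)
qed

text \<open>Layer cake: peel off the constant function with value the minimal weight.\<close>
lemma es_min_weight:
  assumes "kg 2 U E" "tfree 2 E" "\<And>v. v \<in> U \<Longrightarrow> 0 \<le> x v"
  shows "(\<Sum>e\<in>E. Min (x ` e)) \<le> (real t - 2) / 2 * sum x U"
  using assms
proof (induction "card U" arbitrary: U E x)
  case 0
  then have "U = {}" using kg_finite_verts by fastforce
  then have "E = {}" using 0 by (force simp: kg_def)
  then show ?case using \<open>U = {}\<close> by simp
next
  case (Suc n)
  have fU: "finite U" using Suc.prems kg_finite_verts by blast
  have fE: "finite E" using Suc.prems kg_finite by blast
  have "U \<noteq> {}" using Suc.hyps(2) by auto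
  then obtain v where v: "v \<in> U" "\<And>u. u \<in> U \<Longrightarrow> x v \<le> x u"
    using fU by (metis arg_min_if_finite(1) arg_min_least)
  define y where "y u = x u - x v" for u
  have fe: "finite e" "e \<noteq> {}" "e \<subseteq> U" if "e \<in> E" for e
    using that Suc.prems(1) kg_finite_edge[OF Suc.prems(1)] by (auto simp: kg_def)
  have Mn: "Min (x ` e) = x v + Min (y ` e)" if "e \<in> E" for e
    using Min_add_commute[of e y "x v"] fe[OF that] by (simp add: y_def)
  have M0: "Min (y ` e) \<le> 0" if "e \<in> E" "v \<in> e" for e
    using Min_le[of "y ` e" "y v"] fe[OF that(1)] that(2) by (simp add: y_def)
  have "(\<Sum>e\<in>E. Min (y ` e)) \<le> (\<Sum>e\<in>{e\<in>E. e \<subseteq> U - {v}}. Min (y ` e))"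
  proof -
    have "(\<Sum>e\<in>E. Min (y ` e)) \<le> (\<Sum>e\<in>E. if e \<subseteq> U - {v} then Min (y ` e) else 0)"
    proof (rule sum_mono)
      fix e assume e: "e \<in> E"
      show "Min (y ` e) \<le> (if e \<subseteq> U - {v} then Min (y ` e) else 0)"
        using M0[OF e] fe(3)[OF e] by (cases "v \<in> e") (simp_all add: subset_Diff_insert)
    qed
    then show ?thesis using fE by (simp add: sum.inter_filter)
  qed
  also have "\<dots> \<le> (real t - 2) / 2 * sum y (U - {v})"
  proof (rule Suc.hyps(1))
    show "n = card (U - {v})" using v(1) Suc.hyps(2) fU by simp
    show "kg 2 (U - {v}) {e\<in>E. e \<subseteq> U - {v}}" by (rule kg_restrict[OF Suc.prems(1)]) auto
    show "tfree 2 {e\<in>E. e \<subseteq> U - {v}}" by (rule tfree_subset[OF Suc.prems(2)]) auto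
    show "0 \<le> y u" if "u \<in> U - {v}" for u using that v(2) by (simp add: y_def)
  qed
  also have "sum y (U - {v}) = sum y U" using v(1) fU by (simp add: sum_diff1 y_def)
  also have "sum y U = sum x U - card U * x v" by (simp add: y_def sum_subtractf)
  finally have 1: "(\<Sum>e\<in>E. Min (y ` e)) \<le> (real t - 2) / 2 * (sum x U - card U * x v)" .
  have "card E * x v \<le> (real t - 2) / 2 * card U * x v"
    by (intro mult_right_mono es_edges Suc.prems v(1))
  moreover have "(\<Sum>e\<in>E. Min (x ` e)) = card E * x v + (\<Sum>e\<in>E. Min (y ` e))"
    using Mn by (simp add: sum.distrib)
  ultimately show ?case using 1 by (simp add: algebra_simps)
qed

text \<open>Replacing \<open>x u * x v\<close> by the cap times the smaller weight reduces the
  quadratic form to the sum that \<open>es_min_weight\<close> bounds.\<close>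

lemma lag2_cap:
  assumes "kg 2 U E" "tfree 2 E" "\<And>v. v \<in> U \<Longrightarrow> 0 \<le> x v" "\<And>v. v \<in> U \<Longrightarrow> x v \<le> a"
  shows "lag E x \<le> (real t - 2) / 2 * a * sum x U"
proof (cases "U = {}")
  case True
  then have "E = {}" using assms(1) by (force simp: kg_def)
  then show ?thesis by (simp add: True lag_def)
next
  case False
  then have a0: "0 \<le> a" using assms(3,4) by fastforce
  have "lag E x \<le> (\<Sum>e\<in>E. a * Min (x ` e))"
    unfolding lag_def
  proof (rule sum_mono)
    fix e assume e: "e \<in> E"
    then obtain u v where uv: "e = {u, v}" "u \<noteq> v" using assms(1) unfolding kg_def by (meson card_2_iff)
    then have U: "u \<in> U" "v \<in> U" using assms(1) e unfolding kg_def by auto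
    have "x u * x v \<le> a * min (x u) (x v)"
      using mult_mono[OF assms(4)[OF U(1)] order_refl a0 assms(3)[OF U(2)]]
        mult_mono[OF assms(4)[OF U(2)] order_refl a0 assms(3)[OF U(1)]]
      by (auto simp: min_def mult.commute)
    then show "prod x e \<le> a * Min (x ` e)" using uv by simp
  qed
  also have "\<dots> = a * (\<Sum>e\<in>E. Min (x ` e))" by (simp add: sum_distrib_left)
  also have "\<dots> \<le> a * ((real t - 2) / 2 * sum x U)"
    by (rule mult_left_mono[OF es_min_weight a0]) (use assms in auto)
  finally show ?thesis by (simp add: mult_ac)
qed

lemma lag_restrict_support:
  assumes "finite E" "\<And>e. e \<in> E \<Longrightarrow> finite e" "\<And>e v. e \<in> E \<Longrightarrow> v \<in> e \<Longrightarrow> v \<notin> S \<Longrightarrow> x v = 0"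
  shows "lag E x = lag {e\<in>E. e \<subseteq> S} x"
proof -
  have "lag {e\<in>E. e \<subseteq> S} x = (\<Sum>e\<in>E. if e \<subseteq> S then prod x e else 0)"
    unfolding lag_def using assms(1) by (simp add: sum.inter_filter)
  also have "\<dots> = lag E x" unfolding lag_def
  proof (rule sum.cong[OF refl])
    fix e assume e: "e \<in> E"
    show "(if e \<subseteq> S then prod x e else 0) = prod x e"
    proof (cases "e \<subseteq> S")
      case False
      then obtain v where "v \<in> e" "x v = 0" using assms(3) e by blast
      then show ?thesis using assms(2)[OF e] by (auto intro: prod_zero[symmetric])
    qed simp
  qed
  finally show ?thesis by simp
qed

text \<open>In a graph a covered pair is an edge, so \<open>S\<close> is a clique, and a clique on
  \<open>t\<close> vertices contains any tree on \<open>t\<close> vertices.\<close>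

lemma emb2_clique:
  assumes "kg 2 V E" "S \<subseteq> V" "\<And>u v. u \<in> S \<Longrightarrow> v \<in> S \<Longrightarrow> u \<noteq> v \<Longrightarrow> cov E u v" "t \<le> card S"
  shows "\<exists>\<phi>. emb 2 E \<phi> {} \<and> \<phi> ` VT \<subseteq> S"
proof -
  have fS: "finite S" using assms(1,2) kg_finite_verts finite_subset by blast
  obtain \<phi> where \<phi>: "\<phi> ` VT \<subseteq> S" "inj_on \<phi> VT"
    using card_le_inj[OF finite_VT fS] assms(4) by (auto simp: t_def)
  have "\<phi> ` e \<in> E" if e: "e \<in> ET" for e
  proof -
    obtain x y where xy: "e = {x, y}" "x \<noteq> y" "x \<in> VT" "y \<in> VT" using ET_pair[OF e] by blast
    then have "\<phi> x \<noteq> \<phi> y" using \<phi>(2) by (auto dest: inj_onD)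
    then have "cov E (\<phi> x) (\<phi> y)" using \<phi>(1) xy by (intro assms(3)) auto
    then obtain f where f: "f \<in> E" "\<phi> x \<in> f" "\<phi> y \<in> f" by (auto simp: cov_def)
    have "f = {\<phi> x, \<phi> y}"
    proof (rule sym, rule card_subset_eq)
      show "finite f" using kg_finite_edge[OF assms(1) f(1)] .
      show "card {\<phi> x, \<phi> y} = card f" using kg_edge_card[OF assms(1) f(1)] \<open>\<phi> x \<noteq> \<phi> y\<close> by simp
    qed (use f in auto)
    then show ?thesis using f xy by simp
  qed
  then show ?thesis using \<phi> by (auto simp: emb_def)
qed

text \<open>The Motzkin--Straus argument: a minimal support is a clique, which has at most
  \<open>t - 1\<close> vertices because a larger one would contain the tree.\<close>

lemma lag2_motzkin_straus:
  assumes "kg 2 U E" "tfree 2 E" "\<And>v. v \<in> U \<Longrightarrow> 0 \<le> x v"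
  shows "lag E x \<le> (real t - 2) / (2 * (real t - 1)) * (sum x U)\<^sup>2"
proof -
  obtain y where y: "\<forall>v\<in>U. 0 \<le> y v" "sum y U = sum x U" "lag E x \<le> lag E y"
    "\<forall>u\<in>U. \<forall>v\<in>U. u \<noteq> v \<longrightarrow> 0 < y u \<longrightarrow> 0 < y v \<longrightarrow> cov E u v"
    by (rule lag_min_support_obtain[OF assms(1), of x]) (simp add: assms(3))
  define S where "S = {v\<in>U. 0 < y v}"
  have fU: "finite U" using kg_finite_verts[OF assms(1)] .
  have fS: "finite S" using fU by (simp add: S_def)
  have "\<not> t \<le> card S"
  proof
    assume t: "t \<le> card S"
    have "S \<subseteq> U" by (auto simp: S_def)
    moreover have "cov E u v" if "u \<in> S" "v \<in> S" "u \<noteq> v" for u v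
      using y(4) that unfolding S_def by simp
    ultimately obtain \<phi> where "emb 2 E \<phi> {}" using emb2_clique[OF assms(1) _ _ t] by metis
    then show False using assms(2) unfolding tfree_def by metis
  qed
  then have q: "card S \<le> t - 1" by simp
  have sS: "sum y S = sum x U" unfolding y(2)[symmetric] S_def
    by (rule sum.mono_neutral_left) (use fU y(1) in \<open>auto simp: not_less intro: antisym\<close>)
  have "lag E y = lag {e\<in>E. e \<subseteq> S} y"
  proof (rule lag_restrict_support[OF kg_finite[OF assms(1)] kg_finite_edge[OF assms(1)]])
    fix e v assume "e \<in> E" "v \<in> e" "v \<notin> S"
    moreover then have "v \<in> U" using kg_edge_subset[OF assms(1)] by blast
    ultimately show "y v = 0" using y(1) by (force simp: S_def)
  qed
  also have "\<dots> \<le> lag (ksets S 2) y"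
  proof (rule lag_mono_set[OF kg_finite[OF kg_ksets[OF fS]]])
    show "{e\<in>E. e \<subseteq> S} \<subseteq> ksets S 2"
      using kg_edge_card[OF assms(1)] unfolding ksets_def by blast
    show "0 \<le> y v" if "e \<in> ksets S 2" "v \<in> e" for e v
    proof -
      have "v \<in> S" using that unfolding ksets_def by blast
      then show ?thesis by (simp add: S_def)
    qed
  qed
  finally have 1: "lag E y \<le> lag (ksets S 2) y" .
  show ?thesis
  proof (cases "S = {}")
    case True
    then have "ksets S 2 = {}" by (auto simp: ksets_def)
    then have "lag (ksets S 2) y = 0" by (simp add: lag_def)
    moreover have "0 \<le> (real t - 2) / (2 * (real t - 1)) * (sum x U)\<^sup>2" using t_ge by simp
    ultimately show ?thesis using 1 y(3) by linarith
  next
    case False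
    define q where "q = card S"
    have q: "1 \<le> q" "q \<le> t - 1" using False fS \<open>card S \<le> t - 1\<close> by (auto simp: q_def Suc_le_eq card_gt_0_iff)
    have "lag (ksets S 2) y \<le> (q choose 2) * (sum x U / q) ^ 2"
    proof (rule lag_ksets_le[OF fS _ _ _ sS])
      show "0 \<le> y v" if "v \<in> S" for v using that by (simp add: S_def)
    qed (use q in \<open>simp_all add: q_def\<close>)
    also have "\<dots> = (1 - 1 / q) / 2 * (sum x U)\<^sup>2"
    proof -
      have "2 * (q choose 2) = q * ((q - 1) choose 1)"
        using times_binomial_minus1_eq[of 2 q] by simp
      then have "2 * real (q choose 2) = real q * (real q - 1)"
        using q(1) by (metis choose_one of_nat_1 of_nat_diff of_nat_mult of_nat_numeral)
      then have c: "real (q choose 2) = real q * (real q - 1) / 2" by simp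
      have *: "z * (z - 1) / 2 * (S / z)\<^sup>2 = (1 - 1 / z) / 2 * S\<^sup>2" if "z \<noteq> 0" for z S :: real
        using that by (simp add: power2_eq_square field_simps)
      show ?thesis unfolding c using q(1) by (intro *) simp

    qed
    also have "\<dots> \<le> (1 - 1 / (real t - 1)) / 2 * (sum x U)\<^sup>2"
    proof -
      have "real q \<le> real t - 1" using q(2) t_ge by linarith
      then have "1 / (real t - 1) \<le> 1 / q" using q by (intro divide_left_mono) auto
      then show ?thesis by (intro mult_right_mono divide_right_mono) auto
    qed
    also have "(1 - 1 / (real t - 1)) / 2 = (real t - 2) / (2 * (real t - 1))"
      using t_ge by (simp add: field_simps)
    finally show ?thesis using 1 y(3) by linarith
  qed
qed


section \<open>The bounding function and the Lagrangian theorems\<close>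

lemma pp_Suc: "pp (Suc k) = Suc (pp k)"
  using t_ge by (simp add: pp_def)

lemma pp_ge: "t - 1 \<le> pp k" if "2 \<le> k"
  using that t_ge by (simp add: pp_def)

lemma pp_ge_k: "k + 1 \<le> pp k"
  using t_ge by (simp add: pp_def)

lemma pp_pos: "0 < pp k"
  using pp_ge_k[of k] by linarith

lemma phi_lam:
  assumes "2 \<le> k"
  shows "phi k (s / pp k) s = lam k * s ^ k"
proof -
  define p where "p = real (pp k)"
  have p: "0 < p" using pp_pos by (simp add: p_def)
  obtain m where m: "k = Suc (Suc m)" using assms by (metis Suc_le_D numeral_2_eq_2 Suc_le_mono le_Suc_ex add_2_eq_Suc)
  \<comment> \<open>The factor \<open>t - 2\<close> is the last factor \<open>pp k - (k - 1)\<close>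
    of the falling factorial in \<open>pp k choose k\<close>; this is why \<open>phi\<close> meets
    \<open>lam k\<close> exactly.\<close>
  have pt: "p - real (Suc m) = real t - 2"
    using t_ge by (simp add: p_def pp_def m of_nat_diff)
  have "(\<Prod>j\<le>k - 2. s - real j * (s / p)) = (\<Prod>j\<le>m. (s / p) * (p - real j))"
    using p by (intro prod.cong) (auto simp: m field_simps)
  also have "\<dots> = (s / p) ^ Suc m * (\<Prod>j\<le>m. p - real j)"
    unfolding prod.distrib by simp
  finally have P: "(\<Prod>j\<le>k - 2. s - real j * (s / p)) = (s / p) ^ Suc m * (\<Prod>j\<le>m. p - real j)" .
  have 1: "phi k (s / p) s = (p - real (Suc m)) / fact k * (s / p) * ((s / p) ^ Suc m * (\<Prod>j\<le>m. p - real j))"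
    unfolding phi_def P pt ..
  have "real (pp k choose k) = (\<Prod>j = 0..<k. p - real j) / fact k"
    by (simp add: p_def binomial_gbinomial gbinomial_prod_rev)
  also have "(\<Prod>j = 0..<k. p - real j) = (\<Prod>j\<le>m. p - real j) * (p - real (Suc m))"
    by (simp add: m atLeast0LessThan lessThan_Suc_atMost)
  finally have "lam k = (\<Prod>j\<le>m. p - real j) * (p - real (Suc m)) / fact k / p ^ k"
    by (simp add: lam_def p_def)
  moreover have "s / p * (s / p) ^ Suc m = s ^ k / p ^ k" by (simp add: m power_divide)
  moreover have "phi k (s / p) s = (p - real (Suc m)) / fact k * (s / p * (s / p) ^ Suc m) * (\<Prod>j\<le>m. p - real j)"
    unfolding 1 by (simp only: mult_ac)
  ultimately have "phi k (s / p) s = lam k * s ^ k" by simp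
  then show ?thesis by (simp add: p_def)
qed

text \<open>The recursion mirrors \<open>lag_KKT\<close>: a vertex of weight \<open>b\<close> leaves
  total weight \<open>s - b\<close> for its link. The factor of index zero in the product is
  \<open>s\<close>; the others are those for \<open>s - b\<close>, shifted by one index.\<close>

lemma phi_rec:
  assumes "2 \<le> k"
  shows "s * phi k b (s - b) = real (Suc k) * phi (Suc k) b s"
proof -
  obtain m where m: "k = Suc (Suc m)" using assms by (metis Suc_le_D numeral_2_eq_2 Suc_le_mono le_Suc_ex add_2_eq_Suc)
  have "(\<Prod>j\<le>Suc m. s - real j * b) = s * (\<Prod>j\<le>m. s - b - real j * b)"
    by (subst prod.atMost_Suc_shift) (simp add: algebra_simps)
  then have 1: "phi (Suc k) b s = (real t - 2) / fact (Suc k) * b * (s * (\<Prod>j\<le>m. s - b - real j * b))"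
    by (simp add: phi_def m del: fact_Suc)
  have 2: "phi k b (s - b) = (real t - 2) / fact k * b * (\<Prod>j\<le>m. s - b - real j * b)"
    by (simp add: phi_def m del: fact_Suc)
  have 3: "fact (Suc k) = real (Suc k) * fact k" by (rule fact_Suc)
  have "real (Suc k) * (c / (real (Suc k) * f)) = c / f" for c f :: real by simp
  then have 4: "real (Suc k) * (c / fact (Suc k) * d) = c / fact k * d" for c d :: real
    unfolding 3 by (metis mult.assoc)
  show ?thesis unfolding 1 2 using 4[of "real t - 2" "b * (s * (\<Prod>j\<le>m. s - b - real j * b))"]
    by (simp only: mult_ac)
qed

text \<open>All factors lie between zero and one, so the products differ by at most the sum of the
  differences of corresponding factors.\<close>

lemma prod_one_minus_bounds:
  fixes a b :: real
  assumes "0 \<le> a" "a \<le> b" "real m * b \<le> 1"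
  shows "\<bar>(\<Prod>j\<le>m. 1 - real j * a) - (\<Prod>j\<le>m. 1 - real j * b)\<bar> \<le> real (Suc m) * real m * (b - a)"
proof -
  have c: "norm (1 - real j * c) \<le> 1" if "0 \<le> c" "c \<le> b" "j \<le> m" for c j
  proof -
    have "real j * c \<le> real m * b" using that assms by (intro mult_mono) auto
    then show ?thesis using assms that by simp
  qed
  have "norm ((\<Prod>j\<le>m. 1 - real j * a) - (\<Prod>j\<le>m. 1 - real j * b))
      \<le> (\<Sum>j\<le>m. norm ((1 - real j * a) - (1 - real j * b)))"
    by (rule norm_prod_diff) (use c assms in auto)
  also have "\<dots> \<le> (\<Sum>j\<le>m. real m * (b - a))"
  proof (rule sum_mono)
    fix j assume "j \<in> {..m}"
    then have "real j * (b - a) \<le> real m * (b - a)" using assms by (intro mult_right_mono) auto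
    moreover have "norm ((1 - real j * a) - (1 - real j * b)) = \<bar>real j * (b - a)\<bar>"
      by (simp add: algebra_simps)
    moreover have "0 \<le> real j * (b - a)" using assms by simp
    ultimately show "norm ((1 - real j * a) - (1 - real j * b)) \<le> real m * (b - a)" by linarith
  qed
  finally show ?thesis by simp
qed

text \<open>In \<open>phi k b 1\<close> the factor \<open>b\<close> dominates: the product is at
  least \<open>3 / 4\<close> and changes with slope at most \<open>k\<^sup>2\<close>, while
  \<open>k\<^sup>2 * b \<le> 1 / 4\<close>. This is where \<open>t\<close> has to be large compared
  with \<open>k\<^sup>2\<close>. The explicit slope is used again for stability, in
  \<open>largest_class\<close>.\<close>

lemma phi_gap:
  assumes k: "2 \<le> k" "4 * k\<^sup>2 \<le> pp k" and ab: "0 \<le> a" "a \<le> b" "b \<le> 1 / pp k"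
  shows "(real t - 2) / fact k * ((b - a) / 2) \<le> phi k b 1 - phi k a 1"
proof -
  define m where "m = k - 2"
  define A where "A = (\<Prod>j\<le>m. 1 - real j * a)"
  define B where "B = (\<Prod>j\<le>m. 1 - real j * b)"
  have p0: "0 < real (pp k)" using pp_pos by simp
  have mk: "real (Suc m) * real m \<le> (real k)\<^sup>2"
    unfolding power2_eq_square using k by (intro mult_mono) (auto simp: m_def)
  have kp: "(real k)\<^sup>2 * b \<le> 1 / 4"
  proof -
    have "4 * (real k)\<^sup>2 \<le> real (pp k)" using k(2) by (metis of_nat_le_iff of_nat_mult of_nat_numeral of_nat_power)
    then have "(real k)\<^sup>2 * b \<le> (real (pp k) / 4) * (1 / pp k)" using ab p0 by (intro mult_mono) auto
    then show ?thesis using p0 by simp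
  qed
  have "real k * 1 \<le> real k * real k" using k by (intro mult_left_mono) auto
  then have "real m \<le> (real k)\<^sup>2" by (simp add: m_def power2_eq_square)
  then have "real m * b \<le> (real k)\<^sup>2 * b" using ab by (intro mult_right_mono) auto
  then have mb: "real m * b \<le> 1" using kp by linarith
  then have ma: "real m * a \<le> 1" using ab by (meson mult_left_mono of_nat_0_le_iff order_trans)
  have "\<bar>A - B\<bar> \<le> real (Suc m) * real m * (b - a)"
    unfolding A_def B_def by (rule prod_one_minus_bounds) (use ab mb in auto)
  also have "\<dots> \<le> (real k)\<^sup>2 * (b - a)" using mk ab by (intro mult_right_mono) auto
  finally have AB: "\<bar>A - B\<bar> \<le> (real k)\<^sup>2 * (b - a)" .
  have "\<bar>(\<Prod>j\<le>m. 1 - real j * 0) - A\<bar> \<le> real (Suc m) * real m * (a - 0)"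
    unfolding A_def by (rule prod_one_minus_bounds) (use ab ma in auto)
  also have "\<dots> \<le> (real k)\<^sup>2 * b" using mk ab by (intro mult_mono) auto
  finally have A1: "3 / 4 \<le> A" using kp by simp
  have "b * (A - B) \<le> b * ((real k)\<^sup>2 * (b - a))" using AB ab by (intro mult_left_mono) auto
  also have "\<dots> = ((real k)\<^sup>2 * b) * (b - a)" by simp
  also have "\<dots> \<le> 1 / 4 * (b - a)" using kp ab by (intro mult_right_mono) auto
  finally have 1: "b * (A - B) \<le> 1 / 4 * (b - a)" .
  have "3 / 4 * (b - a) \<le> A * (b - a)" using A1 ab by (intro mult_right_mono) auto
  moreover have "b * B - a * A = A * (b - a) - b * (A - B)" by (simp add: algebra_simps)
  ultimately have "(b - a) / 2 \<le> b * B - a * A" using 1 by linarith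
  then have "(real t - 2) / fact k * ((b - a) / 2) \<le> (real t - 2) / fact k * (b * B - a * A)"
    using t_ge by (intro mult_left_mono) auto
  also have "\<dots> = phi k b 1 - phi k a 1"
    by (simp add: phi_def A_def B_def m_def right_diff_distrib mult.assoc)
  finally show ?thesis .
qed

lemma phi_0: "phi k a 0 = 0"
proof -
  have "(\<Prod>j\<le>k - 2. 0 - real j * a) = 0"
    by (rule prod_zero) (auto intro: bexI[of _ 0])
  then show ?thesis by (simp add: phi_def)
qed

lemma phi_scale: "2 \<le> k \<Longrightarrow> phi k (c * a) (c * s) = c ^ k * phi k a s"
proof -
  assume "2 \<le> k"
  then obtain m where m: "k = Suc (Suc m)" by (metis Suc_le_D numeral_2_eq_2 Suc_le_mono le_Suc_ex add_2_eq_Suc)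
  have "(\<Prod>j\<le>m. c * s - real j * (c * a)) = (\<Prod>j\<le>m. c * (s - real j * a))"
    by (intro prod.cong) (auto simp: algebra_simps)
  also have "\<dots> = c ^ Suc m * (\<Prod>j\<le>m. s - real j * a)" by (simp add: prod.distrib)
  finally show ?thesis by (simp add: phi_def m)
qed

lemma phi_mono:
  assumes k: "2 \<le> k" "4 * k\<^sup>2 \<le> pp k" and ab: "0 \<le> a" "a \<le> b" "b \<le> s / pp k"
  shows "phi k a s \<le> phi k b s"
proof (cases "s = 0")
  case True
  then have "b \<le> 0" using ab(3) by simp
  then have "a = b" using ab(1,2) by linarith
  then show ?thesis by simp
next
  case False
  have "0 \<le> s" using ab pp_pos[of k] by (smt (verit) divide_neg_pos of_nat_0_less_iff)
  then have s: "0 < s" using False by simp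
  have "0 \<le> (real t - 2) / fact k * ((b / s - a / s) / 2)"
    using t_ge ab s by (intro mult_nonneg_nonneg divide_nonneg_nonneg) (auto simp: divide_right_mono)
  also have "\<dots> \<le> phi k (b / s) 1 - phi k (a / s) 1"
    by (rule phi_gap[OF k]) (use ab s in \<open>auto simp: divide_right_mono field_simps\<close>)
  finally have "s ^ k * phi k (a / s) 1 \<le> s ^ k * phi k (b / s) 1" using s by simp
  then show ?thesis using phi_scale[OF k(1), of s "a / s" 1] phi_scale[OF k(1), of s "b / s" 1] s by simp
qed

text \<open>Either the cap \<open>a\<close> binds, and the edge count of the Erdos--Sos property decides, or the
  complete pattern on \<open>pp k\<close> vertices is optimal.\<close>
theorem capped_lagrangian:
  assumes "2 \<le> k" "4 * k\<^sup>2 + 4 \<le> t" "kg k V E" "tfree k E"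
    "\<And>v. v \<in> V \<Longrightarrow> 0 \<le> x v" "\<And>v. v \<in> V \<Longrightarrow> x v \<le> a"
  shows "lag E x \<le> phi k (min a (sum x V / pp k)) (sum x V)"
  using assms
proof (induction k arbitrary: V E x a rule: nat_induct_at_least)
  case base
  define s where "s = sum x V"
  have s0: "0 \<le> s" unfolding s_def using base by (intro sum_nonneg) auto
  have p: "pp 2 = t - 1" by (simp add: pp_def)
  have f: "phi 2 c s = (real t - 2) / 2 * c * s" for c by (simp add: phi_def)
  have 1: "lag E x \<le> (real t - 2) / 2 * a * s" unfolding s_def by (rule lag2_cap) (use base in auto)
  have "lag E x \<le> (real t - 2) / (2 * (real t - 1)) * s\<^sup>2" unfolding s_def
    by (rule lag2_motzkin_straus) (use base in auto)
  also have "\<dots> = (real t - 2) / 2 * (s / pp 2) * s"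
    using t_ge by (simp add: p of_nat_diff power2_eq_square field_simps)
  finally have 2: "lag E x \<le> (real t - 2) / 2 * (s / pp 2) * s" .
  show ?case
  proof (cases "a \<le> s / pp 2")
    case True
    then show ?thesis using 1 unfolding s_def[symmetric] f by (simp only: min_absorb1)
  next
    case False
    then have "s / pp 2 \<le> a" by simp
    then show ?thesis using 2 unfolding s_def[symmetric] f by (simp only: min_absorb2)
  qed
next
  case (Suc k)
  define s where "s = sum x V"
  define p where "p = pp (Suc k)"
  have s0: "0 \<le> s" unfolding s_def using Suc.prems by (intro sum_nonneg) auto
  have k2: "2 \<le> Suc k" using Suc.hyps by simp
  have ksq: "4 * k\<^sup>2 + 4 \<le> 4 * (Suc k)\<^sup>2" by (simp add: power2_eq_square)
  have kp: "4 * (Suc k)\<^sup>2 \<le> pp (Suc k)" "4 * k\<^sup>2 \<le> pp k"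
    using Suc.prems(1) pp_ge[OF k2] pp_ge[OF Suc.hyps] ksq by linarith+
  have p0: "0 < real p" "real (pp k) = real p - 1" using pp_Suc[of k] pp_pos[of "Suc k"] by (auto simp: p_def)
  have p1: "1 < real p" using p0 pp_pos[of k] by linarith
  show ?case
  proof (cases "V = {}")
    case True
    then have "E = {}" using Suc.prems(2) by (force simp: kg_def)
    then show ?thesis by (simp add: True lag_def phi_0)
  next
    case False
    define x' where "x' v = (if v \<in> V then x v else 0)" for v
    have x': "x' \<in> wsimplex V a s" using Suc.prems by (auto simp: wsimplex_def x'_def s_def)
    obtain y where y: "y \<in> wsimplex V a s" "\<And>z. z \<in> wsimplex V a s \<Longrightarrow> lag E z \<le> lag E y"
      using lag_maximizer[OF Suc.prems(2) x'] by metis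
    obtain i where i: "i \<in> V" "\<And>j. j \<in> V \<Longrightarrow> y j \<le> y i" "Suc k * lag E y \<le> s * lag (link E i) y"
      using lag_KKT[OF Suc.prems(2) y False] by metis
    \<comment> \<open>The largest weight bounds all weights in the link of \<open>i\<close>, so the
      induction hypothesis is used with the cap \<open>b\<close> instead of
      \<open>a\<close>.\<close>
    define b where "b = y i"
    have fV: "finite V" using kg_finite_verts[OF Suc.prems(2)] .
    have y0: "0 \<le> y v" "y v \<le> a" if "v \<in> V" for v using that y by (auto simp: wsimplex_def)
    have ys: "sum y V = s" using y by (simp add: wsimplex_def)
    have rest: "sum y (V - {i}) = s - b" using ys i(1) fV by (simp add: sum_diff1 b_def)
    have b: "0 \<le> b" "b \<le> a" "b \<le> s"
      using y0 i(1) member_le_sum[of i V y] fV ys by (auto simp: b_def)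
    have IH: "lag (link E i) y \<le> phi k (min b ((s - b) / pp k)) (s - b)"
      unfolding rest[symmetric]
    proof (rule Suc.IH)
      show "4 * k\<^sup>2 + 4 \<le> t" using Suc.prems(1) ksq by linarith
      show "kg k (V - {i}) (link E i)" by (rule kg_link[OF Suc.prems(2)])
      show "tfree k (link E i)" by (rule tfree_link[OF Suc.hyps Suc.prems(3)])
      show "0 \<le> y v" "y v \<le> b" if "v \<in> V - {i}" for v using that y0 i(2) by (auto simp: b_def)
    qed
    \<comment> \<open>If \<open>b\<close> is at most \<open>s / p\<close>, it still binds as a cap
      in the link and \<open>phi_rec\<close> gives equality. If it is larger, the link bound is
      \<open>lam k * (s - b) ^ k\<close>, which decreases in \<open>b\<close> and meets the
      recursion at \<open>b = s / p\<close>.\<close>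
    have key: "s * phi k (min b ((s - b) / pp k)) (s - b) \<le> Suc k * phi (Suc k) (min b (s / p)) s"
    proof (cases "b \<le> s / p")
      case True
      then have "b * p \<le> s" using p0 by (simp add: field_simps)
      then have "b \<le> (s - b) / pp k" using p1 by (simp add: p0(2) field_simps)
      then show ?thesis using True phi_rec[OF Suc.hyps, of s b] by (simp add: min_def)
    next
      case False
      then have "s < b * p" using p0 by (simp add: field_simps)
      then have "(s - b) / pp k < b" using p1 by (simp add: p0(2) field_simps)
      then have "s * phi k (min b ((s - b) / pp k)) (s - b) = s * (lam k * (s - b) ^ k)"
        using phi_lam[OF Suc.hyps] by simp
      also have "\<dots> \<le> s * (lam k * (s - s / p) ^ k)"
        using False b s0 by (intro mult_left_mono power_mono) (auto simp: lam_def)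
      also have "\<dots> = s * phi k (s / p) (s - s / p)"
      proof -
        have "(s - s / p) / pp k = s / p" using p1 by (simp add: p0(2) field_simps)
        then show ?thesis using phi_lam[OF Suc.hyps, of "s - s / p"] by simp
      qed
      also have "\<dots> = Suc k * phi (Suc k) (s / p) s" by (rule phi_rec[OF Suc.hyps])
      finally show ?thesis using False by simp
    qed
    have "Suc k * lag E x = Suc k * lag E x'"
    proof -
      have "x v = x' v" if "e \<in> E" "v \<in> e" for e v
        using kg_edge_subset[OF Suc.prems(2) that(1)] that(2) by (auto simp: x'_def)
      then show ?thesis using lag_cong[of E x x'] by simp
    qed
    also have "\<dots> \<le> Suc k * lag E y" using y(2)[OF x'] by (intro mult_left_mono) auto
    also have "\<dots> \<le> s * lag (link E i) y" by (rule i(3))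
    also have "\<dots> \<le> s * phi k (min b ((s - b) / pp k)) (s - b)" using IH s0 by (rule mult_left_mono)
    also have "\<dots> \<le> Suc k * phi (Suc k) (min b (s / p)) s" by (rule key)
    also have "\<dots> \<le> Suc k * phi (Suc k) (min a (s / p)) s"
      using b s0 p0 unfolding p_def by (intro mult_left_mono phi_mono[OF k2 kp(1)]) (auto simp: p_def)
    finally show ?thesis unfolding s_def p_def by (simp only: mult_le_cancel_left_pos of_nat_0_less_iff zero_less_Suc)
  qed
qed

text \<open>The edges covering the pairs of the support may leave it. So the restriction
  \<open>F\<close> is only known to be free of the expansion, while \<open>kfree\<close> is applied
  to \<open>E\<close>. The cap is chosen as the total weight and hence does not bind.\<close>

theorem kfree_lagrangian:
  assumes "2 \<le> k" "4 * k\<^sup>2 + 4 \<le> t" "kg k V E" "kfree k E" "\<And>v. v \<in> V \<Longrightarrow> 0 \<le> x v"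
  shows "lag E x \<le> lam k * (sum x V) ^ k"
proof -
  obtain y where y: "\<forall>v\<in>V. 0 \<le> y v" "sum y V = sum x V" "lag E x \<le> lag E y"
    "\<forall>u\<in>V. \<forall>v\<in>V. u \<noteq> v \<longrightarrow> 0 < y u \<longrightarrow> 0 < y v \<longrightarrow> cov E u v"
    by (rule lag_min_support_obtain[OF assms(3), of x]) (simp add: assms(5))
  define s where "s = sum x V"
  have s0: "0 \<le> s" unfolding s_def using assms by (intro sum_nonneg) auto
  have fV: "finite V" using kg_finite_verts[OF assms(3)] .
  define S where "S = {v\<in>V. 0 < y v}"
  have sS: "sum y S = s" unfolding s_def y(2)[symmetric] S_def
    by (rule sum.mono_neutral_left) (use fV y(1) in \<open>auto simp: not_less intro: antisym\<close>)
  define F where "F = {e\<in>E. e \<subseteq> S}"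
  have kgF: "kg k S F" unfolding F_def by (rule kg_restrict[OF assms(3)]) (auto simp: S_def)
  have "lag E y = lag F y" unfolding F_def
  proof (rule lag_restrict_support[OF kg_finite[OF assms(3)] kg_finite_edge[OF assms(3)]])
    fix e v assume "e \<in> E" "v \<in> e" "v \<notin> S"
    moreover then have "v \<in> V" using kg_edge_subset[OF assms(3)] by blast
    ultimately show "y v = 0" using y(1) by (force simp: S_def)
  qed
  have tf: "tfree k F"
    unfolding tfree_def
  proof
    assume "\<exists>\<phi> A. emb k F \<phi> A"
    then obtain \<phi> A where emb: "emb k F \<phi> A" by blast
    then have embE: "emb k E \<phi> A" by (auto simp: emb_def F_def)
    have S: "\<phi> x \<in> S" if "x \<in> VT" for x
      using emb_core[OF emb, of "\<phi> x"] emb that by (auto simp: emb_def F_def)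
    have "cov E (\<phi> x) (\<phi> z)" if "x \<in> VT" "z \<in> VT" "x \<noteq> z" for x z
    proof -
      have "\<phi> x \<noteq> \<phi> z" using emb that by (auto simp: emb_def dest: inj_onD)
      then show ?thesis using y(4) S[OF that(1)] S[OF that(2)] by (auto simp: S_def)
    qed
    then show False using assms(4) embE unfolding kfree_def by blast
  qed
  have ys: "y v \<le> s" if "v \<in> S" for v
    unfolding sS[symmetric] using that fV y(1) by (intro member_le_sum) (auto simp: S_def)
  have "lag F y \<le> phi k (min s (sum y S / pp k)) (sum y S)"
    by (rule capped_lagrangian[OF assms(1,2) kgF tf]) (use ys in \<open>auto simp: S_def\<close>)
  also have "min s (sum y S / pp k) = s / pp k"
  proof -
    have p1: "1 \<le> real (pp k)" using pp_pos[of k] by linarith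
    then have "s * 1 \<le> s * real (pp k)" using s0 by (intro mult_left_mono) auto
    then have "s / pp k \<le> s" using p1 by (simp add: divide_le_eq)
    then show ?thesis by (simp add: sS)
  qed
  finally show ?thesis using y(3) \<open>lag E y = lag F y\<close> phi_lam[OF assms(1), of s] sS by (simp add: s_def)
qed

lemma kfree_edges:
  assumes "2 \<le> k" "4 * k\<^sup>2 + 4 \<le> t" "kg k V E" "kfree k E"
  shows "card E \<le> lam k * (card V) ^ k"
  using kfree_lagrangian[OF assms, of "\<lambda>_. 1"] lag_const[OF assms(3), of 1] by simp

end

section \<open>Counting transversal tuples\<close>

lemma card_ksets_le: "finite V \<Longrightarrow> card (ksets V k) \<le> card V ^ k"
  unfolding ksets_def by (cases "k \<le> card V") (simp_all add: n_subsets binomial_le_pow binomial_eq_0)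

lemma card_supersets_le:
  assumes "finite V" "finite B"
  shows "card {e. e \<subseteq> V \<and> card e = k \<and> B \<subseteq> e} \<le> card V ^ (k - card B)"
proof -
  have fin: "finite e" if "e \<subseteq> V" for e using that assms(1) finite_subset by blast
  have "inj_on (\<lambda>e. e - B) {e. e \<subseteq> V \<and> card e = k \<and> B \<subseteq> e}"
    by (rule inj_onI) blast
  moreover have "(\<lambda>e. e - B) ` {e. e \<subseteq> V \<and> card e = k \<and> B \<subseteq> e} \<subseteq> ksets V (k - card B)"
    using assms(2) by (auto simp: ksets_def card_Diff_subset)
  moreover have "finite (ksets V (k - card B))" using kg_finite[OF kg_ksets[OF assms(1)]] .
  ultimately have "card {e. e \<subseteq> V \<and> card e = k \<and> B \<subseteq> e} \<le> card (ksets V (k - card B))"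
    by (rule card_inj_on_le)
  then show ?thesis using card_ksets_le[OF assms(1)] le_trans by blast
qed

lemma double_count:
  assumes "finite Y" "finite F" "\<And>m. m \<in> F \<Longrightarrow> finite m \<and> card m \<le> k"
  shows "(\<Sum>u\<in>Y. card {m\<in>F. u \<in> m}) \<le> k * card F"
proof -
  have "(\<Sum>u\<in>Y. card {m\<in>F. u \<in> m}) = (\<Sum>u\<in>Y. \<Sum>m\<in>F. if u \<in> m then 1 else 0)"
    using assms(2) by (simp add: sum.If_cases Int_def)
  also have "\<dots> = (\<Sum>m\<in>F. \<Sum>u\<in>Y. if u \<in> m then 1 else 0)" by (rule sum.swap)
  also have "\<dots> \<le> (\<Sum>m\<in>F. k)"
  proof (rule sum_mono)
    fix m assume m: "m \<in> F"
    have "(\<Sum>u\<in>Y. if u \<in> m then 1 else (0::nat)) = card (Y \<inter> m)"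
      using assms(1) by (simp add: sum.If_cases Int_def)
    also have "\<dots> \<le> card m" using assms(3)[OF m] by (intro card_mono) auto
    also have "\<dots> \<le> k" using assms(3)[OF m] by simp
    finally show "(\<Sum>u\<in>Y. if u \<in> m then 1 else (0::nat)) \<le> k" .
  qed
  finally show ?thesis by (simp add: mult.commute)
qed

section \<open>Colour classes and their transversals\<close>

definition cls :: "'a set \<Rightarrow> ('a \<Rightarrow> nat) \<Rightarrow> nat \<Rightarrow> 'a set" where
  "cls V c i = {v\<in>V. c v = i}"

text \<open>The complete multipartite \<open>k\<close>-graph whose parts are the colour
  classes.\<close>

definition trans :: "'a set \<Rightarrow> ('a \<Rightarrow> nat) \<Rightarrow> nat \<Rightarrow> 'a set set" where
  "trans V c k = {e. e \<subseteq> V \<and> card e = k \<and> inj_on c e}"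

lemma cls_finite: "finite V \<Longrightarrow> finite (cls V c i)"
  by (simp add: cls_def)

lemma trans_kg: "finite V \<Longrightarrow> kg k V (trans V c k)"
  by (auto simp: kg_def trans_def)

lemma tuple_props:
  assumes "u \<in> PiE I (cls V c)" "i \<in> I"
  shows "u i \<in> V" "c (u i) = i"
  using PiE_mem[OF assms] by (auto simp: cls_def)

lemma tuple_inj: "u \<in> PiE I (cls V c) \<Longrightarrow> inj_on u I"
  by (rule inj_on_inverseI[of I c]) (rule tuple_props)

text \<open>A vertex of \<open>m\<close> can occur in a tuple only at the index that is its colour,
  so the entries at the colours of \<open>m\<close> are forced and only the other indices are free.
  Relative to \<open>card V ^ card I\<close>, the tuples through \<open>m\<close> have proportion at
  most \<open>1 / card V ^ card m\<close>.\<close>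

lemma card_tuples_through:
  assumes "finite I" "finite V"
  shows "card {u \<in> PiE I (cls V c). m \<subseteq> u ` I} * card V ^ card m \<le> card V ^ card I"
proof (cases "{u \<in> PiE I (cls V c). m \<subseteq> u ` I} = {}")
  case True
  show ?thesis unfolding True by simp
next
  case False
  define U where "U = {u \<in> PiE I (cls V c). m \<subseteq> u ` I}"
  have uc: "u (c y) = y" "c y \<in> I" if "u \<in> U" "y \<in> m" for u y
  proof -
    have u: "u \<in> PiE I (cls V c)" "y \<in> u ` I" using that unfolding U_def by blast+
    then obtain i where i: "i \<in> I" "y = u i" by blast
    then have "c y = i" using tuple_props(2)[OF u(1)] by simp
    then show "u (c y) = y" "c y \<in> I" using i by simp_all
  qed
  obtain u0 where u0: "u0 \<in> U" using False by (auto simp: U_def)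
  have inj: "inj_on c m" by (rule inj_on_inverseI[of m u0]) (rule uc(1)[OF u0])
  define J where "J = c ` m"
  have J: "J \<subseteq> I" using uc(2)[OF u0] by (auto simp: J_def)
  have cJ: "card J = card m" unfolding J_def by (rule card_image[OF inj])
  have "card U \<le> card (PiE (I - J) (\<lambda>_. V))"
  proof (rule card_inj_on_le[of "\<lambda>u. restrict u (I - J)"])
    show "inj_on (\<lambda>u. restrict u (I - J)) U"
    proof (rule inj_onI)
      fix u u' assume u: "u \<in> U" "u' \<in> U" and eq: "restrict u (I - J) = restrict u' (I - J)"
      show "u = u'"
      proof (rule PiE_ext[of u I "cls V c" u'])
        show "u \<in> PiE I (cls V c)" "u' \<in> PiE I (cls V c)" using u by (simp_all add: U_def)
        fix i assume i: "i \<in> I"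
        show "u i = u' i"
        proof (cases "i \<in> J")
          case True
          then obtain y where "y \<in> m" "i = c y" by (auto simp: J_def)
          then show ?thesis using uc(1)[OF u(1)] uc(1)[OF u(2)] by simp
        next
          case False
          then show ?thesis using fun_cong[OF eq, of i] i by simp
        qed
      qed
    qed
    show "(\<lambda>u. restrict u (I - J)) ` U \<subseteq> PiE (I - J) (\<lambda>_. V)"
      using tuple_props(1)[of _ I V c] by (auto simp: U_def)
    show "finite (PiE (I - J) (\<lambda>_. V))" using assms by (intro finite_PiE) auto
  qed
  also have "\<dots> = card V ^ (card I - card m)"
    using J assms(1) cJ by (simp add: card_PiE card_Diff_subset finite_subset)
  finally have "card U * card V ^ card m \<le> card V ^ (card I - card m) * card V ^ card m" by simp
  also have "\<dots> = card V ^ card I"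
    using card_mono[OF assms(1) J] cJ by (simp add: power_add[symmetric])
  finally show ?thesis by (simp add: U_def)
qed

text \<open>Union bound: the obstacles in \<open>N\<close>, each weighted by the proportion of
  tuples containing it, do not use up \<open>U\<close>.\<close>

lemma tuple_avoid:
  assumes "finite I" "finite V" "V \<noteq> {}" "finite N" "U \<subseteq> PiE I (cls V c)"
    and lt: "(\<Sum>m\<in>N. 1 / real (card V) ^ card m) * real (card V) ^ card I < card U"
  shows "\<exists>u\<in>U. \<forall>m\<in>N. \<not> m \<subseteq> u ` I"
proof (rule ccontr)
  assume "\<not> ?thesis"
  then have hit: "\<exists>m\<in>N. m \<subseteq> u ` I" if "u \<in> U" for u using that by simp
  have sub: "U \<subseteq> (\<Union>m\<in>N. {u \<in> PiE I (cls V c). m \<subseteq> u ` I})"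
  proof
    fix u assume u: "u \<in> U"
    show "u \<in> (\<Union>m\<in>N. {u \<in> PiE I (cls V c). m \<subseteq> u ` I})"
      using hit[OF u] subsetD[OF assms(5) u] by simp
  qed
  have fin: "finite (PiE I (cls V c))" using assms(1,2) by (intro finite_PiE) (auto simp: cls_finite)
  have n0: "0 < real (card V)" using assms(2,3) by (simp add: card_gt_0_iff)
  have "card U \<le> card (\<Union>m\<in>N. {u \<in> PiE I (cls V c). m \<subseteq> u ` I})"
    by (rule card_mono[OF _ sub]) (use fin assms(4) in auto)
  also have "\<dots> \<le> (\<Sum>m\<in>N. card {u \<in> PiE I (cls V c). m \<subseteq> u ` I})"
    by (rule card_UN_le[OF assms(4)])
  finally have "real (card U) \<le> (\<Sum>m\<in>N. real (card {u \<in> PiE I (cls V c). m \<subseteq> u ` I}))"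
    by (simp only: of_nat_sum[symmetric] of_nat_le_iff)
  also have "\<dots> \<le> (\<Sum>m\<in>N. 1 / real (card V) ^ card m * real (card V) ^ card I)"
  proof (rule sum_mono)
    fix m
    have "real (card {u \<in> PiE I (cls V c). m \<subseteq> u ` I}) * real (card V) ^ card m \<le> real (card V) ^ card I"
      using card_tuples_through[OF assms(1,2), of c m] by (simp only: of_nat_mult[symmetric] of_nat_power[symmetric] of_nat_le_iff)
    then show "real (card {u \<in> PiE I (cls V c). m \<subseteq> u ` I}) \<le> 1 / real (card V) ^ card m * real (card V) ^ card I"
      using n0 by (simp add: field_simps)
  qed
  finally show False using lt by (simp add: sum_distrib_right)
qed

text \<open>Each edge of \<open>H\<close> contributes the product of its class sizes, so the blowup
  of \<open>H\<close> is counted by the Lagrangian polynomial. This is the bridge between weights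
  and actual hypergraphs.\<close>

lemma card_transversal:
  assumes "finite V" "finite H" "\<And>f. f \<in> H \<Longrightarrow> finite f"
  shows "card {e. e \<subseteq> V \<and> inj_on c e \<and> c ` e \<in> H} = lag H (\<lambda>i. card (cls V c i))"
proof -
  have one: "card {e. e \<subseteq> V \<and> inj_on c e \<and> c ` e = f} = (\<Prod>i\<in>f. card (cls V c i))" if f: "finite f" for f
  proof -
    have "inj_on (\<lambda>u. u ` f) (PiE f (cls V c))"
    proof (rule inj_onI)
      fix u u' assume u: "u \<in> PiE f (cls V c)" "u' \<in> PiE f (cls V c)" and eq: "u ` f = u' ` f"
      show "u = u'"
      proof (rule PiE_ext[OF u])
        fix i assume i: "i \<in> f"
        then obtain i' where i': "i' \<in> f" "u i = u' i'" using eq by blast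
        then have "i = i'" using tuple_props(2)[OF u(1) i] tuple_props(2)[OF u(2) i'(1)] by simp
        then show "u i = u' i" using i' by simp
      qed
    qed
    moreover have "(\<lambda>u. u ` f) ` PiE f (cls V c) = {e. e \<subseteq> V \<and> inj_on c e \<and> c ` e = f}" (is "?L = ?R")
    proof (intro equalityI subsetI)
      fix e assume "e \<in> ?L"
      then obtain u where u: "u \<in> PiE f (cls V c)" "e = u ` f" by blast
      have "inj_on c e" unfolding u(2) by (rule inj_on_inverseI[of _ u]) (use tuple_props(2)[OF u(1)] in auto)
      moreover have "c ` e = f" unfolding u(2) image_image using tuple_props(2)[OF u(1)] by simp
      moreover have "e \<subseteq> V" unfolding u(2) using tuple_props(1)[OF u(1)] by blast
      ultimately show "e \<in> ?R" by blast
    next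
      fix e assume e: "e \<in> ?R"
      define u where "u = restrict (the_inv_into e c) f"
      have "u \<in> PiE f (cls V c)"
      proof (rule PiE_I)
        fix i assume i: "i \<in> f"
        then have "the_inv_into e c i \<in> e" using e by (intro the_inv_into_into) auto
        moreover have "c (the_inv_into e c i) = i" using e i by (intro f_the_inv_into_f) auto
        ultimately show "u i \<in> cls V c i" using e i by (auto simp: u_def cls_def)
      qed (simp add: u_def)
      moreover have "u ` f = e"
      proof -
        have cf: "c ` e = f" and inj: "inj_on c e" using e by simp_all
        have "u ` f = the_inv_into e c ` f" by (auto simp: u_def)
        also have "\<dots> = (\<lambda>x. the_inv_into e c (c x)) ` e" unfolding cf[symmetric] image_image ..
        also have "\<dots> = e" using the_inv_into_f_f[OF inj] by simp
        finally show ?thesis .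
      qed
      ultimately show "e \<in> ?L" by blast
    qed
    ultimately have "card {e. e \<subseteq> V \<and> inj_on c e \<and> c ` e = f} = card (PiE f (cls V c))"
      using card_image by fastforce
    then show ?thesis using f by (simp add: card_PiE)
  qed
  have eq: "{e. e \<subseteq> V \<and> inj_on c e \<and> c ` e \<in> H} = (\<Union>f\<in>H. {e. e \<subseteq> V \<and> inj_on c e \<and> c ` e = f})" by blast
  have "card {e. e \<subseteq> V \<and> inj_on c e \<and> c ` e \<in> H} = (\<Sum>f\<in>H. card {e. e \<subseteq> V \<and> inj_on c e \<and> c ` e = f})"
    unfolding eq by (rule card_UN_disjoint) (use assms(1,2) in auto)
  also have "\<dots> = (\<Sum>f\<in>H. \<Prod>i\<in>f. card (cls V c i))"
    using one assms(3) by simp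
  finally show ?thesis by (simp add: lag_def)
qed

lemma trans_eq:
  assumes "c ` V \<subseteq> {..<q}"
  shows "trans V c k = {e. e \<subseteq> V \<and> inj_on c e \<and> c ` e \<in> ksets {..<q} k}"
proof -
  have "card (c ` e) = card e" if "inj_on c e" for e using card_image[OF that] .
  then show ?thesis using assms unfolding trans_def ksets_def by auto
qed

lemma card_trans:
  assumes "finite V" "c ` V \<subseteq> {..<q}"
  shows "card (trans V c k) = lag (ksets {..<q} k) (\<lambda>i. card (cls V c i))"
  unfolding trans_eq[OF assms(2)]
  by (rule card_transversal[OF assms(1)]) (use kg_finite[OF kg_ksets] in \<open>auto simp: ksets_def finite_subset\<close>)

lemma sum_cls:
  assumes "finite V" "c ` V \<subseteq> {..<q}"
  shows "(\<Sum>i<q. card (cls V c i)) = card V"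
proof -
  have "V = (\<Union>i\<in>{..<q}. cls V c i)" using assms(2) by (auto simp: cls_def)
  moreover have "card (\<Union>i\<in>{..<q}. cls V c i) = (\<Sum>i<q. card (cls V c i))"
    by (rule card_UN_disjoint) (use assms(1) in \<open>auto simp: cls_def\<close>)
  ultimately show ?thesis by simp
qed

lemma card_tuples_ge:
  fixes b :: real
  assumes "finite I" "finite V" "0 \<le> b" "\<And>i. i \<in> I \<Longrightarrow> X i \<subseteq> V \<and> b \<le> card (X i)"
  shows "b ^ card I \<le> card (PiE I X)"
proof -
  have "b ^ card I = (\<Prod>i\<in>I. b)" by simp
  also have "\<dots> \<le> (\<Prod>i\<in>I. real (card (X i)))" by (rule prod_mono) (use assms in auto)
  finally show ?thesis using assms(1) by (simp add: card_PiE)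
qed

text \<open>A transversal of the classes other than \<open>j\<close> is chosen to avoid all missing
  edges, all sets missing at \<open>w\<close> or \<open>w'\<close>, and the further obstacles in
  \<open>N\<close>; then both \<open>w\<close> and \<open>w'\<close> fit to it. The four families
  weigh at most \<open>\<beta>\<close> each, while the available tuples have proportion at least
  \<open>\<kappa> ^ (q - 1)\<close>.\<close>

lemma near_complete_tuple:
  fixes E :: "'a set set" and c :: "'a \<Rightarrow> nat" and \<kappa> \<beta> :: real
  assumes fV: "finite V" and c: "c ` V \<subseteq> {..<q}" and k: "1 \<le> k"
    and w: "w \<in> V" "w' \<in> V" "c w = j" "c w' = j"
    and kap: "0 < \<kappa>" "\<And>i. i < q \<Longrightarrow> \<kappa> * card V \<le> card (cls V c i)"
    and M: "M = trans V c k - E"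
    and b: "card M \<le> \<beta> * real (card V) ^ k" "card (link M w) \<le> \<beta> * real (card V) ^ (k - 1)"
      "card (link M w') \<le> \<beta> * real (card V) ^ (k - 1)"
    and N: "finite N" "(\<Sum>m\<in>N. 1 / real (card V) ^ card m) \<le> \<beta>"
    and lt: "4 * \<beta> < \<kappa> ^ (q - 1)"
  obtains g where "\<And>i. i < q \<Longrightarrow> g i \<in> V \<and> c (g i) = i" "g j = w'"
    "\<And>S. S \<subseteq> {..<q} \<Longrightarrow> card S = k \<Longrightarrow> g ` S \<in> E"
    "\<And>S. S \<subseteq> {..<q} - {j} \<Longrightarrow> card S = k - 1 \<Longrightarrow> insert w (g ` S) \<in> E"
    "\<And>m. m \<in> N \<Longrightarrow> \<not> m \<subseteq> g ` ({..<q} - {j})"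
proof -
  define n where "n = real (card V)"
  define I where "I = {..<q} - {j}"
  have V: "V \<noteq> {}" using w by blast
  have n0: "0 < n" using V fV by (simp add: n_def card_gt_0_iff)
  have j: "j < q" using c w by auto
  have fI: "finite I" and cI: "card I = q - 1" using j by (auto simp: I_def)
  have kgM: "kg k V M" unfolding M by (rule kg_subset[OF trans_kg[OF fV]]) auto
  have fM: "finite M" using kg_finite[OF kgM] .
  have fL: "finite (link M v)" for v using finite_link[OF fM] .
  have cL: "card f = k - 1" if "f \<in> link M v" for f v
  proof -
    have f: "v \<notin> f" "insert v f \<in> M" using that by (auto simp: link_def)
    then have "finite f" using kg_finite_edge[OF kgM f(2)] by simp
    then show ?thesis using kg_edge_card[OF kgM f(2)] f(1) by simp
  qed
  have S0: "(\<Sum>m\<in>M. 1 / n ^ card m) \<le> \<beta>"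
  proof -
    have "(\<Sum>m\<in>M. 1 / n ^ card m) = (\<Sum>m\<in>M. 1 / n ^ k)"
      using kg_edge_card[OF kgM] by (intro sum.cong) auto
    also have "\<dots> = card M / n ^ k" by simp
    also have "\<dots> \<le> \<beta>" using b(1) n0 by (simp add: n_def divide_le_eq)
    finally show ?thesis .
  qed
  have SL: "(\<Sum>m\<in>link M v. 1 / n ^ card m) \<le> \<beta>" if "card (link M v) \<le> \<beta> * real (card V) ^ (k - 1)" for v
  proof -
    have "(\<Sum>m\<in>link M v. 1 / n ^ card m) = (\<Sum>m\<in>link M v. 1 / n ^ (k - 1))"
      using cL by (intro sum.cong) auto
    also have "\<dots> = card (link M v) / n ^ (k - 1)" by simp
    also have "\<dots> \<le> \<beta>" using that n0 by (simp add: n_def divide_le_eq)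
    finally show ?thesis .
  qed
  define NN where "NN = M \<union> (link M w \<union> (link M w' \<union> N))"
  have un: "(\<Sum>m\<in>A \<union> B. 1 / n ^ card m) \<le> (\<Sum>m\<in>A. 1 / n ^ card m) + (\<Sum>m\<in>B. 1 / n ^ card m)"
    if "finite A" "finite B" for A B :: "'a set set"
  proof -
    have "0 \<le> (\<Sum>m\<in>A \<inter> B. 1 / n ^ card m)" using n0 by (intro sum_nonneg) auto
    then show ?thesis using sum.union_inter[OF that, of "\<lambda>m. 1 / n ^ card m"] by linarith
  qed
  have "(\<Sum>m\<in>NN. 1 / n ^ card m) \<le> 4 * \<beta>"
    unfolding NN_def using un[of M "link M w \<union> (link M w' \<union> N)"] un[of "link M w" "link M w' \<union> N"]
      un[of "link M w'" N] fM fL N S0 SL[OF b(2)] SL[OF b(3)] unfolding n_def by simp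
  then have "(\<Sum>m\<in>NN. 1 / n ^ card m) * n ^ card I \<le> 4 * \<beta> * n ^ card I"
    using n0 by (intro mult_right_mono) auto
  also have "\<dots> < \<kappa> ^ (q - 1) * n ^ card I" using lt n0 by (intro mult_strict_right_mono) auto
  also have "\<dots> = (\<kappa> * n) ^ card I" by (simp add: cI power_mult_distrib)
  also have "\<dots> \<le> card (PiE I (cls V c))"
    by (rule card_tuples_ge[OF fI fV]) (use kap n0 in \<open>auto simp: I_def cls_def n_def\<close>)
  finally have "\<exists>u\<in>PiE I (cls V c). \<forall>m\<in>NN. \<not> m \<subseteq> u ` I"
    unfolding n_def by (intro tuple_avoid[OF fI fV V]) (use fM fL N in \<open>auto simp: NN_def\<close>)
  then obtain u where u: "u \<in> PiE I (cls V c)" "\<And>m. m \<in> NN \<Longrightarrow> \<not> m \<subseteq> u ` I" by blast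
  define g where "g = u(j := w')"
  have gI: "g i = u i" if "i \<in> I" for i using that by (auto simp: g_def I_def)
  have gimg: "g ` S = u ` S" if "S \<subseteq> I" for S using that gI by (intro image_cong) auto
  have g: "g i \<in> V \<and> c (g i) = i" if "i < q" for i
    using tuple_props[OF u(1), of i] that w by (cases "i = j") (auto simp: g_def I_def)
  have ginj: "inj_on g {..<q}" by (rule inj_on_inverseI[of _ c]) (use g in auto)
  have tr: "g ` S \<in> trans V c (card S)" if "S \<subseteq> {..<q}" for S
  proof -
    have "inj_on c (g ` S)" by (rule inj_on_inverseI[of _ g]) (use g that in auto)
    moreover have "card (g ` S) = card S" using ginj that by (meson card_image inj_on_subset)
    moreover have "g ` S \<subseteq> V" using g that by auto
    ultimately show ?thesis by (simp add: trans_def)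
  qed
  show ?thesis
  proof
    show "g i \<in> V \<and> c (g i) = i" if "i < q" for i by (rule g[OF that])
    show "g j = w'" by (simp add: g_def)
    show "g ` S \<in> E" if S: "S \<subseteq> {..<q}" "card S = k" for S
    proof (rule ccontr)
      assume "g ` S \<notin> E"
      then have m: "g ` S \<in> M" using tr[OF S(1)] S(2) by (simp add: M)
      show False
      proof (cases "j \<in> S")
        case False
        then have "S \<subseteq> I" using S by (auto simp: I_def)
        then show False using u(2)[of "g ` S"] m gimg by (auto simp: NN_def)
      next
        case True
        have SI: "S - {j} \<subseteq> I" using S by (auto simp: I_def)
        have "g ` S = insert w' (g ` (S - {j}))" using True by (auto simp: g_def)
        moreover have "w' \<notin> g ` (S - {j})"
        proof
          assume "w' \<in> g ` (S - {j})"
          then obtain i where "i \<in> S - {j}" "w' = g i" by blast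
          then show False using g[of i] w(4) S(1) by auto
        qed
        ultimately have "g ` (S - {j}) \<in> link M w'" using m by (simp add: link_def)
        then show False using u(2)[of "g ` (S - {j})"] gimg[OF SI] SI by (auto simp: NN_def)
      qed
    qed
    show "insert w (g ` S) \<in> E" if S: "S \<subseteq> {..<q} - {j}" "card S = k - 1" for S
    proof (rule ccontr)
      assume ne: "insert w (g ` S) \<notin> E"
      have SI: "S \<subseteq> I" using S by (simp add: I_def)
      have wn: "w \<notin> g ` S"
      proof
        assume "w \<in> g ` S"
        then obtain i where "i \<in> S" "w = g i" by blast
        then show False using g[of i] w(3) S(1) by auto
      qed
      have t: "g ` S \<in> trans V c (k - 1)" using tr[of S] S by auto
      have cg: "c ` g ` S = S" using g S(1) by (force simp: image_image)
      have "finite (g ` S)" using S(1) finite_subset[OF _ finite_lessThan[of q]] by blast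
      then have "insert w (g ` S) \<in> trans V c k"
        using t wn w(1,3) k S(1) cg unfolding trans_def by auto
      then have "g ` S \<in> link M w" using ne wn by (simp add: M link_def)
      then show False using u(2)[of "g ` S"] gimg[OF SI] SI by (auto simp: NN_def)
    qed
    show "\<not> m \<subseteq> g ` ({..<q} - {j})" if "m \<in> N" for m
      using u(2)[of m] that gimg[of I] by (simp add: NN_def I_def)
  qed
qed

text \<open>Quantifying over all small \<open>Z\<close> is what a greedy choice needs: an edge
  through the pair is available whatever few vertices have been used before.\<close>

definition robust :: "nat \<Rightarrow> 'a set set \<Rightarrow> 'a \<Rightarrow> 'a \<Rightarrow> bool" where
  "robust N E u v \<longleftrightarrow>
     (\<forall>Z. finite Z \<and> card Z \<le> N \<and> u \<notin> Z \<and> v \<notin> Z \<longrightarrow> (\<exists>e\<in>E. u \<in> e \<and> v \<in> e \<and> e \<inter> Z = {}))"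

lemma robust_sym: "robust N E u v \<longleftrightarrow> robust N E v u"
proof -
  have "robust N E v u" if "robust N E u v" for u v
    using that unfolding robust_def by metis
  then show ?thesis by metis
qed

text \<open>All edges through the pair meet one set of at most \<open>N\<close> vertices, hence
  contain a third vertex from it, which leaves \<open>k - 3\<close> free choices. The factor
  \<open>card V\<close> on the left keeps the statement meaningful for \<open>k = 2\<close>, where
  there is no such edge at all.\<close>

lemma nonrobust_codegree:
  assumes kg: "kg k V E" and k: "2 \<le> k" and uv: "u \<noteq> v" "\<not> robust N E u v"
  shows "card {e\<in>E. u \<in> e \<and> v \<in> e} * card V \<le> N * card V ^ (k - 2)"
proof -
  define F where "F = {e\<in>E. u \<in> e \<and> v \<in> e}"
  obtain Z where Z: "finite Z" "card Z \<le> N" "u \<notin> Z" "v \<notin> Z" "\<And>e. e \<in> F \<Longrightarrow> e \<inter> Z \<noteq> {}"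
  proof -
    obtain Z where "finite Z" "card Z \<le> N" "u \<notin> Z" "v \<notin> Z" "\<forall>e\<in>E. \<not> (u \<in> e \<and> v \<in> e \<and> e \<inter> Z = {})"
      using uv(2) unfolding robust_def by metis
    then show ?thesis by (intro that[of Z]) (simp_all add: F_def)
  qed
  have fV: "finite V" using kg_finite_verts[OF kg] .
  have fF: "finite F" using kg_finite[OF kg] by (simp add: F_def)
  show ?thesis
  proof (cases "k = 2")
    case True
    have "F = {}"
    proof (rule ccontr)
      assume "F \<noteq> {}"
      then obtain e where e: "e \<in> F" by blast
      then have "card e = 2" "finite e" "{u, v} \<subseteq> e"
        using kg_edge_card[OF kg] kg_finite_edge[OF kg] True by (auto simp: F_def)
      then have "e = {u, v}" using uv(1) by (metis card_2_iff card_subset_eq)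
      then show False using Z(3,4,5) e by auto
    qed
    then show ?thesis unfolding F_def[symmetric] by simp
  next
    case False
    then have k3: "3 \<le> k" using k by simp
    have "F \<subseteq> (\<Union>z\<in>Z. {e. e \<subseteq> V \<and> card e = k \<and> {u, v, z} \<subseteq> e})"
    proof
      fix e assume e: "e \<in> F"
      then obtain z where "z \<in> Z" "z \<in> e" using Z(5) by blast
      then show "e \<in> (\<Union>z\<in>Z. {e. e \<subseteq> V \<and> card e = k \<and> {u, v, z} \<subseteq> e})"
        using e kg_edge_card[OF kg] kg_edge_subset[OF kg] by (auto simp: F_def)
    qed
    then have "card F \<le> card (\<Union>z\<in>Z. {e. e \<subseteq> V \<and> card e = k \<and> {u, v, z} \<subseteq> e})"
      by (intro card_mono) (use Z(1) fV in auto)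
    also have "\<dots> \<le> (\<Sum>z\<in>Z. card {e. e \<subseteq> V \<and> card e = k \<and> {u, v, z} \<subseteq> e})"
      by (rule card_UN_le[OF Z(1)])
    also have "\<dots> \<le> (\<Sum>z\<in>Z. card V ^ (k - 3))"
    proof (rule sum_mono)
      fix z assume "z \<in> Z"
      then have "z \<noteq> u" "z \<noteq> v" using Z(3,4) by metis+
      then have "card {u, v, z} = 3" using uv(1) by simp
      then show "card {e. e \<subseteq> V \<and> card e = k \<and> {u, v, z} \<subseteq> e} \<le> card V ^ (k - 3)"
        using card_supersets_le[OF fV, of "{u, v, z}" k] by simp
    qed
    also have "\<dots> \<le> N * card V ^ (k - 3)" using Z(2) by simp
    finally have "card F * card V \<le> N * card V ^ (k - 3) * card V" by simp
    also have "\<dots> = N * card V ^ (k - 2)"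
    proof -
      have "k - 2 = Suc (k - 3)" using k3 by simp
      then show ?thesis by simp
    qed
    finally show ?thesis by (simp add: F_def)
  qed
qed

lemma card_trans_through:
  fixes b :: real
  assumes "finite V" "c ` V \<subseteq> {..<q}" "k \<le> q" "2 \<le> k"
    "0 \<le> b" "\<And>i. i < q \<Longrightarrow> b \<le> card (cls V c i)"
    "w \<in> V" "u \<in> V" "c u \<noteq> c w"
  shows "b ^ (k - 2) \<le> card {e \<in> trans V c k. w \<in> e \<and> u \<in> e}"
proof -
  have "card ({..<q} - {c w, c u}) = q - 2"
  proof -
    have "{c w, c u} \<subseteq> {..<q}" using assms(2,7,8) by blast
    then show ?thesis using assms(9) by (simp add: card_Diff_subset)
  qed
  then have "k - 2 \<le> card ({..<q} - {c w, c u})" using assms(3) by simp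
  then obtain K where K: "K \<subseteq> {..<q} - {c w, c u}" "card K = k - 2"
    by (rule obtain_subset_with_card_n)
  have fK: "finite K" using K(1) by (meson finite_Diff finite_lessThan finite_subset)
  have "b ^ (k - 2) \<le> card (PiE K (cls V c))"
    unfolding K(2)[symmetric]
  proof (rule card_tuples_ge[OF fK assms(1,5)])
    fix i assume "i \<in> K"
    then have "i < q" using K(1) by blast
    then show "cls V c i \<subseteq> V \<and> b \<le> real (card (cls V c i))" using assms(6) by (simp add: cls_def)
  qed
  also have "card (PiE K (cls V c)) \<le> card {e \<in> trans V c k. w \<in> e \<and> u \<in> e}"
  proof (rule card_inj_on_le[of "\<lambda>g. {w, u} \<union> g ` K"])
    have dis: "w \<notin> g ` K" "u \<notin> g ` K" if "g \<in> PiE K (cls V c)" for g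
      using tuple_props(2)[OF that] K(1) by force+
    show "inj_on (\<lambda>g. {w, u} \<union> g ` K) (PiE K (cls V c))"
    proof (rule inj_onI)
      fix g g' assume g: "g \<in> PiE K (cls V c)" "g' \<in> PiE K (cls V c)" and eq: "{w, u} \<union> g ` K = {w, u} \<union> g' ` K"
      have D: "({w, u} \<union> h ` K) - {w, u} = h ` K" if "h \<in> PiE K (cls V c)" for h
        using dis[OF that] by (simp add: insert_Diff_if Diff_insert0)
      have "({w, u} \<union> g ` K) - {w, u} = ({w, u} \<union> g' ` K) - {w, u}" by (simp only: eq)
      then have eq': "g ` K = g' ` K" by (simp only: D[OF g(1)] D[OF g(2)])
      show "g = g'"
      proof (rule PiE_ext[OF g])
        fix i assume i: "i \<in> K"
        then obtain i' where i': "i' \<in> K" "g i = g' i'" using eq' by blast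
        then have "i = i'" using tuple_props(2)[OF g(1) i] tuple_props(2)[OF g(2) i'(1)] by simp
        then show "g i = g' i" using i' by simp
      qed
    qed
    show "(\<lambda>g. {w, u} \<union> g ` K) ` PiE K (cls V c) \<subseteq> {e \<in> trans V c k. w \<in> e \<and> u \<in> e}"
    proof (rule image_subsetI)
      fix g assume g: "g \<in> PiE K (cls V c)"
      have cg: "card (g ` K) = k - 2" using card_image[OF tuple_inj[OF g]] K(2) by simp
      have wu: "w \<noteq> u" using assms(9) by auto
      have "card ({w, u} \<union> g ` K) = card {w, u} + card (g ` K)"
        using dis[OF g] fK by (intro card_Un_disjoint) auto
      also have "\<dots> = k" using cg wu assms(4) by simp
      finally have 1: "card ({w, u} \<union> g ` K) = k" .
      have 2: "inj_on c ({w, u} \<union> g ` K)"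
      proof (rule inj_onI)
        fix a b assume "a \<in> {w, u} \<union> g ` K" "b \<in> {w, u} \<union> g ` K" "c a = c b"
        then show "a = b" using tuple_props(2)[OF g] K(1) assms(9) by auto
      qed
      have 3: "{w, u} \<union> g ` K \<subseteq> V" using tuple_props(1)[OF g] assms(7,8) by auto
      show "{w, u} \<union> g ` K \<in> {e \<in> trans V c k. w \<in> e \<and> u \<in> e}"
        using 1 2 3 by (simp add: trans_def)
    qed
    show "finite {e \<in> trans V c k. w \<in> e \<and> u \<in> e}" using kg_finite[OF trans_kg[OF assms(1)]] by simp
  qed
  finally show ?thesis by simp
qed

text \<open>At least \<open>(\<kappa> * card V) ^ (k - 2)\<close> transversal sets pass through
  \<open>w\<close> and a given vertex of another colour. If the pair is not robust, at most half
  that many are edges, so the other half is missing at \<open>w\<close>; double counting the missing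
  sets at \<open>w\<close> bounds the number of such vertices.\<close>

lemma nonrobust_degree:
  fixes \<kappa> :: real
  assumes kg: "kg k V E" and k: "2 \<le> k" "k \<le> q" and c: "c ` V \<subseteq> {..<q}"
    and kap: "0 < \<kappa>" "\<And>i. i < q \<Longrightarrow> \<kappa> * card V \<le> card (cls V c i)"
    and M: "M = trans V c k - E" and n: "2 * real N \<le> \<kappa> ^ (k - 2) * card V" and w: "w \<in> V"
  shows "card {u\<in>V. c u \<noteq> c w \<and> \<not> robust N E w u} * \<kappa> ^ (k - 2) * real (card V) ^ (k - 2)
    \<le> 2 * real k * card (link M w)"
proof -
  define Y where "Y = {u\<in>V. c u \<noteq> c w \<and> \<not> robust N E w u}"
  define n where "n = real (card V)"
  define L where "L = \<kappa> ^ (k - 2) * n ^ (k - 2)"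
  have fV: "finite V" using kg_finite_verts[OF kg] .
  have n0: "0 < n" using w fV by (auto simp: n_def card_gt_0_iff)
  define Mw where "Mw = {m\<in>M. w \<in> m}"
  have kgM: "kg k V M" unfolding M by (rule kg_subset[OF trans_kg[OF fV]]) auto
  have fM: "finite Mw" using kg_finite[OF kgM] by (simp add: Mw_def)
  have each: "L / 2 \<le> card {m\<in>Mw. u \<in> m}" if u: "u \<in> Y" for u
  proof -
    have "(\<kappa> * n) ^ (k - 2) \<le> card {e \<in> trans V c k. w \<in> e \<and> u \<in> e}"
      by (rule card_trans_through[OF fV c k(2,1)]) (use kap n0 w u in \<open>auto simp: Y_def n_def\<close>)
    also have "{e \<in> trans V c k. w \<in> e \<and> u \<in> e} \<subseteq> {m\<in>Mw. u \<in> m} \<union> {e\<in>E. w \<in> e \<and> u \<in> e}"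
      by (auto simp: Mw_def M)
    then have "card {e \<in> trans V c k. w \<in> e \<and> u \<in> e} \<le> card ({m\<in>Mw. u \<in> m} \<union> {e\<in>E. w \<in> e \<and> u \<in> e})"
      using fM kg_finite[OF kg] by (intro card_mono) auto
    also have "\<dots> \<le> card {m\<in>Mw. u \<in> m} + card {e\<in>E. w \<in> e \<and> u \<in> e}" by (rule card_Un_le)
    finally have 1: "L \<le> card {m\<in>Mw. u \<in> m} + card {e\<in>E. w \<in> e \<and> u \<in> e}"
      by (simp add: L_def power_mult_distrib)
    have "card {e\<in>E. w \<in> e \<and> u \<in> e} * card V \<le> N * card V ^ (k - 2)"
      using u by (intro nonrobust_codegree[OF kg k(1)]) (auto simp: Y_def)
    then have "card {e\<in>E. w \<in> e \<and> u \<in> e} * n \<le> real N * n ^ (k - 2)"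
      unfolding n_def by (simp only: of_nat_mult[symmetric] of_nat_power[symmetric] of_nat_le_iff)
    also have "\<dots> \<le> (\<kappa> ^ (k - 2) * n / 2) * n ^ (k - 2)"
      using n n0 by (intro mult_right_mono) (auto simp: n_def)
    also have "\<dots> = L / 2 * n" by (simp add: L_def)
    finally have "card {e\<in>E. w \<in> e \<and> u \<in> e} \<le> L / 2" using n0 by simp
    then show ?thesis using 1 by linarith
  qed
  have "card Y * (L / 2) \<le> (\<Sum>u\<in>Y. real (card {m\<in>Mw. u \<in> m}))"
    using sum_mono[of Y "\<lambda>_. L / 2" "\<lambda>u. real (card {m\<in>Mw. u \<in> m})"] each by simp
  also have "\<dots> = real (\<Sum>u\<in>Y. card {m\<in>Mw. u \<in> m})" by simp
  also have "\<dots> \<le> real (k * card Mw)"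
  proof (rule of_nat_mono, rule double_count[OF _ fM])
    show "finite Y" using fV by (simp add: Y_def)
    show "finite m \<and> card m \<le> k" if "m \<in> Mw" for m
      using that kg_finite_edge[OF kgM] kg_edge_card[OF kgM] by (simp add: Mw_def)
  qed
  also have "card Mw = card (link M w)" by (simp add: Mw_def card_link)
  finally show ?thesis by (simp add: L_def Y_def n_def mult_ac)
qed

context estree
begin

section \<open>Embedding the tree\<close>

text \<open>The first vertex of a longest path is a leaf: a second neighbour would lie on the path
  by maximality and close a cycle.\<close>

lemma leaf_exists: "\<exists>l\<in>VT. \<exists>y\<in>VT. y \<noteq> l \<and> {l, y} \<in> ET \<and> (\<forall>e\<in>ET. l \<in> e \<longrightarrow> e = {l, y})"
proof (rule ccontr)
  assume no: "\<not> ?thesis"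
  have two: "\<exists>b\<in>VT. b \<noteq> a \<and> b \<noteq> y \<and> {a, b} \<in> ET" if a: "a \<in> VT" "{a, y} \<in> ET" for a y
  proof -
    have ya: "y \<in> VT" "y \<noteq> a" using ET_edge[OF a(2)] by auto
    then have "\<not> (\<forall>e\<in>ET. a \<in> e \<longrightarrow> e = {a, y})" using no a by metis
    then obtain e where e: "e \<in> ET" "a \<in> e" "e \<noteq> {a, y}" by metis
    obtain p q where pq: "e = {p, q}" "p \<noteq> q" "p \<in> VT" "q \<in> VT" using ET_pair[OF e(1)] by metis
    show ?thesis
    proof (cases "a = p")
      case True
      then show ?thesis using pq e by (intro bexI[of _ q]) auto
    next
      case False
      then show ?thesis using pq e by (intro bexI[of _ p]) (auto simp: insert_commute)
    qed
  qed
  define P where "P = {xs. distinct xs \<and> set xs \<subseteq> VT \<and> xs \<noteq> [] \<and>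
    (\<forall>i. Suc i < length xs \<longrightarrow> {xs ! i, xs ! Suc i} \<in> ET)}"
  obtain v where "v \<in> VT" using ET_ex ET_pair by metis
  then have "[v] \<in> P" by (simp add: P_def)
  moreover have bound: "length xs \<le> card VT" if "xs \<in> P" for xs
  proof -
    have "length xs = card (set xs)" using that by (simp add: P_def distinct_card)
    also have "\<dots> \<le> card VT" using that finite_VT by (intro card_mono) (auto simp: P_def)
    finally show ?thesis .
  qed
  ultimately have "\<exists>xs. xs \<in> P \<and> (\<forall>ys. ys \<in> P \<longrightarrow> length ys \<le> length xs)"
    using ex_has_greatest_nat[of "\<lambda>xs. xs \<in> P" "[v]" length "Suc (card VT)"] by (simp add: less_Suc_eq_le)
  then obtain xs where xs: "xs \<in> P" and mx: "\<And>ys. ys \<in> P \<Longrightarrow> length ys \<le> length xs" by metis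
  have xsP: "distinct xs" "set xs \<subseteq> VT" "xs \<noteq> []" "\<And>i. Suc i < length xs \<Longrightarrow> {xs ! i, xs ! Suc i} \<in> ET"
    using xs by (auto simp: P_def)
  define a where "a = xs ! 0"
  have aV: "a \<in> VT" using xsP(2,3) by (auto simp: a_def)
  have in_path: "b \<in> set xs" if b: "b \<in> VT" "{a, b} \<in> ET" for b
  proof (rule ccontr)
    assume nb: "b \<notin> set xs"
    have "{(b # xs) ! i, (b # xs) ! Suc i} \<in> ET" if "Suc i < length (b # xs)" for i
      using that b(2) xsP(4) by (cases i) (auto simp: a_def insert_commute)
    then have "b # xs \<in> P" using nb b(1) xsP by (simp add: P_def)
    then show False using mx[of "b # xs"] by simp
  qed
  obtain y0 where y0: "y0 \<in> VT" "y0 \<noteq> a" "{a, y0} \<in> ET" using VT_incident[OF aV] by metis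
  have len2: "Suc 0 < length xs"
  proof (rule ccontr)
    assume "\<not> ?thesis"
    then have "xs = [a]" using xsP(3) by (cases xs) (auto simp: a_def)
    then show False using in_path[OF y0(1,3)] y0(2) by simp
  qed
  have "{a, xs ! Suc 0} \<in> ET" using xsP(4)[OF len2] by (simp add: a_def)
  from two[OF aV this] obtain b where b: "b \<in> VT" "b \<noteq> a" "b \<noteq> xs ! Suc 0" "{a, b} \<in> ET" by metis
  obtain i where i: "i < length xs" "xs ! i = b" using in_path[OF b(1,4)] by (auto simp: in_set_conv_nth)
  have i2: "2 \<le> i"
  proof (rule ccontr)
    assume "\<not> 2 \<le> i"
    then have "i = 0 \<or> i = Suc 0" by linarith
    then show False using i b by (auto simp: a_def)
  qed
  define c where "c = take (Suc i) xs"
  have lc: "length c = Suc i" using i by (simp add: c_def)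
  have cn: "c ! j = xs ! j" if "j \<le> i" for j using that by (simp add: c_def)
  have "is_cycle T c"
    unfolding is_cycle_def
  proof (intro conjI allI impI)
    show "3 \<le> length c" using lc i2 by simp
    show "distinct c" using xsP(1) by (simp add: c_def)
    fix j assume j: "j < length c"
    show "{c ! j, c ! (Suc j mod length c)} \<in> ET"
    proof (cases "j = i")
      case True
      then show ?thesis using b(4) i cn[of i] cn[of 0] lc by (simp add: a_def insert_commute)
    next
      case False
      then have "Suc j < length c" using j lc by simp
      then show ?thesis using xsP(4)[of j] cn[of j] cn[of "Suc j"] lc i by simp
    qed
  qed
  then show False using es unfolding erdos_sos_tree_def is_tree_def by metis
qed

text \<open>The leaf goes to \<open>w\<close>, its neighbour to a vertex over \<open>J\<close>, the
  rest over \<open>J\<close> become the new vertices, and the other tree vertices fill the remaining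
  indices. Only one edge of the copy contains \<open>w\<close>, namely \<open>w\<close> together
  with the image of \<open>J\<close>; all others are \<open>k\<close>-sets of the tuple. A
  non-neighbour \<open>z\<close> of the leaf is placed at the prescribed index \<open>j\<close>, so
  that no edge of the copy has to contain both \<open>w\<close> and \<open>g j\<close>.\<close>

lemma emb_of_tuple:
  assumes k: "2 \<le> k" and g: "inj_on g {..<pp k}" and w: "w \<notin> g ` {..<pp k}" and j: "j < pp k"
    and J: "J \<subseteq> {..<pp k} - {j}" "card J = k - 1"
    and E: "\<And>S. S \<subseteq> {..<pp k} \<Longrightarrow> card S = k \<Longrightarrow> g ` S \<in> E" "insert w (g ` J) \<in> E"
  obtains \<phi> A l z where "emb k E \<phi> A" "l \<in> VT" "z \<in> VT" "l \<noteq> z" "{l, z} \<notin> ET" "\<phi> l = w" "\<phi> z = g j"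
    "A \<subseteq> g ` {..<pp k}" "\<phi> ` (VT - {l}) \<subseteq> g ` {..<pp k}"
    "\<And>x. x \<in> VT \<Longrightarrow> x \<noteq> l \<Longrightarrow> {l, x} \<notin> ET \<Longrightarrow> \<phi> x \<in> g ` ({..<pp k} - J)"
proof -
  obtain l y where l: "l \<in> VT" "y \<in> VT" "y \<noteq> l" "{l, y} \<in> ET" and lE: "\<And>e. e \<in> ET \<Longrightarrow> l \<in> e \<Longrightarrow> e = {l, y}"
    using leaf_exists by metis
  have "card (VT - {l, y}) = t - 2" using l finite_VT by (simp add: t_def)
  then have "VT - {l, y} \<noteq> {}" using t_ge by (intro notI) simp
  then obtain z where z: "z \<in> VT" "z \<noteq> l" "z \<noteq> y" by blast
  have lz: "{l, z} \<notin> ET" using lE[of "{l, z}"] z by (auto simp: doubleton_eq_iff)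
  have fJ: "finite J" using J(1) by (meson finite_Diff finite_lessThan finite_subset)
  have "J \<noteq> {}" using J(2) k by auto
  then obtain j0 where j0: "j0 \<in> J" by blast
  define J' where "J' = J - {j0}"
  have cJ': "card J' = k - 2" using J(2) j0 fJ by (simp add: J'_def)
  define I where "I = {..<pp k} - J'"
  have J'sub: "J' \<subseteq> {..<pp k}" using J(1) by (auto simp: J'_def)
  \<comment> \<open>Removing \<open>k - 2\<close> of the \<open>pp k\<close> indices leaves exactly
    one index for each tree vertex other than the leaf.\<close>
  have cI: "card I = t - 1"
    using J'sub cJ' fJ k t_ge by (simp add: I_def card_Diff_subset J'_def pp_def)
  have I: "j0 \<in> I" "j \<in> I" "j0 \<noteq> j" "finite I" using j0 J(1) j by (auto simp: I_def J'_def)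
  have "card (VT - {l, y, z}) = t - 3" using l z finite_VT by (simp add: t_def)
  moreover have "card (I - {j0, j}) = t - 3" using I cI by simp
  ultimately obtain h0 where h0: "bij_betw h0 (VT - {l, y, z}) (I - {j0, j})"
    using finite_same_card_bij[of "VT - {l, y, z}" "I - {j0, j}"] finite_VT I(4) by auto
  define h where "h x = (if x = y then j0 else if x = z then j else h0 x)" for x
  have h_other: "h x = h0 x" "h0 x \<in> I - {j0, j}" if "x \<in> VT - {l, y, z}" for x
    using that bij_betwE[OF h0] by (auto simp: h_def)
  have hI: "h x \<in> I" if "x \<in> VT - {l}" for x
    using that h_other[of x] I by (cases "x = y \<or> x = z") (auto simp: h_def)
  have hinj: "inj_on h (VT - {l})"
  proof (rule inj_onI)
    fix a b assume ab: "a \<in> VT - {l}" "b \<in> VT - {l}" "h a = h b"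
    have h0i: "h0 a = h0 b \<Longrightarrow> a = b" if "a \<in> VT - {l, y, z}" "b \<in> VT - {l, y, z}"
      using inj_onD[OF bij_betw_imp_inj_on[OF h0]] that by metis
    show "a = b"
    proof (cases "a \<in> {y, z} \<or> b \<in> {y, z}")
      case True
      then show ?thesis using ab h_other(2)[of a] h_other(2)[of b] I(3) z(3) by (auto simp: h_def split: if_splits)
    next
      case False
      then show ?thesis using h0i ab h_other(1)[of a] h_other(1)[of b] by auto
    qed
  qed
  define \<phi> where "\<phi> x = (if x = l then w else g (h x))" for x
  define A where "A = g ` J'"
  have Isub: "I \<subseteq> {..<pp k}" by (auto simp: I_def)
  have \<phi>g: "\<phi> x = g (h x)" if "x \<noteq> l" for x using that by (simp add: \<phi>_def)
  have \<phi>sub: "\<phi> ` (VT - {l}) \<subseteq> g ` I" using hI by (auto simp: \<phi>g)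
  have inj\<phi>: "inj_on \<phi> VT"
  proof (rule inj_onI)
    fix a b assume ab: "a \<in> VT" "b \<in> VT" "\<phi> a = \<phi> b"
    have *: "\<phi> x \<noteq> w" if "x \<in> VT" "x \<noteq> l" for x using \<phi>sub that w Isub by blast
    show "a = b"
    proof (cases "a = l \<or> b = l")
      case True
      then show ?thesis using *[of a] *[of b] ab by (auto simp: \<phi>_def split: if_splits)
    next
      case False
      then have "g (h a) = g (h b)" using ab by (simp add: \<phi>g)
      then have "h a = h b" using inj_onD[OF g] hI[of a] hI[of b] ab False Isub by blast
      then show ?thesis using inj_onD[OF hinj] ab False by blast
    qed
  qed
  have disj: "A \<inter> \<phi> ` VT = {}"
  proof -
    have "g ` J' \<inter> g ` I = {}"
      using inj_on_image_Int[OF g J'sub Isub] by (auto simp: I_def)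
    moreover have "w \<notin> g ` J'" using w J'sub by blast
    moreover have "\<phi> ` VT \<subseteq> insert w (g ` I)" using \<phi>sub by (auto simp: \<phi>_def)
    ultimately show ?thesis unfolding A_def by blast
  qed
  have cA: "card A = k - 2" unfolding A_def using cJ' card_image[OF inj_on_subset[OF g J'sub]] by simp
  have edges: "\<phi> ` e \<union> A \<in> E" if e: "e \<in> ET" for e
  proof (cases "l \<in> e")
    case True
    then have "e = {l, y}" by (intro lE[OF e])
    then have "\<phi> ` e \<union> A = insert w (insert (g j0) (g ` J'))" using l(3)
      by (simp add: \<phi>_def h_def A_def insert_commute)
    also have "insert (g j0) (g ` J') = g ` J" using j0 by (auto simp: J'_def)
    finally show ?thesis using E(2) by simp
  next
    case False
    obtain a b where ab: "e = {a, b}" "a \<noteq> b" "a \<in> VT" "b \<in> VT" using ET_pair[OF e] by metis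
    have nl: "a \<noteq> l" "b \<noteq> l" using False ab by auto
    have hab: "h a \<in> I" "h b \<in> I" "h a \<noteq> h b"
      using hI ab nl inj_onD[OF hinj, of a b] by auto
    have "\<phi> ` e \<union> A = g ` ({h a, h b} \<union> J')" using ab nl by (simp add: \<phi>_def A_def)
    moreover have "card ({h a, h b} \<union> J') = k"
    proof -
      have "card ({h a, h b} \<union> J') = card {h a, h b} + card J'"
        using hab fJ by (intro card_Un_disjoint) (auto simp: I_def J'_def)
      then show ?thesis using hab cJ' k by simp
    qed
    moreover have "{h a, h b} \<union> J' \<subseteq> {..<pp k}" using hab Isub J'sub by blast
    ultimately show ?thesis using E(1)[of "{h a, h b} \<union> J'"] by (simp only:)
  qed
  show ?thesis
  proof
    show "emb k E \<phi> A" using inj\<phi> cA disj edges fJ by (simp add: emb_def A_def J'_def)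
    show "l \<in> VT" "z \<in> VT" "l \<noteq> z" "{l, z} \<notin> ET" using l z lz by auto
    show "\<phi> l = w" by (simp add: \<phi>_def)
    show "\<phi> z = g j" using z by (simp add: \<phi>_def h_def)
    show "A \<subseteq> g ` {..<pp k}" using J'sub by (auto simp: A_def)
    show "\<phi> ` (VT - {l}) \<subseteq> g ` {..<pp k}" using \<phi>sub Isub by blast
    show "\<phi> x \<in> g ` ({..<pp k} - J)" if x: "x \<in> VT" "x \<noteq> l" "{l, x} \<notin> ET" for x
    proof -
      have xy: "x \<noteq> y" using x l(4) by auto
      have "h x \<in> I" using hI x by simp
      moreover have "h x \<noteq> j0"
      proof
        assume "h x = j0"
        then have "h x = h y" by (simp add: h_def)
        then show False using inj_onD[OF hinj, of x y] x l xy by auto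
      qed
      ultimately have "h x \<in> {..<pp k} - J" by (auto simp: I_def J'_def)
      then show ?thesis using x by (simp add: \<phi>g)
    qed
  qed
qed

section \<open>Completing an embedding to a copy of the extension\<close>

definition NP :: "nat set set" where
  "NP = {{x, y} |x y. x \<in> VT \<and> y \<in> VT \<and> x \<noteq> y \<and> {x, y} \<notin> ET}"

text \<open>The combinatorial content of being free of the extension: no copy of the expansion of \<open>T\<close>
  together with the edges \<open>e P\<close> that the extension adds over the uncovered pairs \<open>P\<close>.\<close>
definition xfree :: "nat \<Rightarrow> nat set set \<Rightarrow> bool" where
  "xfree k E \<longleftrightarrow> \<not> (\<exists>\<phi> A e. emb k E \<phi> A \<and>
     (\<forall>P\<in>NP. e P \<in> E \<and> \<phi> ` P \<subseteq> e P \<and> e P \<inter> (\<phi> ` VT \<union> A) = \<phi> ` P) \<and>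
     (\<forall>P\<in>NP. \<forall>Q\<in>NP. P \<noteq> Q \<longrightarrow> (e P - \<phi> ` P) \<inter> (e Q - \<phi> ` Q) = {}))"

text \<open>Bounds the number of vertices of a whole copy of the extension: \<open>t + k\<close> for
  the core and \<open>k\<close> for each of at most \<open>t * t\<close> added edges. Robustness at
  this level therefore never blocks a greedy choice.\<close>

definition NN :: "nat \<Rightarrow> nat" where "NN k = t + k + t * t * k"

lemma emb_edge: "emb k E \<phi> A \<Longrightarrow> e \<in> ET \<Longrightarrow> \<phi> ` e \<union> A \<in> E"
  by (simp add: emb_def)

lemma kfree_xfree: "kfree k E \<Longrightarrow> xfree k E"
proof (rule ccontr)
  assume kf: "kfree k E" and "\<not> xfree k E"
  then obtain \<phi> A e where emb: "emb k E \<phi> A" and e: "\<And>P. P \<in> NP \<Longrightarrow> e P \<in> E \<and> \<phi> ` P \<subseteq> e P"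
    unfolding xfree_def by metis
  have "cov E (\<phi> x) (\<phi> y)" if "x \<in> VT" "y \<in> VT" "x \<noteq> y" for x y
  proof (cases "{x, y} \<in> ET")
    case True
    have "\<phi> ` {x, y} \<union> A \<in> E" by (rule emb_edge[OF emb True])
    then show ?thesis unfolding cov_def by (rule bexI[rotated]) simp
  next
    case False
    then have "{x, y} \<in> NP" using that unfolding NP_def by blast
    from e[OF this] show ?thesis unfolding cov_def by (intro bexI[of _ "e {x, y}"]) auto
  qed
  then show False using kf emb unfolding kfree_def by metis
qed

lemma NP_finite: "finite NP" "card NP \<le> t * t"
proof -
  have "NP \<subseteq> (\<lambda>(x, y). {x, y}) ` (VT \<times> VT)" by (auto simp: NP_def)
  moreover have "finite (VT \<times> VT)" using finite_VT by simp
  ultimately show "finite NP" "card NP \<le> t * t"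
    using surj_card_le[of "VT \<times> VT" NP "\<lambda>(x, y). {x, y}"] finite_subset
    by (auto simp: t_def card_cartesian_product)
qed

text \<open>Greedy choice of the added edges. One non-adjacent pair may be covered by a single edge
  \<open>e0\<close>, provided that \<open>e0\<close> meets the core in this pair alone. All other
  pairs are robust, so each finds an edge avoiding the core and the edges chosen before. The
  induction in \<open>ext\<close> starts with \<open>e0\<close> already in place.\<close>

lemma core_contra:
  assumes kg: "kg k V E" and xf: "xfree k E" and emb: "emb k E \<phi> A"
    and P0: "x0 \<in> VT" "y0 \<in> VT" "x0 \<noteq> y0" "{x0, y0} \<notin> ET"
    and e0: "e0 \<in> E" "e0 \<inter> (\<phi> ` VT \<union> A) = {\<phi> x0, \<phi> y0}"
    and rob: "\<And>x y. x \<in> VT \<Longrightarrow> y \<in> VT \<Longrightarrow> x \<noteq> y \<Longrightarrow> {x, y} \<notin> ET \<Longrightarrow> {x, y} \<noteq> {x0, y0} \<Longrightarrow>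
      robust (NN k) E (\<phi> x) (\<phi> y)"
  shows False
proof -
  define S where "S = \<phi> ` VT \<union> A"
  define Q where "Q = {x0, y0}"
  have Q: "Q \<in> NP" using P0 unfolding NP_def Q_def by blast
  have NPsub: "\<phi> ` P \<subseteq> S" if "P \<in> NP" for P using that by (auto simp: NP_def S_def)
  have fA: "finite A" "card A = k - 2" and inj: "inj_on \<phi> VT" using emb by (auto simp: emb_def)
  have fS: "finite S" "card S \<le> t + k"
  proof -
    show "finite S" using finite_VT fA by (simp add: S_def)
    have "card S \<le> card (\<phi> ` VT) + card A" unfolding S_def by (rule card_Un_le)
    also have "\<dots> \<le> t + k" using fA card_image_le[OF finite_VT, of \<phi>] by (simp add: t_def)
    finally show "card S \<le> t + k" .
  qed
  have ext: "\<exists>e. (\<forall>P\<in>insert Q F. e P \<in> E \<and> e P \<inter> S = \<phi> ` P) \<and>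
      (\<forall>P\<in>insert Q F. \<forall>P'\<in>insert Q F. P \<noteq> P' \<longrightarrow> (e P - \<phi> ` P) \<inter> (e P' - \<phi> ` P') = {})"
    if "finite F" "F \<subseteq> NP - {Q}" for F
    using that
  proof (induction F rule: finite_induct)
    case empty
    show ?case using e0 by (intro exI[of _ "\<lambda>_. e0"]) (auto simp: S_def Q_def)
  next
    case (insert P F)
    have sub: "F \<subseteq> NP - {Q}" using insert.prems by simp
    from insert.IH[OF sub] obtain e where ee: "(\<forall>P\<in>insert Q F. e P \<in> E \<and> e P \<inter> S = \<phi> ` P) \<and>
      (\<forall>P\<in>insert Q F. \<forall>P'\<in>insert Q F. P \<noteq> P' \<longrightarrow> (e P - \<phi> ` P) \<inter> (e P' - \<phi> ` P') = {})"
      by (elim exE)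
    have e: "\<And>P. P \<in> insert Q F \<Longrightarrow> e P \<in> E \<and> e P \<inter> S = \<phi> ` P"
      "\<And>P P'. P \<in> insert Q F \<Longrightarrow> P' \<in> insert Q F \<Longrightarrow> P \<noteq> P' \<Longrightarrow> (e P - \<phi> ` P) \<inter> (e P' - \<phi> ` P') = {}"
      using conjunct1[OF ee] conjunct2[OF ee] by metis+
    have PN: "P \<in> NP" "P \<noteq> Q" using insert.prems by auto
    obtain x y where xy: "P = {x, y}" "x \<in> VT" "y \<in> VT" "x \<noteq> y" "{x, y} \<notin> ET"
      using PN(1) unfolding NP_def by blast
    \<comment> \<open>Everything used so far except the pair itself.\<close>
    define Z where "Z = (S \<union> (\<Union>P'\<in>insert Q F. e P')) - \<phi> ` P"
    have fF: "finite (insert Q F)" using insert.hyps by simp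
    have fin: "finite (e P')" "card (e P') \<le> k" if "P' \<in> insert Q F" for P'
      using e(1)[OF that] kg_finite_edge[OF kg] kg_edge_card[OF kg] by auto
    have "card (S \<union> (\<Union>P'\<in>insert Q F. e P')) \<le> card S + card (\<Union>P'\<in>insert Q F. e P')" by (rule card_Un_le)
    also have "card (\<Union>P'\<in>insert Q F. e P') \<le> (\<Sum>P'\<in>insert Q F. card (e P'))" by (rule card_UN_le[OF fF])
    also have "\<dots> \<le> card (insert Q F) * k" using sum_bounded_above[of "insert Q F" "\<lambda>P'. card (e P')" k] fin by simp
    also have "\<dots> \<le> t * t * k"
    proof -
      have "insert Q F \<subseteq> NP" using insert.prems Q by blast
      then have "card (insert Q F) \<le> t * t" using card_mono[OF NP_finite(1)] NP_finite(2) le_trans by blast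
      then show ?thesis by simp
    qed
    finally have "card (S \<union> (\<Union>P'\<in>insert Q F. e P')) \<le> NN k" using fS(2) by (simp add: NN_def)
    moreover have fU: "finite (S \<union> (\<Union>P'\<in>insert Q F. e P'))" using fS(1) fF fin by auto
    ultimately have cZ: "card Z \<le> NN k" "finite Z"
      using card_mono[OF fU, of Z] by (auto simp: Z_def)
    have "robust (NN k) E (\<phi> x) (\<phi> y)"
      by (rule rob) (use xy PN(2) in \<open>simp_all add: Q_def\<close>)
    then have "\<exists>f\<in>E. \<phi> x \<in> f \<and> \<phi> y \<in> f \<and> f \<inter> Z = {}"
      unfolding robust_def using cZ xy by (auto simp: Z_def)
    then obtain f where f: "f \<in> E" "\<phi> x \<in> f" "\<phi> y \<in> f" "f \<inter> Z = {}" by blast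
    define e' where "e' = e(P := f)"
    have fS': "f \<inter> S = \<phi> ` P" using f xy by (auto simp: Z_def S_def)
    have new: "(f - \<phi> ` P) \<inter> (e P' - \<phi> ` P') = {}" if "P' \<in> insert Q F" for P'
      using f(4) that by (auto simp: Z_def)
    have nP: "P \<notin> insert Q F" using insert.hyps PN by simp
    have e'old: "e' P' = e P'" if "P' \<in> insert Q F" for P' using that nP by (auto simp: e'_def)
    have e'P: "e' P = f" by (simp add: e'_def)
    have com: "insert Q (insert P F) = insert P (insert Q F)" by blast
    show ?case
      unfolding com
    proof (intro exI[of _ e'] conjI ballI impI)
      fix P' assume P': "P' \<in> insert P (insert Q F)"
      show "e' P' \<in> E" "e' P' \<inter> S = \<phi> ` P'"
        using P' e(1)[of P'] e'old[of P'] e'P f(1) fS' by auto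
      fix P'' assume P'': "P'' \<in> insert P (insert Q F)" and ne: "P' \<noteq> P''"
      consider "P' = P" "P'' \<in> insert Q F" | "P'' = P" "P' \<in> insert Q F" | "P' \<in> insert Q F" "P'' \<in> insert Q F"
        using P' P'' ne by auto
      then show "(e' P' - \<phi> ` P') \<inter> (e' P'' - \<phi> ` P'') = {}"
      proof cases
        case 1
        then show ?thesis using new[OF 1(2)] e'old[OF 1(2)] e'P by simp
      next
        case 2
        then show ?thesis using new[OF 2(2)] e'old[OF 2(2)] e'P by (simp add: Int_commute)
      next
        case 3
        then show ?thesis using e(2)[OF 3 ne] e'old[OF 3(1)] e'old[OF 3(2)] by simp
      qed
    qed
  qed
  have "insert Q (NP - {Q}) = NP" using Q by blast
  moreover have "finite (NP - {Q})" using NP_finite(1) by simp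
  ultimately obtain e where ee: "(\<forall>P\<in>NP. e P \<in> E \<and> e P \<inter> S = \<phi> ` P) \<and>
      (\<forall>P\<in>NP. \<forall>P'\<in>NP. P \<noteq> P' \<longrightarrow> (e P - \<phi> ` P) \<inter> (e P' - \<phi> ` P') = {})"
    using ext[of "NP - {Q}"] by (metis order_refl)
  have e: "\<And>P. P \<in> NP \<Longrightarrow> e P \<in> E \<and> e P \<inter> S = \<phi> ` P"
      "\<And>P P'. P \<in> NP \<Longrightarrow> P' \<in> NP \<Longrightarrow> P \<noteq> P' \<Longrightarrow> (e P - \<phi> ` P) \<inter> (e P' - \<phi> ` P') = {}"
    using conjunct1[OF ee] conjunct2[OF ee] by metis+
  have "\<forall>P\<in>NP. e P \<in> E \<and> \<phi> ` P \<subseteq> e P \<and> e P \<inter> (\<phi> ` VT \<union> A) = \<phi> ` P"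
    using e(1) unfolding S_def by blast
  then show False using xf emb e(2) unfolding xfree_def by metis
qed

end

section \<open>From approximate to exact colourability\<close>

text \<open>With \<open>x = 1 / q\<close> the quotient of the two densities is
  \<open>(1 - k * x) / (1 - x) ^ k\<close>, which is below one by Bernoulli's inequality, strictly
  because \<open>2 \<le> k\<close>.\<close>

lemma complete_density_strict:
  assumes "2 \<le> k" "k \<le> q"
  shows "real ((q - 1) choose k) / real (q - 1) ^ k < real (q choose k) / real q ^ k"
proof -
  define x where "x = 1 / real q"
  have q: "2 \<le> q" using assms by simp
  have x: "0 < x" "x \<le> 1 / 2" using q by (auto simp: x_def field_simps)
  obtain m where m: "k = Suc m" "1 \<le> m" using assms(1) by (cases k) auto
  have "1 - real m * x \<le> (1 - x) ^ m"
    using Bernoulli_inequality[of "- x" m] x by simp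
  then have "(1 - x) * (1 - real m * x) \<le> (1 - x) * (1 - x) ^ m" using x by (intro mult_left_mono) auto
  moreover have "0 < real m * (x * x)" using m x by simp
  ultimately have B: "1 - real k * x < (1 - x) ^ k" by (simp add: m algebra_simps)
  have "q * ((q - 1) choose k) = (q - k) * (q choose k)"
  proof -
    have "q * ((q - 1) choose (q - k - 1)) = (q - k) * (q choose (q - k))" if "k < q"
      using times_binomial_minus1_eq[of "q - k" q] that by simp
    moreover have "(q - 1) choose (q - k - 1) = (q - 1) choose k" if "k < q"
      using that binomial_symmetric[of k "q - 1"] by (simp add: diff_commute)
    moreover have "q choose (q - k) = q choose k" using binomial_symmetric[OF assms(2)] by simp
    ultimately show ?thesis using assms by (cases "k = q") (auto simp: binomial_eq_0)
  qed
  then have "real (q * ((q - 1) choose k)) = real ((q - k) * (q choose k))" by simp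
  then have c: "real ((q - 1) choose k) = (1 - real k * x) * real (q choose k)"
    using q assms by (simp add: x_def of_nat_diff field_simps)
  have q1: "real (q - 1) = (1 - x) * real q" using q by (simp add: x_def of_nat_diff field_simps)
  have pos: "0 < real (q choose k)" using assms by (simp add: zero_less_binomial)
  have px: "0 < (1 - x) ^ k" using x by simp
  have "real ((q - 1) choose k) / real (q - 1) ^ k = (1 - real k * x) / (1 - x) ^ k * (real (q choose k) / real q ^ k)"
    unfolding c q1 by (simp add: power_mult_distrib)
  also have "\<dots> < 1 * (real (q choose k) / real q ^ k)"
    using B px pos q by (intro mult_strict_right_mono) (auto simp: field_simps)
  finally show ?thesis by simp
qed

text \<open>Edges avoiding \<open>j\<close> live on \<open>q - 1\<close> vertices and reach at most
  the smaller density; the remaining edges contribute at most \<open>x j\<close>. So a light part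
  would cost nearly the whole gap between the two densities.\<close>

lemma complete_lower_weight:
  assumes "2 \<le> k" "k \<le> q" "\<And>i. i < q \<Longrightarrow> 0 \<le> x i" "sum x {..<q} = 1" "j < q"
    and lag: "real (q choose k) / real q ^ k - \<epsilon> \<le> lag (ksets {..<q} k) x"
  shows "real (q choose k) / real q ^ k - real ((q - 1) choose k) / real (q - 1) ^ k - \<epsilon> \<le> x j"
proof -
  obtain m where m: "k = Suc m" using assms(1) by (cases k) auto
  have kg: "kg k {..<q} (ksets {..<q} k)" by (rule kg_ksets) simp
  have xj: "x j \<le> 1" using member_le_sum[of j "{..<q}" x] assms(3,4,5) by simp
  have r: "sum x ({..<q} - {j}) = 1 - x j" using assms(4,5) by (simp add: sum_diff1)
  have sp: "lag (ksets {..<q} k) x = lag {e\<in>ksets {..<q} k. j \<notin> e} x + x j * lag (link (ksets {..<q} k) j) x"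
    by (rule lag_split[OF kg_finite[OF kg] kg_finite_edge[OF kg]])
  have e1: "{e\<in>ksets {..<q} k. j \<notin> e} = ksets ({..<q} - {j}) k" by (auto simp: ksets_def)
  have "lag (ksets ({..<q} - {j}) k) x \<le> real ((q - 1) choose k) * ((1 - x j) / real (q - 1)) ^ k"
    by (rule lag_ksets_le) (use assms r in auto)
  also have "\<dots> \<le> real ((q - 1) choose k) * (1 / real (q - 1)) ^ k"
    using assms(1,2,3,5) xj by (intro mult_left_mono power_mono divide_right_mono) auto
  also have "\<dots> = real ((q - 1) choose k) / real (q - 1) ^ k" by (simp add: power_divide)
  finally have 1: "lag {e\<in>ksets {..<q} k. j \<notin> e} x \<le> real ((q - 1) choose k) / real (q - 1) ^ k"
    unfolding e1 .
  have "lag (link (ksets {..<q} k) j) x \<le> (sum x ({..<q} - {j})) ^ m"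
    by (rule lag_le_power) (use kg_link[of m "{..<q}" "ksets {..<q} k" j] kg m assms(3) in auto)
  also have "\<dots> \<le> 1" unfolding r using xj assms(3,5) by (intro power_le_one) auto
  finally have "x j * lag (link (ksets {..<q} k) j) x \<le> x j * 1"
    using assms(3,5) by (intro mult_left_mono) auto
  then show ?thesis using sp 1 lag by linarith
qed

text \<open>Shifting weight \<open>s = sqrt \<epsilon>\<close> towards \<open>j\<close> cannot beat the maximum, so no partial
  derivative is much larger than the average one.\<close>
lemma complete_gradient:
  assumes "2 \<le> k" "k \<le> q" "\<And>i. i < q \<Longrightarrow> 0 \<le> x i" "sum x {..<q} = 1" "j < q"
    and eps: "0 < s" "s \<le> 1" "real (q choose k) / real q ^ k - s\<^sup>2 \<le> lag (ksets {..<q} k) x"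
  shows "lag (link (ksets {..<q} k) j) x \<le> real k * (real (q choose k) / real q ^ k) + (real q + 2) * s"
proof -
  define E where "E = ksets {..<q} k"
  define L where "L = real (q choose k) / real q ^ k"
  define d where "d i = lag (link E i) x" for i
  obtain m where m: "k = Suc (Suc m)" using assms(1) by (metis Suc_le_D numeral_2_eq_2 Suc_le_mono le_Suc_ex add_2_eq_Suc)
  have kg: "kg k {..<q} E" unfolding E_def by (rule kg_ksets) simp
  have q0: "0 < q" using assms by simp
  have max: "lag E y \<le> L" if "\<And>i. i < q \<Longrightarrow> 0 \<le> y i" "sum y {..<q} = 1" for y
    using lag_ksets_le[of "{..<q}" q y 1 k] that q0 by (simp add: E_def L_def power_divide)
  have d1: "0 \<le> d i \<and> d i \<le> 1" if "i < q" for i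
  proof -
    have kl: "kg (Suc m) ({..<q} - {i}) (link E i)" by (rule kg_link) (use kg m in simp)
    have "d i \<le> (sum x ({..<q} - {i})) ^ Suc m"
      unfolding d_def by (rule lag_le_power[OF kl]) (use assms(3) in auto)
    also have "\<dots> \<le> 1"
    proof (rule power_le_one)
      show "0 \<le> sum x ({..<q} - {i})" using assms(3) by (intro sum_nonneg) auto
      show "sum x ({..<q} - {i}) \<le> 1" using assms(3,4) that by (simp add: sum_diff1)
    qed
    finally have "d i \<le> 1" .
    moreover have "0 \<le> d i" unfolding d_def
    proof (rule lag_nonneg)
      fix e v assume "e \<in> link E i" "v \<in> e"
      then have "v \<in> {..<q}" using kg_edge_subset[OF kl] by blast
      then show "0 \<le> x v" using assms(3) by simp
    qed
    ultimately show ?thesis by simp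
  qed
  have dd: "lag (link (link E i) j) x \<le> 1" for i
  proof -
    have kl: "kg m ({..<q} - {i} - {j}) (link (link E i) j)" by (intro kg_link) (use kg m in simp)
    have "lag (link (link E i) j) x \<le> (sum x ({..<q} - {i} - {j})) ^ m"
      by (rule lag_le_power[OF kl]) (use assms(3) in simp)
    also have "\<dots> \<le> 1"
    proof (rule power_le_one)
      show "0 \<le> sum x ({..<q} - {i} - {j})" using assms(3) by (intro sum_nonneg) auto
      have "sum x ({..<q} - {i} - {j}) \<le> sum x {..<q}" using assms(3) by (intro sum_mono2) auto
      then show "sum x ({..<q} - {i} - {j}) \<le> 1" using assms(4) by simp
    qed
    finally show ?thesis .
  qed
  have each: "x i * (d j - d i) \<le> x i * (2 * s) + s" if i: "i < q" for i
  \<comment> \<open>If \<open>x i < s\<close>, the shift would leave the simplex, but then the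
    summand itself is at most \<open>s\<close>.\<close>
  proof (cases "i = j \<or> x i < s")
    case True
    have "x i * (d j - d i) \<le> s"
    proof (cases "i = j")
      case True then show ?thesis using eps by simp
    next
      case False
      then have xs: "x i < s" using \<open>i = j \<or> x i < s\<close> by simp
      have "x i * (d j - d i) \<le> x i * 1" using assms(3)[OF i] d1[OF i] d1[OF assms(5)] by (intro mult_left_mono) auto
      then show ?thesis using xs by simp
    qed
    moreover have "0 \<le> x i * (2 * s)" using assms(3)[OF i] eps by simp
    ultimately show ?thesis by linarith
  next
    case False
    then have ij: "i \<noteq> j" and xs: "s \<le> x i" by auto
    define y where "y = x(i := x i - s, j := x j + s)"
    have "sum y {..<q} = (\<Sum>v\<in>{..<q}. x v + (if v = i then - s else 0) + (if v = j then s else 0))"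
      using ij by (intro sum.cong) (auto simp: y_def)
    also have "\<dots> = 1" using assms(4,5) i by (simp add: sum.distrib)
    finally have "sum y {..<q} = 1" .
    moreover have "0 \<le> y v" if "v < q" for v using assms(3)[OF that] assms(3)[OF assms(5)] xs eps by (simp add: y_def)
    ultimately have "lag E y \<le> L" using max by blast
    moreover have "lag E y = lag E x + s * (d j - d i) - s\<^sup>2 * lag (link (link E i) j) x"
      unfolding y_def d_def by (rule lag_shift[OF kg_finite[OF kg] kg_finite_edge[OF kg] ij])
    moreover have "s\<^sup>2 * lag (link (link E i) j) x \<le> s\<^sup>2 * 1" using dd by (intro mult_left_mono) auto
    ultimately have "s * (d j - d i) \<le> 2 * s\<^sup>2" using eps(3) unfolding E_def[symmetric] L_def[symmetric] by linarith
    then have "s * (d j - d i) \<le> s * (2 * s)" by (simp add: power2_eq_square)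
    then have "d j - d i \<le> 2 * s" using eps(1) by simp
    then have "x i * (d j - d i) \<le> x i * (2 * s)" using assms(3)[OF i] by (rule mult_left_mono)
    then show ?thesis using eps(1) by simp
  qed
  have "(\<Sum>i<q. x i * (d j - d i)) \<le> (\<Sum>i<q. x i * (2 * s) + s)"
    by (rule sum_mono) (use each in simp)
  also have "\<dots> = 2 * s + real q * s" using assms(4) by (simp add: sum.distrib sum_distrib_right[symmetric])
  also have "(\<Sum>i<q. x i * (d j - d i)) = d j - (\<Sum>i<q. x i * d i)"
    using assms(4) by (simp add: right_diff_distrib sum_subtractf sum_distrib_right[symmetric])
  also have "(\<Sum>i<q. x i * d i) = k * lag E x" unfolding d_def by (rule lag_euler[OF kg])
  finally have "d j \<le> k * lag E x + (real q + 2) * s" by (simp add: algebra_simps)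
  moreover have "real k * lag E x \<le> real k * L" using max[of x] assms(3,4) by (intro mult_left_mono) auto
  ultimately show ?thesis unfolding d_def E_def L_def by linarith
qed

text \<open>Vertices of \<open>Y1\<close> are charged the trivial codegree bound and enter by their
  number. Vertices of \<open>Y2\<close> are not robust with \<open>v\<close>, so each carries so few
  edges that together they cost only \<open>N * card V ^ (k - 2)\<close>, however many they
  are.\<close>

lemma link_avoid:
  assumes kg: "kg k V E" and k: "2 \<le> k" and v: "v \<in> V"
    and Y: "Y1 \<subseteq> V" "Y2 \<subseteq> V" "\<And>u. u \<in> Y2 \<Longrightarrow> u \<noteq> v \<Longrightarrow> \<not> robust N E v u"
  shows "real (card (link E v)) - card Y1 * real (card V) ^ (k - 2) - N * real (card V) ^ (k - 2)
    \<le> card {f\<in>link E v. f \<inter> (Y1 \<union> Y2) = {}}"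
proof -
  define n where "n = card V"
  have fV: "finite V" using kg_finite_verts[OF kg] .
  have n0: "0 < n" using v fV by (auto simp: n_def card_gt_0_iff)
  have fL: "finite (link E v)" using finite_link[OF kg_finite[OF kg]] .
  obtain m where m: "k = Suc m" using k by (cases k) auto
  have kgL: "kg m (V - {v}) (link E v)" by (rule kg_link) (use kg m in simp)
  have "link E v \<subseteq> {f\<in>link E v. f \<inter> (Y1 \<union> Y2) = {}} \<union> ((\<Union>u\<in>Y1. {f\<in>link E v. u \<in> f}) \<union> (\<Union>u\<in>Y2. {f\<in>link E v. u \<in> f}))"
    by blast
  then have "card (link E v) \<le> card ({f\<in>link E v. f \<inter> (Y1 \<union> Y2) = {}} \<union> ((\<Union>u\<in>Y1. {f\<in>link E v. u \<in> f}) \<union> (\<Union>u\<in>Y2. {f\<in>link E v. u \<in> f})))"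
    using fL Y fV by (intro card_mono) (auto intro: finite_subset)
  also have "\<dots> \<le> card {f\<in>link E v. f \<inter> (Y1 \<union> Y2) = {}} + (card (\<Union>u\<in>Y1. {f\<in>link E v. u \<in> f}) + card (\<Union>u\<in>Y2. {f\<in>link E v. u \<in> f}))"
    by (intro order_trans[OF card_Un_le] add_left_mono card_Un_le)
  finally have 1: "card (link E v) \<le> card {f\<in>link E v. f \<inter> (Y1 \<union> Y2) = {}} + (card (\<Union>u\<in>Y1. {f\<in>link E v. u \<in> f}) + card (\<Union>u\<in>Y2. {f\<in>link E v. u \<in> f}))" .
  have fY: "finite Y1" "finite Y2" using Y(1,2) fV finite_subset by blast+
  have "card (\<Union>u\<in>Y1. {f\<in>link E v. u \<in> f}) \<le> (\<Sum>u\<in>Y1. card {f\<in>link E v. u \<in> f})" by (rule card_UN_le[OF fY(1)])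
  also have "\<dots> \<le> (\<Sum>u\<in>Y1. n ^ (k - 2))"
  proof (rule sum_mono)
    fix u
    have "card {f\<in>link E v. u \<in> f} \<le> card {e. e \<subseteq> V \<and> card e = m \<and> {u} \<subseteq> e}"
      using kg_edge_subset[OF kgL] kg_edge_card[OF kgL] fV by (intro card_mono) auto
    also have "\<dots> \<le> n ^ (m - card {u})" unfolding n_def by (rule card_supersets_le[OF fV]) simp
    also have "m - card {u} = k - 2" using m by simp
    finally show "card {f\<in>link E v. u \<in> f} \<le> n ^ (k - 2)" .
  qed
  finally have 2: "card (\<Union>u\<in>Y1. {f\<in>link E v. u \<in> f}) \<le> card Y1 * n ^ (k - 2)" by simp
  have "card (\<Union>u\<in>Y2. {f\<in>link E v. u \<in> f}) * n \<le> (\<Sum>u\<in>Y2. card {f\<in>link E v. u \<in> f}) * n"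
    using card_UN_le[OF fY(2), of "\<lambda>u. {f\<in>link E v. u \<in> f}"] by (intro mult_right_mono) auto
  also have "\<dots> = (\<Sum>u\<in>Y2. card {f\<in>link E v. u \<in> f} * n)" by (rule sum_distrib_right)
  also have "\<dots> \<le> (\<Sum>u\<in>Y2. N * n ^ (k - 2))"
  proof (rule sum_mono)
    fix u assume u: "u \<in> Y2"
    show "card {f\<in>link E v. u \<in> f} * n \<le> N * n ^ (k - 2)"
    proof (cases "u = v")
      case True
      then have e: "{f\<in>link E v. u \<in> f} = {}" by (auto simp: link_def)
      show ?thesis unfolding e by simp
    next
      case False
      have inj: "inj_on (insert v) {f\<in>link E v. u \<in> f}" by (rule inj_on_subset[OF inj_insert_link]) auto
      have "insert v ` {f\<in>link E v. u \<in> f} \<subseteq> {e\<in>E. v \<in> e \<and> u \<in> e}" by (auto simp: link_def)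
      then have "card {f\<in>link E v. u \<in> f} \<le> card {e\<in>E. v \<in> e \<and> u \<in> e}"
        using card_inj_on_le[OF inj] kg_finite[OF kg] by simp
      then have "card {f\<in>link E v. u \<in> f} * n \<le> card {e\<in>E. v \<in> e \<and> u \<in> e} * n" by simp
      also have "\<dots> \<le> N * n ^ (k - 2)" unfolding n_def
        by (rule nonrobust_codegree[OF kg k _ Y(3)[OF u False]]) (use False in simp)
      finally show ?thesis .
    qed
  qed
  also have "\<dots> = card Y2 * (N * n ^ (k - 2))" by simp
  also have "\<dots> \<le> n * (N * n ^ (k - 2))" unfolding n_def using card_mono[OF fV Y(2)] by (rule mult_right_mono) simp
  finally have "card (\<Union>u\<in>Y2. {f\<in>link E v. u \<in> f}) \<le> N * n ^ (k - 2)" using n0 by (simp add: mult.commute)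
  then have "card (link E v) \<le> card {f\<in>link E v. f \<inter> (Y1 \<union> Y2) = {}} + (card Y1 * n ^ (k - 2) + N * n ^ (k - 2))"
    using 1 2 by linarith
  then have "real (card (link E v)) \<le> real (card {f\<in>link E v. f \<inter> (Y1 \<union> Y2) = {}} + (card Y1 * n ^ (k - 2) + N * n ^ (k - 2)))"
    by (simp only: of_nat_le_iff)
  then show ?thesis by (simp add: n_def)
qed

definition badpairs :: "nat \<Rightarrow> 'a set \<Rightarrow> 'a set set \<Rightarrow> ('a \<Rightarrow> nat) \<Rightarrow> 'a set set" where
  "badpairs N V E c = (\<lambda>(a, b). {a, b}) ` (SIGMA a:V. {b\<in>V. c b \<noteq> c a \<and> \<not> robust N E a b})"

text \<open>Summing \<open>nonrobust_degree\<close> over all vertices, with the handshake identity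
  for the missing sets, bounds the number of bad pairs by a multiple of
  \<open>\<beta> * card V ^ 2\<close>.\<close>

lemma badpairs_sum:
  fixes \<kappa> \<beta> :: real
  assumes kg: "kg k V E" and k: "2 \<le> k" "k \<le> q" and c: "c ` V \<subseteq> {..<q}" and V: "V \<noteq> {}"
    and kap: "0 < \<kappa>" "\<And>i. i < q \<Longrightarrow> \<kappa> * card V \<le> card (cls V c i)"
    and M: "card (trans V c k - E) \<le> \<beta> * real (card V) ^ k" and n: "2 * real N \<le> \<kappa> ^ (k - 2) * card V"
  shows "finite (badpairs N V E c)"
    "(\<Sum>m\<in>badpairs N V E c. 1 / real (card V) ^ card m) \<le> 2 * real k ^ 2 * \<beta> / \<kappa> ^ (k - 2)"
proof -
  define n where "n = real (card V)"
  define Y where "Y a = {b\<in>V. c b \<noteq> c a \<and> \<not> robust N E a b}" for a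
  have fV: "finite V" using kg_finite_verts[OF kg] .
  have n0: "0 < n" using V fV by (auto simp: n_def card_gt_0_iff)
  have fS: "finite (SIGMA a:V. Y a)" using fV by (auto simp: Y_def)
  show fin: "finite (badpairs N V E c)" using fS by (simp add: badpairs_def Y_def)
  have c2: "card m = 2" if "m \<in> badpairs N V E c" for m
    using that by (auto simp: badpairs_def card_2_iff)
  have kgM: "kg k V (trans V c k - E)" by (rule kg_subset[OF trans_kg[OF fV]]) auto
  have e: "k = (k - 2) + 2" using k(1) by simp
  have "card (badpairs N V E c) \<le> card (SIGMA a:V. Y a)" unfolding badpairs_def Y_def
    by (rule card_image_le) (use fS in \<open>simp add: Y_def\<close>)
  also have "\<dots> = (\<Sum>a\<in>V. card (Y a))" using fV by (intro card_SigmaI) (auto simp: Y_def)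
  finally have "real (card (badpairs N V E c)) \<le> (\<Sum>a\<in>V. real (card (Y a)))"
    by (simp only: of_nat_sum[symmetric] of_nat_le_iff)
  then have "card (badpairs N V E c) * (\<kappa> ^ (k - 2) * n ^ (k - 2)) \<le> (\<Sum>a\<in>V. real (card (Y a))) * (\<kappa> ^ (k - 2) * n ^ (k - 2))"
    using kap n0 by (intro mult_right_mono) auto
  also have "\<dots> = (\<Sum>a\<in>V. card (Y a) * \<kappa> ^ (k - 2) * n ^ (k - 2))" by (simp add: sum_distrib_right mult.assoc)
  also have "\<dots> \<le> (\<Sum>a\<in>V. 2 * real k * card (link (trans V c k - E) a))"
  proof (rule sum_mono)
    fix a assume a: "a \<in> V"
    show "card (Y a) * \<kappa> ^ (k - 2) * n ^ (k - 2) \<le> 2 * real k * card (link (trans V c k - E) a)"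
      unfolding Y_def n_def by (rule nonrobust_degree[OF kg k c kap refl n a])
  qed
  also have "\<dots> = 2 * real k * real (\<Sum>a\<in>V. card (link (trans V c k - E) a))" by (simp add: sum_distrib_left)
  also have "(\<Sum>a\<in>V. card (link (trans V c k - E) a)) = k * card (trans V c k - E)" by (rule sum_card_link[OF kgM])
  also have "2 * real k * real (k * card (trans V c k - E)) = 2 * real k ^ 2 * card (trans V c k - E)"
    by (simp add: power2_eq_square)
  also have "\<dots> \<le> 2 * real k ^ 2 * (\<beta> * n ^ k)" using M by (intro mult_left_mono) (auto simp: n_def)
  also have "n ^ k = n ^ (k - 2) * n\<^sup>2" by (subst e) (rule power_add)
  finally have "(card (badpairs N V E c) * \<kappa> ^ (k - 2)) * n ^ (k - 2) \<le> (2 * real k ^ 2 * \<beta> * n\<^sup>2) * n ^ (k - 2)"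
    by (simp only: mult_ac)
  then have 1: "card (badpairs N V E c) * \<kappa> ^ (k - 2) \<le> 2 * real k ^ 2 * \<beta> * n\<^sup>2"
    using n0 by (simp only: mult_le_cancel_right_pos zero_less_power)
  have "(\<Sum>m\<in>badpairs N V E c. 1 / n ^ card m) = card (badpairs N V E c) / n\<^sup>2"
    using c2 by simp
  also have "\<dots> \<le> 2 * real k ^ 2 * \<beta> / \<kappa> ^ (k - 2)"
    using 1 n0 kap(1) by (simp add: field_simps)
  finally show "(\<Sum>m\<in>badpairs N V E c. 1 / real (card V) ^ card m) \<le> 2 * real k ^ 2 * \<beta> / \<kappa> ^ (k - 2)"
    by (simp add: n_def)
qed

lemma badpairsI: "a \<in> V \<Longrightarrow> b \<in> V \<Longrightarrow> c a \<noteq> c b \<Longrightarrow> \<not> robust N E a b \<Longrightarrow> {a, b} \<in> badpairs N V E c"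
  unfolding badpairs_def by (rule image_eqI[of _ _ "(a, b)"]) auto

context estree
begin

lemma lam_pos: "0 < lam k"
  using pp_pos[of k] pp_ge_k[of k] by (simp add: lam_def zero_less_binomial)

text \<open>If \<open>w\<close> and \<open>w'\<close> had a common edge \<open>e0\<close>, a
  transversal through \<open>w'\<close> together with the extra vertex \<open>w\<close> would carry
  the core, with the leaf at \<open>w\<close> and a non-neighbour at \<open>w'\<close>. The edge
  \<open>e0\<close> serves that pair. All other non-adjacent pairs are robust, because outside
  \<open>w'\<close> the transversal avoids \<open>e0\<close>, the non-robust partners of
  \<open>w\<close> and \<open>w'\<close>, and all bad pairs.\<close>

lemma same_colour_uncovered:
  fixes \<kappa> \<beta> :: real
  assumes k: "2 \<le> k" and kg: "kg k V E" and xf: "xfree k E" and c: "c ` V \<subseteq> {..<pp k}"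
    and kap: "0 < \<kappa>" "\<And>i. i < pp k \<Longrightarrow> \<kappa> * card V \<le> card (cls V c i)"
    and b: "0 \<le> \<beta>" "card (trans V c k - E) \<le> \<beta> * real (card V) ^ k"
    and w: "w \<in> V" "w' \<in> V" "w \<noteq> w'" "c w = c w'"
      "card (link (trans V c k - E) w) \<le> \<beta> * real (card V) ^ (k - 1)"
      "card (link (trans V c k - E) w') \<le> \<beta> * real (card V) ^ (k - 1)"
    and n: "2 * real (NN k) \<le> \<kappa> ^ (k - 2) * card V"
    and lt: "4 * (\<beta> + real k / card V + 6 * real k ^ 2 * \<beta> / \<kappa> ^ (k - 2)) < \<kappa> ^ (pp k - 1)"
  shows "\<not> cov E w w'"
proof
  assume "cov E w w'"
  then obtain e0 where e0: "e0 \<in> E" "w \<in> e0" "w' \<in> e0" unfolding cov_def by (elim bexE conjE)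
  define n where "n = real (card V)"
  define q where "q = pp k"
  define j where "j = c w"
  have kq: "k \<le> q" "k - 1 \<le> q - 1" using pp_ge_k[of k] by (simp_all add: q_def)
  have fV: "finite V" using kg_finite_verts[OF kg] .
  have V0: "V \<noteq> {}" using w(1) by blast
  have n0: "0 < n" using V0 fV by (simp add: n_def card_gt_0_iff)
  have j: "j < q" using c w(1) by (auto simp: j_def q_def)
  define M where "M = trans V c k - E"
  define Y where "Y a = {u\<in>V. c u \<noteq> c a \<and> \<not> robust (NN k) E a u}" for a
  define P where "P = badpairs (NN k) V E c"
  define S1 where "S1 = (\<lambda>u. {u}) ` e0"
  define S2 where "S2 = (\<lambda>u. {u}) ` Y w"
  define S3 where "S3 = (\<lambda>u. {u}) ` Y w'"
  define N where "N = S1 \<union> (S2 \<union> (S3 \<union> P))"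
  define D where "D = \<kappa> ^ (k - 2)"
  have D0: "0 < D" using kap(1) by (simp add: D_def)
  have fY: "finite (Y a)" for a using fV by (simp add: Y_def)
  have fe0: "finite e0" "card e0 = k" using kg_finite_edge[OF kg e0(1)] kg_edge_card[OF kg e0(1)] by simp_all
  have single: "(\<Sum>m\<in>(\<lambda>u. {u}) ` A. 1 / n ^ card m) = card A / n" if "finite A" for A :: "nat set"
    using that by (subst sum.reindex) (auto simp: inj_on_def)
  have Ysum: "card (Y a) / n \<le> 2 * real k * \<beta> / D"
    if a: "a \<in> V" "card (link M a) \<le> \<beta> * n ^ (k - 1)" for a
  proof -
    have e: "k - 1 = Suc (k - 2)" using k by simp
    have "card (Y a) * D * n ^ (k - 2) \<le> 2 * real k * card (link M a)"
      unfolding Y_def n_def D_def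
      by (rule nonrobust_degree[OF kg k kq(1)[unfolded q_def] c kap M_def n a(1)])
    also have "\<dots> \<le> 2 * real k * (\<beta> * n ^ (k - 1))" using a(2) by (intro mult_left_mono) auto
    also have "\<dots> = (2 * real k * \<beta> * n) * n ^ (k - 2)" unfolding e by simp
    finally have "card (Y a) * D \<le> 2 * real k * \<beta> * n"
      using n0 by (simp only: mult_le_cancel_right_pos zero_less_power)
    then show ?thesis using n0 D0 by (simp add: field_simps)
  qed
  have P: "finite P" "(\<Sum>m\<in>P. 1 / n ^ card m) \<le> 2 * real k ^ 2 * \<beta> / D"
    unfolding P_def n_def D_def
    using badpairs_sum[OF kg k kq(1)[unfolded q_def] c V0 kap b(2) n] by simp_all
  have un: "(\<Sum>m\<in>A \<union> B. 1 / n ^ card m) \<le> (\<Sum>m\<in>A. 1 / n ^ card m) + (\<Sum>m\<in>B. 1 / n ^ card m)"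
    if "finite A" "finite B" for A B :: "nat set set"
  proof -
    have "0 \<le> (\<Sum>m\<in>A \<inter> B. 1 / n ^ card m)" using n0 by (intro sum_nonneg) auto
    then show ?thesis using sum.union_inter[OF that, of "\<lambda>m. 1 / n ^ card m"] by linarith
  qed
  have fS: "finite S1" "finite S2" "finite S3" using fe0 fY by (simp_all add: S1_def S2_def S3_def)
  have fN: "finite N" using fS P(1) by (simp add: N_def)
  have s1: "(\<Sum>m\<in>S1. 1 / n ^ card m) = real k / n" unfolding S1_def using single[OF fe0(1)] fe0(2) by simp
  have s2: "(\<Sum>m\<in>S2. 1 / n ^ card m) \<le> 2 * real k * \<beta> / D"
    unfolding S2_def using single[OF fY] Ysum[OF w(1)] w(5) by (simp add: M_def n_def)
  have s3: "(\<Sum>m\<in>S3. 1 / n ^ card m) \<le> 2 * real k * \<beta> / D"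
    unfolding S3_def using single[OF fY] Ysum[OF w(2)] w(6) by (simp add: M_def n_def)
  have kk: "2 * (2 * real k * \<beta> / D) + 2 * real k ^ 2 * \<beta> / D \<le> 6 * real k ^ 2 * \<beta> / D"
  proof -
    have "real k * 1 \<le> real k * real k" using k by (intro mult_left_mono) auto
    then have "(4 * real k + 2 * real k ^ 2) * (\<beta> / D) \<le> (6 * real k ^ 2) * (\<beta> / D)"
      using b(1) D0 by (intro mult_right_mono) (auto simp: power2_eq_square)
    moreover have "2 * (2 * real k * \<beta> / D) + 2 * real k ^ 2 * \<beta> / D = (4 * real k + 2 * real k ^ 2) * (\<beta> / D)"
      by (simp add: algebra_simps add_divide_distrib)
    ultimately show ?thesis by simp
  qed
  define B where "B = \<beta> + real k / n + 6 * real k ^ 2 * \<beta> / D"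
  have f3: "finite (S3 \<union> P)" using fS P(1) by simp
  then have f2: "finite (S2 \<union> (S3 \<union> P))" using fS by simp
  have sN: "(\<Sum>m\<in>N. 1 / n ^ card m) \<le> B"
  proof -
    define x1 where "x1 = 2 * real k * \<beta> / D"
    define x2 where "x2 = 2 * real k ^ 2 * \<beta> / D"
    define x3 where "x3 = 6 * real k ^ 2 * \<beta> / D"
    show ?thesis
      using un[OF fS(1) f2] un[OF fS(2) f3] un[OF fS(3) P(1)] P(2) s1 s2 s3 kk b(1)
      unfolding N_def B_def x1_def[symmetric] x2_def[symmetric] x3_def[symmetric] by linarith
  qed
  have bB: "\<beta> \<le> B" using b(1) n0 D0 by (simp add: B_def)
  have up: "x \<le> B * n ^ i" if "x \<le> \<beta> * n ^ i" for x i
  proof -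
    have "0 \<le> n ^ i" using n0 by simp
    then show ?thesis using that mult_right_mono[OF bB, of "n ^ i"] by linarith
  qed
  have cq: "c ` V \<subseteq> {..<q}" and k1: "1 \<le> k" and cw: "c w = j" "c w' = j"
    using c k w(4) by (simp_all add: q_def j_def)
  have kapq: "\<kappa> * card V \<le> card (cls V c i)" if "i < q" for i using kap(2) that by (simp add: q_def)
  have up1: "card M \<le> B * real (card V) ^ k" using up b(2) by (simp add: M_def n_def)
  have up2: "card (link M w) \<le> B * real (card V) ^ (k - 1)" using up w(5) by (simp add: M_def n_def)
  have up3: "card (link M w') \<le> B * real (card V) ^ (k - 1)" using up w(6) by (simp add: M_def n_def)
  have ltB: "4 * B < \<kappa> ^ (q - 1)" using lt by (simp add: B_def n_def q_def D_def)
  obtain g where g: "\<And>i. i < q \<Longrightarrow> g i \<in> V \<and> c (g i) = i" "g j = w'"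
    "\<And>S. S \<subseteq> {..<q} \<Longrightarrow> card S = k \<Longrightarrow> g ` S \<in> E"
    "\<And>S. S \<subseteq> {..<q} - {j} \<Longrightarrow> card S = k - 1 \<Longrightarrow> insert w (g ` S) \<in> E"
    "\<And>m. m \<in> N \<Longrightarrow> \<not> m \<subseteq> g ` ({..<q} - {j})"
    by (rule near_complete_tuple[OF fV cq k1 w(1,2) cw kap(1) kapq M_def up1 up2 up3 fN sN[unfolded n_def] ltB], assumption)
      (rule that)
  have ginj: "inj_on g {..<q}" by (rule inj_on_inverseI[of _ c]) (use g(1) in simp)
  have wg: "w \<notin> g ` {..<q}"
  proof
    assume "w \<in> g ` {..<q}"
    then obtain i where "w = g i" "i \<in> {..<q}" by (rule imageE)
    then have i: "i < q" "w = g i" by simp_all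
    then have "i = j" using g(1)[of i] by (simp add: j_def)
    then show False using i g(2) w(3) by simp
  qed
  have "k - 1 \<le> card ({..<q} - {j})" using kq(2) j by simp
  then obtain J where J: "J \<subseteq> {..<q} - {j}" "card J = k - 1" by (rule obtain_subset_with_card_n)
  obtain \<phi> A l z where emb: "emb k E \<phi> A" and l: "l \<in> VT" "z \<in> VT" "l \<noteq> z" "{l, z} \<notin> ET" "\<phi> l = w" "\<phi> z = g j"
    and sub: "A \<subseteq> g ` {..<pp k}" "\<phi> ` (VT - {l}) \<subseteq> g ` {..<pp k}"
    by (rule emb_of_tuple[OF k ginj[unfolded q_def] wg[unfolded q_def] j[unfolded q_def]
          J(1)[unfolded q_def] J(2) g(3)[unfolded q_def] g(4)[OF J]], assumption, assumption) (rule that)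
  have inj\<phi>: "inj_on \<phi> VT" using emb by (simp add: emb_def)
  have avoid: "g i \<notin> e0" "g i \<notin> Y w" "g i \<notin> Y w'" if "i < q" "i \<noteq> j" for i
    using g(5)[of "{g i}"] that by (auto simp: N_def S1_def S2_def S3_def)
  have other: "\<exists>i<q. i \<noteq> j \<and> \<phi> x = g i" if x: "x \<in> VT" "x \<noteq> l" "x \<noteq> z" for x
  proof -
    have "\<phi> x \<in> g ` {..<q}" using x by (intro subsetD[OF sub(2)[unfolded q_def[symmetric]]] imageI) simp
    then obtain i where "\<phi> x = g i" "i \<in> {..<q}" by (rule imageE)
    then have i: "i < q" "\<phi> x = g i" by simp_all
    have "i \<noteq> j"
    proof
      assume "i = j"
      then have "\<phi> x = \<phi> z" using i l(6) by simp
      then show False using inj_onD[OF inj\<phi>] x l(2) by metis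
    qed
    then show ?thesis using i by metis
  qed
  have robW: "robust (NN k) E w (g i)" if "i < q" "i \<noteq> j" for i
    using avoid(2)[OF that] g(1)[OF that(1)] that(2) by (auto simp: Y_def j_def)
  have robW': "robust (NN k) E w' (g i)" if "i < q" "i \<noteq> j" for i
    using avoid(3)[OF that] g(1)[OF that(1)] that(2) w(4) by (auto simp: Y_def j_def)
  have robG: "robust (NN k) E (g i) (g i')" if "i < q" "i \<noteq> j" "i' < q" "i' \<noteq> j" "i \<noteq> i'" for i i'
  proof (rule ccontr)
    assume "\<not> ?thesis"
    then have "{g i, g i'} \<in> N"
      unfolding N_def P_def using badpairsI[of "g i" V "g i'" c "NN k" E] g(1) that by simp
    then show False using g(5)[of "{g i, g i'}"] that by simp
  qed
  show False
  proof (rule core_contra[OF kg xf emb l(1,2,3,4) e0(1)])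
    show "e0 \<inter> (\<phi> ` VT \<union> A) = {\<phi> l, \<phi> z}"
    proof
      show "{\<phi> l, \<phi> z} \<subseteq> e0 \<inter> (\<phi> ` VT \<union> A)" using l(5,6) e0 g(2) imageI[OF l(1), of \<phi>] imageI[OF l(2), of \<phi>] by simp
      show "e0 \<inter> (\<phi> ` VT \<union> A) \<subseteq> {\<phi> l, \<phi> z}"
      proof
        fix a assume a: "a \<in> e0 \<inter> (\<phi> ` VT \<union> A)"
        show "a \<in> {\<phi> l, \<phi> z}"
        proof (cases "a = w")
          case True then show ?thesis using l(5) by simp
        next
          case False
          then have "a \<in> g ` {..<q}" using a sub l(5) unfolding q_def by blast
          then obtain i where "a = g i" "i \<in> {..<q}" by (rule imageE)
          then have i: "i < q" "a = g i" by simp_all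
          then have "i = j" using avoid(1)[of i] a by auto
          then show ?thesis using i l(6) by simp
        qed
      qed
    qed
    fix x y assume xy: "x \<in> VT" "y \<in> VT" "x \<noteq> y" "{x, y} \<notin> ET" "{x, y} \<noteq> {l, z}"
    have rz: "robust (NN k) E (\<phi> z) (\<phi> b)" if "b \<in> VT" "b \<noteq> l" "b \<noteq> z" for b
      using other[OF that] robW' l(6) g(2) by auto
    have rl: "robust (NN k) E (\<phi> l) (\<phi> b)" if "b \<in> VT" "b \<noteq> l" "b \<noteq> z" for b
      using other[OF that] robW l(5) by auto
    have comm: "{a, b} = {b, a}" for a b :: nat by (rule insert_commute)
    consider "x = l" | "y = l" | "x = z" "y \<noteq> l" | "y = z" "x \<noteq> l" | "x \<noteq> l" "x \<noteq> z" "y \<noteq> l" "y \<noteq> z" by metis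
    then show "robust (NN k) E (\<phi> x) (\<phi> y)"
    proof cases
      case 1
      then have "y \<noteq> l" "y \<noteq> z" using xy by auto
      then show ?thesis using rl[of y] xy 1 by simp
    next
      case 2
      then have "x \<noteq> l" "x \<noteq> z" using xy comm[of x l] by auto
      then show ?thesis using rl[of x] xy 2 robust_sym[of "NN k" E "\<phi> l" "\<phi> x"] by simp
    next
      case 3
      then show ?thesis using rz[of y] xy by simp
    next
      case 4
      then show ?thesis using rz[of x] xy robust_sym[of "NN k" E "\<phi> z" "\<phi> x"] by simp
    next
      case 5
      obtain i where i: "i < q" "i \<noteq> j" "\<phi> x = g i" using other[OF xy(1) 5(1,2)] by metis
      obtain i' where i': "i' < q" "i' \<noteq> j" "\<phi> y = g i'" using other[OF xy(2) 5(3,4)] by metis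
      have "i \<noteq> i'" using i i' inj_onD[OF inj\<phi> _ xy(1,2)] xy(3) by auto
      then show ?thesis using robG[OF i(1,2) i'(1,2)] i i' by simp
    qed
  qed
qed

text \<open>If \<open>v\<close> had many robust partners in every colour and many edges into them,
  it could be added as the extra vertex: a transversal of such partners extending a member of
  \<open>F\<close> carries the core with the leaf at \<open>v\<close>. Hence some colour contains
  few robust partners of \<open>v\<close>, and this is the colour that \<open>v\<close> can
  receive.\<close>

lemma some_colour_avoided:
  fixes \<kappa> \<beta> \<gamma> \<alpha> :: real
  assumes k: "2 \<le> k" and kg: "kg k V E" and xf: "xfree k E" and c: "c ` V \<subseteq> {..<pp k}"
    and kap: "0 < \<kappa>" "\<And>i. i < pp k \<Longrightarrow> \<kappa> * card V \<le> card (cls V c i)"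
    and b: "0 \<le> \<beta>" "card (trans V c k - E) \<le> \<beta> * real (card V) ^ k"
    and v: "v \<in> V" and X: "\<And>i. i < pp k \<Longrightarrow> X i \<subseteq> {u \<in> cls V c i. u \<noteq> v \<and> robust (NN k) E v u}"
    and gam: "0 \<le> \<gamma>" "\<And>i. i < pp k \<Longrightarrow> \<gamma> * card V \<le> card (X i)"
    and F: "F \<subseteq> {f \<in> link E v. inj_on c f \<and> f \<subseteq> (\<Union>i<pp k. X i)}" "\<alpha> * real (card V) ^ (k - 1) \<le> card F"
    and n: "2 * real (NN k) \<le> \<kappa> ^ (k - 2) * card V"
    and lt: "2 ^ pp k * (\<beta> + 1 / card V + 2 * real k ^ 2 * \<beta> / \<kappa> ^ (k - 2)) < \<alpha> * \<gamma> ^ (pp k - (k - 1))"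
  shows False
proof -
  define n where "n = real (card V)"
  define q where "q = pp k"
  have kq: "k \<le> q" "k - 1 < q" using pp_ge_k[of k] by (simp_all add: q_def)
  have fV: "finite V" using kg_finite_verts[OF kg] .
  have V0: "V \<noteq> {}" using v by blast
  have n0: "0 < n" using V0 fV by (simp add: n_def card_gt_0_iff)
  define M where "M = trans V c k - E"
  define P where "P = badpairs (NN k) V E c"
  obtain m where m: "k = Suc m" using k by (cases k) auto
  have kgL: "kg m (V - {v}) (link E v)" by (rule kg_link) (use kg m in simp)
  have kgM: "kg k V M" unfolding M_def by (rule kg_subset[OF trans_kg[OF fV]]) auto
  have fF: "finite F" by (rule finite_subset[OF F(1)]) (simp add: finite_link[OF kg_finite[OF kg]])
  have Ff: "f \<in> link E v" "inj_on c f" "f \<subseteq> (\<Union>i<q. X i)" "f \<subseteq> V" "finite f" "card f = k - 1" if "f \<in> F" for f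
  proof -
    show 1: "f \<in> link E v" "inj_on c f" "f \<subseteq> (\<Union>i<q. X i)" using that F(1) unfolding q_def by blast+
    show "f \<subseteq> V" using kg_edge_subset[OF kgL 1(1)] by blast
    show "finite f" using kg_finite_edge[OF kgL 1(1)] .
    show "card f = k - 1" using kg_edge_card[OF kgL 1(1)] m by simp
  qed
  have XV: "X i \<subseteq> cls V c i" if "i < q" for i using X[of i] that unfolding q_def by blast
  have Xc: "c a = i" "a \<in> V" "robust (NN k) E v a" "a \<noteq> v" if "a \<in> X i" "i < q" for a i
    using X[of i] that unfolding q_def cls_def by blast+
  have Fc: "c ` f \<in> ksets {..<q} (k - 1)" if "f \<in> F" for f
    using Ff(2,4,6)[OF that] c card_image unfolding ksets_def q_def by fastforce
  have fK: "finite (ksets {..<q} (k - 1))" by (rule kg_finite[OF kg_ksets]) simp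
  have cK: "card (ksets {..<q} (k - 1)) \<le> 2 ^ q"
  proof -
    have "card (ksets {..<q} (k - 1)) \<le> card (Pow {..<q})" by (rule card_mono) (auto simp: ksets_def)
    then show ?thesis by (simp add: card_Pow)
  qed
  \<comment> \<open>Pigeonhole over at most \<open>2 ^ q\<close> colour patterns.\<close>
  have "\<exists>J\<in>ksets {..<q} (k - 1). card F / 2 ^ q \<le> card {f\<in>F. c ` f = J}"
  proof (rule ccontr)
    assume neg: "\<not> ?thesis"
    have strict: "real (card {f\<in>F. c ` f = J}) < card F / 2 ^ q" if "J \<in> ksets {..<q} (k - 1)" for J
      using neg that by (simp add: not_le)
    then have less: "real (card {f\<in>F. c ` f = J}) \<le> card F / 2 ^ q" if "J \<in> ksets {..<q} (k - 1)" for J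
      using that by (simp add: less_imp_le)
    obtain J0 where J0: "J0 \<in> ksets {..<q} (k - 1)"
      using obtain_subset_with_card_n[of "k - 1" "{..<q}"] kq by (auto simp: ksets_def)
    have "F = (\<Union>J\<in>ksets {..<q} (k - 1). {f\<in>F. c ` f = J})" using Fc by blast
    then have "card F \<le> (\<Sum>J\<in>ksets {..<q} (k - 1). card {f\<in>F. c ` f = J})"
      using card_UN_le[OF fK, of "\<lambda>J. {f\<in>F. c ` f = J}"] by simp
    then have "real (card F) \<le> (\<Sum>J\<in>ksets {..<q} (k - 1). real (card {f\<in>F. c ` f = J}))"
      by (simp only: of_nat_sum[symmetric] of_nat_le_iff)
    also have "\<dots> < (\<Sum>J\<in>ksets {..<q} (k - 1). card F / 2 ^ q)"
      by (rule sum_strict_mono_ex1[OF fK]) (use less strict J0 in blast)+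
    also have "\<dots> = card (ksets {..<q} (k - 1)) * (card F / 2 ^ q)" by simp
    also have "\<dots> \<le> 2 ^ q * (card F / 2 ^ q)"
    proof (rule mult_right_mono)
      show "real (card (ksets {..<q} (k - 1))) \<le> 2 ^ q"
        using cK by (metis of_nat_le_iff of_nat_numeral of_nat_power)
    qed simp
    finally show False by simp
  qed
  then obtain J where J: "J \<in> ksets {..<q} (k - 1)" "card F / 2 ^ q \<le> card {f\<in>F. c ` f = J}" by blast
  have Jq: "J \<subseteq> {..<q}" "card J = k - 1" using J(1) by (simp_all add: ksets_def)
  define FJ where "FJ = {f\<in>F. c ` f = J}"
  \<comment> \<open>Full tuples whose part over \<open>J\<close> is a member of \<open>F\<close>.
    Their number is bounded below by combining each member of \<open>FJ\<close> with free choices at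
    the other indices.\<close>
  define U where "U = {u \<in> PiE {..<q} X. u ` J \<in> F}"
  have finX: "finite (X i)" if "i < q" for i using XV[OF that] cls_finite[OF fV] finite_subset by blast
  have fPi: "finite (PiE {..<q} X)" using finX by (intro finite_PiE) auto
  have "card (FJ \<times> PiE ({..<q} - J) X) \<le> card U"
  proof (rule card_inj_on_le)
    define comb where "comb fh = (\<lambda>i\<in>{..<q}. if i \<in> J then the_inv_into (fst fh) c i else snd fh i)"
      for fh :: "nat set \<times> (nat \<Rightarrow> nat)"
    have combP: "comb fh ` J = fst fh" "restrict (comb fh) ({..<q} - J) = snd fh" "comb fh \<in> U"
      if fh: "fh \<in> FJ \<times> PiE ({..<q} - J) X" for fh
    proof -
      obtain f h where eq: "fh = (f, h)" and f: "f \<in> F" "c ` f = J" and h: "h \<in> PiE ({..<q} - J) X"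
        using fh by (auto simp: FJ_def)
      have inv: "the_inv_into f c i \<in> f" "c (the_inv_into f c i) = i" if "i \<in> J" for i
        using the_inv_into_into[OF Ff(2)[OF f(1)]] f_the_inv_into_f[OF Ff(2)[OF f(1)]] that f(2) by simp_all
      have "comb fh ` J = the_inv_into f c ` J" using Jq(1) by (intro image_cong) (auto simp: comb_def eq)
      also have "\<dots> = (\<lambda>x. the_inv_into f c (c x)) ` f" unfolding f(2)[symmetric] image_image ..
      also have "\<dots> = f" using the_inv_into_f_f[OF Ff(2)[OF f(1)]] by simp
      finally show img: "comb fh ` J = fst fh" by (simp add: eq)
      show "restrict (comb fh) ({..<q} - J) = snd fh"
        using h by (auto simp: comb_def eq restrict_def PiE_def extensional_def fun_eq_iff)
      have "comb fh \<in> PiE {..<q} X"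
      proof (rule PiE_I)
        fix i assume i: "i \<in> {..<q}"
        show "comb fh i \<in> X i"
        proof (cases "i \<in> J")
          case True
          obtain i' where i': "i' < q" "the_inv_into f c i \<in> X i'" using inv(1)[OF True] Ff(3)[OF f(1)] by blast
          then have "i' = i" using Xc(1)[OF i'(2,1)] inv(2)[OF True] by simp
          then show ?thesis using i' i True by (simp add: comb_def eq)
        next
          case False
          then show ?thesis using PiE_mem[OF h, of i] i by (simp add: comb_def eq)
        qed
      qed (simp add: comb_def)
      then show "comb fh \<in> U" using img f by (simp add: U_def eq)
    qed
    show "inj_on comb (FJ \<times> PiE ({..<q} - J) X)"
      by (rule inj_on_inverseI[of _ "\<lambda>u. (u ` J, restrict u ({..<q} - J))"]) (use combP in simp)
    show "comb ` (FJ \<times> PiE ({..<q} - J) X) \<subseteq> U" using combP(3) by blast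
    show "finite U" using fPi by (simp add: U_def)
  qed
  then have "card FJ * card (PiE ({..<q} - J) X) \<le> card U" by (simp add: card_cartesian_product)
  then have 1: "real (card FJ) * real (card (PiE ({..<q} - J) X)) \<le> card U"
    by (simp only: of_nat_mult[symmetric] of_nat_le_iff)
  have cJ: "card ({..<q} - J) = q - (k - 1)" using Jq finite_subset[OF Jq(1)] by (simp add: card_Diff_subset)
  have "(\<gamma> * n) ^ card ({..<q} - J) \<le> card (PiE ({..<q} - J) X)"
    by (rule card_tuples_ge[OF _ fV]) (use gam n0 Xc(2) in \<open>auto simp: n_def q_def\<close>)
  then have 2: "(\<gamma> * n) ^ (q - (k - 1)) \<le> card (PiE ({..<q} - J) X)" unfolding cJ .
  have a0: "0 \<le> \<alpha>"
  proof (rule ccontr)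
    assume "\<not> 0 \<le> \<alpha>"
    then have "\<alpha> * \<gamma> ^ (pp k - (k - 1)) \<le> 0" using gam(1) by (intro mult_nonpos_nonneg) auto
    moreover have "0 \<le> 2 ^ pp k * (\<beta> + 1 / card V + 2 * real k ^ 2 * \<beta> / \<kappa> ^ (k - 2))"
      using b(1) kap(1) by (intro mult_nonneg_nonneg add_nonneg_nonneg) auto
    ultimately show False using lt by linarith
  qed
  have 3: "\<alpha> * n ^ (k - 1) / 2 ^ q \<le> card FJ"
    using J(2) F(2) divide_right_mono[OF F(2), of "2 ^ q"] by (simp add: FJ_def n_def)
  have "\<alpha> * n ^ (k - 1) / 2 ^ q * (\<gamma> * n) ^ (q - (k - 1)) \<le> real (card FJ) * real (card (PiE ({..<q} - J) X))"
    using 2 3 a0 gam(1) n0 by (intro mult_mono) auto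
  then have "\<alpha> * n ^ (k - 1) / 2 ^ q * (\<gamma> * n) ^ (q - (k - 1)) \<le> card U" using 1 by linarith
  moreover have "\<alpha> * n ^ (k - 1) / 2 ^ q * (\<gamma> * n) ^ (q - (k - 1)) = \<alpha> * \<gamma> ^ (q - (k - 1)) / 2 ^ q * n ^ q"
  proof -
    have "q = (k - 1) + (q - (k - 1))" using kq by simp
    then have "n ^ q = n ^ (k - 1) * n ^ (q - (k - 1))" by (metis power_add)
    then show ?thesis by (simp add: power_mult_distrib)
  qed
  ultimately have U: "\<alpha> * \<gamma> ^ (q - (k - 1)) / 2 ^ q * n ^ q \<le> card U" by (simp only:)
  define N where "N = insert {v} (M \<union> P)"
  have P: "finite P" "(\<Sum>m\<in>P. 1 / n ^ card m) \<le> 2 * real k ^ 2 * \<beta> / \<kappa> ^ (k - 2)"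
    unfolding P_def n_def
    using badpairs_sum[OF kg k kq(1)[unfolded q_def] c V0 kap b(2) n] by simp_all
  have fM: "finite M" using kg_finite[OF kgM] .
  have sM: "(\<Sum>m\<in>M. 1 / n ^ card m) \<le> \<beta>"
  proof -
    have "(\<Sum>m\<in>M. 1 / n ^ card m) = (\<Sum>m\<in>M. 1 / n ^ k)"
      using kg_edge_card[OF kgM] by (intro sum.cong) auto
    also have "\<dots> = card M / n ^ k" by simp
    also have "\<dots> \<le> \<beta>" using b(2) n0 by (simp add: n_def M_def divide_le_eq)
    finally show ?thesis .
  qed
  have "(\<Sum>m\<in>N. 1 / n ^ card m) \<le> 1 / n + (\<Sum>m\<in>M \<union> P. 1 / n ^ card m)"
    unfolding N_def using n0 fM P(1) by (cases "{v} \<in> M \<union> P") (auto simp: insert_absorb)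
  also have "(\<Sum>m\<in>M \<union> P. 1 / n ^ card m) \<le> (\<Sum>m\<in>M. 1 / n ^ card m) + (\<Sum>m\<in>P. 1 / n ^ card m)"
  proof -
    have "0 \<le> (\<Sum>m\<in>M \<inter> P. 1 / n ^ card m)" using n0 by (intro sum_nonneg) auto
    then show ?thesis using sum.union_inter[OF fM P(1), of "\<lambda>m. 1 / n ^ card m"] by linarith
  qed
  finally have sN: "(\<Sum>m\<in>N. 1 / n ^ card m) \<le> \<beta> + 1 / n + 2 * real k ^ 2 * \<beta> / \<kappa> ^ (k - 2)"
    using sM P(2) by linarith
  define B where "B = \<beta> + 1 / n + 2 * real k ^ 2 * \<beta> / \<kappa> ^ (k - 2)"
  have "2 ^ q * B < \<alpha> * \<gamma> ^ (q - (k - 1))" using lt by (simp add: B_def n_def q_def)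
  then have "B < \<alpha> * \<gamma> ^ (q - (k - 1)) / 2 ^ q" by (simp add: field_simps)
  then have "(\<Sum>m\<in>N. 1 / n ^ card m) * n ^ q < \<alpha> * \<gamma> ^ (q - (k - 1)) / 2 ^ q * n ^ q"
    using sN n0 by (intro mult_strict_right_mono) (auto simp: B_def)
  then have "(\<Sum>m\<in>N. 1 / n ^ card m) * n ^ q < card U" using U by linarith
  moreover have "U \<subseteq> PiE {..<q} (cls V c)"
  proof
    fix u assume "u \<in> U"
    then have u: "u \<in> PiE {..<q} X" by (simp add: U_def)
    show "u \<in> PiE {..<q} (cls V c)" by (rule subsetD[OF PiE_mono u]) (use XV in simp)
  qed
  ultimately have "\<exists>u\<in>U. \<forall>m\<in>N. \<not> m \<subseteq> u ` {..<q}"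
    unfolding n_def by (intro tuple_avoid[OF _ fV V0]) (use fM P(1) in \<open>auto simp: N_def\<close>)
  then obtain g where g: "g \<in> U" "\<And>m. m \<in> N \<Longrightarrow> \<not> m \<subseteq> g ` {..<q}" by blast
  have gX: "g i \<in> X i" if "i < q" for i using g(1) that by (auto simp: U_def)
  have gc: "c (g i) = i" "g i \<in> V" "robust (NN k) E v (g i)" if "i < q" for i using Xc[OF gX[OF that] that] by simp_all
  have ginj: "inj_on g {..<q}" by (rule inj_on_inverseI[of _ c]) (use gc(1) in simp)
  have vg: "v \<notin> g ` {..<q}" using g(2)[of "{v}"] by (simp add: N_def)
  have gE: "g ` S \<in> E" if S: "S \<subseteq> {..<q}" "card S = k" for S
  proof (rule ccontr)
    assume ne: "g ` S \<notin> E"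
    have "inj_on c (g ` S)" by (rule inj_on_inverseI[of _ g]) (use gc(1) S(1) in auto)
    moreover have "card (g ` S) = k" using card_image[OF inj_on_subset[OF ginj S(1)]] S(2) by simp
    moreover have "g ` S \<subseteq> V" using gc(2) S(1) by auto
    ultimately have "g ` S \<in> N" using ne by (simp add: N_def M_def trans_def)
    then show False using g(2)[of "g ` S"] S(1) by blast
  qed
  have gJ: "insert v (g ` J) \<in> E" using g(1) Ff(1)[of "g ` J"] by (simp add: U_def link_def)
  have "{..<q} - J \<noteq> {}" using cJ kq by (intro notI) simp
  then obtain j where j: "j < q" "j \<notin> J" by blast
  have Jj: "J \<subseteq> {..<q} - {j}" using Jq(1) j(2) by blast
  obtain \<phi> A l z where emb: "emb k E \<phi> A" and l: "l \<in> VT" "z \<in> VT" "l \<noteq> z" "{l, z} \<notin> ET" "\<phi> l = v" "\<phi> z = g j"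
    and sub: "A \<subseteq> g ` {..<pp k}" "\<phi> ` (VT - {l}) \<subseteq> g ` {..<pp k}"
    by (rule emb_of_tuple[OF k ginj[unfolded q_def] vg[unfolded q_def] j(1)[unfolded q_def]
          Jj[unfolded q_def] Jq(2) gE[unfolded q_def] gJ], assumption, assumption) (rule that)
  have inj\<phi>: "inj_on \<phi> VT" using emb by (simp add: emb_def)
  have fA: "finite A" "card A = k - 2" using emb by (simp_all add: emb_def)
  have other: "\<exists>i<q. \<phi> x = g i" if x: "x \<in> VT" "x \<noteq> l" for x
  proof -
    have "\<phi> x \<in> g ` {..<q}" using x by (intro subsetD[OF sub(2)[unfolded q_def[symmetric]]] imageI) simp
    then obtain i where "\<phi> x = g i" "i \<in> {..<q}" by (rule imageE)
    then show ?thesis by (intro exI[of _ i]) simp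
  qed
  \<comment> \<open>Unlike in \<open>same_colour_uncovered\<close>, no edge through the pair of the
    leaf and \<open>z\<close> is given in advance; robustness of this pair supplies one that avoids
    the rest of the core.\<close>
  define Z where "Z = (\<phi> ` VT \<union> A) - {\<phi> l, \<phi> z}"
  have fZ: "finite (\<phi> ` VT \<union> A)" using finite_VT fA by simp
  have "card Z \<le> card (\<phi> ` VT \<union> A)" unfolding Z_def using fZ by (intro card_mono) auto
  also have "\<dots> \<le> card (\<phi> ` VT) + card A" by (rule card_Un_le)
  also have "\<dots> \<le> NN k" using card_image_le[OF finite_VT, of \<phi>] fA(2) by (simp add: t_def NN_def)
  finally have cZ: "card Z \<le> NN k" .
  have "robust (NN k) E (\<phi> l) (\<phi> z)" using gc(3)[OF j(1)] l(5,6) by simp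
  moreover have "finite Z" "\<phi> l \<notin> Z" "\<phi> z \<notin> Z" using fZ by (simp_all add: Z_def)
  ultimately have "\<exists>e\<in>E. \<phi> l \<in> e \<and> \<phi> z \<in> e \<and> e \<inter> Z = {}" unfolding robust_def using cZ by metis
  then obtain e0 where e0: "e0 \<in> E" "\<phi> l \<in> e0" "\<phi> z \<in> e0" "e0 \<inter> Z = {}" by metis
  have robG: "robust (NN k) E (g i) (g i')" if "i < q" "i' < q" "i \<noteq> i'" for i i'
  proof (rule ccontr)
    assume "\<not> ?thesis"
    then have "{g i, g i'} \<in> N"
      unfolding N_def P_def using badpairsI[of "g i" V "g i'" c "NN k" E] gc that by simp
    then show False using g(2)[of "{g i, g i'}"] that by simp
  qed
  have rl: "robust (NN k) E (\<phi> l) (\<phi> b)" if "b \<in> VT" "b \<noteq> l" for b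
    using other[OF that] gc(3) l(5) by auto
  show False
  proof (rule core_contra[OF kg xf emb l(1,2,3,4) e0(1)])
    show "e0 \<inter> (\<phi> ` VT \<union> A) = {\<phi> l, \<phi> z}" using e0 l(1,2) unfolding Z_def by blast
    fix x y assume xy: "x \<in> VT" "y \<in> VT" "x \<noteq> y" "{x, y} \<notin> ET"
    consider "x = l" | "y = l" | "x \<noteq> l" "y \<noteq> l" by metis
    then show "robust (NN k) E (\<phi> x) (\<phi> y)"
    proof cases
      case 1
      then show ?thesis using rl[of y] xy by simp
    next
      case 2
      then show ?thesis using rl[of x] xy robust_sym[of "NN k" E "\<phi> l" "\<phi> x"] by simp
    next
      case 3
      obtain i where i: "i < q" "\<phi> x = g i" using other[OF xy(1) 3(1)] by metis
      obtain i' where i': "i' < q" "\<phi> y = g i'" using other[OF xy(2) 3(2)] by metis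
      have "i \<noteq> i'" using i i' inj_onD[OF inj\<phi> _ xy(1,2)] xy(3) by auto
      then show ?thesis using robG[OF i(1) i'(1)] i i' by simp
    qed
  qed
qed


section \<open>Choice of constants and the exact colouring theorem\<close>

lemma add_three_le: "(a::real) \<le> b \<Longrightarrow> z = b + b + w \<Longrightarrow> b + a + w \<le> z"
  by simp

text \<open>The value corresponding to \<open>lam k\<close> with one part fewer; the gap between the
  two is the price of losing a colour class.\<close>

definition lam' :: "nat \<Rightarrow> real" where
  "lam' k = real ((pp k - 1) choose k) / real (pp k - 1) ^ k"

lemma lam'_less: "2 \<le> k \<Longrightarrow> lam' k < lam k"
  unfolding lam'_def lam_def by (rule complete_density_strict) (use pp_ge_k[of k] in simp_all)

text \<open>Nearly optimal transversal density forces nearly optimal class sizes. This gives few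
  missing transversal sets, classes of linear size, and through \<open>complete_gradient\<close> an
  upper bound for the transversal sets avoiding one colour. The deficiency is written as
  \<open>s\<^sup>2\<close> because \<open>complete_gradient\<close> loses a square root.\<close>

lemma transversal_data:
  assumes k: "2 \<le> k" and kg: "kg k V E" and V0: "V \<noteq> {}" and c: "c ` V \<subseteq> {..<pp k}"
    and s: "0 < s" "s \<le> 1" "(lam k - s\<^sup>2) * real (card V) ^ k \<le> card {e\<in>E. inj_on c e}"
  shows "card (trans V c k - E) \<le> s\<^sup>2 * real (card V) ^ k"
    and "j < pp k \<Longrightarrow> (lam k - lam' k - s\<^sup>2) * card V \<le> card (cls V c j)"
    and "j < pp k \<Longrightarrow> card {f. f \<subseteq> V \<and> inj_on c f \<and> c ` f \<in> ksets ({..<pp k} - {j}) (k - 1)}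
      \<le> (k * lam k + (real (pp k) + 2) * s) * real (card V) ^ (k - 1)"
proof -
  define n where "n = real (card V)"
  define q where "q = pp k"
  have kq: "k \<le> q" using pp_ge_k[of k] by (simp add: q_def)
  have fV: "finite V" using kg_finite_verts[OF kg] .
  have n0: "0 < n" using V0 fV by (simp add: n_def card_gt_0_iff)
  have c: "c ` V \<subseteq> {..<q}" using c by (simp add: q_def)
  define x where "x i = card (cls V c i) / n" for i
  have nx: "(\<lambda>i. real (card (cls V c i))) = (\<lambda>i. n * x i)" using n0 by (simp add: x_def)
  have x0: "0 \<le> x i" for i using n0 by (simp add: x_def)
  have "real (\<Sum>i<q. card (cls V c i)) = n" unfolding sum_cls[OF fV c] by (simp add: n_def)
  then have "(\<Sum>i<q. real (card (cls V c i))) = n" by simp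
  then have sx: "sum x {..<q} = 1" using n0 by (simp add: x_def sum_divide_distrib[symmetric])
  have kgK: "kg k {..<q} (ksets {..<q} k)" by (rule kg_ksets) simp
  have ct: "card (trans V c k) = n ^ k * lag (ksets {..<q} k) x"
    unfolding card_trans[OF fV c] nx by (rule lag_scale[OF kgK])
  have L: "lag (ksets {..<q} k) x \<le> lam k"
    using lag_ksets_le[of "{..<q}" q x 1 k] x0 sx kq k by (simp add: lam_def q_def power_divide)
  have Et: "{e\<in>E. inj_on c e} \<subseteq> trans V c k"
    using kg_edge_subset[OF kg] kg_edge_card[OF kg] unfolding trans_def by blast
  have ft: "finite (trans V c k)" using kg_finite[OF trans_kg[OF fV]] .
  have "card {e\<in>E. inj_on c e} \<le> card (trans V c k)" by (rule card_mono[OF ft Et])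
  then have "(lam k - s\<^sup>2) * n ^ k \<le> real (card (trans V c k))"
    using s(3) unfolding n_def by linarith
  then have "(lam k - s\<^sup>2) * n ^ k \<le> n ^ k * lag (ksets {..<q} k) x" unfolding ct .
  then have low: "lam k - s\<^sup>2 \<le> lag (ksets {..<q} k) x"
    using n0 by (simp add: mult.commute[of _ "n ^ k"])
  have "trans V c k - E = trans V c k - {e\<in>E. inj_on c e}" by (auto simp: trans_def)
  then have "card (trans V c k - E) = card (trans V c k) - card {e\<in>E. inj_on c e}"
    using card_Diff_subset[OF finite_subset[OF Et ft] Et] by simp
  then have "real (card (trans V c k - E)) = card (trans V c k) - real (card {e\<in>E. inj_on c e})"
    using card_mono[OF ft Et] by (simp add: of_nat_diff)
  also have "\<dots> \<le> n ^ k * lam k - (lam k - s\<^sup>2) * n ^ k"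
  proof -
    have "real (card (trans V c k)) \<le> n ^ k * lam k" unfolding ct using L n0 by (intro mult_left_mono) auto
    then show ?thesis using s(3) unfolding n_def by linarith
  qed
  finally show "card (trans V c k - E) \<le> s\<^sup>2 * real (card V) ^ k" by (simp add: n_def algebra_simps)
  show "(lam k - lam' k - s\<^sup>2) * card V \<le> card (cls V c j)" if "j < pp k"
  proof -
    have "lam k - lam' k - s\<^sup>2 \<le> x j"
      using complete_lower_weight[OF k kq x0 sx that[folded q_def], of "s\<^sup>2"] low
      by (simp add: lam_def lam'_def q_def)
    then show ?thesis using n0 by (simp add: x_def n_def field_simps)
  qed
  show "card {f. f \<subseteq> V \<and> inj_on c f \<and> c ` f \<in> ksets ({..<pp k} - {j}) (k - 1)}
      \<le> (k * lam k + (real (pp k) + 2) * s) * real (card V) ^ (k - 1)" if j: "j < pp k"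
  proof -
    have "finite ({..<q} - {j})" by simp
    then have fK: "finite (ksets ({..<q} - {j}) (k - 1))" "\<And>f. f \<in> ksets ({..<q} - {j}) (k - 1) \<Longrightarrow> finite f"
      using kg_finite[OF kg_ksets] kg_finite_edge[OF kg_ksets] by blast+
    have kk: "k = Suc (k - 1)" using k by simp
    have lk: "link (ksets {..<q} k) j = ksets ({..<q} - {j}) (k - 1)"
      using j by (subst kk, subst link_ksets) (auto simp: q_def)
    have "card {f. f \<subseteq> V \<and> inj_on c f \<and> c ` f \<in> ksets ({..<q} - {j}) (k - 1)} = lag (ksets ({..<q} - {j}) (k - 1)) (\<lambda>i. card (cls V c i))"
      by (rule card_transversal[OF fV fK])
    also have "\<dots> = n ^ (k - 1) * lag (link (ksets {..<q} k) j) x"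
      unfolding lk nx by (rule lag_scale[OF kg_ksets]) simp
    also have "\<dots> \<le> n ^ (k - 1) * (k * lam k + (real q + 2) * s)"
    proof (rule mult_left_mono)
      show "lag (link (ksets {..<q} k) j) x \<le> k * lam k + (real q + 2) * s"
        using complete_gradient[OF k kq x0 sx j[folded q_def] s(1,2)] low by (simp add: lam_def q_def)
    qed (use n0 in simp)
    finally show ?thesis by (simp add: q_def n_def mult.commute)
  qed
qed

text \<open>Only the order of the constants is settled here: \<open>\<beta>\<close> and the
  threshold are fixed from \<open>k\<close> and \<open>\<kappa>\<close> before any hypergraph is
  given.\<close>

lemma same_colour_uncovered_ex:
  fixes \<kappa> :: real
  assumes k: "2 \<le> k" and kap: "0 < \<kappa>"
  obtains \<beta> :: real and n0 :: nat where "0 < \<beta>"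
    "\<forall>V E c w w'. kg k V E \<longrightarrow> xfree k E \<longrightarrow> n0 \<le> card V \<longrightarrow> c ` V \<subseteq> {..<pp k} \<longrightarrow>
      (\<forall>i<pp k. \<kappa> * card V \<le> card (cls V c i)) \<longrightarrow>
      card (trans V c k - E) \<le> \<beta> * real (card V) ^ k \<longrightarrow> w \<in> V \<longrightarrow> w' \<in> V \<longrightarrow> w \<noteq> w' \<longrightarrow> c w = c w' \<longrightarrow>
      card (link (trans V c k - E) w) \<le> \<beta> * real (card V) ^ (k - 1) \<longrightarrow>
      card (link (trans V c k - E) w') \<le> \<beta> * real (card V) ^ (k - 1) \<longrightarrow> \<not> cov E w w'"
proof -
  define D where "D = \<kappa> ^ (k - 2)"
  define R where "R = \<kappa> ^ (pp k - 1)"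
  define C where "C = 2 + 6 * real k ^ 2 / D"
  \<comment> \<open>\<open>C\<close> collects the coefficients of \<open>\<beta>\<close> once
    \<open>k / card V\<close> is at most \<open>\<beta>\<close>; the \<open>8\<close> leaves a
    factor two below the strict bound \<open>R\<close>.\<close>
  define \<beta> where "\<beta> = R / (8 * C)"
  have D0: "0 < D" "0 < R" using kap by (auto simp: D_def R_def)
  then have C0: "0 < C" unfolding C_def by (intro add_pos_nonneg) auto
  have b0: "0 < \<beta>" using D0 C0 by (simp add: \<beta>_def)
  obtain n0 :: nat where n0: "max (real k / \<beta>) (2 * real (NN k) / D) + 1 \<le> real n0" using real_arch_simple by blast
  show ?thesis
  proof (rule that[OF b0], intro allI impI)
    fix V E c w w'
    assume a: "kg k V E" "xfree k E" "n0 \<le> card V" "c ` V \<subseteq> {..<pp k}"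
      "\<forall>i<pp k. \<kappa> * card V \<le> card (cls V c i)"
      "card (trans V c k - E) \<le> \<beta> * real (card V) ^ k" "w \<in> V" "w' \<in> V" "w \<noteq> w'" "c w = c w'"
      "card (link (trans V c k - E) w) \<le> \<beta> * real (card V) ^ (k - 1)"
      "card (link (trans V c k - E) w') \<le> \<beta> * real (card V) ^ (k - 1)"
    have "0 \<le> real k / \<beta>" using b0 by simp
    then have n: "real k / \<beta> \<le> card V" "2 * real (NN k) / D \<le> card V" "0 < card V" using n0 a(3) by linarith+
    have n1: "2 * real (NN k) \<le> \<kappa> ^ (k - 2) * card V" using n(2) D0 by (simp add: D_def[symmetric] field_simps)
    have "real k / card V \<le> \<beta>" using n(1,3) b0 by (simp add: field_simps)
    moreover have "\<beta> * C = \<beta> + \<beta> + 6 * real k ^ 2 * \<beta> / D" by (simp add: C_def algebra_simps)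
    ultimately have "\<beta> + real k / card V + 6 * real k ^ 2 * \<beta> / D \<le> \<beta> * C"
      by (rule add_three_le)
    then have "4 * (\<beta> + real k / card V + 6 * real k ^ 2 * \<beta> / D) \<le> 4 * (\<beta> * C)"
      by (rule mult_left_mono) simp
    also have "\<dots> = R / 2" using C0 by (simp add: \<beta>_def)
    also have "\<dots> < R" using D0 by simp
    finally have lt: "4 * (\<beta> + real k / card V + 6 * real k ^ 2 * \<beta> / \<kappa> ^ (k - 2)) < \<kappa> ^ (pp k - 1)"
      by (simp add: D_def R_def)
    show "\<not> cov E w w'"
      by (rule same_colour_uncovered[OF k a(1,2,4) kap a(5)[rule_format] less_imp_le[OF b0] a(6-12) n1 lt])
  qed
qed

lemma some_colour_avoided_ex:
  fixes \<kappa> \<gamma> \<alpha> :: real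
  assumes k: "2 \<le> k" and kap: "0 < \<kappa>" and gam: "0 < \<gamma>" and al: "0 < \<alpha>"
  obtains \<beta> :: real and n0 :: nat where "0 < \<beta>"
    "\<forall>V E c v X F. kg k V E \<longrightarrow> xfree k E \<longrightarrow> n0 \<le> card V \<longrightarrow> c ` V \<subseteq> {..<pp k} \<longrightarrow>
      (\<forall>i<pp k. \<kappa> * card V \<le> card (cls V c i)) \<longrightarrow>
      card (trans V c k - E) \<le> \<beta> * real (card V) ^ k \<longrightarrow> v \<in> V \<longrightarrow>
      (\<forall>i<pp k. X i \<subseteq> {u \<in> cls V c i. u \<noteq> v \<and> robust (NN k) E v u}) \<longrightarrow>
      (\<forall>i<pp k. \<gamma> * card V \<le> card (X i)) \<longrightarrow>
      F \<subseteq> {f \<in> link E v. inj_on c f \<and> f \<subseteq> (\<Union>i<pp k. X i)} \<longrightarrow>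
      \<alpha> * real (card V) ^ (k - 1) \<le> card F \<longrightarrow> False"
proof -
  define D where "D = \<kappa> ^ (k - 2)"
  define R where "R = \<alpha> * \<gamma> ^ (pp k - (k - 1))"
  define C where "C = 2 + 2 * real k ^ 2 / D"
  define \<beta> where "\<beta> = R / (2 * 2 ^ pp k * C)"
  have D0: "0 < D" "0 < R" using kap al gam by (auto simp: D_def R_def)
  then have C0: "0 < C" unfolding C_def by (intro add_pos_nonneg) auto
  have b0: "0 < \<beta>" using D0 C0 by (simp add: \<beta>_def)
  obtain n0 :: nat where n0: "max (1 / \<beta>) (2 * real (NN k) / D) + 1 \<le> real n0" using real_arch_simple by blast
  show ?thesis
  proof (rule that[OF b0], intro allI impI)
    fix V E c v X F
    assume a: "kg k V E" "xfree k E" "n0 \<le> card V" "c ` V \<subseteq> {..<pp k}"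
      "\<forall>i<pp k. \<kappa> * card V \<le> card (cls V c i)"
      "card (trans V c k - E) \<le> \<beta> * real (card V) ^ k" "v \<in> V"
      "\<forall>i<pp k. X i \<subseteq> {u \<in> cls V c i. u \<noteq> v \<and> robust (NN k) E v u}"
      "\<forall>i<pp k. \<gamma> * card V \<le> card (X i)"
      "F \<subseteq> {f \<in> link E v. inj_on c f \<and> f \<subseteq> (\<Union>i<pp k. X i)}" "\<alpha> * real (card V) ^ (k - 1) \<le> card F"
    have "0 \<le> 1 / \<beta>" using b0 by simp
    then have n: "1 / \<beta> \<le> card V" "2 * real (NN k) / D \<le> card V" "0 < card V" using n0 a(3) by linarith+
    have n1: "2 * real (NN k) \<le> \<kappa> ^ (k - 2) * card V" using n(2) D0 by (simp add: D_def[symmetric] field_simps)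
    have "1 / card V \<le> \<beta>" using n(1,3) b0 by (simp add: field_simps)
    moreover have "\<beta> * C = \<beta> + \<beta> + 2 * real k ^ 2 * \<beta> / D" by (simp add: C_def algebra_simps)
    ultimately have "\<beta> + 1 / card V + 2 * real k ^ 2 * \<beta> / D \<le> \<beta> * C" by (rule add_three_le)
    then have "2 ^ pp k * (\<beta> + 1 / card V + 2 * real k ^ 2 * \<beta> / D) \<le> 2 ^ pp k * (\<beta> * C)"
      by (rule mult_left_mono) simp
    also have "\<dots> = R / 2" using C0 by (simp add: \<beta>_def)
    also have "\<dots> < R" using D0 by simp
    finally have lt: "2 ^ pp k * (\<beta> + 1 / card V + 2 * real k ^ 2 * \<beta> / \<kappa> ^ (k - 2)) < \<alpha> * \<gamma> ^ (pp k - (k - 1))"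
      by (simp add: D_def R_def)
    show False
      by (rule some_colour_avoided[OF k a(1,2,4) kap a(5)[rule_format] less_imp_le[OF b0] a(6,7) a(8)[rule_format] less_imp_le[OF gam] a(9)[rule_format] a(10,11) n1 lt])
  qed
qed

lemma card_touching:
  assumes "finite V" "B \<subseteq> V"
  shows "card {f. f \<subseteq> V \<and> card f = m \<and> f \<inter> B \<noteq> {}} \<le> card B * card V ^ (m - 1)"
proof -
  have fB: "finite B" using assms finite_subset by blast
  have "{f. f \<subseteq> V \<and> card f = m \<and> f \<inter> B \<noteq> {}} \<subseteq> (\<Union>b\<in>B. {f. f \<subseteq> V \<and> card f = m \<and> {b} \<subseteq> f})" by auto
  then have "card {f. f \<subseteq> V \<and> card f = m \<and> f \<inter> B \<noteq> {}} \<le> card (\<Union>b\<in>B. {f. f \<subseteq> V \<and> card f = m \<and> {b} \<subseteq> f})"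
    by (intro card_mono) (use assms(1) fB in auto)
  also have "\<dots> \<le> (\<Sum>b\<in>B. card {f. f \<subseteq> V \<and> card f = m \<and> {b} \<subseteq> f})" by (rule card_UN_le[OF fB])
  also have "\<dots> \<le> (\<Sum>b\<in>B. card V ^ (m - 1))"
    by (rule sum_mono) (use card_supersets_le[OF assms(1), of "{_}" m] in simp)
  finally show ?thesis by simp
qed

text \<open>Vertices at which few transversal sets are missing form \<open>W\<close>, and on
  \<open>W\<close> the colouring is already proper by \<open>same_colour_uncovered\<close>. Every
  other vertex receives a colour in which it has few robust partners. Its link then nearly avoids
  that colour, and as its degree is close to the maximal number of transversal sets avoiding a
  colour, few of them are missing at it too. So the first argument, run with the new colouring,
  reaches all vertices.\<close>

theorem exact_colouring:
  assumes k: "2 \<le> k"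
  obtains \<epsilon> :: real and n0 :: nat where "0 < \<epsilon>"
    "\<forall>V E c. kg k V E \<longrightarrow> xfree k E \<longrightarrow> n0 \<le> card V \<longrightarrow>
      (\<forall>v\<in>V. (k * lam k - \<epsilon>) * real (card V) ^ (k - 1) \<le> card (link E v)) \<longrightarrow>
      c ` V \<subseteq> {..<pp k} \<longrightarrow> card {e\<in>E. \<not> inj_on c e} \<le> \<epsilon> * real (card V) ^ k \<longrightarrow>
      (\<exists>c'. c' ` V \<subseteq> {..<pp k} \<and> (\<forall>e\<in>E. inj_on c' e))"
proof -
  define q where "q = pp k"
  define \<kappa> where "\<kappa> = (lam k - lam' k) / 2"
  define dd where "dd = k * lam k"
  have kap: "0 < \<kappa>" using lam'_less[OF k] by (simp add: \<kappa>_def)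
  have dd0: "0 < dd" using lam_pos k by (simp add: dd_def)
  obtain \<beta>1 n1 where b1: "0 < \<beta>1" and E1': "\<forall>V E c w w'. kg k V E \<longrightarrow> xfree k E \<longrightarrow> n1 \<le> card V \<longrightarrow> c ` V \<subseteq> {..<pp k} \<longrightarrow>
      (\<forall>i<pp k. \<kappa> * card V \<le> card (cls V c i)) \<longrightarrow>
      card (trans V c k - E) \<le> \<beta>1 * real (card V) ^ k \<longrightarrow> w \<in> V \<longrightarrow> w' \<in> V \<longrightarrow> w \<noteq> w' \<longrightarrow> c w = c w' \<longrightarrow>
      card (link (trans V c k - E) w) \<le> \<beta>1 * real (card V) ^ (k - 1) \<longrightarrow>
      card (link (trans V c k - E) w') \<le> \<beta>1 * real (card V) ^ (k - 1) \<longrightarrow> \<not> cov E w w'"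
    by (rule same_colour_uncovered_ex[OF k kap]) (rule that)
  note E1 = E1'[rule_format]
  have kap2: "0 < \<kappa> / 2" using kap by simp
  obtain \<beta>3 n3 where b3: "0 < \<beta>3" and E3': "\<forall>V E c w w'. kg k V E \<longrightarrow> xfree k E \<longrightarrow> n3 \<le> card V \<longrightarrow> c ` V \<subseteq> {..<pp k} \<longrightarrow>
      (\<forall>i<pp k. \<kappa> / 2 * card V \<le> card (cls V c i)) \<longrightarrow>
      card (trans V c k - E) \<le> \<beta>3 * real (card V) ^ k \<longrightarrow> w \<in> V \<longrightarrow> w' \<in> V \<longrightarrow> w \<noteq> w' \<longrightarrow> c w = c w' \<longrightarrow>
      card (link (trans V c k - E) w) \<le> \<beta>3 * real (card V) ^ (k - 1) \<longrightarrow>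
      card (link (trans V c k - E) w') \<le> \<beta>3 * real (card V) ^ (k - 1) \<longrightarrow> \<not> cov E w w'"
    by (rule same_colour_uncovered_ex[OF k kap2]) (rule that)
  note E3 = E3'[rule_format]
  \<comment> \<open>The recolouring threshold \<open>\<gamma>\<close> has to be small against
    \<open>\<beta>3\<close>, the tolerance of the final colouring; so \<open>\<beta>3\<close> is
    obtained before it, and the tolerance \<open>\<beta>\<close> of the first colouring
    last.\<close>
  define \<gamma> where "\<gamma> = \<beta>3 / 8"
  define \<alpha> where "\<alpha> = dd / 2"
  have g0: "0 < \<gamma>" and al0: "0 < \<alpha>" using b3 dd0 by (auto simp: \<gamma>_def \<alpha>_def)
  obtain \<beta>2 n2 where b2: "0 < \<beta>2" and E2': "\<forall>V E c v X F. kg k V E \<longrightarrow> xfree k E \<longrightarrow> n2 \<le> card V \<longrightarrow> c ` V \<subseteq> {..<pp k} \<longrightarrow>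
      (\<forall>i<pp k. \<kappa> * card V \<le> card (cls V c i)) \<longrightarrow>
      card (trans V c k - E) \<le> \<beta>2 * real (card V) ^ k \<longrightarrow> v \<in> V \<longrightarrow>
      (\<forall>i<pp k. X i \<subseteq> {u \<in> cls V c i. u \<noteq> v \<and> robust (NN k) E v u}) \<longrightarrow>
      (\<forall>i<pp k. \<gamma> * card V \<le> card (X i)) \<longrightarrow>
      F \<subseteq> {f \<in> link E v. inj_on c f \<and> f \<subseteq> (\<Union>i<pp k. X i)} \<longrightarrow>
      \<alpha> * real (card V) ^ (k - 1) \<le> card F \<longrightarrow> False"
    by (rule some_colour_avoided_ex[OF k kap g0 al0]) (rule that)
  note E2 = E2'[rule_format]
  define \<beta> where "\<beta> = min (min \<beta>1 \<beta>2) (min (\<beta>3 / 8) (min (\<kappa> / 2) (dd / 8)))"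
  have b: "0 < \<beta>" "\<beta> \<le> \<beta>1" "\<beta> \<le> \<beta>2" "\<beta> \<le> \<beta>3 / 8" "\<beta> \<le> \<kappa> / 2" "\<beta> \<le> dd / 8"
    using b1 b2 b3 kap dd0 by (simp_all add: \<beta>_def)
  \<comment> \<open>Each entry of the minimum serves one later estimate:
    \<open>\<beta>\<^sup>2 / k\<close> bounds the exceptional set \<open>B\<close>, and the last
    entry absorbs the error of \<open>complete_gradient\<close>.\<close>
  define s where "s = min (min 1 \<kappa>) (min \<beta> (min (\<beta>\<^sup>2 / k) (min (dd / 4) (\<beta>3 / (8 * (real q + 2))))))"
  have s0: "0 < s" using kap b(1) dd0 k b3 by (simp add: s_def add_nonneg_pos)
  have s: "0 < s" "s \<le> 1" "s \<le> \<kappa>" "s \<le> \<beta>" "s \<le> \<beta>\<^sup>2 / k" "s \<le> dd / 4" "s \<le> \<beta>3 / (8 * (real q + 2))"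
    by (rule s0) (simp_all only: s_def min_le_iff_disj order_refl simp_thms)
  have ss: "s\<^sup>2 \<le> s" using s(1,2) by (simp add: power2_eq_square mult_left_le)
  define \<epsilon> where "\<epsilon> = s\<^sup>2 / 2"
  have e0: "0 < \<epsilon>" using s(1) by (simp add: \<epsilon>_def)
  obtain n4 :: nat where n4: "real (NN k) / \<beta> + 1 \<le> real n4" using real_arch_simple by blast
  define n0 where "n0 = Max {n1, n2, n3, n4}"
  have n0: "n1 \<le> n0" "n2 \<le> n0" "n3 \<le> n0" "n4 \<le> n0" by (simp_all add: n0_def)
  show ?thesis
  proof (rule that[OF e0], intro allI impI)
    fix V E c
    assume kg: "kg k V E" and xf: "xfree k E" and nV: "n0 \<le> card V"
      and deg': "\<forall>v\<in>V. (k * lam k - \<epsilon>) * real (card V) ^ (k - 1) \<le> card (link E v)"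
      and c: "c ` V \<subseteq> {..<pp k}" and nt: "card {e\<in>E. \<not> inj_on c e} \<le> \<epsilon> * real (card V) ^ k"
    note deg = deg'[rule_format]
    define n where "n = real (card V)"
    have fV: "finite V" using kg_finite_verts[OF kg] .
    have fE: "finite E" using kg_finite[OF kg] .
    have nb: "real (NN k) / \<beta> \<le> n" "1 \<le> n" using n4 n0(4) nV b(1) unfolding n_def
      by (smt (verit) divide_nonneg_pos of_nat_0_le_iff of_nat_mono)+
    have NNn: "real (NN k) \<le> \<beta> * n" using nb(1) b(1) by (simp add: field_simps)
    have n0': "0 < n" using nb by simp
    have V0: "V \<noteq> {}" using n0' by (auto simp: n_def)
    have kk: "k - 1 = Suc (k - 2)" "k = Suc (k - 1)" using k by simp_all
    have pw: "n ^ (k - 1) = n * n ^ (k - 2)" "n ^ k = n * n ^ (k - 1)"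
      by (metis kk(1) power_Suc) (metis kk(2) power_Suc)
    have bz: "(x * n) * n ^ (k - 2) = x * n ^ (k - 1)" for x by (simp only: pw(1) mult.assoc)
    have p0: "0 < n ^ (k - 2)" "0 < n ^ (k - 1)" "0 < n ^ k" using n0' by simp_all
    have "n * ((dd - \<epsilon>) * n ^ (k - 1)) = (\<Sum>v\<in>V. (dd - \<epsilon>) * n ^ (k - 1))" by (simp add: n_def)
    also have "\<dots> \<le> (\<Sum>v\<in>V. real (card (link E v)))"
      by (rule sum_mono) (use deg in \<open>simp add: dd_def n_def\<close>)
    also have "\<dots> = real (\<Sum>v\<in>V. card (link E v))" by simp
    also have "\<dots> = k * real (card E)" unfolding sum_card_link[OF kg] by simp
    finally have "(dd - \<epsilon>) * n ^ k \<le> k * real (card E)" by (simp add: pw(2) mult_ac)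
    moreover have "(real k * lam k - real k * \<epsilon>) * n ^ k \<le> (dd - \<epsilon>) * n ^ k"
      using k e0 p0 by (intro mult_right_mono) (auto simp: dd_def)
    ultimately have "real k * ((lam k - \<epsilon>) * n ^ k) \<le> real k * real (card E)" by (simp add: algebra_simps)
    then have cE: "(lam k - \<epsilon>) * n ^ k \<le> card E" using k by simp
    have "card E = card {e\<in>E. inj_on c e} + card {e\<in>E. \<not> inj_on c e}"
      using fE by (subst card_Un_disjoint[symmetric]) (auto intro!: arg_cong[of _ _ card])
    then have "real (card E) = real (card {e\<in>E. inj_on c e}) + real (card {e\<in>E. \<not> inj_on c e})" by simp
    then have tr: "(lam k - s\<^sup>2) * real (card V) ^ k \<le> card {e\<in>E. inj_on c e}"
      using cE nt unfolding n_def[symmetric] by (simp add: \<epsilon>_def algebra_simps)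
    note data = transversal_data[OF k kg V0 c s(1,2) tr]
    define M where "M = trans V c k - E"
    have kgM: "kg k V M" unfolding M_def by (rule kg_subset[OF trans_kg[OF fV]]) auto
    have cM: "card M \<le> s\<^sup>2 * n ^ k" using data(1) by (simp add: M_def n_def)
    have cls: "\<kappa> * card V \<le> card (cls V c j)" if "j < pp k" for j
    proof -
      have "\<kappa> * card V \<le> (lam k - lam' k - s\<^sup>2) * card V"
        using ss s(3) by (intro mult_right_mono) (auto simp: \<kappa>_def)
      then show ?thesis using data(2)[OF that] by linarith
    qed
    have cMx: "card M \<le> x * n ^ k" if "s \<le> x" for x
    proof -
      have "s\<^sup>2 * n ^ k \<le> x * n ^ k" using ss that p0 by (intro mult_right_mono) auto
      then show ?thesis using cM by linarith
    qed
    define W where "W = {v\<in>V. card (link M v) \<le> \<beta> * n ^ (k - 1)}"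
    define B where "B = V - W"
    have fB: "finite B" "B \<subseteq> V" using fV by (auto simp: B_def)
    have cB: "card B \<le> \<beta> * n"
    proof -
      have "card B * (\<beta> * n ^ (k - 1)) = (\<Sum>v\<in>B. \<beta> * n ^ (k - 1))" by simp
      also have "\<dots> \<le> (\<Sum>v\<in>B. real (card (link M v)))" by (rule sum_mono) (auto simp: B_def W_def)
      also have "\<dots> \<le> (\<Sum>v\<in>V. real (card (link M v)))" by (rule sum_mono2) (use fV fB in auto)
      also have "\<dots> = real (\<Sum>v\<in>V. card (link M v))" by simp
      also have "\<dots> = k * real (card M)" unfolding sum_card_link[OF kgM] by simp
      also have "\<dots> \<le> k * ((\<beta>\<^sup>2 / k) * n ^ k)" using cMx[OF s(5)] by (intro mult_left_mono) auto
      also have "\<dots> = (\<beta> * n) * (\<beta> * n ^ (k - 1))" using k by (simp add: pw(2) power2_eq_square)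
      finally show ?thesis using mult_pos_pos[OF b(1) p0(2)] by (simp only: mult_le_cancel_right_pos)
    qed
    have proper: "\<not> cov E w w'" if "w \<in> W" "w' \<in> W" "w \<noteq> w'" "c w = c w'" for w w'
    proof (rule E1[OF kg xf _ c cls])
      show "n1 \<le> card V" using n0 nV by simp
      show "card (trans V c k - E) \<le> \<beta>1 * real (card V) ^ k"
        using cMx[of \<beta>1] s(4) b(2) by (simp add: M_def n_def)
      have "\<beta> * n ^ (k - 1) \<le> \<beta>1 * n ^ (k - 1)" using b(2) p0 by (intro mult_right_mono) auto
      then show "card (link (trans V c k - E) w) \<le> \<beta>1 * real (card V) ^ (k - 1)"
        "card (link (trans V c k - E) w') \<le> \<beta>1 * real (card V) ^ (k - 1)"
        using that(1,2) unfolding W_def M_def n_def by auto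
    qed (use that in \<open>simp_all add: W_def\<close>)
    have Winj: "inj_on c f" if "f \<in> link E v" "f \<subseteq> W" for f v
    proof (rule inj_onI)
      fix a a' assume a: "a \<in> f" "a' \<in> f" "c a = c a'"
      have "insert v f \<in> E" using that(1) by (simp add: link_def)
      then have "cov E a a'" using a unfolding cov_def by (intro bexI[of _ "insert v f"]) auto
      then show "a = a'" using proper[of a a'] a that(2) by blast
    qed
    have linkV: "f \<subseteq> V" "v \<notin> f" "card f = k - 1" if "f \<in> link E v" for f v
    proof -
      have e: "insert v f \<in> E" "v \<notin> f" using that by (simp_all add: link_def)
      show "f \<subseteq> V" "v \<notin> f" using kg_edge_subset[OF kg e(1)] e(2) by auto
      have "finite f" using kg_finite_edge[OF kg e(1)] by simp
      then show "card f = k - 1" using kg_edge_card[OF kg e(1)] e(2) by simp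
    qed
    define X where "X v i = {u\<in>W. c u = i \<and> u \<noteq> v \<and> robust (NN k) E v u}" for v i
    have ex_j: "\<exists>j<pp k. card (X v j) < \<gamma> * n" if v: "v \<in> V" for v
    proof (rule ccontr)
      assume "\<not> ?thesis"
      then have big: "\<gamma> * card V \<le> card (X v i)" if "i < pp k" for i using that by (force simp: n_def)
      define Y2 where "Y2 = {u\<in>V. u \<noteq> v \<and> \<not> robust (NN k) E v u}"
      define F where "F = {f\<in>link E v. f \<inter> (B \<union> Y2) = {}}"
      have "real (card (link E v)) - card B * n ^ (k - 2) - NN k * n ^ (k - 2) \<le> card F"
        unfolding F_def n_def by (rule link_avoid[OF kg k v fB(2)]) (auto simp: Y2_def)
      moreover have "card B * n ^ (k - 2) \<le> (\<beta> * n) * n ^ (k - 2)" using cB p0 by (intro mult_right_mono) auto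
      moreover have "NN k * n ^ (k - 2) \<le> (\<beta> * n) * n ^ (k - 2)" using NNn p0 by (intro mult_right_mono) auto
      moreover have "(dd - \<epsilon>) * n ^ (k - 1) \<le> card (link E v)" using deg[OF v] by (simp add: dd_def n_def)
      ultimately have 1: "(dd - \<epsilon> - 2 * \<beta>) * n ^ (k - 1) \<le> card F"
        unfolding bz left_diff_distrib by linarith
      have "\<epsilon> \<le> dd / 8" using ss s(6) by (simp add: \<epsilon>_def)
      then have "\<alpha> \<le> dd - \<epsilon> - 2 * \<beta>" using b(6) dd0 unfolding \<alpha>_def by linarith
      then have "\<alpha> * n ^ (k - 1) \<le> (dd - \<epsilon> - 2 * \<beta>) * n ^ (k - 1)"
        using p0(2) by (rule mult_right_mono[OF _ less_imp_le])
      then have F: "\<alpha> * real (card V) ^ (k - 1) \<le> card F" using 1 by (simp add: n_def)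
      have FX: "F \<subseteq> {f \<in> link E v. inj_on c f \<and> f \<subseteq> (\<Union>i<pp k. X v i)}"
      proof
        fix f assume "f \<in> F"
        then have f: "f \<in> link E v" "f \<inter> (B \<union> Y2) = {}" by (simp_all add: F_def)
        have fW: "f \<subseteq> W" using f(2) linkV(1)[OF f(1)] by (auto simp: B_def)
        have "u \<in> (\<Union>i<pp k. X v i)" if u: "u \<in> f" for u
        proof -
          have "u \<in> V" "u \<in> W" "u \<noteq> v" "u \<notin> Y2" using u f(2) fW linkV[OF f(1)] by auto
          then show ?thesis using c by (auto simp: X_def Y2_def)
        qed
        then show "f \<in> {f \<in> link E v. inj_on c f \<and> f \<subseteq> (\<Union>i<pp k. X v i)}"
          using f(1) Winj[OF f(1) fW] by blast
      qed
      show False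
      proof (rule E2[OF kg xf _ c cls _ v _ big FX F])
        show "n2 \<le> card V" using n0 nV by simp
        show "card (trans V c k - E) \<le> \<beta>2 * real (card V) ^ k"
          using cMx[of \<beta>2] s(4) b(3) by (simp add: M_def n_def)
        show "X v i \<subseteq> {u \<in> cls V c i. u \<noteq> v \<and> robust (NN k) E v u}" for i
          by (auto simp: X_def cls_def W_def)
      qed
    qed
    define J where "J v = (SOME j. j < pp k \<and> card (X v j) < \<gamma> * n)" for v
    have J: "J v < pp k" "card (X v (J v)) < \<gamma> * n" if "v \<in> V" for v
      using someI_ex[OF ex_j[OF that]] unfolding J_def by simp_all
    define c' where "c' v = (if v \<in> W then c v else J v)" for v
    have c': "c' ` V \<subseteq> {..<pp k}" using c J(1) by (auto simp: c'_def)
    have c'W: "inj_on c' f \<longleftrightarrow> inj_on c f" if "f \<subseteq> W" for f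
      by (rule inj_on_cong) (use that in \<open>simp add: c'_def subset_iff\<close>)
    define M' where "M' = trans V c' k - E"
    have kgM': "kg k V M'" unfolding M'_def by (rule kg_subset[OF trans_kg[OF fV]]) auto
    define TB where "TB = {f. f \<subseteq> V \<and> card f = k - 1 \<and> f \<inter> B \<noteq> {}}"
    have fTB: "finite TB" unfolding TB_def using fV by simp
    have "card TB \<le> card B * card V ^ (k - 1 - 1)" unfolding TB_def by (rule card_touching[OF fV fB(2)])
    also have "k - 1 - 1 = k - 2" by simp
    finally have "real (card TB) \<le> real (card B * card V ^ (k - 2))" by (simp only: of_nat_le_iff)
    also have "\<dots> = card B * n ^ (k - 2)" by (simp add: n_def)
    also have "\<dots> \<le> (\<beta> * n) * n ^ (k - 2)" using cB p0 by (intro mult_right_mono) auto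
    finally have cTB: "card TB \<le> \<beta> * n ^ (k - 1)" unfolding bz .
    have M'fact: "v \<notin> f \<and> f \<subseteq> V \<and> card f = k - 1 \<and> inj_on c' (insert v f) \<and> f \<notin> link E v"
      if "f \<in> link M' v" for f v
    proof -
      have e: "insert v f \<in> M'" "v \<notin> f" using that by (simp_all add: link_def)
      then have "finite f" using kg_finite_edge[OF kgM' e(1)] by simp
      then have "card f = k - 1" using kg_edge_card[OF kgM' e(1)] e(2) by simp
      then show ?thesis using e by (auto simp: M'_def trans_def link_def)
    qed
    have link': "card (link M' v) \<le> \<beta>3 * n ^ (k - 1)" if v: "v \<in> V" for v
    proof (cases "v \<in> W")
      case True
      have "link M' v \<subseteq> TB \<union> link M v"
      proof
        fix f assume "f \<in> link M' v"
        note f = M'fact[OF this]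
        show "f \<in> TB \<union> link M v"
        proof (cases "f \<inter> B = {}")
          case False then show ?thesis using f by (simp add: TB_def)
        next
          case fb: True
          then have "insert v f \<subseteq> W" using f True by (auto simp: B_def)
          then have "inj_on c' (insert v f) \<longleftrightarrow> inj_on c (insert v f)" by (rule c'W)
          moreover have "inj_on c' (insert v f)" using f by (elim conjE)
          ultimately have "inj_on c (insert v f)" by (rule iffD1)
          moreover have "insert v f \<subseteq> V" "card (insert v f) = k"
            using f v finite_subset[OF _ fV, of f] k by auto
          ultimately show ?thesis using f by (auto simp: M_def link_def trans_def)
        qed
      qed
      then have "card (link M' v) \<le> card (TB \<union> link M v)"
        using fTB finite_link[OF kg_finite[OF kgM]] by (intro card_mono) auto
      also have "\<dots> \<le> card TB + card (link M v)" by (rule card_Un_le)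
      finally have "real (card (link M' v)) \<le> card TB + real (card (link M v))" by linarith
      also have "\<dots> \<le> (2 * \<beta>) * n ^ (k - 1)" using cTB True by (simp add: W_def)
      also have "\<dots> \<le> \<beta>3 * n ^ (k - 1)" using b(4) b3 p0 by (intro mult_right_mono) auto
      finally show ?thesis .
    next
      case False
      define j where "j = J v"
      have j: "j < pp k" using J(1)[OF v] by (simp add: j_def)
      define Tj where "Tj = {f. f \<subseteq> V \<and> inj_on c f \<and> c ` f \<in> ksets ({..<pp k} - {j}) (k - 1)}"
      have fTj: "finite Tj" using fV by (simp add: Tj_def)
      define Y1 where "Y1 = B \<union> X v j"
      define Y2 where "Y2 = {u\<in>V. c u = j \<and> (u = v \<or> \<not> robust (NN k) E v u)}"
      define G where "G = {f\<in>link E v. f \<inter> (Y1 \<union> Y2) = {}}"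
      have XV: "X v j \<subseteq> V" by (auto simp: X_def W_def)
      have "real (card (link E v)) - card Y1 * n ^ (k - 2) - NN k * n ^ (k - 2) \<le> card G"
        unfolding G_def n_def by (rule link_avoid[OF kg k v]) (use fB XV in \<open>auto simp: Y1_def Y2_def\<close>)
      moreover have "card Y1 * n ^ (k - 2) \<le> (\<beta> * n + \<gamma> * n) * n ^ (k - 2)"
      proof (rule mult_right_mono)
        have "card Y1 \<le> card B + card (X v j)" unfolding Y1_def by (rule card_Un_le)
        then show "card Y1 \<le> \<beta> * n + \<gamma> * n" using cB J(2)[OF v] unfolding j_def by linarith
      qed (use p0 in simp)
      moreover have "NN k * n ^ (k - 2) \<le> (\<beta> * n) * n ^ (k - 2)" using NNn p0 by (intro mult_right_mono) auto
      moreover have "(dd - \<epsilon>) * n ^ (k - 1) \<le> card (link E v)" using deg[OF v] by (simp add: dd_def n_def)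
      ultimately have cG: "(dd - \<epsilon> - 2 * \<beta> - \<gamma>) * n ^ (k - 1) \<le> card G"
        unfolding bz distrib_right left_diff_distrib by linarith
      \<comment> \<open>\<open>G\<close> is the part of the link of \<open>v\<close> that avoids the
        exceptional set and colour \<open>j\<close>. By the degree condition it nearly fills
        \<open>Tj\<close>, whose size is bounded by \<open>transversal_data\<close>; what is left of
        \<open>Tj\<close> bounds the missing sets.\<close>
      have GT: "G \<subseteq> Tj"
      proof
        fix f assume "f \<in> G"
        then have f: "f \<in> link E v" "f \<inter> (Y1 \<union> Y2) = {}" by (simp_all add: G_def)
        have fW: "f \<subseteq> W" using f(2) linkV(1)[OF f(1)] by (auto simp: B_def Y1_def)
        have inj: "inj_on c f" by (rule Winj[OF f(1) fW])
        have "c u \<noteq> j" if u: "u \<in> f" for u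
        proof
          assume "c u = j"
          moreover have "u \<in> V" "u \<in> W" "u \<notin> X v j" "u \<notin> Y2"
            using u f(2) fW linkV[OF f(1)] by (auto simp: Y1_def)
          ultimately show False by (auto simp: X_def Y2_def)
        qed
        moreover have "card (c ` f) = k - 1" using card_image[OF inj] linkV(3)[OF f(1)] by simp
        ultimately show "f \<in> Tj" using inj linkV(1)[OF f(1)] c unfolding Tj_def ksets_def by auto
      qed
      have "link M' v \<subseteq> TB \<union> (Tj - G)"
      proof
        fix f assume "f \<in> link M' v"
        note f = M'fact[OF this]
        show "f \<in> TB \<union> (Tj - G)"
        proof (cases "f \<inter> B = {}")
          case False then show ?thesis using f by (simp add: TB_def)
        next
          case True
          then have fW: "f \<subseteq> W" using f by (auto simp: B_def)
          have injf: "inj_on c' f" using f by (auto intro: inj_on_subset)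
          then have inj: "inj_on c f" using fW c'W by simp
          have "c u \<noteq> j" if u: "u \<in> f" for u
          proof -
            have "u \<noteq> v" using f u by auto
            then have "c' u \<noteq> c' v"
              using f u inj_onD[of c' "insert v f" u v] by (meson insertI1 insertI2)
            then show ?thesis using u fW \<open>v \<notin> W\<close> by (auto simp: c'_def j_def)
          qed
          moreover have "card (c ` f) = k - 1" using card_image[OF inj] f by simp
          ultimately have "f \<in> Tj" using inj f c unfolding Tj_def ksets_def by auto
          then show ?thesis using f by (simp add: G_def)
        qed
      qed
      then have "card (link M' v) \<le> card (TB \<union> (Tj - G))"
        using fTB fTj by (intro card_mono) auto
      also have "\<dots> \<le> card TB + card (Tj - G)" by (rule card_Un_le)
      also have "card (Tj - G) = card Tj - card G" using GT fTj finite_subset by (intro card_Diff_subset) auto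
      finally have "real (card (link M' v)) \<le> card TB + (real (card Tj) - card G)"
        using card_mono[OF fTj GT] by linarith
      also have "\<dots> \<le> \<beta> * n ^ (k - 1) + ((dd + (real q + 2) * s) * n ^ (k - 1) - (dd - \<epsilon> - 2 * \<beta> - \<gamma>) * n ^ (k - 1))"
        using cTB cG data(3)[OF j] unfolding Tj_def dd_def q_def n_def by linarith
      also have "\<dots> = (3 * \<beta> + (real q + 2) * s + \<epsilon> + \<gamma>) * n ^ (k - 1)" by (simp add: algebra_simps)
      also have "\<dots> \<le> \<beta>3 * n ^ (k - 1)"
      proof (rule mult_right_mono)
        have "(real q + 2) * s \<le> (real q + 2) * (\<beta>3 / (8 * (real q + 2)))" using s(7) by (intro mult_left_mono) auto
        also have "\<dots> = \<beta>3 / 8" by (simp add: field_simps)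
        finally have "(real q + 2) * s \<le> \<beta>3 / 8" .
        moreover have "\<epsilon> \<le> \<beta>3 / 8" using ss s(4) s(1) b(4) by (simp add: \<epsilon>_def)
        ultimately show "3 * \<beta> + (real q + 2) * s + \<epsilon> + \<gamma> \<le> \<beta>3" using b(4) b3 by (simp add: \<gamma>_def)
      qed (use p0 in simp)
      finally show ?thesis .
    qed
    have cM': "card M' \<le> \<beta>3 * n ^ k"
    proof -
      have "k * real (card M') = real (\<Sum>v\<in>V. card (link M' v))" unfolding sum_card_link[OF kgM'] by simp
      also have "\<dots> = (\<Sum>v\<in>V. real (card (link M' v)))" by simp
      also have "\<dots> \<le> (\<Sum>v\<in>V. \<beta>3 * n ^ (k - 1))" by (rule sum_mono) (rule link')
      also have "\<dots> = \<beta>3 * n ^ k" by (simp add: n_def[symmetric] pw(2))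
      finally have "k * real (card M') \<le> \<beta>3 * n ^ k" .
      moreover have "1 * real (card M') \<le> k * real (card M')" using k by (intro mult_right_mono) auto
      ultimately show ?thesis by linarith
    qed
    have cls': "\<kappa> / 2 * card V \<le> card (cls V c' j)" if j: "j < pp k" for j
    proof -
      have "cls V c j - B \<subseteq> cls V c' j" by (auto simp: cls_def B_def c'_def)
      then have "card (cls V c j - B) \<le> card (cls V c' j)" using cls_finite[OF fV] by (intro card_mono)
      moreover have "card (cls V c j) - card B \<le> card (cls V c j - B)" using fB by (intro diff_card_le_card_Diff)
      ultimately have "real (card (cls V c j)) - card B \<le> card (cls V c' j)" by linarith
      moreover have "\<beta> * n \<le> \<kappa> / 2 * n" using b(5) n0' by (intro mult_right_mono) auto
      ultimately show ?thesis using cls[OF j] cB by (simp add: n_def)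
    qed
    have "inj_on c' e" if e: "e \<in> E" for e
    proof (rule inj_onI)
      fix a a' assume a: "a \<in> e" "a' \<in> e" "c' a = c' a'"
      have aV: "a \<in> V" "a' \<in> V" using a kg_edge_subset[OF kg e] by auto
      show "a = a'"
      proof (rule ccontr)
        assume "a \<noteq> a'"
        then have "\<not> cov E a a'"
          using E3[OF kg xf _ c' cls' _ aV _ a(3)] n0 nV cM' link' aV by (simp add: M'_def n_def)
        then show False using a e by (auto simp: cov_def)
      qed
    qed
    then show "\<exists>c'. c' ` V \<subseteq> {..<pp k} \<and> (\<forall>e\<in>E. inj_on c' e)" using c' by blast
  qed
qed

end

section \<open>Symmetrized hypergraphs\<close>

context estree
begin

definition stab :: "nat \<Rightarrow> bool" where
  "stab k \<longleftrightarrow> (\<forall>\<delta>::real. 0 < \<delta> \<longrightarrow> (\<exists>\<epsilon>>0. \<exists>n0::nat. \<forall>V E. kg k V E \<longrightarrow> kfree k E \<longrightarrow> n0 \<le> card V \<longrightarrow>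
     (lam k - \<epsilon>) * real (card V) ^ k \<le> card E \<longrightarrow>
     (\<exists>U\<subseteq>V. card (V - U) \<le> \<delta> * card V \<and>
       (\<exists>c. c ` U \<subseteq> {..<pp k} \<and> (\<forall>e\<in>E. e \<subseteq> U \<longrightarrow> inj_on c e)))))"

definition symm :: "nat set \<Rightarrow> nat set set \<Rightarrow> bool" where
  "symm V E \<longleftrightarrow> (\<forall>u\<in>V. \<forall>v\<in>V. u \<noteq> v \<longrightarrow> \<not> cov E u v \<longrightarrow> link E u = link E v)"

text \<open>Stability for the hypergraphs at which symmetrization stops. An approximate colouring
  suffices, since \<open>exact_colouring\<close> repairs it.\<close>

definition terminal :: "nat \<Rightarrow> bool" where
  "terminal k \<longleftrightarrow> (\<forall>\<eta>>0. \<exists>\<epsilon>>0. \<exists>n0::nat. \<forall>V E. kg k V E \<longrightarrow> kfree k E \<longrightarrow> n0 \<le> card V \<longrightarrow> symm V E \<longrightarrow>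
     (\<forall>v\<in>V. (k * lam k - \<epsilon>) * real (card V) ^ (k - 1) \<le> card (link E v)) \<longrightarrow>
     (\<exists>c. c ` V \<subseteq> {..<pp k} \<and> card {e\<in>E. \<not> inj_on c e} \<le> \<eta> * real (card V) ^ k))"

section \<open>Twin classes and the induction on the uniformity\<close>

lemma cov_link_ne: "cov E u v \<Longrightarrow> u \<noteq> v \<Longrightarrow> link E u \<noteq> link E v"
proof
  assume "cov E u v" "u \<noteq> v" and eq: "link E u = link E v"
  then obtain e where e: "e \<in> E" "u \<in> e" "v \<in> e" by (auto simp: cov_def)
  then have "e - {u} \<in> link E u" by (simp add: link_def insert_absorb)
  then have "e - {u} \<in> link E v" using eq by simp
  then show False using e \<open>u \<noteq> v\<close> by (simp add: link_def)
qed

lemma symm_cov: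
  "symm V E \<Longrightarrow> u \<in> V \<Longrightarrow> v \<in> V \<Longrightarrow> link E u \<noteq> link E v \<Longrightarrow> cov E u v"
  unfolding symm_def by metis

text \<open>A symmetrized graph is complete multipartite with the twin classes as parts, and
  \<open>t\<close> classes would give a clique on \<open>t\<close> vertices. So the twin classes
  themselves form a colouring without exceptions.\<close>

lemma terminal_2: "terminal 2"
  unfolding terminal_def
proof (intro allI impI)
  fix \<eta> :: real assume eta: "0 < \<eta>"
  have main: "\<exists>c. c ` V \<subseteq> {..<pp 2} \<and> card {e\<in>E. \<not> inj_on c e} \<le> \<eta> * real (card V) ^ 2"
    if kg: "kg 2 V E" and kf: "kfree 2 E" and sy: "symm V E" for V E
  proof -
    have fV: "finite V" using kg_finite_verts[OF kg] .
    define Q where "Q = link E ` V"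
    have fQ: "finite Q" using fV by (simp add: Q_def)
    have "card Q \<le> t - 1"
    proof (rule ccontr)
      assume "\<not> ?thesis"
      then have tQ: "t \<le> card Q" by simp
      define r where "r = inv_into V (link E)"
      define S where "S = r ` Q"
      have r: "r l \<in> V" "link E (r l) = l" if "l \<in> Q" for l
        using that inv_into_into[of l "link E" V] f_inv_into_f[of l "link E" V] by (simp_all add: Q_def r_def)
      have "inj_on r Q" by (rule inj_on_inverseI[of _ "link E"]) (rule r(2))
      then have cS: "card S = card Q" by (simp add: S_def card_image)
      have SV: "S \<subseteq> V" using r(1) by (auto simp: S_def)
      have Sc: "cov E u v" if "u \<in> S" "v \<in> S" "u \<noteq> v" for u v
      proof (rule symm_cov[OF sy])
        show "u \<in> V" "v \<in> V" using that SV by auto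
        show "link E u \<noteq> link E v" using that r(2) by (auto simp: S_def)
      qed
      obtain \<phi> where \<phi>: "emb 2 E \<phi> {}" "\<phi> ` VT \<subseteq> S"
        using emb2_clique[OF kg SV Sc] tQ cS by auto
      have "\<forall>x\<in>VT. \<forall>y\<in>VT. x \<noteq> y \<longrightarrow> cov E (\<phi> x) (\<phi> y)"
      proof (intro ballI impI)
        fix x y assume xy: "x \<in> VT" "y \<in> VT" "x \<noteq> y"
        have "inj_on \<phi> VT" using \<phi>(1) by (simp add: emb_def)
        then have "\<phi> x \<noteq> \<phi> y" using xy by (auto dest: inj_onD)
        then show "cov E (\<phi> x) (\<phi> y)" using Sc \<phi>(2) xy by auto
      qed
      then show False using kf \<phi>(1) unfolding kfree_def by metis
    qed
    then have "card Q \<le> card {..<pp 2}" using t_ge by (simp add: pp_def)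
    then obtain h where h: "h ` Q \<subseteq> {..<pp 2}" "inj_on h Q"
      using card_le_inj[OF fQ, of "{..<pp 2}"] by auto
    define c where "c v = h (link E v)" for v
    have "inj_on c e" if e: "e \<in> E" for e
    proof (rule inj_onI)
      fix a b assume ab: "a \<in> e" "b \<in> e" "c a = c b"
      have V: "a \<in> V" "b \<in> V" using ab kg_edge_subset[OF kg e] by auto
      then have "link E a = link E b" using inj_onD[OF h(2), of "link E a" "link E b"] ab(3)
        unfolding c_def Q_def by (meson imageI)
      then show "a = b" using cov_link_ne[of E a b] ab e by (auto simp: cov_def)
    qed
    then have e0: "{e\<in>E. \<not> inj_on c e} = {}" by simp
    have "c ` V \<subseteq> {..<pp 2}" using h(1) by (auto simp: c_def Q_def)
    then show ?thesis using eta unfolding e0[symmetric]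
      by (intro exI[of _ c]) (simp add: e0)
  qed
  show "\<exists>\<epsilon>>0. \<exists>n0::nat. \<forall>V E. kg 2 V E \<longrightarrow> kfree 2 E \<longrightarrow> n0 \<le> card V \<longrightarrow> symm V E \<longrightarrow>
     (\<forall>v\<in>V. (real 2 * lam 2 - \<epsilon>) * real (card V) ^ (2 - 1) \<le> card (link E v)) \<longrightarrow>
     (\<exists>c. c ` V \<subseteq> {..<pp 2} \<and> card {e\<in>E. \<not> inj_on c e} \<le> \<eta> * real (card V) ^ 2)"
    by (rule exI[of _ 1], rule conjI, simp, rule exI[of _ 0], intro allI impI, rule main)
qed

text \<open>Replacing the vertices of an edge by twins one at a time keeps it an edge; no two
  replacements collide, since two vertices of one edge are never twins.\<close>

lemma symm_transversal:
  assumes rho: "\<And>u. u \<in> V \<Longrightarrow> link E (\<rho> u) = link E u" and e: "e \<in> E" "e \<subseteq> V" "finite e"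
  shows "inj_on \<rho> e" "\<rho> ` e \<in> E"
proof -
  have dif: "link E a \<noteq> link E b" if "a \<in> e" "b \<in> e" "a \<noteq> b" for a b
    using that e(1) by (intro cov_link_ne) (auto simp: cov_def)
  show "inj_on \<rho> e"
  proof (rule inj_onI)
    fix a b assume ab: "a \<in> e" "b \<in> e" "\<rho> a = \<rho> b"
    then have "link E a = link E b" using rho[of a] rho[of b] e(2) by auto
    then show "a = b" using dif ab by metis
  qed
  have "\<rho> ` F \<union> (e - F) \<in> E" if "finite F" "F \<subseteq> e" for F
    using that
  proof (induction F rule: finite_induct)
    case empty
    then show ?case using e(1) by simp
  next
    case (insert a F)
    define g where "g = \<rho> ` F \<union> (e - insert a F)"
    have IH: "\<rho> ` F \<union> (e - F) \<in> E" using insert by simp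
    have ae: "a \<in> e" "a \<in> V" using insert.prems e(2) by auto
    have "a \<notin> \<rho> ` F"
    proof
      assume "a \<in> \<rho> ` F"
      then obtain b where b: "b \<in> F" "a = \<rho> b" by blast
      have "b \<in> e" "b \<in> V" "b \<noteq> a" using b insert e(2) by auto
      then have "link E a = link E b" using rho[of b] b by simp
      then show False using dif ae(1) \<open>b \<in> e\<close> \<open>b \<noteq> a\<close> by metis
    qed
    then have ag: "a \<notin> g" by (simp add: g_def)
    have "insert a g = \<rho> ` F \<union> (e - F)" using ae insert.hyps by (auto simp: g_def)
    then have "g \<in> link E a" using IH ag by (simp add: link_def)
    then have "g \<in> link E (\<rho> a)" using rho[OF ae(2)] by simp
    then have "insert (\<rho> a) g \<in> E" by (simp add: link_def)
    then show ?case by (simp add: g_def)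
  qed
  from this[OF e(3) order_refl] show "\<rho> ` e \<in> E" by simp
qed

text \<open>The link of \<open>v\<close> is contained in the blowup of its restriction
  \<open>H\<close> to one representative per twin class. Representatives of different classes are
  covered in \<open>E\<close>, so \<open>H\<close> is free of the expansion. The class sizes are the
  weights, and the largest of them acts as the cap in \<open>capped_lagrangian\<close>.\<close>

lemma symm_degree:
  assumes m: "2 \<le> m" "4 * m\<^sup>2 + 4 \<le> t" and kg: "kg (Suc m) V E" and kf: "kfree (Suc m) E" and sy: "symm V E"
    and v: "v \<in> V" and mx: "\<And>u. u \<in> V \<Longrightarrow> card {w\<in>V. link E w = link E u} \<le> s"
    and s: "s = card {w\<in>V. link E w = link E v}"
  shows "kg m (V - {w\<in>V. link E w = link E v}) (link E v)"
    "card (link E v) \<le> phi m (min s ((real (card V) - s) / pp m)) (real (card V) - s)"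
proof -
  define C where "C = {w\<in>V. link E w = link E v}"
  define V' where "V' = V - C"
  define L where "L = link E v"
  have fV: "finite V" using kg_finite_verts[OF kg] .
  have fV': "finite V'" using fV by (simp add: V'_def)
  have kgL: "kg m (V - {v}) L" unfolding L_def by (rule kg_link[OF kg])
  have fC: "f \<inter> C = {}" if "f \<in> L" for f
  proof (rule ccontr)
    assume "f \<inter> C \<noteq> {}"
    then obtain u where u: "u \<in> f" "link E u = link E v" by (auto simp: C_def)
    have "insert v f \<in> E" "v \<notin> f" using that by (simp_all add: L_def link_def)
    then have "cov E u v" "u \<noteq> v" using u by (auto simp: cov_def)
    then show False using cov_link_ne u(2) by metis
  qed
  show kgV': "kg m (V - {w\<in>V. link E w = link E v}) (link E v)"
    unfolding C_def[symmetric] unfolding L_def[symmetric] kg_def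
  proof (intro conjI ballI)
    show "finite (V - C)" using fV by simp
    fix f assume f: "f \<in> L"
    show "f \<subseteq> V - C" using kg_edge_subset[OF kgL f] fC[OF f] by auto
    show "card f = m" by (rule kg_edge_card[OF kgL f])
  qed
  define \<rho> where "\<rho> u = (SOME w. w \<in> V \<and> link E w = link E u)" for u
  have rho: "\<rho> u \<in> V" "link E (\<rho> u) = link E u" if "u \<in> V" for u
  proof -
    have "\<rho> u \<in> V \<and> link E (\<rho> u) = link E u" unfolding \<rho>_def by (rule someI[of _ u]) (use that in simp)
    then show "\<rho> u \<in> V" "link E (\<rho> u) = link E u" by simp_all
  qed
  have rho_eq: "\<rho> u = \<rho> w" if "link E u = link E w" for u w using that by (simp add: \<rho>_def)
  define H where "H = {f\<in>L. f \<subseteq> \<rho> ` V'}"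
  have Lsub: "L \<subseteq> {e. e \<subseteq> V' \<and> inj_on \<rho> e \<and> \<rho> ` e \<in> H}"
  proof
    fix f assume f: "f \<in> L"
    have e: "insert v f \<in> E" "v \<notin> f" using f by (simp_all add: L_def link_def)
    have eV: "insert v f \<subseteq> V" "finite (insert v f)" using kg_edge_subset[OF kg e(1)] kg_finite_edge[OF kg e(1)] by simp_all
    note tr = symm_transversal[OF rho(2) e(1) eV]
    have fV1: "f \<subseteq> V'" using eV(1) fC[OF f] by (auto simp: V'_def)
    have "\<rho> v \<notin> \<rho> ` f" using tr(1) e(2) by (auto simp: inj_on_def)
    then have "\<rho> ` f \<in> link E (\<rho> v)" using tr(2) by (simp add: link_def)
    then have "\<rho> ` f \<in> L" using rho(2)[OF v] by (simp add: L_def)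
    moreover have "\<rho> ` f \<subseteq> \<rho> ` V'" using fV1 by blast
    moreover have "inj_on \<rho> f" by (rule inj_on_subset[OF tr(1) subset_insertI])
    ultimately show "f \<in> {e. e \<subseteq> V' \<and> inj_on \<rho> e \<and> \<rho> ` e \<in> H}" using fV1 by (simp add: H_def)
  qed
  define R where "R = \<rho> ` V'"
  have fR: "finite R" using fV' by (simp add: R_def)
  have kgH: "kg m R H" using kg_edge_card[OF kgL] fR by (simp add: kg_def H_def R_def)
  have "card L \<le> card {e. e \<subseteq> V' \<and> inj_on \<rho> e \<and> \<rho> ` e \<in> H}"
    by (rule card_mono[OF _ Lsub]) (use fV' in simp)
  then have "real (card L) \<le> real (card {e. e \<subseteq> V' \<and> inj_on \<rho> e \<and> \<rho> ` e \<in> H})"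
    by (simp only: of_nat_le_iff)
  also have "\<dots> = lag H (\<lambda>i. card (cls V' \<rho> i))"
    by (rule card_transversal[OF fV' kg_finite[OF kgH] kg_finite_edge[OF kgH]])
  finally have 1: "real (card L) \<le> lag H (\<lambda>i. card (cls V' \<rho> i))" .
  have tf: "tfree m H"
    unfolding tfree_def
  proof
    assume "\<exists>\<phi> A. emb m H \<phi> A"
    then obtain \<phi> A where emb: "emb m H \<phi> A" by metis
    have HL: "H \<subseteq> link E v" by (auto simp: H_def L_def)
    have embE: "emb (Suc m) E \<phi> (insert v A)" by (rule emb_link[OF m(1) emb_mono[OF emb HL]])
    have R: "\<phi> x \<in> R" if "x \<in> VT" for x
    proof -
      obtain y where "y \<in> VT" "{x, y} \<in> ET" using VT_incident[OF \<open>x \<in> VT\<close>] by metis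
      then have "\<phi> ` {x, y} \<union> A \<in> H" by (intro emb_edge[OF emb])
      then have "\<phi> ` {x, y} \<union> A \<subseteq> R" using kg_edge_subset[OF kgH] by metis
      then show ?thesis by simp
    qed
    have "cov E (\<phi> x) (\<phi> y)" if xy: "x \<in> VT" "y \<in> VT" "x \<noteq> y" for x y
    proof -
      have "inj_on \<phi> VT" using emb by (simp add: emb_def)
      then have ne: "\<phi> x \<noteq> \<phi> y" using xy by (auto dest: inj_onD)
      obtain a b where ab: "a \<in> V'" "\<phi> x = \<rho> a" "b \<in> V'" "\<phi> y = \<rho> b" using R[OF xy(1)] R[OF xy(2)] by (auto simp: R_def)
      have abV: "a \<in> V" "b \<in> V" using ab by (auto simp: V'_def)
      have "link E a \<noteq> link E b" using rho_eq ne ab by metis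
      then have "link E (\<rho> a) \<noteq> link E (\<rho> b)" using rho(2) abV by simp
      then show ?thesis using symm_cov[OF sy rho(1)[OF abV(1)] rho(1)[OF abV(2)]] ab by simp
    qed
    then show False using kf embE unfolding kfree_def by metis
  qed
  have sumR: "(\<Sum>i\<in>R. real (card (cls V' \<rho> i))) = real (card V) - s"
  proof -
    have "V' = (\<Union>i\<in>R. cls V' \<rho> i)" by (auto simp: cls_def R_def)
    moreover have "card (\<Union>i\<in>R. cls V' \<rho> i) = (\<Sum>i\<in>R. card (cls V' \<rho> i))"
      by (rule card_UN_disjoint) (use fR fV' in \<open>auto simp: cls_def\<close>)
    ultimately have "card V' = (\<Sum>i\<in>R. card (cls V' \<rho> i))" by simp
    moreover have CV: "C \<subseteq> V" by (auto simp: C_def)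
    moreover have "card V' = card V - s" unfolding V'_def s C_def[symmetric] using CV fV finite_subset by (intro card_Diff_subset) auto
    moreover have "s \<le> card V" unfolding s C_def[symmetric] using card_mono[OF fV CV] .
    ultimately show ?thesis by (simp add: of_nat_sum[symmetric] of_nat_diff del: of_nat_sum)
  qed
  have cap: "real (card (cls V' \<rho> i)) \<le> s" if i: "i \<in> R" for i
  proof -
    obtain u where u: "u \<in> V'" "i = \<rho> u" using i by (auto simp: R_def)
    have "cls V' \<rho> i \<subseteq> {w\<in>V. link E w = link E u}"
    proof
      fix w assume "w \<in> cls V' \<rho> i"
      then have w: "w \<in> V" "\<rho> w = \<rho> u" using u by (auto simp: cls_def V'_def)
      moreover have "u \<in> V" using u by (simp add: V'_def)
      ultimately show "w \<in> {w\<in>V. link E w = link E u}" using rho(2)[of w] rho(2)[of u] by simp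
    qed
    then have "card (cls V' \<rho> i) \<le> card {w\<in>V. link E w = link E u}" using fV by (intro card_mono) auto
    also have "\<dots> \<le> s" using mx[of u] u by (simp add: V'_def)
    finally show ?thesis by simp
  qed
  have "lag H (\<lambda>i. real (card (cls V' \<rho> i))) \<le> phi m (min s (sum (\<lambda>i. real (card (cls V' \<rho> i))) R / pp m)) (sum (\<lambda>i. real (card (cls V' \<rho> i))) R)"
    by (rule capped_lagrangian[OF m kgH tf _ cap]) simp_all
  then show "card (link E v) \<le> phi m (min s ((real (card V) - s) / pp m)) (real (card V) - s)"
    using 1 unfolding sumR L_def by linarith
qed

lemma kfree_link: "2 \<le> m \<Longrightarrow> kfree (Suc m) E \<Longrightarrow> kfree m (link E v)"
  unfolding kfree_def[of m]
proof
  assume m: "2 \<le> m" and kf: "kfree (Suc m) E"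
    and "\<exists>\<phi> A. emb m (link E v) \<phi> A \<and> (\<forall>x\<in>VT. \<forall>y\<in>VT. x \<noteq> y \<longrightarrow> cov (link E v) (\<phi> x) (\<phi> y))"
  then obtain \<phi> A where emb: "emb m (link E v) \<phi> A"
    and c: "\<forall>x\<in>VT. \<forall>y\<in>VT. x \<noteq> y \<longrightarrow> cov (link E v) (\<phi> x) (\<phi> y)" by metis
  have "cov E a b" if h: "cov (link E v) a b" for a b
  proof -
    obtain f where "f \<in> link E v" "a \<in> f" "b \<in> f" using h by (auto simp: cov_def)
    then show ?thesis unfolding cov_def by (intro bexI[of _ "insert v f"]) (auto simp: link_def)
  qed
  then show False using kf emb_link[OF m emb] c unfolding kfree_def by metis
qed

text \<open>\<open>phi_rec\<close> at equal weights: the link of a vertex in the extremal hypergraph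
  is extremal on a \<open>1 - 1 / pp (Suc m)\<close> fraction of the vertices.\<close>

lemma lam_rec: "2 \<le> m \<Longrightarrow> lam m * (1 - 1 / pp (Suc m)) ^ m = Suc m * lam (Suc m)"
proof -
  assume m: "2 \<le> m"
  define p where "p = real (pp (Suc m))"
  have p: "real (pp m) = p - 1" "1 < p" using pp_Suc[of m] pp_pos[of m] by (simp_all add: p_def)
  have "(1 - 1 / p) / pp m = 1 / p" unfolding p(1) using p(2) by (simp add: field_simps)
  then have "lam m * (1 - 1 / p) ^ m = phi m (1 / p) (1 - 1 / p)" using phi_lam[OF m, of "1 - 1 / p"] by simp
  also have "\<dots> = Suc m * phi (Suc m) (1 / p) 1" using phi_rec[OF m, of 1 "1 / p"] by simp
  also have "phi (Suc m) (1 / p) 1 = lam (Suc m)" using phi_lam[of "Suc m" 1] m by (simp add: p_def)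
  finally show ?thesis by (simp add: p_def)
qed

text \<open>If the largest class were well below \<open>n / pp (Suc m)\<close>, then by
  \<open>phi_gap\<close> the degree bound of \<open>symm_degree\<close> would fall short of the
  assumed minimum degree.\<close>

lemma largest_class:
  assumes m: "2 \<le> m" "4 * (Suc m)\<^sup>2 + 4 \<le> t" and n: "0 < n" and s: "0 \<le> s" "s \<le> n"
    and deg: "(Suc m * lam (Suc m) - \<epsilon>) * n ^ m \<le> phi m (min s ((n - s) / pp m)) (n - s)"
  shows "1 / pp (Suc m) - 2 * fact (Suc m) / (Suc m * (real t - 2)) * \<epsilon> \<le> s / n \<or> \<epsilon> < 0"
proof (cases "s / n \<le> 1 / pp (Suc m) \<and> 0 \<le> \<epsilon>")
  case False
  show ?thesis
  proof (cases "\<epsilon> < 0")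
    case False
    then have "1 / pp (Suc m) < s / n" using \<open>\<not> (s / n \<le> 1 / pp (Suc m) \<and> 0 \<le> \<epsilon>)\<close> by auto
    moreover have "0 \<le> 2 * fact (Suc m) / (Suc m * (real t - 2)) * \<epsilon>"
      using False t_ge by (intro mult_nonneg_nonneg divide_nonneg_nonneg) auto
    ultimately show ?thesis by linarith
  qed simp
next
  case True
  define k where "k = Suc m"
  define p where "p = real (pp k)"
  have k2: "2 \<le> k" using m by (simp add: k_def)
  have p: "real (pp m) = p - 1" "1 < p" using pp_Suc[of m] pp_pos[of m] by (simp_all add: p_def k_def)
  have kp: "4 * k\<^sup>2 \<le> pp k" using m(2) pp_ge[OF k2] by (simp add: k_def)
  have sn: "s / n \<le> 1 / p" using True by (simp add: p_def k_def)
  then have "s * p \<le> n" using n p by (simp add: field_simps)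
  then have "s \<le> (n - s) / pp m" unfolding p(1) using p(2) by (simp add: field_simps)
  then have "(k * lam k - \<epsilon>) * n ^ m \<le> phi m s (n - s)" using deg by (simp add: k_def min_def)
  then have "n * ((k * lam k - \<epsilon>) * n ^ m) \<le> n * phi m s (n - s)" using n by (intro mult_left_mono) auto
  also have "\<dots> = k * phi k s n" using phi_rec[OF m(1), of n s] by (simp add: k_def)
  also have "phi k s n = n ^ k * phi k (s / n) 1" using phi_scale[OF k2, of n "s / n" 1] n by simp
  finally have "(k * lam k - \<epsilon>) * n ^ k \<le> (k * phi k (s / n) 1) * n ^ k" by (simp add: k_def mult_ac)
  then have 1: "k * lam k - \<epsilon> \<le> k * phi k (s / n) 1" using n by simp
  have "(real t - 2) / fact k * ((1 / p - s / n) / 2) \<le> phi k (1 / p) 1 - phi k (s / n) 1"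
    by (rule phi_gap[OF k2 kp]) (use sn s n in \<open>simp_all add: p_def\<close>)
  also have "phi k (1 / p) 1 = lam k" using phi_lam[OF k2, of 1] by (simp add: p_def)
  finally have "k * ((real t - 2) / fact k * ((1 / p - s / n) / 2)) \<le> k * (lam k - phi k (s / n) 1)"
    by (rule mult_left_mono) simp
  then have "k * ((real t - 2) / fact k * ((1 / p - s / n) / 2)) \<le> \<epsilon>" using 1 by (simp add: algebra_simps)
  moreover have "0 < k * (real t - 2)" using k2 t_ge by simp
  ultimately have "1 / p - s / n \<le> 2 * fact k / (k * (real t - 2)) * \<epsilon>"
  proof -
    define F where "F = (fact k :: real)"
    define K where "K = k * (real t - 2)"
    have F0: "0 < F" by (simp add: F_def)
    have K0: "0 < K" using \<open>0 < k * (real t - 2)\<close> by (simp add: K_def)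
    have "k * ((real t - 2) / fact k * ((1 / p - s / n) / 2)) = K / F * (1 / p - s / n) / 2"
      by (simp add: K_def F_def)
    then have "K / F * (1 / p - s / n) / 2 \<le> \<epsilon>" using \<open>k * ((real t - 2) / fact k * ((1 / p - s / n) / 2)) \<le> \<epsilon>\<close> by linarith
    then have "(2 * F / K) * (K / F * (1 / p - s / n) / 2) \<le> (2 * F / K) * \<epsilon>" using F0 K0 by (intro mult_left_mono) auto
    moreover have "(2 * F / K) * (K / F * d / 2) = d" for d using F0 K0 by simp
    ultimately show ?thesis unfolding F_def K_def by simp
  qed
  then show ?thesis unfolding p_def k_def by linarith
qed


lemma power_diff_le:
  fixes x y :: real
  assumes "0 \<le> x" "x \<le> y" "y \<le> 1"
  shows "y ^ m \<le> x ^ m + m * (y - x)"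
proof -
  have "norm (y ^ m - x ^ m) \<le> m * norm (y - x)" by (rule norm_power_diff) (use assms in auto)
  then show ?thesis using assms by (simp add: abs_le_iff)
qed

text \<open>The largest twin class takes at least nearly a \<open>1 / p\<close> fraction, so the
  link of its vertices lives on few vertices, while the degree condition makes it large; by
  \<open>lam_rec\<close> it is nearly extremal there. The bound with \<open>\<theta>\<close> keeps
  its vertex set large enough for the induction hypothesis.\<close>

lemma link_nearly_complete:
  assumes m: "2 \<le> m" "4 * (Suc m)\<^sup>2 + 4 \<le> t" and e1: "0 < \<epsilon>1"
  obtains \<epsilon> \<theta> :: real where "0 < \<epsilon>" "0 < \<theta>"
    "\<forall>V E. kg (Suc m) V E \<longrightarrow> kfree (Suc m) E \<longrightarrow> symm V E \<longrightarrow> V \<noteq> {} \<longrightarrow>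
      (\<forall>v\<in>V. (Suc m * lam (Suc m) - \<epsilon>) * real (card V) ^ m \<le> card (link E v)) \<longrightarrow>
      (\<exists>v\<in>V. kg m (V - {w\<in>V. link E w = link E v}) (link E v) \<and>
        (lam m - \<epsilon>1) * real (card (V - {w\<in>V. link E w = link E v})) ^ m \<le> card (link E v) \<and>
        \<theta> * card V \<le> card (V - {w\<in>V. link E w = link E v}))"
proof -
  define k where "k = Suc m"
  define p where "p = real (pp k)"
  define C where "C = 2 * fact k / (k * (real t - 2))"
  define dd where "dd = k * lam k"
  have p1: "1 < p" using pp_ge_k[of k] by (simp add: p_def k_def)
  have C0: "0 < C" using t_ge by (simp add: C_def k_def)
  have dd0: "0 < dd" using lam_pos by (simp add: dd_def k_def)
  have lm0: "0 < lam m" by (rule lam_pos)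
  \<comment> \<open>The second entry keeps \<open>y\<close> at most one; the third makes the error
    \<open>lam m * m * C * \<epsilon>\<close> small against \<open>\<epsilon>1\<close> times the
    degree.\<close>
  define \<epsilon> where "\<epsilon> = min (dd / 2) (min (1 / (p * C)) (\<epsilon>1 * (dd / 2) / (lam m * m * C + 1)))"
  have den: "0 < lam m * m * C + 1" using lm0 C0 by (intro add_nonneg_pos) auto
  have e0: "0 < \<epsilon>" using dd0 p1 C0 e1 den by (simp add: \<epsilon>_def)
  have e: "\<epsilon> \<le> dd / 2" "\<epsilon> \<le> 1 / (p * C)" "\<epsilon> \<le> \<epsilon>1 * (dd / 2) / (lam m * m * C + 1)"
    by (simp_all only: \<epsilon>_def min_le_iff_disj order_refl simp_thms)
  have eC: "C * \<epsilon> \<le> 1 / p"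
  proof -
    have "C * \<epsilon> \<le> C * (1 / (p * C))" using e(2) C0 by (intro mult_left_mono) auto
    also have "\<dots> = 1 / p" using C0 by simp
    finally show ?thesis .
  qed
  have e3: "\<epsilon> * (lam m * m * C + 1) \<le> \<epsilon>1 * (dd / 2)" using e(3) den by (simp only: pos_le_divide_eq)
  have th: "0 < dd / 2" using dd0 by simp
  show ?thesis
  proof (rule that[OF e0 th], intro allI impI)
    fix V E assume kg: "kg (Suc m) V E" and kf: "kfree (Suc m) E" and sy: "symm V E" and V0: "V \<noteq> {}"
      and deg: "\<forall>v\<in>V. (Suc m * lam (Suc m) - \<epsilon>) * real (card V) ^ m \<le> card (link E v)"
    have fV: "finite V" using kg_finite_verts[OF kg] .
    define n where "n = real (card V)"
    have n0: "0 < n" using V0 fV by (simp add: n_def card_gt_0_iff)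
    define cl where "cl u = card {w\<in>V. link E w = link E u}" for u
    have "Max (cl ` V) \<in> cl ` V" using fV V0 by (intro Max_in) auto
    then obtain v where v: "v \<in> V" "cl v = Max (cl ` V)" by force
    have mx: "cl u \<le> cl v" if "u \<in> V" for u unfolding v(2) using that fV by simp
    have m4: "4 * m\<^sup>2 + 4 \<le> t"
    proof -
      have "m\<^sup>2 \<le> (Suc m)\<^sup>2" by (intro power_mono) auto
      then show ?thesis using m(2) by linarith
    qed
    note sd = symm_degree[OF m(1) m4 kg kf sy v(1) mx[unfolded cl_def] refl]
    define V' where "V' = V - {w\<in>V. link E w = link E v}"
    define s where "s = real (cl v)"
    have cV': "real (card V') = n - s"
    proof -
      have sub: "{w\<in>V. link E w = link E v} \<subseteq> V" by blast
      have "card V' = card V - cl v" unfolding V'_def cl_def using sub fV finite_subset by (intro card_Diff_subset) auto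
      moreover have "cl v \<le> card V" unfolding cl_def using card_mono[OF fV sub] .
      ultimately show ?thesis by (simp add: n_def s_def of_nat_diff)
    qed
    have s: "0 \<le> s" "s \<le> n" using cV' by (simp_all add: s_def)
    have dv: "(dd - \<epsilon>) * n ^ m \<le> card (link E v)" using deg v(1) by (simp add: dd_def k_def n_def)
    have "(Suc m * lam (Suc m) - \<epsilon>) * n ^ m \<le> phi m (min s ((n - s) / pp m)) (n - s)"
      using dv sd(2) unfolding dd_def k_def n_def s_def cl_def by linarith
    from largest_class[OF m n0 s this] e0
    have sn: "1 / p - C * \<epsilon> \<le> s / n" by (simp add: p_def C_def k_def)
    define x where "x = 1 - 1 / p"
    define y where "y = x + C * \<epsilon>"
    have xy: "0 \<le> x" "x \<le> y" "y \<le> 1" using p1 eC C0 e0 by (auto simp: x_def y_def)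
    have lx: "lam m * x ^ m = dd" using lam_rec[OF m(1)] by (simp add: x_def p_def k_def dd_def)
    have "n - s \<le> y * n"
    proof -
      have "(1 / p - C * \<epsilon>) * n \<le> s" using sn n0 by (simp only: pos_le_divide_eq)
      then show ?thesis by (simp add: y_def x_def algebra_simps)
    qed
    then have "(n - s) ^ m \<le> (y * n) ^ m" using s by (intro power_mono) auto
    then have "lam m * (n - s) ^ m \<le> lam m * y ^ m * n ^ m" using lm0 by (simp add: power_mult_distrib mult.assoc)
    also have "\<dots> \<le> (dd + lam m * m * (C * \<epsilon>)) * n ^ m"
    proof (rule mult_right_mono)
      have "lam m * y ^ m \<le> lam m * (x ^ m + m * (y - x))" using power_diff_le[OF xy] lm0 by (intro mult_left_mono) auto
      then show "lam m * y ^ m \<le> dd + lam m * m * (C * \<epsilon>)" using lx by (simp add: y_def algebra_simps)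
    qed (use n0 in simp)
    finally have 1: "lam m * (n - s) ^ m \<le> (dd + lam m * m * (C * \<epsilon>)) * n ^ m" .
    have kgL: "kg m V' (link E v)" using sd(1) by (simp add: V'_def)
    have fV': "finite V'" using fV by (simp add: V'_def)
    have "link E v \<subseteq> ksets V' m" using kgL unfolding kg_def ksets_def by blast
    then have "card (link E v) \<le> card (ksets V' m)" by (intro card_mono kg_finite[OF kg_ksets[OF fV']])
    also have "\<dots> \<le> card V' ^ m" by (rule card_ksets_le[OF fV'])
    finally have "real (card (link E v)) \<le> real (card V') ^ m" by (simp only: of_nat_power[symmetric] of_nat_le_iff)
    then have L: "card (link E v) \<le> (n - s) ^ m" by (simp add: cV')
    have half: "dd / 2 * n ^ m \<le> card (link E v)"
    proof -
      have "dd / 2 * n ^ m \<le> (dd - \<epsilon>) * n ^ m" using e(1) n0 by (intro mult_right_mono) auto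
      then show ?thesis using dv by linarith
    qed
    have "\<epsilon>1 * (dd / 2 * n ^ m) \<le> \<epsilon>1 * (n - s) ^ m" using half L e1 by (intro mult_left_mono) auto
    moreover have "(\<epsilon> * (lam m * m * C + 1)) * n ^ m \<le> (\<epsilon>1 * (dd / 2)) * n ^ m" using e3 n0 by (intro mult_right_mono) auto
    ultimately have 2: "(\<epsilon> * (lam m * m * C + 1)) * n ^ m \<le> \<epsilon>1 * (n - s) ^ m" by (simp only: mult.assoc)
    have "(dd + lam m * m * (C * \<epsilon>)) * n ^ m - (\<epsilon> * (lam m * m * C + 1)) * n ^ m = (dd - \<epsilon>) * n ^ m"
      by (simp add: algebra_simps)
    then have A: "(lam m - \<epsilon>1) * (n - s) ^ m \<le> card (link E v)"
      using 1 2 dv unfolding left_diff_distrib[of "lam m"] by linarith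
    have B: "dd / 2 * n \<le> n - s"
    proof -
      have "dd / 2 * n ^ m \<le> (n - s) ^ m" using half L by linarith
      also have "(n - s) ^ m = (n - s) * (n - s) ^ (m - 1)" using m(1) by (metis power_minus_mult mult.commute zero_less_numeral order_less_le_trans)
      also have "\<dots> \<le> (n - s) * n ^ (m - 1)" using s by (intro mult_left_mono power_mono) auto
      finally have "(dd / 2 * n) * n ^ (m - 1) \<le> (n - s) * n ^ (m - 1)"
        using power_minus_mult[of m n] m(1) by (simp add: mult_ac)
      then show ?thesis using n0 by simp
    qed
    have "kg m V' (link E v) \<and> (lam m - \<epsilon>1) * real (card V') ^ m \<le> card (link E v) \<and> dd / 2 * card V \<le> card V'"
      using kgL A B unfolding cV' n_def by simp
    then show "\<exists>v\<in>V. kg m (V - {w\<in>V. link E w = link E v}) (link E v) \<and>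
        (lam m - \<epsilon>1) * real (card (V - {w\<in>V. link E w = link E v})) ^ m \<le> card (link E v) \<and>
        dd / 2 * card V \<le> card (V - {w\<in>V. link E w = link E v})"
      unfolding V'_def by (rule bexI[OF _ v(1)])
  qed
qed

text \<open>The argument of \<open>same_colour_uncovered\<close> inside the link of
  \<open>v\<close>: the transversal lives in the link and \<open>v\<close> joins the new vertices,
  while \<open>w\<close> and \<open>w'\<close> only have to be covered in \<open>E\<close>. As
  \<open>kfree\<close> forbids cores with covered pairs, no added edges have to be chosen.\<close>

lemma symm_same_colour:
  fixes \<kappa> \<beta> :: real
  assumes m: "2 \<le> m" and kf: "kfree (Suc m) E" and F: "F \<subseteq> link E v" and kg: "kg m U F"
    and c: "c ` U \<subseteq> {..<pp m}"
    and kap: "0 < \<kappa>" "\<And>i. i < pp m \<Longrightarrow> \<kappa> * card U \<le> card (cls U c i)"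
    and b: "card (trans U c m - F) \<le> \<beta> * real (card U) ^ m"
    and w: "w \<in> U" "w' \<in> U" "w \<noteq> w'" "c w = c w'"
      "card (link (trans U c m - F) w) \<le> \<beta> * real (card U) ^ (m - 1)"
      "card (link (trans U c m - F) w') \<le> \<beta> * real (card U) ^ (m - 1)"
    and b0: "0 \<le> \<beta>" and lt: "4 * \<beta> < \<kappa> ^ (pp m - 1)"
  shows "\<not> cov E w w'"
proof
  assume cov: "cov E w w'"
  define q where "q = pp m"
  define j where "j = c w"
  have fU: "finite U" using kg_finite_verts[OF kg] .
  have j: "j < q" using c w(1) by (auto simp: j_def q_def)
  have mq: "m < q" using pp_ge_k[of m] by (simp add: q_def)
  have cq: "c ` U \<subseteq> {..<q}" and k1: "1 \<le> m" and cw: "c w = j" "c w' = j"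
    using c m w(4) by (simp_all add: q_def j_def)
  have kapq: "\<kappa> * card U \<le> card (cls U c i)" if "i < q" for i using kap(2) that by (simp add: q_def)
  have sN: "(\<Sum>x\<in>{}. 1 / real (card U) ^ card x) \<le> \<beta>" for x :: "nat set" using b0 by simp
  obtain g where g: "\<And>i. i < q \<Longrightarrow> g i \<in> U \<and> c (g i) = i" "g j = w'"
    "\<And>S. S \<subseteq> {..<q} \<Longrightarrow> card S = m \<Longrightarrow> g ` S \<in> F"
    "\<And>S. S \<subseteq> {..<q} - {j} \<Longrightarrow> card S = m - 1 \<Longrightarrow> insert w (g ` S) \<in> F"
    by (rule near_complete_tuple[OF fU cq k1 w(1,2) cw kap(1) kapq refl b w(5,6) finite.emptyI sN lt[folded q_def]], assumption)
      (rule that)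
  have ginj: "inj_on g {..<q}" by (rule inj_on_inverseI[of _ c]) (use g(1) in simp)
  have wg: "w \<notin> g ` {..<q}"
  proof
    assume "w \<in> g ` {..<q}"
    then obtain i where "w = g i" "i \<in> {..<q}" by (rule imageE)
    then have i: "i < q" "w = g i" by simp_all
    then have "i = j" using g(1)[of i] by (simp add: j_def)
    then show False using i g(2) w(3) by simp
  qed
  have cj: "card ({..<q} - {j}) = q - 1" using j by simp
  have "m - 1 \<le> card ({..<q} - {j})" using cj mq by simp
  then obtain J where J: "J \<subseteq> {..<q} - {j}" "card J = m - 1" by (rule obtain_subset_with_card_n)
  obtain \<phi> A l z where emb: "emb m F \<phi> A" and l: "l \<in> VT" "\<phi> l = w"
    and sub: "\<phi> ` (VT - {l}) \<subseteq> g ` {..<pp m}"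
    by (rule emb_of_tuple[OF m ginj[unfolded q_def] wg[unfolded q_def] j[unfolded q_def]
          J(1)[unfolded q_def] J(2) g(3)[unfolded q_def] g(4)[OF J]], assumption, assumption) (rule that)
  have embE: "emb (Suc m) E \<phi> (insert v A)" by (rule emb_link[OF m emb_mono[OF emb F]])
  have Fcov: "cov E a b" if "f \<in> F" "a \<in> f" "b \<in> f" for f a b
    using that F unfolding cov_def by (intro bexI[of _ "insert v f"]) (auto simp: link_def)
  have gg: "cov E (g i) (g i')" if i: "i < q" "i' < q" for i i'
  proof -
    have "card {i, i'} \<le> m" using m by (cases "i = i'") auto
    then obtain S where S: "{i, i'} \<subseteq> S" "S \<subseteq> {..<q}" "card S = m"
      using exists_subset_between[of "{i, i'}" m "{..<q}"] i mq by auto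
    show ?thesis using Fcov[OF g(3)[OF S(2,3)]] S(1) by simp
  qed
  have wgc: "cov E w (g i)" if i: "i < q" for i
  proof (cases "i = j")
    case True
    then show ?thesis using cov g(2) by simp
  next
    case False
    have "{i} \<subseteq> {..<q} - {j}" "card {i} \<le> m - 1" "m - 1 \<le> card ({..<q} - {j})" using i False m mq cj by auto
    then obtain S where S: "{i} \<subseteq> S" "S \<subseteq> {..<q} - {j}" "card S = m - 1"
      using exists_subset_between[of "{i}" "m - 1" "{..<q} - {j}"] by auto
    show ?thesis using Fcov[OF g(4)[OF S(2,3)]] S(1) by simp
  qed
  have gx: "\<exists>i<q. \<phi> x = g i" if x: "x \<in> VT" "x \<noteq> l" for x
  proof -
    have "\<phi> x \<in> g ` {..<q}" using x by (intro subsetD[OF sub[unfolded q_def[symmetric]]] imageI) simp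
    then obtain i where "\<phi> x = g i" "i \<in> {..<q}" by (rule imageE)
    then show ?thesis by (intro exI[of _ i]) simp
  qed
  have "cov E (\<phi> x) (\<phi> y)" if xy: "x \<in> VT" "y \<in> VT" "x \<noteq> y" for x y
  proof -
    consider "x = l" | "y = l" | "x \<noteq> l" "y \<noteq> l" by metis
    then show ?thesis
    proof cases
      case 1
      then obtain i where "i < q" "\<phi> y = g i" using gx[of y] xy by metis
      then show ?thesis using wgc l(2) 1 by simp
    next
      case 2
      then obtain i where "i < q" "\<phi> x = g i" using gx[of x] xy by metis
      then show ?thesis using wgc l(2) 2 cov_sym[of E "g i" w] by simp
    next
      case 3
      obtain i where i: "i < q" "\<phi> x = g i" using gx[OF xy(1) 3(1)] by metis
      obtain i' where "i' < q" "\<phi> y = g i'" using gx[OF xy(2) 3(2)] by metis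
      then show ?thesis using gg i by simp
    qed
  qed
  then show False using kf embE unfolding kfree_def by metis
qed

text \<open>The twin class \<open>C\<close> of \<open>v\<close> gets the additional colour
  \<open>pp m\<close>, and the stability hypothesis colours the link of \<open>v\<close> on
  \<open>U\<close>. For typical vertices equal colour implies uncovered, hence twins, hence never in
  a common edge. The few other vertices get colour zero and lie in few edges.\<close>

lemma terminal_Suc:
  assumes m: "2 \<le> m" "4 * (Suc m)\<^sup>2 + 4 \<le> t" and st: "stab m"
  shows "terminal (Suc m)"
  unfolding terminal_def
proof (intro allI impI)
  fix \<eta> :: real assume eta: "0 < \<eta>"
  define k where "k = Suc m"
  define \<kappa> where "\<kappa> = (lam m - lam' m) / 2"
  have kap: "0 < \<kappa>" using lam'_less[OF m(1)] by (simp add: \<kappa>_def)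
  define \<beta> where "\<beta> = \<kappa> ^ (pp m - 1) / 8"
  have b0: "0 < \<beta>" using kap by (simp add: \<beta>_def)
  have b4: "4 * \<beta> < \<kappa> ^ (pp m - 1)" using kap by (simp add: \<beta>_def)
  define s where "s = min (min 1 \<kappa>) (min \<beta> (min (\<eta> * \<beta> / (2 * m)) (min (lam m) (\<eta> / 2))))"
  have s0: "0 < s" using kap b0 eta m(1) lam_pos[of m] by (simp add: s_def)
  have s: "s \<le> 1" "s \<le> \<kappa>" "s \<le> \<beta>" "s \<le> \<eta> * \<beta> / (2 * m)" "s \<le> lam m" "s \<le> \<eta> / 2"
    by (simp_all only: s_def min_le_iff_disj order_refl simp_thms)
  have ss: "s\<^sup>2 \<le> s" using s0 s(1) by (simp add: power2_eq_square mult_left_le)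
  define \<delta> where "\<delta> = s\<^sup>2 / 2"
  have d0: "0 < \<delta>" using s0 by (simp add: \<delta>_def)
  obtain \<epsilon>1' n1 where e1': "0 < \<epsilon>1'" and st': "\<forall>V E. kg m V E \<longrightarrow> kfree m E \<longrightarrow> n1 \<le> card V \<longrightarrow>
     (lam m - \<epsilon>1') * real (card V) ^ m \<le> card E \<longrightarrow>
     (\<exists>U\<subseteq>V. card (V - U) \<le> \<delta> * card V \<and>
       (\<exists>c. c ` U \<subseteq> {..<pp m} \<and> (\<forall>e\<in>E. e \<subseteq> U \<longrightarrow> inj_on c e)))"
    using st[unfolded stab_def, rule_format, OF d0] by metis
  define \<epsilon>1 where "\<epsilon>1 = min \<epsilon>1' (s\<^sup>2 / 2)"
  have e1: "0 < \<epsilon>1" "\<epsilon>1 \<le> \<epsilon>1'" "\<epsilon>1 \<le> s\<^sup>2 / 2" using e1' s0 by (simp_all add: \<epsilon>1_def)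
  obtain \<epsilon> \<theta> :: real where e: "0 < \<epsilon>" and th: "0 < \<theta>" and nc: "\<forall>V E. kg (Suc m) V E \<longrightarrow> kfree (Suc m) E \<longrightarrow> symm V E \<longrightarrow> V \<noteq> {} \<longrightarrow>
      (\<forall>v\<in>V. (Suc m * lam (Suc m) - \<epsilon>) * real (card V) ^ m \<le> card (link E v)) \<longrightarrow>
      (\<exists>v\<in>V. kg m (V - {w\<in>V. link E w = link E v}) (link E v) \<and>
        (lam m - \<epsilon>1) * real (card (V - {w\<in>V. link E w = link E v})) ^ m \<le> card (link E v) \<and>
        \<theta> * card V \<le> card (V - {w\<in>V. link E w = link E v}))"
    by (rule link_nearly_complete[OF m e1(1)]) (rule that)
  obtain n0 :: nat where n0: "max (real n1 / \<theta>) (1 / \<theta>) + 1 \<le> real n0" using real_arch_simple by blast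
  have main: "\<exists>c. c ` V \<subseteq> {..<pp k} \<and> card {e\<in>E. \<not> inj_on c e} \<le> \<eta> * real (card V) ^ k"
    if kg: "kg k V E" and kf: "kfree k E" and nV: "n0 \<le> card V" and sy: "symm V E"
      and deg: "\<forall>v\<in>V. (k * lam k - \<epsilon>) * real (card V) ^ (k - 1) \<le> card (link E v)" for V E
  proof -
    have fV: "finite V" using kg_finite_verts[OF kg] .
    define n where "n = real (card V)"
    have "0 \<le> 1 / \<theta>" using th by simp
    then have nb: "real n1 / \<theta> \<le> n" "1 / \<theta> \<le> n" "1 \<le> n" using n0 nV unfolding n_def by linarith+
    have V0: "V \<noteq> {}" using nb by (auto simp: n_def)
    obtain v where v: "v \<in> V" and kgL': "kg m (V - {w\<in>V. link E w = link E v}) (link E v)"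
      and cL': "(lam m - \<epsilon>1) * real (card (V - {w\<in>V. link E w = link E v})) ^ m \<le> card (link E v)"
      and bV': "\<theta> * card V \<le> card (V - {w\<in>V. link E w = link E v})"
      using nc[rule_format, of V E] kg kf sy V0 deg unfolding k_def by auto
    define C where "C = {w\<in>V. link E w = link E v}"
    define V' where "V' = V - C"
    define L where "L = link E v"
    have kgL: "kg m V' L" using kgL' by (simp add: V'_def L_def C_def)
    have cL: "(lam m - \<epsilon>1) * real (card V') ^ m \<le> card L" using cL' by (simp add: V'_def L_def C_def)
    have fV': "finite V'" using fV by (simp add: V'_def)
    have bigV': "n1 \<le> card V'" "1 \<le> card V'"
    proof -
      have "\<theta> * n \<le> card V'" using bV' by (simp add: V'_def C_def n_def)
      moreover have "real n1 \<le> \<theta> * n" "1 \<le> \<theta> * n" using nb(1,2) th by (simp_all add: field_simps)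
      ultimately show "n1 \<le> card V'" "1 \<le> card V'" by linarith+
    qed
    have kfL: "kfree m L" unfolding L_def using kfree_link[OF m(1)] kf by (simp add: k_def)
    have "(lam m - \<epsilon>1') * real (card V') ^ m \<le> (lam m - \<epsilon>1) * real (card V') ^ m"
      using e1(2) by (intro mult_right_mono) auto
    then have "(lam m - \<epsilon>1') * real (card V') ^ m \<le> card L" using cL by linarith
    then obtain U c where U: "U \<subseteq> V'" "card (V' - U) \<le> \<delta> * card V'" and c: "c ` U \<subseteq> {..<pp m}"
      and Uprop: "\<forall>e\<in>L. e \<subseteq> U \<longrightarrow> inj_on c e"
      using st'[rule_format, OF kgL kfL bigV'(1)] by metis
    define F where "F = {f\<in>L. f \<subseteq> U}"
    have kgF: "kg m U F" unfolding F_def by (rule kg_restrict[OF kgL U(1)])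
    have fU: "finite U" using U(1) fV' finite_subset by blast
    define n' where "n' = real (card V')"
    have n'1: "1 \<le> n'" using bigV'(2) by (simp add: n'_def)
    have n'n: "n' \<le> n" unfolding n'_def n_def using fV by (simp add: V'_def card_mono)
    have fL: "finite L" using kg_finite[OF kgL] .
    have "L \<subseteq> F \<union> {f. f \<subseteq> V' \<and> card f = m \<and> f \<inter> (V' - U) \<noteq> {}}"
      using kg_edge_subset[OF kgL] kg_edge_card[OF kgL] unfolding F_def by blast
    then have "card L \<le> card (F \<union> {f. f \<subseteq> V' \<and> card f = m \<and> f \<inter> (V' - U) \<noteq> {}})"
      using fL fV' by (intro card_mono) (auto simp: F_def)
    also have "\<dots> \<le> card F + card {f. f \<subseteq> V' \<and> card f = m \<and> f \<inter> (V' - U) \<noteq> {}}" by (rule card_Un_le)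
    also have "\<dots> \<le> card F + card (V' - U) * card V' ^ (m - 1)"
      by (intro add_left_mono card_touching[OF fV']) blast
    finally have "real (card L) \<le> real (card F + card (V' - U) * card V' ^ (m - 1))" by (simp only: of_nat_le_iff)
    then have "real (card L) \<le> card F + card (V' - U) * n' ^ (m - 1)" by (simp add: n'_def)
    moreover have "card (V' - U) * n' ^ (m - 1) \<le> (\<delta> * n') * n' ^ (m - 1)"
      using U(2) n'1 by (intro mult_right_mono) (auto simp: n'_def)
    moreover have "(\<delta> * n') * n' ^ (m - 1) = \<delta> * n' ^ m" using power_minus_mult[of m n'] m(1) by (simp add: mult_ac)
    ultimately have "(lam m - \<epsilon>1) * n' ^ m - \<delta> * n' ^ m \<le> card F" using cL unfolding n'_def by linarith
    then have "(lam m - \<epsilon>1 - \<delta>) * n' ^ m \<le> card F" by (simp only: left_diff_distrib)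
    moreover have "(lam m - s\<^sup>2) * n' ^ m \<le> (lam m - \<epsilon>1 - \<delta>) * n' ^ m"
      using e1(3) n'1 by (intro mult_right_mono) (auto simp: \<delta>_def)
    moreover have "(lam m - s\<^sup>2) * real (card U) ^ m \<le> (lam m - s\<^sup>2) * n' ^ m"
    proof (rule mult_left_mono)
      show "real (card U) ^ m \<le> n' ^ m" unfolding n'_def using card_mono[OF fV' U(1)] by (intro power_mono) auto
      show "0 \<le> lam m - s\<^sup>2" using ss s(5) by linarith
    qed
    ultimately have cF: "(lam m - s\<^sup>2) * real (card U) ^ m \<le> card F" by linarith
    have U0: "U \<noteq> {}"
    proof
      assume "U = {}"
      then have "1 * n' \<le> \<delta> * n'" using U(2) by (simp add: n'_def)
      moreover have "\<delta> * n' < 1 * n'" using ss s(1) n'1 by (intro mult_strict_right_mono) (auto simp: \<delta>_def)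
      ultimately show False by linarith
    qed
    have "{e\<in>F. inj_on c e} = F" using Uprop by (auto simp: F_def)
    then have cF': "(lam m - s\<^sup>2) * real (card U) ^ m \<le> card {e\<in>F. inj_on c e}" using cF by simp
    note data = transversal_data[OF m(1) kgF U0 c s0 s(1) cF']
    define M where "M = trans U c m - F"
    have kgM: "kg m U M" unfolding M_def by (rule kg_subset[OF trans_kg[OF fU]]) auto
    define u where "u = real (card U)"
    have u0: "0 < u" using U0 fU by (simp add: u_def card_gt_0_iff)
    have cM: "card M \<le> s\<^sup>2 * u ^ m" using data(1) by (simp add: M_def u_def)
    have clsU: "\<kappa> * card U \<le> card (cls U c i)" if "i < pp m" for i
    proof -
      have "\<kappa> * card U \<le> (lam m - lam' m - s\<^sup>2) * card U"
        using ss s(2) by (intro mult_right_mono) (auto simp: \<kappa>_def)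
      then show ?thesis using data(2)[OF that] by linarith
    qed
    define W where "W = {x\<in>U. card (link M x) \<le> \<beta> * u ^ (m - 1)}"
    have cW: "card (U - W) \<le> \<eta> / 2 * u"
    proof -
      have "card (U - W) * (\<beta> * u ^ (m - 1)) = (\<Sum>x\<in>U - W. \<beta> * u ^ (m - 1))" by simp
      also have "\<dots> \<le> (\<Sum>x\<in>U - W. real (card (link M x)))" by (rule sum_mono) (auto simp: W_def)
      also have "\<dots> \<le> (\<Sum>x\<in>U. real (card (link M x)))" by (rule sum_mono2) (use fU in auto)
      also have "\<dots> = real (\<Sum>x\<in>U. card (link M x))" by simp
      also have "\<dots> = m * real (card M)" unfolding sum_card_link[OF kgM] by simp
      also have "\<dots> \<le> m * ((\<eta> * \<beta> / (2 * m)) * u ^ m)"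
      proof (rule mult_left_mono)
        have "s\<^sup>2 * u ^ m \<le> (\<eta> * \<beta> / (2 * m)) * u ^ m" using ss s(4) u0 by (intro mult_right_mono) auto
        then show "real (card M) \<le> (\<eta> * \<beta> / (2 * m)) * u ^ m" using cM by linarith
      qed simp
      also have "\<dots> = (\<eta> / 2 * u) * (\<beta> * u ^ (m - 1))"
        using m(1) power_minus_mult[of m u] by (simp add: mult_ac)
      finally show ?thesis using b0 u0 by (simp only: mult_le_cancel_right_pos mult_pos_pos zero_less_power)
    qed
    have same: "link E w = link E w'" if w: "w \<in> W" "w' \<in> W" "c w = c w'" for w w'
    proof (rule ccontr)
      assume ne: "link E w \<noteq> link E w'"
      then have ww: "w \<noteq> w'" by auto
      have wU: "w \<in> U" "w' \<in> U" using w by (simp_all add: W_def)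
      then have wV: "w \<in> V" "w' \<in> V" using U(1) by (auto simp: V'_def)
      have cov: "cov E w w'" by (rule symm_cov[OF sy wV ne])
      have "s\<^sup>2 * u ^ m \<le> \<beta> * u ^ m" using ss s(3) u0 by (intro mult_right_mono) auto
      then have bM: "card (trans U c m - F) \<le> \<beta> * real (card U) ^ m" using cM by (simp add: M_def u_def)
      have "\<not> cov E w w'"
      proof (rule symm_same_colour[OF m(1) kf[unfolded k_def] _ kgF c kap clsU bM wU ww w(3) _ _ less_imp_le[OF b0] b4])
        show "F \<subseteq> link E v" by (auto simp: F_def L_def)
        show "card (link (trans U c m - F) w) \<le> \<beta> * real (card U) ^ (m - 1)"
          "card (link (trans U c m - F) w') \<le> \<beta> * real (card U) ^ (m - 1)"
          using w(1,2) by (simp_all add: W_def M_def u_def)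
      qed
      then show False using cov by simp
    qed
    have pk: "pp k = Suc (pp m)" using pp_Suc by (simp add: k_def)
    define c2 where "c2 x = (if x \<in> C then pp m else if x \<in> W then c x else 0)" for x
    have WC: "W \<inter> C = {}" using U(1) by (auto simp: W_def V'_def)
    have cWlt: "c x < pp m" if "x \<in> W" for x using c that by (auto simp: W_def)
    have c2V: "c2 ` V \<subseteq> {..<pp k}" using cWlt by (auto simp: c2_def pk less_Suc_eq)
    define R where "R = (V' - U) \<union> (U - W)"
    have bad: "e \<inter> R \<noteq> {}" if e: "e \<in> E" "\<not> inj_on c2 e" for e
    proof
      assume eR: "e \<inter> R = {}"
      obtain a b where ab: "a \<in> e" "b \<in> e" "a \<noteq> b" "c2 a = c2 b" using e(2) by (auto simp: inj_on_def)
      have V: "a \<in> V" "b \<in> V" using ab kg_edge_subset[OF kg e(1)] by auto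
      have CW: "x \<in> C \<or> x \<in> W" if "x \<in> e" "x \<in> V" for x using that eR by (auto simp: R_def V'_def)
      have "link E a = link E b"
      proof (cases "a \<in> C \<or> b \<in> C")
        case True
        have "a \<in> C \<and> b \<in> C"
        proof (rule ccontr)
          assume "\<not> ?thesis"
          then have "(a \<in> C \<and> b \<in> W \<and> b \<notin> C) \<or> (b \<in> C \<and> a \<in> W \<and> a \<notin> C)" using True CW[OF ab(1) V(1)] CW[OF ab(2) V(2)] by auto
          then show False using ab(4) cWlt[of a] cWlt[of b] by (auto simp: c2_def)
        qed
        then show ?thesis by (simp add: C_def)
      next
        case False
        then have "a \<in> W" "b \<in> W" using CW[OF ab(1) V(1)] CW[OF ab(2) V(2)] by auto
        then show ?thesis using same[of a b] ab(4) False by (simp add: c2_def)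
      qed
      moreover have "cov E a b" using ab e(1) by (auto simp: cov_def)
      ultimately show False using cov_link_ne ab(3) by metis
    qed
    have RV: "R \<subseteq> V" using U(1) by (auto simp: R_def V'_def)
    have cR: "card R \<le> \<eta> * n"
    proof -
      have "card R \<le> card (V' - U) + card (U - W)" unfolding R_def by (rule card_Un_le)
      then have "real (card R) \<le> \<delta> * n' + \<eta> / 2 * u" using U(2) cW unfolding n'_def by linarith
      moreover have "\<delta> * n' \<le> \<eta> / 2 * n" using ss s0 s(6) n'n n'1 by (intro mult_mono) (auto simp: \<delta>_def)
      moreover have "\<eta> / 2 * u \<le> \<eta> / 2 * n"
      proof (rule mult_left_mono)
        show "u \<le> n" unfolding u_def n_def using card_mono[OF fV, of U] U(1) by (auto simp: V'_def)
      qed (use eta in simp)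
      ultimately show ?thesis by linarith
    qed
    have "{e\<in>E. \<not> inj_on c2 e} \<subseteq> {f. f \<subseteq> V \<and> card f = k \<and> f \<inter> R \<noteq> {}}"
      using bad kg_edge_subset[OF kg] kg_edge_card[OF kg] by auto
    then have "card {e\<in>E. \<not> inj_on c2 e} \<le> card {f. f \<subseteq> V \<and> card f = k \<and> f \<inter> R \<noteq> {}}"
      using fV by (intro card_mono) auto
    also have "\<dots> \<le> card R * card V ^ (k - 1)" by (rule card_touching[OF fV RV])
    finally have "real (card {e\<in>E. \<not> inj_on c2 e}) \<le> real (card R * card V ^ (k - 1))" by (simp only: of_nat_le_iff)
    also have "\<dots> = card R * n ^ m" by (simp add: n_def k_def)
    also have "\<dots> \<le> (\<eta> * n) * n ^ m" using cR nb(3) by (intro mult_right_mono) auto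
    also have "\<dots> = \<eta> * n ^ k" by (simp add: k_def)
    finally show ?thesis using c2V by (intro exI[of _ c2]) (simp add: n_def)
  qed
  show "\<exists>\<epsilon>>0. \<exists>n0::nat. \<forall>V E. kg (Suc m) V E \<longrightarrow> kfree (Suc m) E \<longrightarrow> n0 \<le> card V \<longrightarrow> symm V E \<longrightarrow>
     (\<forall>v\<in>V. (Suc m * lam (Suc m) - \<epsilon>) * real (card V) ^ (Suc m - 1) \<le> card (link E v)) \<longrightarrow>
     (\<exists>c. c ` V \<subseteq> {..<pp (Suc m)} \<and> card {e\<in>E. \<not> inj_on c e} \<le> \<eta> * real (card V) ^ Suc m)"
    by (rule exI[of _ \<epsilon>], rule conjI, rule e, rule exI[of _ n0], intro allI impI,
        rule main[unfolded k_def])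
qed

end

section \<open>Stability\<close>

text \<open>Zykov symmetrization: \<open>v\<close> loses its edges and becomes a twin of
  \<open>u\<close>.\<close>

definition sym_graph :: "'a set set \<Rightarrow> 'a \<Rightarrow> 'a \<Rightarrow> 'a set set" where
  "sym_graph E u v = {e\<in>E. v \<notin> e} \<union> insert v ` link E u"

text \<open>Ordered pairs; their number measures progress when the number of edges does not
  change.\<close>

definition twins :: "'a set \<Rightarrow> 'a set set \<Rightarrow> ('a \<times> 'a) set" where
  "twins V E = {(x, y). x \<in> V \<and> y \<in> V \<and> link E x = link E y}"

lemma link_uncov: "\<not> cov E u v \<Longrightarrow> f \<in> link E u \<Longrightarrow> v \<notin> f"
  unfolding cov_def link_def by auto

lemma sym_kg:
  assumes kg: "kg k V E" and uv: "u \<in> V" "v \<in> V" "u \<noteq> v" "\<not> cov E u v"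
  shows "kg k V (sym_graph E u v)" "\<not> cov (sym_graph E u v) u v"
    "card (sym_graph E u v) + card (link E v) = card E + card (link E u)"
proof -
  have fE: "finite E" using kg_finite[OF kg] .
  have 1: "insert v f \<subseteq> V \<and> card (insert v f) = k" if f: "f \<in> link E u" for f
  proof -
    have e: "insert u f \<in> E" "u \<notin> f" "v \<notin> f" using f link_uncov[OF uv(4) f] by (simp_all add: link_def)
    have "finite f" using kg_finite_edge[OF kg e(1)] by simp
    then show ?thesis using kg_edge_subset[OF kg e(1)] kg_edge_card[OF kg e(1)] e(2,3) uv(2) by simp
  qed
  show "kg k V (sym_graph E u v)"
    using kg 1 unfolding kg_def sym_graph_def by auto
  show "\<not> cov (sym_graph E u v) u v"
  proof
    assume "cov (sym_graph E u v) u v"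
    then obtain e where e: "e \<in> sym_graph E u v" "u \<in> e" "v \<in> e" by (auto simp: cov_def)
    then obtain f where "f \<in> link E u" "e = insert v f" by (auto simp: sym_graph_def)
    then show False using e(2) uv(3) by (auto simp: link_def)
  qed
  have inj: "inj_on (insert v) (link E u)"
    by (rule inj_onI) (metis insert_ident link_uncov[OF uv(4)])
  have "card (sym_graph E u v) = card {e\<in>E. v \<notin> e} + card (insert v ` link E u)"
    unfolding sym_graph_def using fE finite_link[OF fE] by (intro card_Un_disjoint) auto
  also have "card (insert v ` link E u) = card (link E u)" by (rule card_image[OF inj])
  finally have c1: "card (sym_graph E u v) = card {e\<in>E. v \<notin> e} + card (link E u)" .
  have "card E = card {e\<in>E. v \<notin> e} + card {e\<in>E. v \<in> e}"
    using fE by (subst card_Un_disjoint[symmetric]) (auto intro!: arg_cong[of _ _ card])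
  then show "card (sym_graph E u v) + card (link E v) = card E + card (link E u)" using c1 card_link[of E v] by simp
qed

lemma sym_link_v:
  assumes "u \<noteq> v" "\<not> cov E u v"
  shows "link (sym_graph E u v) v = link E u"
proof (intro equalityI subsetI)
  fix f assume "f \<in> link (sym_graph E u v) v"
  then have f: "v \<notin> f" "insert v f \<in> sym_graph E u v" by (simp_all add: link_def)
  then obtain g where g: "g \<in> link E u" "insert v f = insert v g" by (auto simp: sym_graph_def)
  have "v \<notin> g" by (rule link_uncov[OF assms(2) g(1)])
  then have "f = g" using g(2) f(1) by (simp add: insert_ident)
  then show "f \<in> link E u" using g by simp
next
  fix f assume f: "f \<in> link E u"
  have "v \<notin> f" by (rule link_uncov[OF assms(2) f])
  then show "f \<in> link (sym_graph E u v) v" using f unfolding link_def[of "sym_graph E u v"] by (simp add: sym_graph_def)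
qed

text \<open>The new link of \<open>x\<close> is determined by its old link, so vertices other than
  \<open>v\<close> that were twins remain twins.\<close>

lemma sym_link_other:
  assumes "u \<noteq> v" "\<not> cov E u v" "x \<noteq> v"
  shows "link (sym_graph E u v) x = {f\<in>link E x. v \<notin> f} \<union> {insert v g |g. v \<notin> g \<and> u \<notin> g \<and> insert u g \<in> link E x}"
    (is "?L = ?R")
proof (intro equalityI subsetI)
  fix f assume "f \<in> ?L"
  then have f: "x \<notin> f" "insert x f \<in> sym_graph E u v" by (simp_all add: link_def)
  show "f \<in> ?R"
  proof (cases "v \<in> f")
    case False
    then have "insert x f \<in> E" using f(2) assms(3) by (auto simp: sym_graph_def)
    then show ?thesis using f(1) False by (simp add: link_def)
  next
    case True
    define g where "g = f - {v}"
    have fg: "f = insert v g" "v \<notin> g" using True by (auto simp: g_def)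
    obtain h where h: "h \<in> link E u" "insert x f = insert v h" using f(2) True by (auto simp: sym_graph_def)
    have vh: "v \<notin> h" by (rule link_uncov[OF assms(2) h(1)])
    have "insert v (insert x g) = insert v h" using h(2) fg by (simp add: insert_commute)
    then have hg: "h = insert x g" using vh fg(2) assms(3) by (metis insert_ident insert_iff)
    have u: "u \<notin> insert x g" "insert u (insert x g) \<in> E" using h(1) hg by (simp_all add: link_def)
    then have "insert u g \<in> link E x" using f(1) fg by (auto simp: link_def insert_commute)
    then show ?thesis using fg u by auto
  qed
next
  fix f assume "f \<in> ?R"
  then consider "f \<in> link E x" "v \<notin> f" | g where "f = insert v g" "v \<notin> g" "u \<notin> g" "insert u g \<in> link E x" by auto
  then show "f \<in> ?L"
  proof cases
    case 1
    then show ?thesis using assms(3) by (auto simp: link_def sym_graph_def)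
  next
    case 2
    have x: "x \<notin> insert u g" "insert x (insert u g) \<in> E" using 2(4) by (simp_all add: link_def)
    have "insert x g \<in> link E u" using x 2(3) by (auto simp: link_def insert_commute)
    then have "insert v (insert x g) \<in> sym_graph E u v" by (simp add: sym_graph_def)
    then show ?thesis using x 2(1) assms(3) by (simp add: link_def insert_commute)
  qed
qed

text \<open>Moving \<open>v\<close> to a class at least as large as its own destroys at most
  \<open>2 * card Cv\<close> ordered pairs and creates \<open>2 * card Cu + 1\<close>.\<close>

lemma sym_twins:
  assumes fV: "finite V" and uv: "u \<in> V" "v \<in> V" "u \<noteq> v" "\<not> cov E u v" "link E u \<noteq> link E v"
    and le: "card {x\<in>V. link E x = link E v} \<le> card {x\<in>V. link E x = link E u}"
  shows "card (twins V E) < card (twins V (sym_graph E u v))"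
proof -
  define S where "S = sym_graph E u v"
  define Cu where "Cu = {x\<in>V. link E x = link E u}"
  define Cv where "Cv = {x\<in>V. link E x = link E v}"
  define P where "P = {(x, y) \<in> twins V E. x \<noteq> v \<and> y \<noteq> v}"
  have fin: "finite Cu" "finite Cv" "finite P"
  proof -
    show "finite Cu" "finite Cv" using fV by (simp_all add: Cu_def Cv_def)
    have "P \<subseteq> V \<times> V" by (auto simp: P_def twins_def)
    then show "finite P" using fV finite_subset by blast
  qed
  have pres: "link S x = link S y" if "x \<noteq> v" "y \<noteq> v" "link E x = link E y" for x y
    unfolding S_def sym_link_other[OF uv(3,4) that(1)] sym_link_other[OF uv(3,4) that(2)] that(3) ..
  have Sv: "link S v = link S u"
  proof -
    have "link S u = link E u"
      unfolding S_def sym_link_other[OF uv(3,4,3)] using link_uncov[OF uv(4)] by (auto simp: link_def)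
    then show ?thesis using sym_link_v[OF uv(3,4)] by (simp add: S_def)
  qed
  have vCu: "v \<notin> Cu" using uv(5) by (auto simp: Cu_def)
  have "twins V E \<subseteq> P \<union> (({v} \<times> Cv) \<union> (Cv \<times> {v}))"
    by (auto simp: P_def Cv_def twins_def)
  then have "card (twins V E) \<le> card (P \<union> (({v} \<times> Cv) \<union> (Cv \<times> {v})))"
    using fin by (intro card_mono) auto
  also have "\<dots> \<le> card P + (card ({v} \<times> Cv) + card (Cv \<times> {v}))"
    by (intro order_trans[OF card_Un_le] add_left_mono card_Un_le)
  also have "\<dots> = card P + 2 * card Cv" by (simp add: card_cartesian_product)
  also have "\<dots> < card P + (card ({v} \<times> insert v Cu) + card (Cu \<times> {v}))"
    using le fin vCu unfolding Cu_def[symmetric] Cv_def[symmetric] by (simp add: card_cartesian_product)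
  also have "\<dots> = card (P \<union> (({v} \<times> insert v Cu) \<union> (Cu \<times> {v})))"
  proof -
    have "card (({v} \<times> insert v Cu) \<union> (Cu \<times> {v})) = card ({v} \<times> insert v Cu) + card (Cu \<times> {v})"
      using fin vCu by (intro card_Un_disjoint) auto
    moreover have "card (P \<union> (({v} \<times> insert v Cu) \<union> (Cu \<times> {v}))) = card P + card (({v} \<times> insert v Cu) \<union> (Cu \<times> {v}))"
      using fin by (intro card_Un_disjoint) (auto simp: P_def)
    ultimately show ?thesis by simp
  qed
  also have "\<dots> \<le> card (twins V S)"
  proof (rule card_mono)
    show "finite (twins V S)" by (rule finite_subset[of _ "V \<times> V"]) (use fV in \<open>auto simp: twins_def\<close>)
    have "P \<subseteq> twins V S" using pres by (auto simp: P_def twins_def)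
    moreover have Cu: "link S x = link S v" if "x \<in> Cu" for x
    proof -
      have "x \<noteq> v" "link E x = link E u" using that vCu by (auto simp: Cu_def)
      then show ?thesis using pres[of x u] uv(3) Sv by simp
    qed
    have "{v} \<times> insert v Cu \<subseteq> twins V S"
    proof
      fix z assume "z \<in> {v} \<times> insert v Cu"
      then obtain x where x: "z = (v, x)" "x = v \<or> x \<in> Cu" by auto
      have "x \<in> V" "link S v = link S x" using x(2) Cu[of x] uv(2) by (auto simp: Cu_def)
      then show "z \<in> twins V S" using x(1) uv(2) by (simp add: twins_def)
    qed
    moreover have "Cu \<times> {v} \<subseteq> twins V S"
    proof
      fix z assume "z \<in> Cu \<times> {v}"
      then obtain x where x: "z = (x, v)" "x \<in> Cu" by auto
      have "x \<in> V" "link S x = link S v" using x(2) Cu[of x] by (auto simp: Cu_def)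
      then show "z \<in> twins V S" using x(1) uv(2) by (simp add: twins_def)
    qed
    ultimately show "P \<union> (({v} \<times> insert v Cu) \<union> (Cu \<times> {v})) \<subseteq> twins V S" by simp
  qed
  finally show ?thesis by (simp add: S_def)
qed

text \<open>The threshold is the increment of \<open>a * x ^ k\<close> between consecutive vertex
  numbers, so the losses telescope.\<close>

lemma delete_low_degree:
  fixes a :: real
  assumes "kg k V E"
  shows "\<exists>U\<subseteq>V. (\<forall>v\<in>U. a * (real (card U) ^ k - (real (card U) - 1) ^ k) \<le> card (link {e\<in>E. e \<subseteq> U} v)) \<and>
    real (card E) - card {e\<in>E. e \<subseteq> U} \<le> a * (real (card V) ^ k - real (card U) ^ k)"
  using assms
proof (induction "card V" arbitrary: V E rule: less_induct)
  case less
  note kg = less.prems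
  have fV: "finite V" using kg_finite_verts[OF kg] .
  have fE: "finite E" using kg_finite[OF kg] .
  have EV: "{e\<in>E. e \<subseteq> V} = E" using kg_edge_subset[OF kg] by auto
  show ?case
  proof (cases "\<forall>v\<in>V. a * (real (card V) ^ k - (real (card V) - 1) ^ k) \<le> card (link E v)")
    case True
    show ?thesis by (intro exI[of _ V]) (simp add: EV True)
  next
    case False
    then obtain v where v: "v \<in> V" "card (link E v) < a * (real (card V) ^ k - (real (card V) - 1) ^ k)"
      by (auto simp: not_le)
    define V' where "V' = V - {v}"
    define E' where "E' = {e\<in>E. e \<subseteq> V'}"
    have kg': "kg k V' E'" unfolding E'_def by (rule kg_restrict[OF kg]) (auto simp: V'_def)
    have "card V' < card V" unfolding V'_def by (rule card_Diff1_less[OF fV v(1)])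
    from less.hyps[OF this kg'] obtain U where U: "U \<subseteq> V'"
      "\<forall>v\<in>U. a * (real (card U) ^ k - (real (card U) - 1) ^ k) \<le> card (link {e\<in>E'. e \<subseteq> U} v)"
      "real (card E') - card {e\<in>E'. e \<subseteq> U} \<le> a * (real (card V') ^ k - real (card U) ^ k)" by (elim exE conjE) (rule that)
    have EU: "{e\<in>E'. e \<subseteq> U} = {e\<in>E. e \<subseteq> U}" using U(1) by (auto simp: E'_def)
    have "E' = {e\<in>E. v \<notin> e}" using kg_edge_subset[OF kg] by (auto simp: E'_def V'_def)
    then have "card E = card E' + card {e\<in>E. v \<in> e}"
      using fE by (simp, subst card_Un_disjoint[symmetric]) (auto intro!: arg_cong[of _ _ card])
    then have cE: "real (card E) = card E' + real (card (link E v))" by (simp add: card_link)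
    have "1 \<le> card V" using v(1) fV by (metis One_nat_def Suc_leI card_gt_0_iff empty_iff)
    then have cV': "real (card V') = real (card V) - 1" using v(1) fV by (simp add: V'_def of_nat_diff)
    have "real (card E) - card {e\<in>E. e \<subseteq> U} \<le> a * (real (card V) ^ k - real (card U) ^ k)"
      using U(3) v(2) cE unfolding EU cV' by (simp add: algebra_simps)
    then show ?thesis using U(1,2) unfolding EU by (intro exI[of _ U]) (auto simp: V'_def)
  qed
qed

lemma power_step_ge:
  fixes b :: real
  assumes "0 \<le> b"
  shows "b ^ Suc j + Suc j * b ^ j \<le> (b + 1) ^ Suc j"
proof (induction j)
  case 0
  then show ?case by simp
next
  case (Suc j)
  have "b ^ Suc (Suc j) + Suc (Suc j) * b ^ Suc j \<le> (b ^ Suc j + Suc j * b ^ j) * (b + 1)"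
    using assms by (simp add: algebra_simps)
  also have "\<dots> \<le> (b + 1) ^ Suc j * (b + 1)" using Suc assms by (intro mult_right_mono) auto
  finally show ?case by (simp add: mult.commute)
qed

text \<open>Converts the discrete increment of \<open>delete_low_degree\<close> into a multiple of
  \<open>m ^ (k - 1)\<close>; the error consists of \<open>k * e\<close> and a Bernoulli error of
  order \<open>1 / m\<close>.\<close>

lemma degree_threshold:
  fixes m a e L :: real
  assumes k: "1 \<le> k" and m: "1 \<le> m" and L: "0 \<le> L" and e: "0 \<le> e" "e \<le> L"
    and big: "k * e + L * real k ^ 2 / m \<le> e1"
  shows "(k * L - e1) * m ^ (k - 1) \<le> (L - e) * (m ^ k - (m - 1) ^ k)"
proof -
  obtain j where j: "k = Suc j" using k by (cases k) auto
  have "(m - 1) ^ Suc j + Suc j * (m - 1) ^ j \<le> ((m - 1) + 1) ^ Suc j" by (rule power_step_ge) (use m in simp)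
  then have 1: "Suc j * (m - 1) ^ j \<le> m ^ k - (m - 1) ^ k" by (simp add: j)
  have "1 + real j * (- (1 / m)) \<le> (1 + (- (1 / m))) ^ j"
    by (rule Bernoulli_inequality) (use m in simp)
  then have "m ^ j * (1 - real j / m) \<le> m ^ j * (1 - 1 / m) ^ j" using m by (intro mult_left_mono) auto
  also have "\<dots> = (m - 1) ^ j" using m by (simp add: power_mult_distrib[symmetric] right_diff_distrib)
  finally have 2: "m ^ j * (1 - real j / m) \<le> (m - 1) ^ j" .
  have "real j / m \<le> real k / m" using m by (intro divide_right_mono) (auto simp: j)
  then have "k * m ^ j * (1 - real k / m) \<le> k * m ^ j * (1 - real j / m)" using m by (intro mult_left_mono) auto
  also have "\<dots> = k * (m ^ j * (1 - real j / m))" by simp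
  also have "\<dots> \<le> k * (m - 1) ^ j" using 2 by (intro mult_left_mono) auto
  also have "\<dots> \<le> m ^ k - (m - 1) ^ k" using 1 by (simp add: j)
  finally have 3: "k * m ^ j * (1 - real k / m) \<le> m ^ k - (m - 1) ^ k" .
  have pos: "0 \<le> e * (real k ^ 2 / m)" using e m by simp
  have "k * L - e1 \<le> k * L - k * e - L * (real k ^ 2 / m)" using big by simp
  also have "\<dots> \<le> k * L - k * e - L * (real k ^ 2 / m) + e * (real k ^ 2 / m)" using pos by simp
  also have "\<dots> = (L - e) * (k * (1 - real k / m))" by (simp add: algebra_simps power2_eq_square diff_divide_distrib)
  finally have "(k * L - e1) * m ^ j \<le> (L - e) * (k * (1 - real k / m)) * m ^ j" using m by (intro mult_right_mono) auto
  also have "\<dots> = (L - e) * (k * m ^ j * (1 - real k / m))" by (simp only: mult_ac)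
  also have "\<dots> \<le> (L - e) * (m ^ k - (m - 1) ^ k)" using 3 e by (intro mult_left_mono) auto
  finally show ?thesis by (simp add: j)
qed

context estree
begin

text \<open>The map \<open>\<tau>\<close> sending \<open>v\<close> to \<open>u\<close> takes edges
  of the symmetrized hypergraph to edges of \<open>E\<close>. It is injective on a forbidden core,
  because all pairs of the core are covered while \<open>u\<close> and \<open>v\<close> are
  not.\<close>

lemma sym_kfree:
  assumes uv: "u \<noteq> v" "\<not> cov (sym_graph E u v) u v" "\<not> cov E u v" and kf: "kfree k E"
  shows "kfree k (sym_graph E u v)"
  unfolding kfree_def
proof
  define S where "S = sym_graph E u v"
  assume "\<exists>\<phi> A. emb k (sym_graph E u v) \<phi> A \<and> (\<forall>x\<in>VT. \<forall>y\<in>VT. x \<noteq> y \<longrightarrow> cov (sym_graph E u v) (\<phi> x) (\<phi> y))"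
  then obtain \<phi> A where emb: "emb k S \<phi> A"
    and c: "\<forall>x\<in>VT. \<forall>y\<in>VT. x \<noteq> y \<longrightarrow> cov S (\<phi> x) (\<phi> y)" unfolding S_def by metis
  define \<tau> where "\<tau> x = (if x = v then u else x)" for x
  have tE: "\<tau> ` e \<in> E" if "e \<in> S" for e
  proof -
    from that consider "e \<in> E" "v \<notin> e" | f where "f \<in> link E u" "e = insert v f"
      by (auto simp: S_def sym_graph_def)
    then show ?thesis
    proof cases
      case 1
      then have "\<tau> ` e = e" by (force simp: \<tau>_def)
      then show ?thesis using 1 by simp
    next
      case 2
      have "v \<notin> f" by (rule link_uncov[OF uv(3) 2(1)])
      then have tf: "\<tau> ` f = f" by (force simp: \<tau>_def)
      have tv: "\<tau> v = u" by (simp add: \<tau>_def)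
      have "\<tau> ` e = insert u f" unfolding 2(2) image_insert tv tf ..
      then show ?thesis using 2 by (simp add: link_def)
    qed
  qed
  have inj: "inj_on \<tau> (\<phi> ` VT \<union> A)"
  proof (rule inj_onI)
    fix a b assume ab: "a \<in> \<phi> ` VT \<union> A" "b \<in> \<phi> ` VT \<union> A" "\<tau> a = \<tau> b"
    show "a = b"
    proof (rule ccontr)
      assume "a \<noteq> b"
      then have "cov S a b" by (rule emb_cov[OF emb c ab(1,2)])
      moreover have "(a = v \<and> b = u) \<or> (a = u \<and> b = v)" using ab(3) \<open>a \<noteq> b\<close> by (auto simp: \<tau>_def split: if_splits)
      ultimately show False using uv(2) cov_sym[of S u v] by (auto simp: S_def)
    qed
  qed
  have inj1: "inj_on \<tau> (\<phi> ` VT)" "inj_on \<tau> A" by (rule inj_on_subset[OF inj], blast)+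
  have "emb k E (\<tau> \<circ> \<phi>) (\<tau> ` A)"
    unfolding emb_def
  proof (intro conjI ballI)
    show "inj_on (\<tau> \<circ> \<phi>) VT" using emb inj1(1) by (intro comp_inj_on) (simp_all add: emb_def)
    show "finite (\<tau> ` A)" using emb by (simp add: emb_def)
    show "card (\<tau> ` A) = k - 2" using card_image[OF inj1(2)] emb by (simp add: emb_def)
    have "\<tau> ` (A \<inter> \<phi> ` VT) = \<tau> ` A \<inter> \<tau> ` \<phi> ` VT"
      by (rule inj_on_image_Int[OF inj]) auto
    then show "\<tau> ` A \<inter> (\<tau> \<circ> \<phi>) ` VT = {}" using emb by (simp add: emb_def image_image)
    fix e assume "e \<in> ET"
    then have "\<tau> ` (\<phi> ` e \<union> A) \<in> E" by (intro tE emb_edge[OF emb])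
    then show "(\<tau> \<circ> \<phi>) ` e \<union> \<tau> ` A \<in> E" by (simp only: image_comp[symmetric] image_Un)
  qed
  moreover have "cov E ((\<tau> \<circ> \<phi>) x) ((\<tau> \<circ> \<phi>) y)" if xy: "x \<in> VT" "y \<in> VT" "x \<noteq> y" for x y
  proof -
    have "cov S (\<phi> x) (\<phi> y)" using c xy by metis
    then obtain e where "e \<in> S" "\<phi> x \<in> e" "\<phi> y \<in> e" by (auto simp: cov_def)
    then show ?thesis unfolding cov_def using tE[of e] by (intro bexI[of _ "\<tau> ` e"]) auto
  qed
  ultimately show False using kf unfolding kfree_def by metis
qed

text \<open>The induction carries the conclusion back through a round of deletions and one twin
  replacement. The colouring of the new hypergraph is valid for old edges that avoid
  \<open>v\<close>, and \<open>exact_colouring\<close> turns it into an exact one, so errors do not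
  accumulate over the steps.\<close>

theorem stab_of_terminal:
  assumes k: "2 \<le> k" "4 * k\<^sup>2 + 4 \<le> t" and tm: "terminal k"
  shows "stab k"
  unfolding stab_def
proof (intro allI impI)
  fix \<delta> :: real assume d0: "0 < \<delta>"
  define L where "L = lam k"
  have L0: "0 < L" unfolding L_def by (rule lam_pos)
  obtain \<epsilon>E nE where eE: "0 < \<epsilon>E" and EX: "\<forall>V E c. kg k V E \<longrightarrow> xfree k E \<longrightarrow> nE \<le> card V \<longrightarrow>
      (\<forall>v\<in>V. (k * lam k - \<epsilon>E) * real (card V) ^ (k - 1) \<le> card (link E v)) \<longrightarrow>
      c ` V \<subseteq> {..<pp k} \<longrightarrow> card {e\<in>E. \<not> inj_on c e} \<le> \<epsilon>E * real (card V) ^ k \<longrightarrow>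
      (\<exists>c'. c' ` V \<subseteq> {..<pp k} \<and> (\<forall>e\<in>E. inj_on c' e))"
    by (rule exact_colouring[OF k(1)]) (rule that)
  obtain \<epsilon>T and nT :: nat where eT: "0 < \<epsilon>T" and TT: "\<forall>V E. kg k V E \<longrightarrow> kfree k E \<longrightarrow> nT \<le> card V \<longrightarrow> symm V E \<longrightarrow>
     (\<forall>v\<in>V. (k * lam k - \<epsilon>T) * real (card V) ^ (k - 1) \<le> card (link E v)) \<longrightarrow>
     (\<exists>c. c ` V \<subseteq> {..<pp k} \<and> card {e\<in>E. \<not> inj_on c e} \<le> \<epsilon>E * real (card V) ^ k)"
    using mp[OF spec[OF tm[unfolded terminal_def], of "\<epsilon>E"] eE] by (elim exE conjE) (rule that)
  define e1 where "e1 = min \<epsilon>E \<epsilon>T"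
  define \<delta>' where "\<delta>' = min \<delta> (\<epsilon>E / 2)"
  define e2 where "e2 = min (e1 / (2 * k)) L"
  \<comment> \<open>The deficit allowed by \<open>\<epsilon>\<close> is at most
    \<open>\<delta>'\<close> times what deleting all vertices at the rate \<open>e2\<close> would
    consume; so only a \<open>\<delta>'\<close> fraction can be deleted.\<close>
  define \<epsilon> where "\<epsilon> = min e2 (\<delta>' * e2)"
  have e1: "0 < e1" "e1 \<le> \<epsilon>E" "e1 \<le> \<epsilon>T" using eE eT by (simp_all add: e1_def)
  have d': "0 < \<delta>'" "\<delta>' \<le> \<delta>" "\<delta>' \<le> \<epsilon>E / 2" using d0 eE by (simp_all add: \<delta>'_def)
  have e2: "0 < e2" "e2 \<le> e1 / (2 * k)" "e2 \<le> L" using e1(1) L0 k(1) by (simp_all add: e2_def)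
  have ke2: "k * e2 \<le> e1 / 2"
  proof -
    have "k * e2 \<le> k * (e1 / (2 * k))" using e2(2) by (intro mult_left_mono) auto
    then show ?thesis using k(1) by simp
  qed
  have e: "0 < \<epsilon>" "\<epsilon> \<le> e2" "\<epsilon> \<le> \<delta>' * e2" using e2(1) d'(1) by (simp_all add: \<epsilon>_def)
  obtain N1 :: nat where N1: "max (2 / \<epsilon>E) (2 * L * real k ^ 2 / e1) \<le> real N1" using real_arch_simple by blast
  define N0 where "N0 = max (max nE nT) (max N1 1)"
  have N0: "nE \<le> N0" "nT \<le> N0" "N1 \<le> N0" "1 \<le> N0" by (simp_all add: N0_def)
  have N0r: "2 / \<epsilon>E \<le> real N0" "2 * L * real k ^ 2 / e1 \<le> real N0" using N1 N0(3) by linarith+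
  have exact: "\<exists>c'. c' ` U \<subseteq> {..<pp k} \<and> (\<forall>e\<in>F. inj_on c' e)"
    if "kg k U F" "kfree k F" "N0 \<le> card U"
      "\<forall>v\<in>U. (k * L - e1) * real (card U) ^ (k - 1) \<le> card (link F v)"
      "c ` U \<subseteq> {..<pp k}" "card {e\<in>F. \<not> inj_on c e} \<le> \<epsilon>E * real (card U) ^ k" for U F c
  proof (rule EX[rule_format, OF that(1) kfree_xfree[OF that(2)] _ _ that(5,6)])
    show "nE \<le> card U" using that(3) N0(1) by simp
    fix v assume v: "v \<in> U"
    have "(k * lam k - \<epsilon>E) * real (card U) ^ (k - 1) \<le> (k * L - e1) * real (card U) ^ (k - 1)"
      using e1(2) by (intro mult_right_mono) (auto simp: L_def)
    then show "(k * lam k - \<epsilon>E) * real (card U) ^ (k - 1) \<le> card (link F v)" using that(4) v by fastforce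
  qed
  \<comment> \<open>Lexicographic: the number of vertices, then the sets that are not edges, then
    the pairs that are not twins.\<close>
  define meas :: "(nat set \<times> nat set set \<Rightarrow> nat) list" where
    "meas = [\<lambda>p. card (fst p), \<lambda>p. card (Pow (fst p)) - card (snd p),
       \<lambda>p. card (fst p \<times> fst p) - card (twins (fst p) (snd p))]"
  have claim: "kg k (fst p) (snd p) \<longrightarrow> kfree k (snd p) \<longrightarrow>
      L * real (card (fst p)) ^ k - card (snd p) \<le> \<epsilon> * (real (card (fst p)) ^ k - real N0 ^ k) \<longrightarrow>
      (\<exists>U\<subseteq>fst p. card (fst p - U) \<le> \<delta>' * card (fst p) \<and>
        (\<exists>c. c ` U \<subseteq> {..<pp k} \<and> (\<forall>e\<in>snd p. e \<subseteq> U \<longrightarrow> inj_on c e)))" for p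
  proof (induction p rule: wf_induct_rule[OF wf_measures[of meas]])
    case (1 p)
    show ?case
    proof (intro impI)
      define V where "V = fst p"
      define E where "E = snd p"
      assume "kg k (fst p) (snd p)" "kfree k (snd p)"
        "L * real (card (fst p)) ^ k - card (snd p) \<le> \<epsilon> * (real (card (fst p)) ^ k - real N0 ^ k)"
      then have kg: "kg k V E" and kf: "kfree k E" and D: "L * real (card V) ^ k - card E \<le> \<epsilon> * (real (card V) ^ k - real N0 ^ k)"
        by (simp_all add: V_def E_def)
      have fV: "finite V" using kg_finite_verts[OF kg] .
      define n where "n = real (card V)"
      obtain U where U: "U \<subseteq> V"
        "\<forall>v\<in>U. (L - e2) * (real (card U) ^ k - (real (card U) - 1) ^ k) \<le> card (link {e\<in>E. e \<subseteq> U} v)"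
        "real (card E) - card {e\<in>E. e \<subseteq> U} \<le> (L - e2) * (real (card V) ^ k - real (card U) ^ k)"
        using delete_low_degree[OF kg, of "L - e2"] by (elim exE conjE) (rule that)
      define F where "F = {e\<in>E. e \<subseteq> U}"
      define m where "m = real (card U)"
      have kgF: "kg k U F" unfolding F_def by (rule kg_restrict[OF kg U(1)])
      have kfF: "kfree k F" by (rule kfree_subset[OF kf]) (auto simp: F_def)
      have fU: "finite U" using U(1) fV finite_subset by blast
      have mn: "m \<le> n" unfolding m_def n_def using card_mono[OF fV U(1)] by simp
      have m0: "0 \<le> m" by (simp add: m_def)
      have mnk: "m ^ k \<le> n ^ k" by (rule power_mono[OF mn m0])
      have DF0: "0 \<le> L * m ^ k - card F" using kfree_edges[OF k kgF kfF] by (simp add: m_def L_def)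
      have DF: "L * m ^ k - card F \<le> (L * n ^ k - card E) - e2 * (n ^ k - m ^ k)"
        using U(3) unfolding F_def[symmetric] m_def[symmetric] n_def[symmetric] by (simp add: algebra_simps)
      have D': "L * n ^ k - card E \<le> \<epsilon> * n ^ k - \<epsilon> * real N0 ^ k" using D by (simp add: n_def algebra_simps)
      have emn: "\<epsilon> * (n ^ k - m ^ k) \<le> e2 * (n ^ k - m ^ k)" using e(2) mnk by (intro mult_right_mono) auto
      then have DF1: "L * m ^ k - card F \<le> \<epsilon> * (m ^ k - real N0 ^ k)"
        using DF D' by (simp add: algebra_simps)
      \<comment> \<open>The deficit is never negative by \<open>kfree_edges\<close>, so the
        invariant itself forces at least \<open>N0\<close> remaining vertices.\<close>
      then have "0 \<le> \<epsilon> * (m ^ k - real N0 ^ k)" using DF0 by linarith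
      then have "real N0 ^ k \<le> m ^ k" using e(1) by (simp add: zero_le_mult_iff)
      then have "real N0 \<le> m" using m0 k(1) power_mono_iff[of "real N0" m k] by simp
      then have mN: "N0 \<le> card U" by (simp add: m_def)
      have m1: "1 \<le> m" using mN N0(4) by (simp add: m_def)
      have n1: "1 \<le> n" using m1 mn by linarith
      have UV: "card (V - U) \<le> \<delta>' * card V"
      proof -
        have "e2 * (n ^ k - m ^ k) \<le> \<epsilon> * n ^ k" using DF DF0 D' e(1) by (smt (verit) mult_nonneg_nonneg of_nat_0_le_iff zero_le_power)
        also have "\<dots> \<le> (\<delta>' * e2) * n ^ k" using e(3) n1 by (intro mult_right_mono) auto
        finally have "e2 * (n ^ k - m ^ k) \<le> e2 * (\<delta>' * n ^ k)" by (simp only: mult_ac)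
        then have 1: "n ^ k - m ^ k \<le> \<delta>' * n ^ k" using e2(1) by simp
        have nk: "n ^ k = n * n ^ (k - 1)" "m ^ k = m * m ^ (k - 1)"
          using power_minus_mult[of k n] power_minus_mult[of k m] k(1) by (simp_all add: mult.commute)
        have "m * m ^ (k - 1) \<le> m * n ^ (k - 1)" using mn m0 by (intro mult_left_mono power_mono) auto
        then have "(n - m) * n ^ (k - 1) \<le> (\<delta>' * n) * n ^ (k - 1)" using 1 unfolding nk by (simp add: algebra_simps)
        then have "n - m \<le> \<delta>' * n" using n1 by simp
        moreover have "real (card (V - U)) = n - m"
          using card_Diff_subset[OF fU U(1)] card_mono[OF fV U(1)] by (simp add: n_def m_def of_nat_diff)
        ultimately show ?thesis by (simp add: n_def)
      qed
      have degF: "\<forall>v\<in>U. (k * L - e1) * real (card U) ^ (k - 1) \<le> card (link F v)"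
      proof
        fix v assume v: "v \<in> U"
        have "2 * L * real k ^ 2 / e1 \<le> m" using N0r(2) mN by (simp add: m_def)
        then have "2 * L * real k ^ 2 \<le> m * e1" using e1(1) by (simp add: pos_divide_le_eq)
        then have "L * real k ^ 2 / m \<le> e1 / 2" using m1 by (simp add: pos_divide_le_eq mult.commute)
        then have big: "k * e2 + L * real k ^ 2 / m \<le> e1" using ke2 by linarith
        have "(k * L - e1) * m ^ (k - 1) \<le> (L - e2) * (m ^ k - (m - 1) ^ k)"
          by (rule degree_threshold[OF _ m1 less_imp_le[OF L0] less_imp_le[OF e2(1)] e2(3) big]) (use k(1) in simp)
        then show "(k * L - e1) * real (card U) ^ (k - 1) \<le> card (link F v)"
          using U(2) v unfolding F_def m_def by fastforce
      qed
      have "\<exists>c'. c' ` U \<subseteq> {..<pp k} \<and> (\<forall>e\<in>F. inj_on c' e)"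
      proof (cases "symm U F")
        case True
        have degT: "(k * lam k - \<epsilon>T) * real (card U) ^ (k - 1) \<le> card (link F v)" if v: "v \<in> U" for v
        proof -
          have "(k * lam k - \<epsilon>T) * real (card U) ^ (k - 1) \<le> (k * L - e1) * real (card U) ^ (k - 1)"
            using e1(3) by (intro mult_right_mono) (auto simp: L_def)
          then show ?thesis using degF v by fastforce
        qed
        then have degT': "\<forall>v\<in>U. (k * lam k - \<epsilon>T) * real (card U) ^ (k - 1) \<le> card (link F v)" by (rule ballI)
        have "nT \<le> card U" using mN N0(2) by simp
        then obtain c where "c ` U \<subseteq> {..<pp k}" "card {e\<in>F. \<not> inj_on c e} \<le> \<epsilon>E * real (card U) ^ k"
          using TT[THEN spec, THEN spec, THEN mp, OF kgF, THEN mp, OF kfF, THEN mp, OF \<open>nT \<le> card U\<close>, THEN mp, OF True,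
            THEN mp, OF degT'] by (elim exE conjE) (rule that)
        then show ?thesis by (rule exact[OF kgF kfF mN degF])
      next
        case False
        then obtain a b where ab: "a \<in> U" "b \<in> U" "a \<noteq> b" "\<not> cov F a b" "link F a \<noteq> link F b"
          unfolding symm_def by metis
        define cl where "cl u = card {x\<in>U. link F x = link F u}" for u
        \<comment> \<open>The vertex of smaller degree is replaced, and for equal degrees the one in
          the class that is not larger; so either edges or twin pairs are gained.\<close>
        have "\<exists>u v. u \<in> U \<and> v \<in> U \<and> u \<noteq> v \<and> \<not> cov F u v \<and> link F u \<noteq> link F v \<and>
          (card (link F v) < card (link F u) \<or> card (link F v) = card (link F u) \<and> cl v \<le> cl u)"
        proof (cases "card (link F b) < card (link F a) \<or> card (link F b) = card (link F a) \<and> cl b \<le> cl a")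
          case True
          then show ?thesis using ab by (intro exI[of _ a] exI[of _ b]) simp
        next
          case False
          then have "card (link F a) < card (link F b) \<or> card (link F a) = card (link F b) \<and> cl a \<le> cl b" by linarith
          then show ?thesis using ab cov_sym[of F a b] by (intro exI[of _ b] exI[of _ a]) auto
        qed
        then obtain u v where uv: "u \<in> U" "v \<in> U" "u \<noteq> v" "\<not> cov F u v" "link F u \<noteq> link F v"
          and or: "card (link F v) < card (link F u) \<or> card (link F v) = card (link F u) \<and> cl v \<le> cl u" by (elim exE conjE) (rule that)
        define S where "S = sym_graph F u v"
        note sk = sym_kg[OF kgF uv(1-4)]
        have kgS: "kg k U S" using sk(1) by (simp add: S_def)
        have kfS: "kfree k S" unfolding S_def by (rule sym_kfree[OF uv(3) sk(2) uv(4) kfF])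
        have FS: "card F \<le> card S" using sk(3) or unfolding S_def by linarith
        then have DS: "L * real (card U) ^ k - card S \<le> \<epsilon> * (real (card U) ^ k - real N0 ^ k)"
          using DF1 unfolding m_def by linarith
        have lower: "((U, S), p) \<in> measures meas"
        proof (cases "U = V")
          case False
          then have "card U < card V" using U(1) fV by (metis psubset_card_mono psubsetI)
          then show ?thesis by (simp add: meas_def V_def)
        next
          case True
          then have FE: "F = E" using kg_edge_subset[OF kg] by (auto simp: F_def)
          have p: "p = (V, E)" by (simp add: V_def E_def)
          have "S \<subseteq> Pow V" using kg_edge_subset[OF kgS] True by auto
          then have SP: "card S \<le> card (Pow V)" using fV by (intro card_mono) auto
          show ?thesis
          proof (cases "card (link F v) < card (link F u)")
            case lt: True
            then have "card E < card S" using sk(3) unfolding S_def FE by linarith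
            then show ?thesis using SP True unfolding p meas_def by (simp add: diff_less_mono2)
          next
            case False
            then have eq: "card (link F v) = card (link F u)" "cl v \<le> cl u" using or by auto
            have cSE: "card S = card E" using sk(3) eq(1) unfolding S_def FE by linarith
            have tw: "card (twins V E) < card (twins V S)"
              using sym_twins[OF fU uv eq(2)[unfolded cl_def]] True unfolding S_def FE by simp
            have "twins V S \<subseteq> V \<times> V" by (auto simp: twins_def)
            then have "card (twins V S) \<le> card (V \<times> V)" using fV by (intro card_mono) auto
            then have "card (V \<times> V) - card (twins V S) < card (V \<times> V) - card (twins V E)"
              using tw by (intro diff_less_mono2) auto
            then show ?thesis using True cSE unfolding p meas_def by simp
          qed
        qed
        have "\<exists>U2\<subseteq>fst (U, S). card (fst (U, S) - U2) \<le> \<delta>' * card (fst (U, S)) \<and>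
            (\<exists>c. c ` U2 \<subseteq> {..<pp k} \<and> (\<forall>e\<in>snd (U, S). e \<subseteq> U2 \<longrightarrow> inj_on c e))"
          by (rule 1[OF lower, rule_format]) (use kgS kfS DS in simp_all)
        then obtain U2 c2 where U2: "U2 \<subseteq> U" "card (U - U2) \<le> \<delta>' * card U" "c2 ` U2 \<subseteq> {..<pp k}"
          "\<forall>e\<in>S. e \<subseteq> U2 \<longrightarrow> inj_on c2 e" by auto
        define c where "c x = (if x \<in> U2 then c2 x else 0)" for x
        have cU: "c ` U \<subseteq> {..<pp k}" using U2(3) pp_pos[of k] by (auto simp: c_def)
        \<comment> \<open>The only old edges that the symmetrized hypergraph may lack are edges
          through \<open>v\<close>.\<close>
        define R where "R = insert v (U - U2)"
        have "e \<inter> R \<noteq> {}" if e: "e \<in> F" "\<not> inj_on c e" for e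
        proof
          assume "e \<inter> R = {}"
          then have eU: "e \<subseteq> U2" "v \<notin> e" using kg_edge_subset[OF kgF e(1)] by (auto simp: R_def)
          then have "inj_on c2 e" using U2(4) e(1) by (simp add: S_def sym_graph_def)
          moreover have "inj_on c e \<longleftrightarrow> inj_on c2 e" by (rule inj_on_cong) (use eU in \<open>auto simp: c_def\<close>)
          ultimately show False using e(2) by simp
        qed
        then have "{e\<in>F. \<not> inj_on c e} \<subseteq> {f. f \<subseteq> U \<and> card f = k \<and> f \<inter> R \<noteq> {}}"
          using kg_edge_subset[OF kgF] kg_edge_card[OF kgF] by auto
        then have "card {e\<in>F. \<not> inj_on c e} \<le> card {f. f \<subseteq> U \<and> card f = k \<and> f \<inter> R \<noteq> {}}"
          using fU by (intro card_mono) auto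
        also have "\<dots> \<le> card R * card U ^ (k - 1)" by (rule card_touching[OF fU]) (use uv(2) in \<open>auto simp: R_def\<close>)
        finally have "real (card {e\<in>F. \<not> inj_on c e}) \<le> real (card R * card U ^ (k - 1))" by (simp only: of_nat_le_iff)
        then have "real (card {e\<in>F. \<not> inj_on c e}) \<le> card R * m ^ (k - 1)" by (simp add: m_def)
        also have "\<dots> \<le> (\<epsilon>E * m) * m ^ (k - 1)"
        proof (rule mult_right_mono)
          have "card R \<le> card (U - U2) + 1" unfolding R_def using fU by (simp add: card_insert_if)
          then have "real (card R) \<le> \<delta>' * m + 1" using U2(2) unfolding m_def by linarith
          also have "\<dots> \<le> \<epsilon>E / 2 * m + \<epsilon>E / 2 * m"
          proof (rule add_mono)
            show "\<delta>' * m \<le> \<epsilon>E / 2 * m" using d'(3) m0 by (rule mult_right_mono)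
            have "2 / \<epsilon>E \<le> m" using N0r(1) mN by (simp add: m_def)
            then show "1 \<le> \<epsilon>E / 2 * m" using eE by (simp add: pos_divide_le_eq mult.commute)
          qed
          finally show "real (card R) \<le> \<epsilon>E * m" by simp
        qed (use m0 in simp)
        also have "\<dots> = \<epsilon>E * m ^ k" using power_minus_mult[of k m] k(1) by (simp add: mult_ac)
        finally have "card {e\<in>F. \<not> inj_on c e} \<le> \<epsilon>E * real (card U) ^ k" by (simp add: m_def)
        then show ?thesis by (rule exact[OF kgF kfF mN degF cU])
      qed
      then obtain c' where c': "c' ` U \<subseteq> {..<pp k}" "\<forall>e\<in>F. inj_on c' e" by (elim exE conjE) (rule that)
      have "\<forall>e\<in>E. e \<subseteq> U \<longrightarrow> inj_on c' e" using c'(2) by (simp add: F_def)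
      then show "\<exists>U\<subseteq>fst p. card (fst p - U) \<le> \<delta>' * card (fst p) \<and>
        (\<exists>c. c ` U \<subseteq> {..<pp k} \<and> (\<forall>e\<in>snd p. e \<subseteq> U \<longrightarrow> inj_on c e))"
        using U(1) UV c'(1) unfolding V_def[symmetric] E_def[symmetric] by (intro exI[of _ U] exI[of _ c'] conjI)
    qed
  qed
  have main: "\<exists>U\<subseteq>V. card (V - U) \<le> \<delta> * card V \<and>
       (\<exists>c. c ` U \<subseteq> {..<pp k} \<and> (\<forall>e\<in>E. e \<subseteq> U \<longrightarrow> inj_on c e))"
    if kg: "kg k V E" and kf: "kfree k E" and nV: "2 * N0 \<le> card V"
      and cE: "(lam k - \<epsilon> / 2) * real (card V) ^ k \<le> card E" for V E
  proof -
    define n where "n = real (card V)"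
    have nN: "2 * real N0 \<le> n" using nV unfolding n_def by linarith
    have "2 * real N0 ^ k \<le> 2 ^ k * real N0 ^ k"
      using k(1) self_le_power[of "2::real" k] by (intro mult_right_mono) auto
    also have "\<dots> = (2 * real N0) ^ k" by (simp add: power_mult_distrib)
    also have "\<dots> \<le> n ^ k" using nN by (intro power_mono) auto
    finally have "\<epsilon> * (2 * real N0 ^ k) \<le> \<epsilon> * n ^ k" using e(1) by (intro mult_left_mono) auto
    then have "L * n ^ k - card E \<le> \<epsilon> * (n ^ k - real N0 ^ k)"
      using cE unfolding n_def[symmetric] L_def[symmetric] by (simp add: algebra_simps)
    then have "\<exists>U\<subseteq>fst (V, E). card (fst (V, E) - U) \<le> \<delta>' * card (fst (V, E)) \<and>
        (\<exists>c. c ` U \<subseteq> {..<pp k} \<and> (\<forall>e\<in>snd (V, E). e \<subseteq> U \<longrightarrow> inj_on c e))"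
      using kg kf by (intro claim[rule_format]) (simp_all add: n_def)
    then obtain U where U: "U \<subseteq> V" "card (V - U) \<le> \<delta>' * card V" "\<exists>c. c ` U \<subseteq> {..<pp k} \<and> (\<forall>e\<in>E. e \<subseteq> U \<longrightarrow> inj_on c e)"
      by auto
    have "\<delta>' * card V \<le> \<delta> * card V" using d'(2) by (intro mult_right_mono) auto
    then show ?thesis using U by (intro exI[of _ U]) auto
  qed
  show "\<exists>\<epsilon>>0. \<exists>n0::nat. \<forall>V E. kg k V E \<longrightarrow> kfree k E \<longrightarrow> n0 \<le> card V \<longrightarrow>
     (lam k - \<epsilon>) * real (card V) ^ k \<le> card E \<longrightarrow>
     (\<exists>U\<subseteq>V. card (V - U) \<le> \<delta> * card V \<and>
       (\<exists>c. c ` U \<subseteq> {..<pp k} \<and> (\<forall>e\<in>E. e \<subseteq> U \<longrightarrow> inj_on c e)))"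
    by (rule exI[of _ "\<epsilon> / 2"], rule conjI, use e(1) in simp, rule exI[of _ "2 * N0"], intro allI impI, rule main)
qed

theorem stability: "2 \<le> k \<Longrightarrow> 4 * k\<^sup>2 + 4 \<le> t \<Longrightarrow> stab k"
proof (induction k rule: nat_induct_at_least)
  case base
  then show ?case using stab_of_terminal[OF _ _ terminal_2] by simp
next
  case (Suc m)
  have "m\<^sup>2 \<le> (Suc m)\<^sup>2" by (intro power_mono) auto
  then have "4 * m\<^sup>2 + 4 \<le> t" using Suc.prems by linarith
  then have "stab m" by (rule Suc.IH)
  then have "terminal (Suc m)" by (rule terminal_Suc[OF Suc.hyps Suc.prems])
  then show ?case using stab_of_terminal[OF _ Suc.prems] Suc.hyps by simp
qed

end

section \<open>Sizes of complete multipartite hypergraphs\<close>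

lemma lag_mono:
  assumes "\<And>e v. e \<in> E \<Longrightarrow> v \<in> e \<Longrightarrow> 0 \<le> x v \<and> x v \<le> y v"
  shows "lag E x \<le> lag E y"
  unfolding lag_def by (intro sum_mono prod_mono) (use assms in blast)

lemma card_ksets: "finite V \<Longrightarrow> card (ksets V k) = card V choose k"
  by (simp add: ksets_def n_subsets)

lemma lag_ksets_perm:
  assumes bij: "bij_betw \<pi> A A"
  shows "lag (ksets A k) (\<lambda>i. z (\<pi> i)) = lag (ksets A k) z"
proof -
  have inj: "inj_on \<pi> A" and img: "\<pi> ` A = A" using bij by (simp_all add: bij_betw_def)
  have K: "(\<lambda>e. \<pi> ` e) ` ksets A k = ksets A k"
  proof (intro equalityI subsetI)
    fix e assume "e \<in> (\<lambda>e. \<pi> ` e) ` ksets A k"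
    then obtain f where f: "f \<subseteq> A" "card f = k" "e = \<pi> ` f" by (auto simp: ksets_def)
    have "card e = k" using card_image[OF inj_on_subset[OF inj f(1)]] f by simp
    then show "e \<in> ksets A k" using f img by (auto simp: ksets_def)
  next
    fix e assume e: "e \<in> ksets A k"
    then have "e \<subseteq> \<pi> ` A" "card e = k" using img by (auto simp: ksets_def)
    then obtain f where f: "f \<subseteq> A" "e = \<pi> ` f" by (meson subset_imageE)
    have "card f = k" using card_image[OF inj_on_subset[OF inj f(1)]] f \<open>card e = k\<close> by simp
    then show "e \<in> (\<lambda>e. \<pi> ` e) ` ksets A k" using f by (auto simp: ksets_def)
  qed
  have sub: "f \<subseteq> A" if "f \<in> ksets A k" for f using that by (simp add: ksets_def)
  have I: "inj_on (\<lambda>e. \<pi> ` e) (ksets A k)"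
    by (rule inj_onI) (metis inj_on_image_eq_iff[OF inj] sub)
  have "lag (ksets A k) z = (\<Sum>f\<in>ksets A k. \<Prod>v\<in>\<pi> ` f. z v)"
    unfolding lag_def by (subst K[symmetric]) (simp add: sum.reindex[OF I])
  also have "\<dots> = (\<Sum>f\<in>ksets A k. \<Prod>v\<in>f. z (\<pi> v))"
    by (rule sum.cong[OF refl]) (simp add: prod.reindex[OF inj_on_subset[OF inj sub]])
  finally show ?thesis by (simp add: lag_def)
qed

text \<open>Moves one vertex from part \<open>i\<close> to part \<open>j\<close>. For integer sizes
  the factor \<open>y i - y j - 1\<close> is positive exactly when \<open>y i\<close> exceeds
  \<open>y j\<close> by at least two.\<close>

lemma lag_ksets_exchange:
  assumes fV: "finite V" and ij: "i \<in> V" "j \<in> V" "i \<noteq> j" and k: "2 \<le> k"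
  shows "lag (ksets V k) (y(i := y i - 1, j := y j + 1)) =
    lag (ksets V k) y + (y i - y j - 1) * lag (ksets (V - {i, j}) (k - 2)) y"
proof -
  obtain l where l: "k = Suc (Suc l)" using k by (metis Suc_le_D numeral_2_eq_2 Suc_le_mono)
  have fin: "finite (ksets W m)" "\<And>e. e \<in> ksets W m \<Longrightarrow> finite e" if "finite W" for W :: "'a set" and m
    using kg_finite[OF kg_ksets[OF that]] kg_finite_edge[OF kg_ksets[OF that]] by auto
  define D where "D = lag (ksets (V - {i, j}) l) y"
  define R where "R = lag (ksets (V - {i, j}) (Suc l)) y"
  have one: "lag (link (ksets V k) a) y = R + y b * D"
    if ab: "a \<in> V" "b \<in> V" "a \<noteq> b" "{a, b} = {i, j}" for a b
  proof -
    have 1: "link (ksets V k) a = ksets (V - {a}) (Suc l)" unfolding l by (rule link_ksets[OF fV ab(1)])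
    have "{e \<in> ksets (V - {a}) (Suc l). b \<notin> e} = ksets (V - {a, b}) (Suc l)" by (auto simp: ksets_def)
    moreover have "link (ksets (V - {a}) (Suc l)) b = ksets (V - {a} - {b}) l"
      by (rule link_ksets) (use fV ab in auto)
    moreover have "V - {a} - {b} = V - {a, b}" by blast
    moreover have fa: "finite (V - {a})" using fV by simp
    ultimately show ?thesis
      unfolding 1 using lag_split[of "ksets (V - {a}) (Suc l)" y b, OF fin(1)[OF fa] fin(2)[OF fa]]
      by (simp add: ab(4) D_def R_def)
  qed
  have two: "link (link (ksets V k) i) j = ksets (V - {i, j}) l"
  proof -
    have "link (link (ksets V k) i) j = ksets (V - {i} - {j}) l"
      unfolding l link_ksets[OF fV ij(1)] by (rule link_ksets) (use fV ij in auto)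
    moreover have "V - {i} - {j} = V - {i, j}" by blast
    ultimately show ?thesis by simp
  qed
  have "lag (ksets V k) (y(i := y i - 1, j := y j + 1)) =
      lag (ksets V k) y + 1 * (lag (link (ksets V k) j) y - lag (link (ksets V k) i) y)
      - 1\<^sup>2 * lag (link (link (ksets V k) i) j) y"
    by (rule lag_shift) (use fin[OF fV] ij in auto)
  also have "\<dots> = lag (ksets V k) y + (R + y i * D - (R + y j * D)) - D"
    using one[of i j] one[of j i] ij two by (simp add: D_def insert_commute)
  also have "\<dots> = lag (ksets V k) y + (y i - y j - 1) * D" by (simp add: algebra_simps)
  finally show ?thesis by (simp add: D_def l)
qed

text \<open>Among any \<open>k\<close> vertices of positive weight at least \<open>k - 2\<close> lie
  outside \<open>{i, j}\<close>.\<close>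

lemma lag_ksets_zero:
  assumes fV: "finite V" and k: "2 \<le> k" and y: "\<And>v. v \<in> V \<Longrightarrow> (0::real) \<le> y v"
    and D: "lag (ksets (V - {i, j}) (k - 2)) y = 0"
  shows "lag (ksets V k) y = 0"
proof -
  have "(\<Prod>v\<in>e. y v) = 0" if e: "e \<in> ksets V k" for e
  proof (rule ccontr)
    assume ne: "(\<Prod>v\<in>e. y v) \<noteq> 0"
    have e': "e \<subseteq> V" "card e = k" using e by (simp_all add: ksets_def)
    have fe: "finite e" using e'(1) fV finite_subset by blast
    have pos: "0 < y v" if "v \<in> e" for v
      using ne fe that y[of v] e'(1) by (metis less_eq_real_def prod_zero_iff subsetD)
    have "card e \<le> card (e - {i, j}) + card {i, j}"
      using diff_card_le_card_Diff[of "{i, j}" e] by simp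
    moreover have "card {i, j} \<le> 2" by (simp add: card_insert_if)
    ultimately have "k - 2 \<le> card (e - {i, j})" using e'(2) by linarith
    then obtain g where g: "g \<subseteq> e - {i, j}" "card g = k - 2" by (meson obtain_subset_with_card_n)
    have gk: "g \<in> ksets (V - {i, j}) (k - 2)" using g e' by (auto simp: ksets_def)
    have "0 < (\<Prod>v\<in>g. y v)" by (rule prod_pos) (use g pos in auto)
    also have "\<dots> \<le> lag (ksets (V - {i, j}) (k - 2)) y"
      unfolding lag_def
    proof (rule member_le_sum[OF gk])
      show "0 \<le> (\<Prod>v\<in>f. y v)" if "f \<in> ksets (V - {i, j}) (k - 2) - {g}" for f
        by (rule prod_nonneg) (use that y in \<open>auto simp: ksets_def\<close>)
      show "finite (ksets (V - {i, j}) (k - 2))" using kg_finite[OF kg_ksets[of "V - {i, j}" "k - 2"]] fV by simp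
    qed
    finally show False using D by simp
  qed
  then show ?thesis by (simp add: lag_def)
qed

section \<open>Balanced part sizes and the Turan function\<close>

definition balanced :: "nat \<Rightarrow> (nat \<Rightarrow> nat) \<Rightarrow> bool" where
  "balanced p y \<longleftrightarrow> (\<forall>i<p. \<forall>j<p. y i \<le> y j + 1)"

definition part_size :: "nat \<Rightarrow> nat \<Rightarrow> nat \<Rightarrow> nat" where
  "part_size p n i = n div p + (if i < n mod p then 1 else 0)"

text \<open>The number of edges of the balanced complete \<open>p\<close>-partite
  \<open>k\<close>-graph on \<open>n\<close> vertices, as a real number.\<close>

definition turan :: "nat \<Rightarrow> nat \<Rightarrow> nat \<Rightarrow> real" where
  "turan p k n = lag (ksets {..<p} k) (\<lambda>i. real (part_size p n i))"

text \<open>Sizes differing by at most one are quotient and quotient plus one of the division of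
  \<open>n\<close> by \<open>p\<close>, and the remainder counts the larger parts.\<close>

lemma balanced_values:
  assumes p: "0 < p" and b: "balanced p y" and n: "(\<Sum>i<p. y i) = n"
  shows "\<And>i. i < p \<Longrightarrow> y i \<noteq> Suc (n div p) \<Longrightarrow> y i = n div p"
    "card {i\<in>{..<p}. y i = Suc (n div p)} = n mod p"
proof -
  have "Min (y ` {..<p}) \<in> y ` {..<p}" by (rule Min_in) (use p in auto)
  then obtain i0 where "i0 < p" "Min (y ` {..<p}) = y i0" by auto
  then have i0: "i0 < p" "\<And>i. i < p \<Longrightarrow> y i0 \<le> y i"
    using Min_le[of "y ` {..<p}"] by auto
  define a where "a = y i0"
  define S where "S = {i\<in>{..<p}. y i = Suc a}"
  have val: "y i = a + (if y i = Suc a then 1 else 0)" if "i < p" for i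
  proof -
    have "y i \<le> y i0 + 1" using b i0(1) that by (simp add: balanced_def)
    moreover have "y i0 \<le> y i" by (rule i0(2)[OF that])
    ultimately show ?thesis by (simp add: a_def)
  qed
  have "n = (\<Sum>i<p. a + (if y i = Suc a then 1 else 0))" unfolding n[symmetric] by (rule sum.cong[OF refl], rule val) simp
  also have "\<dots> = p * a + card S" by (simp add: sum.distrib sum.If_cases S_def Int_def)
  finally have n': "n = p * a + card S" .
  have "S \<subseteq> {..<p} - {i0}" by (auto simp: S_def a_def)
  then have "card S \<le> card ({..<p} - {i0})" by (rule card_mono[rotated]) simp
  then have "card S < p" using i0(1) by simp
  then have dm: "n div p = a" "n mod p = card S" using n' p by simp_all
  show "y i = n div p" if "i < p" "y i \<noteq> Suc (n div p)" for i
    using val[OF that(1)] that(2) unfolding dm(1) by simp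
  show "card {i\<in>{..<p}. y i = Suc (n div p)} = n mod p" unfolding dm by (simp add: S_def)
qed

lemma balanced_perm:
  assumes p: "0 < p" and b: "balanced p y" "balanced p z" and eq: "(\<Sum>i<p. y i) = (\<Sum>i<p. z i)"
  obtains \<pi> where "bij_betw \<pi> {..<p} {..<p}" "\<And>i. i < p \<Longrightarrow> z (\<pi> i) = y i"
proof -
  define n where "n = (\<Sum>i<p. y i)"
  define a where "a = n div p"
  define S where "S x = {i\<in>{..<p}. x i = Suc a}" for x :: "nat \<Rightarrow> nat"
  have y: "\<And>i. i < p \<Longrightarrow> y i \<noteq> Suc a \<Longrightarrow> y i = a" "card (S y) = n mod p"
    using balanced_values[OF p b(1) n_def[symmetric]] by (simp_all add: a_def S_def)
  have z: "\<And>i. i < p \<Longrightarrow> z i \<noteq> Suc a \<Longrightarrow> z i = a" "card (S z) = n mod p"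
    using balanced_values[OF p b(2), of n] eq by (simp_all add: a_def S_def n_def)
  have fS: "finite (S x)" and subS: "S x \<subseteq> {..<p}" for x by (auto simp: S_def)
  have "card ({..<p} - S y) = card ({..<p} - S z)"
    using y(2) z(2) by (simp add: card_Diff_subset fS subS)
  then obtain g h where g: "bij_betw g (S y) (S z)" and h: "bij_betw h ({..<p} - S y) ({..<p} - S z)"
    using finite_same_card_bij[of "S y" "S z"] finite_same_card_bij[of "{..<p} - S y" "{..<p} - S z"]
      y(2) z(2) fS by auto
  define \<pi> where "\<pi> i = (if i \<in> S y then g i else h i)" for i
  have g': "bij_betw \<pi> (S y) (S z)"
    using g by (rule bij_betw_cong[THEN iffD1, rotated]) (simp add: \<pi>_def)
  have h': "bij_betw \<pi> ({..<p} - S y) ({..<p} - S z)"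
    using h by (rule bij_betw_cong[THEN iffD1, rotated]) (simp add: \<pi>_def)
  have "bij_betw \<pi> (S y \<union> ({..<p} - S y)) (S z \<union> ({..<p} - S z))"
    by (rule bij_betw_combine[OF g' h']) blast
  moreover have "S x \<union> ({..<p} - S x) = {..<p}" for x using subS by blast
  ultimately have bij: "bij_betw \<pi> {..<p} {..<p}" by simp
  have "z (\<pi> i) = y i" if i: "i < p" for i
  proof (cases "i \<in> S y")
    case True
    then have "\<pi> i \<in> S z" using g' by (auto dest: bij_betwE)
    then show ?thesis using True by (simp add: S_def)
  next
    case False
    then have "\<pi> i \<in> {..<p} - S z" using h' i by (auto dest: bij_betwE)
    then show ?thesis using False y(1)[OF i] z(1)[of "\<pi> i"] i by (auto simp: S_def)
  qed
  then show ?thesis by (rule that[OF bij])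
qed

lemma part_size:
  assumes "0 < p"
  shows "balanced p (part_size p n)" "(\<Sum>i<p. part_size p n i) = n"
proof -
  show "balanced p (part_size p n)" by (simp add: balanced_def part_size_def)
  have "{..<p} \<inter> {i. i < n mod p} = {..<n mod p}" using mod_less_divisor[OF assms, of n] by auto
  then have "(\<Sum>i<p. part_size p n i) = p * (n div p) + n mod p"
    by (simp add: part_size_def sum.distrib sum.If_cases)
  then show "(\<Sum>i<p. part_size p n i) = n" by simp
qed

lemma turan_balanced:
  assumes "0 < p" "balanced p y" "(\<Sum>i<p. y i) = n"
  shows "lag (ksets {..<p} k) (\<lambda>i. real (y i)) = turan p k n"
proof -
  obtain \<pi> where pi: "bij_betw \<pi> {..<p} {..<p}" "\<And>i. i < p \<Longrightarrow> part_size p n (\<pi> i) = y i"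
    using balanced_perm[OF assms(1,2) part_size(1)[OF assms(1), of n]] assms(3) part_size(2)[OF assms(1), of n]
    by metis
  have "lag (ksets {..<p} k) (\<lambda>i. real (y i)) = lag (ksets {..<p} k) (\<lambda>i. real (part_size p n (\<pi> i)))"
    by (rule lag_cong) (use pi(2) in \<open>auto simp: ksets_def\<close>)
  also have "\<dots> = turan p k n" unfolding turan_def by (rule lag_ksets_perm[OF pi(1), where z="\<lambda>i. real (part_size p n i)"])
  finally show ?thesis .
qed

text \<open>One exchange between parts whose sizes differ by at least two. The decreasing sum of
  squares makes the process terminate; the gain is kept explicit for
  \<open>turan_unique\<close>.\<close>

lemma unbalanced_step:
  assumes k: "2 \<le> k" and ub: "\<not> balanced p y"
  obtains y' i j where "(\<Sum>i<p. y' i) = (\<Sum>i<p. y i)" "(\<Sum>i<p. (y' i)\<^sup>2) < (\<Sum>i<p. (y i)\<^sup>2)"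
    "lag (ksets {..<p} k) (\<lambda>i. real (y i)) + lag (ksets ({..<p} - {i, j}) (k - 2)) (\<lambda>i. real (y i))
      \<le> lag (ksets {..<p} k) (\<lambda>i. real (y' i))"
proof -
  obtain i j where ij: "i < p" "j < p" "y j + 1 < y i" using ub by (auto simp: balanced_def not_le)
  define y' where "y' = y(i := y i - 1, j := y j + 1)"
  have ne: "i \<noteq> j" using ij by auto
  have split: "(\<Sum>l<p. g l) = g i + (g j + sum g ({..<p} - {i} - {j}))" for g :: "nat \<Rightarrow> nat"
    using ij ne by (simp add: sum.remove[of "{..<p}" i] sum.remove[of "{..<p} - {i}" j])
  have rest: "sum (\<lambda>l. h (y' l)) ({..<p} - {i} - {j}) = sum (\<lambda>l. h (y l)) ({..<p} - {i} - {j})" for h :: "nat \<Rightarrow> nat"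
    by (rule sum.cong) (auto simp: y'_def)
  have y'i: "y' i = y i - 1" "y' j = y j + 1" using ne by (simp_all add: y'_def)
  have 1: "(\<Sum>i<p. y' i) = (\<Sum>i<p. y i)"
    unfolding split[of y'] split[of y] using rest[of "\<lambda>x. x"] y'i ij by simp
  have "(y i - 1)\<^sup>2 + (y j + 1)\<^sup>2 < (y i)\<^sup>2 + (y j)\<^sup>2"
  proof -
    obtain d where d: "y i = y j + 2 + d" using ij(3) by (metis Suc_eq_plus1 add_2_eq_Suc' less_eq_Suc_le nat_le_iff_add)
    show ?thesis unfolding d by (simp add: power2_eq_square algebra_simps)
  qed
  then have 2: "(\<Sum>i<p. (y' i)\<^sup>2) < (\<Sum>i<p. (y i)\<^sup>2)"
    unfolding split[of "\<lambda>l. (y' l)\<^sup>2"] split[of "\<lambda>l. (y l)\<^sup>2"] using rest[of "\<lambda>x. x\<^sup>2"] y'i by simp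
  define x where "x l = real (y l)" for l
  define D where "D = lag (ksets ({..<p} - {i, j}) (k - 2)) x"
  have D0: "0 \<le> D" unfolding D_def by (rule lag_nonneg) (simp add: x_def)
  have "(\<lambda>l. real (y' l)) = x(i := x i - 1, j := x j + 1)"
    using ij by (auto simp: y'_def x_def fun_eq_iff)
  then have "lag (ksets {..<p} k) (\<lambda>l. real (y' l)) = lag (ksets {..<p} k) x + (x i - x j - 1) * D"
    unfolding D_def using lag_ksets_exchange[of "{..<p}" i j k x] ij ne k by simp
  moreover have "1 * D \<le> (x i - x j - 1) * D" using D0 ij by (intro mult_right_mono) (simp_all add: x_def)
  ultimately have "lag (ksets {..<p} k) x + D \<le> lag (ksets {..<p} k) (\<lambda>l. real (y' l))" by simp
  then show ?thesis unfolding D_def x_def using 1 2 by (intro that) 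
qed

lemma turan_max:
  assumes k: "2 \<le> k" and p: "0 < p" and n: "(\<Sum>i<p. y i) = n"
  shows "lag (ksets {..<p} k) (\<lambda>i. real (y i)) \<le> turan p k n"
  using n
proof (induction "\<Sum>i<p. (y i)\<^sup>2" arbitrary: y rule: less_induct)
  case less
  show ?case
  proof (cases "balanced p y")
    case True
    then show ?thesis using turan_balanced[OF p True less.prems] by simp
  next
    case False
    obtain y' i j where y': "(\<Sum>i<p. y' i) = (\<Sum>i<p. y i)" "(\<Sum>i<p. (y' i)\<^sup>2) < (\<Sum>i<p. (y i)\<^sup>2)"
      "lag (ksets {..<p} k) (\<lambda>i. real (y i)) + lag (ksets ({..<p} - {i, j}) (k - 2)) (\<lambda>i. real (y i))
        \<le> lag (ksets {..<p} k) (\<lambda>i. real (y' i))"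
      by (rule unbalanced_step[OF k False])
    have "0 \<le> lag (ksets ({..<p} - {i, j}) (k - 2)) (\<lambda>i. real (y i))" by (rule lag_nonneg) simp
    moreover have "lag (ksets {..<p} k) (\<lambda>i. real (y' i)) \<le> turan p k n"
      by (rule less.hyps[OF y'(2)]) (use y'(1) less.prems in simp)
    ultimately show ?thesis using y'(3) by linarith
  qed
qed

lemma turan_ge: "real (p choose k) * real (n div p) ^ k \<le> turan p k n"
proof -
  have "real (p choose k) * real (n div p) ^ k = lag (ksets {..<p} k) (\<lambda>i. real (n div p))"
    using lag_const[OF kg_ksets[of "{..<p}" k]] by (simp add: card_ksets)
  also have "\<dots> \<le> turan p k n" unfolding turan_def by (rule lag_mono) (simp add: part_size_def)
  finally show ?thesis .
qed

text \<open>At an unbalanced optimum the gain in \<open>unbalanced_step\<close> would be zero, and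
  then there would be no edges at all by \<open>lag_ksets_zero\<close>; but with
  \<open>k \<le> p\<close> and \<open>p \<le> n\<close> the optimum is positive.\<close>

lemma turan_unique:
  assumes k: "2 \<le> k" "k \<le> p" and np: "p \<le> n" and n: "(\<Sum>i<p. y i) = n"
    and eq: "turan p k n \<le> lag (ksets {..<p} k) (\<lambda>i. real (y i))"
  shows "balanced p y"
proof (rule ccontr)
  assume False: "\<not> balanced p y"
  have p: "0 < p" using k by simp
  obtain y' i j where y': "(\<Sum>i<p. y' i) = (\<Sum>i<p. y i)"
    "lag (ksets {..<p} k) (\<lambda>i. real (y i)) + lag (ksets ({..<p} - {i, j}) (k - 2)) (\<lambda>i. real (y i))
      \<le> lag (ksets {..<p} k) (\<lambda>i. real (y' i))"
    by (rule unbalanced_step[OF k(1) False])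
  have "0 \<le> lag (ksets ({..<p} - {i, j}) (k - 2)) (\<lambda>i. real (y i))" by (rule lag_nonneg) simp
  moreover have "lag (ksets {..<p} k) (\<lambda>i. real (y' i)) \<le> turan p k n"
    by (rule turan_max[OF k(1) p]) (use y'(1) n in simp)
  ultimately have "lag (ksets ({..<p} - {i, j}) (k - 2)) (\<lambda>i. real (y i)) = 0"
    using y'(2) eq by linarith
  then have "lag (ksets {..<p} k) (\<lambda>i. real (y i)) = 0"
    by (intro lag_ksets_zero[OF _ k(1)]) simp_all
  moreover have "0 < real (p choose k) * real (n div p) ^ k"
    using k np p by (simp add: div_greater_zero_iff)
  ultimately show False using eq turan_ge[of p k n] by linarith
qed

text \<open>Adding a vertex to part \<open>0\<close> may leave the sizes unbalanced, but by
  \<open>turan_max\<close> the result is still at most the optimum.\<close>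

lemma turan_step:
  assumes k: "2 \<le> k" and p: "0 < p"
  shows "turan p k n + real ((p - 1) choose (k - 1)) * real (n div p) ^ (k - 1) \<le> turan p k (Suc n)"
proof -
  obtain l where l: "k = Suc l" using k by (cases k) auto
  define x where "x i = real (part_size p n i)" for i
  define y where "y = (part_size p n)(0 := Suc (part_size p n 0))"
  have L: "link (ksets {..<p} k) 0 = ksets ({..<p} - {0}) l" unfolding l by (rule link_ksets) (use p in auto)
  have fin: "finite (ksets {..<p} k)" "\<And>e. e \<in> ksets {..<p} k \<Longrightarrow> finite e"
    using kg_finite[OF kg_ksets[of "{..<p}" k]] kg_finite_edge[OF kg_ksets[of "{..<p}" k]] by auto
  have sy: "(\<Sum>i<p. y i) = Suc n"
  proof -
    have "(\<Sum>i<p. y i) = Suc (part_size p n 0) + sum (part_size p n) ({..<p} - {0})"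
      using p by (simp add: sum.remove[of "{..<p}" 0] y_def)
    also have "\<dots> = Suc (\<Sum>i<p. part_size p n i)" using p by (simp add: sum.remove[of "{..<p}" 0])
    finally show ?thesis using part_size(2)[OF p] by simp
  qed
  have a: "lag {e \<in> ksets {..<p} k. 0 \<notin> e} (\<lambda>i. real (y i)) = lag {e \<in> ksets {..<p} k. 0 \<notin> e} x"
    by (rule lag_cong) (metis (mono_tags, lifting) fun_upd_apply mem_Collect_eq x_def y_def)
  have b: "lag (link (ksets {..<p} k) 0) (\<lambda>i. real (y i)) = lag (link (ksets {..<p} k) 0) x"
    by (rule lag_cong) (metis (mono_tags, lifting) fun_upd_apply mem_Collect_eq x_def y_def link_def)
  have "lag (ksets {..<p} k) (\<lambda>i. real (y i)) = lag {e \<in> ksets {..<p} k. 0 \<notin> e} x + real (y 0) * lag (link (ksets {..<p} k) 0) x"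
    using lag_split[OF fin, of "\<lambda>i. real (y i)" 0] a b by simp
  also have "\<dots> = lag (ksets {..<p} k) x + lag (link (ksets {..<p} k) 0) x"
    using lag_split[OF fin, of x 0] by (simp add: y_def x_def algebra_simps)
  finally have 1: "lag (ksets {..<p} k) x + lag (link (ksets {..<p} k) 0) x \<le> turan p k (Suc n)"
    using turan_max[OF k p sy] by simp
  have "real ((p - 1) choose (k - 1)) * real (n div p) ^ (k - 1) = lag (ksets ({..<p} - {0}) l) (\<lambda>i. real (n div p))"
    using lag_const[OF kg_ksets[of "{..<p} - {0}" l]] p by (simp add: card_ksets l)
  also have "\<dots> \<le> lag (ksets ({..<p} - {0}) l) x" by (rule lag_mono) (simp add: part_size_def x_def)
  finally have 2: "real ((p - 1) choose (k - 1)) * real (n div p) ^ (k - 1) \<le> lag (link (ksets {..<p} k) 0) x" by (simp only: L)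
  have "x = (\<lambda>i. real (part_size p n i))" by (simp add: x_def fun_eq_iff)
  then have "turan p k n = lag (ksets {..<p} k) x" by (simp add: turan_def)
  then show ?thesis using 1 2 by linarith
qed

text \<open>Rounding down costs a relative error of at most \<open>j * p / n\<close>, by Bernoulli's
  inequality.\<close>

lemma div_power_ge:
  assumes p: "0 < p" and n: "p \<le> n"
  shows "real n ^ j * (1 - real j * p / n) / real p ^ j \<le> real ((n - 1) div p) ^ j"
proof -
  define x where "x = 1 - real p / n"
  have n0: "0 < real n" using p n by simp
  have x: "0 \<le> x" "x \<le> 1" using n n0 by (simp_all add: x_def divide_le_eq)
  have "1 + real j * (- (p / n)) \<le> (1 + - (p / n)) ^ j"
    by (rule Bernoulli_inequality) (use n n0 in \<open>simp add: divide_le_eq\<close>)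
  then have 1: "1 - real j * p / n \<le> x ^ j" by (simp add: x_def)
  have "n \<le> Suc ((n - 1) div p) * p"
  proof -
    have "n - 1 < Suc ((n - 1) div p) * p" using div_less_iff_less_mult[OF p, of "n - 1" "Suc ((n - 1) div p)"] by simp
    then show ?thesis by simp
  qed
  then have "real n \<le> real (Suc ((n - 1) div p) * p)" by (simp only: of_nat_le_iff)
  then have "real n \<le> (real ((n - 1) div p) + 1) * p" by (simp add: algebra_simps)
  moreover have "real n * x = real n - p" using n0 by (simp add: x_def right_diff_distrib)
  ultimately have "real n * x \<le> real ((n - 1) div p) * p" by (simp add: algebra_simps)
  then have 2: "real n * x / p \<le> real ((n - 1) div p)" using p by (simp add: divide_le_eq)
  have "real n ^ j * (1 - real j * p / n) / real p ^ j \<le> real n ^ j * x ^ j / real p ^ j"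
    using 1 n0 p by (intro divide_right_mono mult_left_mono) auto
  also have "\<dots> = (real n * x / p) ^ j" by (simp add: power_mult_distrib power_divide)
  also have "\<dots> \<le> real ((n - 1) div p) ^ j" by (rule power_mono[OF 2]) (use x n0 in auto)
  finally show ?thesis .
qed

text \<open>The coefficient \<open>k * (p choose k) / p ^ k\<close> equals
  \<open>((p - 1) choose (k - 1)) / p ^ (k - 1)\<close>, the normalised degree in a balanced
  hypergraph. The slack \<open>\<epsilon> * n ^ (k - 1)\<close> absorbs the rounding and the extra
  \<open>1\<close>, which is the surplus gained per deleted vertex in
  \<open>descend\<close>.\<close>

lemma turan_growth:
  fixes \<epsilon> :: real
  assumes k: "2 \<le> k" and p: "0 < p" and e: "0 < \<epsilon>"
  obtains m1 where "\<forall>n>m1.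
    turan p k (n - 1) + (k * (real (p choose k) / real p ^ k) - \<epsilon>) * real n ^ (k - 1) + 1 \<le> turan p k n"
proof -
  define C where "C = real ((p - 1) choose (k - 1)) / real p ^ (k - 1)"
  have C: "k * (real (p choose k) / real p ^ k) = C"
  proof -
    have "k * (p choose k) = p * ((p - 1) choose (k - 1))"
      using times_binomial_minus1_eq[of k p] k by simp
    then have "real k * real (p choose k) = real p * real ((p - 1) choose (k - 1))"
      by (simp only: of_nat_mult[symmetric])
    moreover have "real p ^ k = real p * real p ^ (k - 1)" using k by (simp add: power_eq_if)
    ultimately show ?thesis using p by (simp add: C_def)
  qed
  have C0: "0 \<le> C" by (simp add: C_def)
  obtain m0 :: nat where m0: "(C * (real (k - 1) * p) + 1) / \<epsilon> \<le> real m0" using real_arch_simple by blast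
  define m1 where "m1 = max m0 p"
  have "real m0 \<le> real m1" by (simp add: m1_def)
  then have m1: "(C * (real (k - 1) * p) + 1) / \<epsilon> \<le> m1" "p \<le> m1" using m0 by (linarith, simp add: m1_def)
  show ?thesis
  proof (rule that[of m1], intro allI impI)
    fix n assume n: "m1 < n"
    define j where "j = k - 1"
    define q where "q = real j * p"
    have j: "1 \<le> j" using k by (simp add: j_def)
    have n0: "1 \<le> real n" "p \<le> n" using n m1(2) p by auto
    have "(C * q + 1) / \<epsilon> \<le> n" using m1(1) n by (simp add: q_def j_def)
    then have big: "C * q + 1 \<le> \<epsilon> * n" using e by (simp add: divide_le_eq mult.commute)
    have "turan p k (n - 1) + real ((p - 1) choose (k - 1)) * real ((n - 1) div p) ^ (k - 1) \<le> turan p k n"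
      using turan_step[OF k p, of "n - 1"] n by simp
    moreover have "C * (real n ^ j * (1 - q / n)) \<le> real ((p - 1) choose (k - 1)) * real ((n - 1) div p) ^ (k - 1)"
    proof -
      have "real ((p - 1) choose (k - 1)) * (real n ^ j * (1 - real j * p / n) / real p ^ j)
          \<le> real ((p - 1) choose (k - 1)) * real ((n - 1) div p) ^ j"
        by (rule mult_left_mono[OF div_power_ge[OF p n0(2)]]) simp
      then show ?thesis by (simp add: C_def j_def q_def)
    qed
    moreover have "(C - \<epsilon>) * real n ^ j + 1 \<le> C * (real n ^ j * (1 - q / n))"
    proof -
      have nj: "real n ^ j = real n * real n ^ (j - 1)" using j by (simp add: power_eq_if)
      have "C * q * real n ^ (j - 1) + 1 \<le> (C * q + 1) * real n ^ (j - 1)"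
        using one_le_power[OF n0(1), of "j - 1"] by (simp add: algebra_simps)
      also have "\<dots> \<le> \<epsilon> * n * real n ^ (j - 1)" using big by (intro mult_right_mono) auto
      finally have 1: "C * q * real n ^ (j - 1) + 1 \<le> \<epsilon> * real n ^ j" by (simp add: nj mult.assoc)
      have "C * (real n ^ j * (1 - q / n)) = C * real n ^ j - C * q * real n ^ (j - 1)"
        using n0(1) by (simp add: nj algebra_simps)
      then show ?thesis using 1 by (simp add: algebra_simps)
    qed
    ultimately show "turan p k (n - 1) + (k * (real (p choose k) / real p ^ k) - \<epsilon>) * real n ^ (k - 1) + 1 \<le> turan p k n"
      unfolding C j_def by linarith
  qed
qed

lemma turan_asymp:
  fixes \<epsilon> :: real
  assumes k: "2 \<le> k" and p: "0 < p" and e: "0 < \<epsilon>"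
  obtains m1 where "\<forall>n\<ge>m1. (real (p choose k) / real p ^ k - \<epsilon>) * real n ^ k \<le> turan p k n"
proof -
  define C where "C = real (p choose k) / real p ^ k"
  have C0: "0 \<le> C" by (simp add: C_def)
  obtain m0 :: nat where m0: "C * (real k * p) / \<epsilon> \<le> real m0" using real_arch_simple by blast
  define m1 where "m1 = max m0 p"
  have "real m0 \<le> real m1" by (simp add: m1_def)
  then have m1: "C * (real k * p) / \<epsilon> \<le> m1" "p \<le> m1" using m0 by (linarith, simp add: m1_def)
  show ?thesis
  proof (rule that[of m1], intro allI impI)
    fix n assume n: "m1 \<le> n"
    define q where "q = real k * p"
    have n0: "0 < real n" "p \<le> n" using n m1(2) p by auto
    have "C * q / \<epsilon> \<le> n" using m1(1) n unfolding q_def by linarith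
    then have "C * q \<le> \<epsilon> * n" using e by (simp add: divide_le_eq mult.commute)
    then have big: "C * q / n \<le> \<epsilon>" using n0 by (simp add: divide_le_eq)
    have "(C - \<epsilon>) * real n ^ k \<le> (C - C * q / n) * real n ^ k" using big by (intro mult_right_mono) auto
    also have "\<dots> = real (p choose k) * (real n ^ k * (1 - real k * p / n) / real p ^ k)"
      by (simp add: C_def q_def algebra_simps diff_divide_distrib)
    also have "\<dots> \<le> real (p choose k) * real ((n - 1) div p) ^ k"
      by (rule mult_left_mono[OF div_power_ge[OF p n0(2)]]) simp
    also have "\<dots> \<le> real (p choose k) * real (n div p) ^ k"
      by (intro mult_left_mono power_mono) (auto simp: div_le_mono)
    also have "\<dots> \<le> turan p k n" by (rule turan_ge)
    finally show "(real (p choose k) / real p ^ k - \<epsilon>) * real n ^ k \<le> turan p k n" by (simp add: C_def)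
  qed
qed

section \<open>Coloured hypergraphs and isomorphism of balanced blowups\<close>

lemma coloured_card_le:
  assumes k: "2 \<le> k" and p: "0 < p" and kg: "kg k V E" and c: "c ` V \<subseteq> {..<p}" and E: "\<forall>e\<in>E. inj_on c e"
  shows "card E \<le> turan p k (card V)"
    "k \<le> p \<Longrightarrow> p \<le> card V \<Longrightarrow> turan p k (card V) \<le> card E \<Longrightarrow> E = trans V c k \<and> balanced p (\<lambda>i. card (cls V c i))"
proof -
  have fV: "finite V" using kg_finite_verts[OF kg] .
  have sub: "E \<subseteq> trans V c k" using kg E by (auto simp: trans_def kg_def)
  have fin: "finite (trans V c k)" using kg_finite[OF trans_kg[OF fV]] .
  have s: "(\<Sum>i<p. card (cls V c i)) = card V" by (rule sum_cls[OF fV c])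
  have ct: "real (card (trans V c k)) = lag (ksets {..<p} k) (\<lambda>i. real (card (cls V c i)))"
    by (rule card_trans[OF fV c])
  have le: "real (card (trans V c k)) \<le> turan p k (card V)" unfolding ct by (rule turan_max[OF k p s])
  have cE: "card E \<le> card (trans V c k)" by (rule card_mono[OF fin sub])
  show "card E \<le> turan p k (card V)" using cE le by linarith
  assume k': "k \<le> p" "p \<le> card V" and ge: "turan p k (card V) \<le> card E"
  have "card E = card (trans V c k)" using cE le ge by linarith
  then have "E = trans V c k" by (rule card_subset_eq[OF fin sub])
  moreover have "balanced p (\<lambda>i. card (cls V c i))"
    by (rule turan_unique[OF k k' s]) (use ge cE ct in linarith)
  ultimately show "E = trans V c k \<and> balanced p (\<lambda>i. card (cls V c i))" ..
qed

text \<open>A permutation of the colours matches the class sizes, and bijections between matched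
  classes glue to an isomorphism.\<close>

lemma trans_isomorphic:
  assumes p: "0 < p"
    and G: "finite (verts G)" "c ` verts G \<subseteq> {..<p}" "edges G = trans (verts G) c k" "balanced p (\<lambda>i. card (cls (verts G) c i))"
    and H: "finite (verts H)" "d ` verts H \<subseteq> {..<p}" "edges H = trans (verts H) d k" "balanced p (\<lambda>i. card (cls (verts H) d i))"
    and card: "card (verts G) = card (verts H)"
  shows "isomorphic G H"
proof -
  have "(\<Sum>i<p. card (cls (verts G) c i)) = (\<Sum>i<p. card (cls (verts H) d i))"
    using sum_cls[OF G(1,2)] sum_cls[OF H(1,2)] card by simp
  then obtain \<pi> where pi: "bij_betw \<pi> {..<p} {..<p}" "\<And>i. i < p \<Longrightarrow> card (cls (verts H) d (\<pi> i)) = card (cls (verts G) c i)"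
    using balanced_perm[OF p G(4) H(4)] by metis
  have "\<exists>g. bij_betw g (cls (verts G) c i) (cls (verts H) d (\<pi> i))" if "i < p" for i
    by (rule finite_same_card_bij) (use pi(2)[OF that] G(1) H(1) in \<open>simp_all add: cls_finite\<close>)
  then obtain g where g: "\<And>i. i < p \<Longrightarrow> bij_betw (g i) (cls (verts G) c i) (cls (verts H) d (\<pi> i))" by metis
  define f where "f v = g (c v) v" for v
  have cp: "c v < p" if "v \<in> verts G" for v using G(2) that by auto
  have fv: "f v \<in> verts H" "d (f v) = \<pi> (c v)" if "v \<in> verts G" for v
    using bij_betwE[OF g[OF cp[OF that]]] that by (auto simp: cls_def f_def)
  have dc: "d (f v) = d (f w) \<longleftrightarrow> c v = c w" if "v \<in> verts G" "w \<in> verts G" for v w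
    using fv(2)[OF that(1)] fv(2)[OF that(2)] inj_onD[OF bij_betw_imp_inj_on[OF pi(1)]] cp[OF that(1)] cp[OF that(2)] by auto
  have inj: "inj_on f (verts G)"
  proof (rule inj_onI)
    fix v w assume vw: "v \<in> verts G" "w \<in> verts G" and eq: "f v = f w"
    have "c v = c w" using dc[OF vw] eq by simp
    moreover have "inj_on (g (c v)) (cls (verts G) c (c v))" by (rule bij_betw_imp_inj_on[OF g[OF cp[OF vw(1)]]])
    ultimately show "v = w" using eq vw by (auto simp: f_def cls_def dest: inj_onD)
  qed
  have surj: "f ` verts G = verts H"
  proof (intro equalityI subsetI)
    fix w assume w: "w \<in> verts H"
    have "d w < p" using w H(2) by auto
    then have "d w \<in> \<pi> ` {..<p}" using pi(1) by (simp add: bij_betw_def)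
    then obtain i where i: "i < p" "d w = \<pi> i" by auto
    then have "w \<in> g i ` cls (verts G) c i" using g[OF i(1)] w by (simp add: bij_betw_def cls_def)
    then obtain v where "v \<in> verts G" "c v = i" "w = g i v" by (auto simp: cls_def)
    then have "v \<in> verts G" "w = f v" by (simp_all add: f_def)
    then show "w \<in> f ` verts G" by blast
  qed (use fv in auto)
  have tr: "f ` e \<in> trans (verts H) d k \<longleftrightarrow> e \<in> trans (verts G) c k" if e: "e \<subseteq> verts G" for e
  proof -
    have "card (f ` e) = card e" by (rule card_image[OF inj_on_subset[OF inj e]])
    moreover have "inj_on d (f ` e) \<longleftrightarrow> inj_on c e"
    proof
      assume L: "inj_on d (f ` e)"
      show "inj_on c e"
      proof (rule inj_onI)
        fix v w assume vw: "v \<in> e" "w \<in> e" "c v = c w"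
        then have "d (f v) = d (f w)" using dc e by blast
        then have "f v = f w" using L vw by (auto dest: inj_onD)
        then show "v = w" using inj vw e by (auto dest: inj_onD)
      qed
    next
      assume R: "inj_on c e"
      show "inj_on d (f ` e)"
      proof (rule inj_onI)
        fix a b assume "a \<in> f ` e" "b \<in> f ` e" and eq: "d a = d b"
        then obtain v w where vw: "v \<in> e" "w \<in> e" "a = f v" "b = f w" by blast
        then have "c v = c w" using dc[of v w] e eq by blast
        then show "a = b" using R vw by (auto dest: inj_onD)
      qed
    qed
    moreover have "f ` e \<subseteq> verts H" using e fv by auto
    ultimately show ?thesis using e by (simp add: trans_def)
  qed
  have "edges H = (\<lambda>e. f ` e) ` edges G"
  proof (intro equalityI subsetI)
    fix e assume e: "e \<in> edges H"
    then have "e \<subseteq> f ` verts G" using surj by (simp add: H(3) trans_def)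
    then obtain e' where e': "e' \<subseteq> verts G" "e = f ` e'" by (meson subset_imageE)
    then have "e' \<in> edges G" using tr[OF e'(1)] e by (simp add: H(3) G(3))
    then show "e \<in> (\<lambda>e. f ` e) ` edges G" using e' by blast
  next
    fix e assume "e \<in> (\<lambda>e. f ` e) ` edges G"
    then obtain e' where e': "e' \<in> edges G" "e = f ` e'" by blast
    then have "e' \<subseteq> verts G" by (simp add: G(3) trans_def)
    then show "e \<in> edges H" using tr e' by (simp add: H(3) G(3))
  qed
  then show ?thesis unfolding isomorphic_def using inj surj by (auto simp: bij_betw_def)
qed

text \<open>Translates parts numbered from \<open>1\<close> to \<open>p\<close> into colours below
  \<open>p\<close>. Floor and ceiling of \<open>n / p\<close> differ by at most one, which is
  \<open>balanced\<close>.\<close>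

lemma balanced_blowup_trans:
  assumes p: "0 < p" and K: "balanced_blowup k p n K"
  obtains c where "finite (verts K)" "card (verts K) = n" "c ` verts K \<subseteq> {..<p}" "edges K = trans (verts K) c k"
    "balanced p (\<lambda>i. card (cls (verts K) c i))"
proof -
  obtain P :: "nat \<Rightarrow> _" where fin: "finite (verts K)" "card (verts K) = n" and P: "disjoint_family_on P {1..p}"
    "(\<Union>i\<in>{1..p}. P i) = verts K"
    "\<forall>i\<in>{1..p}. int (card (P i)) \<in> {\<lfloor>real n / real p\<rfloor>, \<lceil>real n / real p\<rceil>}"
    "edges K = {e. e \<subseteq> verts K \<and> card e = k \<and> (\<forall>i\<in>{1..p}. card (e \<inter> P i) \<le> 1)}"
    using K unfolding balanced_blowup_def by (elim exE conjE) (rule that; assumption)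
  have ex: "\<exists>i. i < p \<and> v \<in> P (Suc i)" if v: "v \<in> verts K" for v
  proof -
    obtain i where i: "i \<in> {1..p}" "v \<in> P i" using v P(2) by blast
    then show ?thesis by (intro exI[of _ "i - 1"]) auto
  qed
  then obtain c where c: "\<And>v. v \<in> verts K \<Longrightarrow> c v < p \<and> v \<in> P (Suc (c v))" by metis
  have uniq: "c v = i" if v: "v \<in> P (Suc i)" "i < p" for v i
  proof -
    have "v \<in> verts K" using v P(2) by force
    then have cv: "c v < p" "v \<in> P (Suc (c v))" using c by simp_all
    show ?thesis
    proof (rule ccontr)
      assume "c v \<noteq> i"
      then have "P (Suc (c v)) \<inter> P (Suc i) = {}"
        using P(1) cv(1) v(2) by (intro disjoint_family_onD[OF P(1)]) auto
      then show False using cv v by blast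
    qed
  qed
  have cls: "cls (verts K) c i = P (Suc i)" if "i < p" for i
  proof (intro equalityI subsetI)
    fix v assume "v \<in> cls (verts K) c i"
    then show "v \<in> P (Suc i)" using c[of v] by (auto simp: cls_def)
  next
    fix v assume v: "v \<in> P (Suc i)"
    then have "v \<in> verts K" using that P(2) by force
    then show "v \<in> cls (verts K) c i" using uniq[OF v that] by (simp add: cls_def)
  qed
  have "edges K = trans (verts K) c k"
  proof -
    have "(\<forall>i\<in>{1..p}. card (e \<inter> P i) \<le> 1) \<longleftrightarrow> inj_on c e" if e: "e \<subseteq> verts K" for e
    proof
      have fe: "finite e" using e fin(1) finite_subset by blast
      assume L: "\<forall>i\<in>{1..p}. card (e \<inter> P i) \<le> 1"
      show "inj_on c e"
      proof (rule inj_onI)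
        fix v w assume vw: "v \<in> e" "w \<in> e" "c v = c w"
        have "c v < p" "v \<in> P (Suc (c v))" "w \<in> P (Suc (c v))" using c[of v] c[of w] vw e by auto
        then have "card (e \<inter> P (Suc (c v))) \<le> 1" "{v, w} \<subseteq> e \<inter> P (Suc (c v))" using L vw by auto
        then show "v = w" using fe by (metis card_le_Suc0_iff_eq finite_Int insert_subset One_nat_def)
      qed
    next
      have fe: "finite e" using e fin(1) finite_subset by blast
      assume R: "inj_on c e"
      show "\<forall>i\<in>{1..p}. card (e \<inter> P i) \<le> 1"
      proof
        fix i assume i: "i \<in> {1..p}"
        have "v = w" if "v \<in> e \<inter> P i" "w \<in> e \<inter> P i" for v w
        proof -
          have "c v = i - 1" "c w = i - 1" using uniq[of v "i - 1"] uniq[of w "i - 1"] that i by auto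
          then show ?thesis using inj_onD[OF R, of v w] that by simp
        qed
        then show "card (e \<inter> P i) \<le> 1" using fe card_le_Suc0_iff_eq[of "e \<inter> P i"] by auto
      qed
    qed
    then show ?thesis unfolding P(4) trans_def by auto
  qed
  moreover have "balanced p (\<lambda>i. card (cls (verts K) c i))"
    unfolding balanced_def
  proof (intro allI impI)
    fix i j assume ij: "i < p" "j < p"
    have "int (card (P (Suc i))) \<in> {\<lfloor>real n / real p\<rfloor>, \<lceil>real n / real p\<rceil>}"
      "int (card (P (Suc j))) \<in> {\<lfloor>real n / real p\<rfloor>, \<lceil>real n / real p\<rceil>}" using P(3) ij by auto
    moreover have "\<lceil>real n / real p\<rceil> \<le> \<lfloor>real n / real p\<rfloor> + 1" "\<lfloor>real n / real p\<rfloor> \<le> \<lceil>real n / real p\<rceil>" by linarith+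
    ultimately have "int (card (P (Suc i))) \<le> int (card (P (Suc j))) + 1"
      by (simp only: insert_iff empty_iff simp_thms) (elim disjE; linarith)
    then show "card (cls (verts K) c i) \<le> card (cls (verts K) c j) + 1" using cls ij by simp
  qed
  moreover have "c ` verts K \<subseteq> {..<p}" using c by auto
  ultimately show ?thesis using fin by (intro that)
qed

section \<open>Deleting vertices of small degree\<close>

text \<open>A deletion raises the guaranteed surplus \<open>s\<close> by one and lowers
  \<open>card V\<close> by one, so \<open>s + card V\<close> stays constant. Its assumed size
  excludes descending to \<open>m1\<close> vertices, where the surplus would exceed
  \<open>m1 ^ k\<close> and hence the number of all \<open>k\<close>-sets.\<close>

lemma descend:
  fixes f :: "nat \<Rightarrow> real" and d :: real
  assumes growth: "\<And>n. m1 < n \<Longrightarrow> f (n - 1) + d * real n ^ (k - 1) + 1 \<le> f n" and f0: "\<And>n. 0 \<le> f n"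
    and "kg k V E" "f (card V) + real s \<le> card E" "m1 \<le> card V" "m1 + m1 ^ k < s + card V"
  shows "\<exists>U\<subseteq>V. m1 \<le> card U \<and> f (card U) + (real (s + card V) - card U) \<le> card {e\<in>E. e \<subseteq> U} \<and>
    (\<forall>v\<in>U. d * real (card U) ^ (k - 1) \<le> card (link {e\<in>E. e \<subseteq> U} v))"
proof -
  have full: False if kg: "kg k V E" and le: "f (card V) + real s \<le> card E" and m: "m1 = card V" "m1 + m1 ^ k < s + card V"
    for V E s
  proof -
    have fV: "finite V" using kg_finite_verts[OF kg] .
    have "E \<subseteq> ksets V k" using kg by (auto simp: kg_def ksets_def)
    then have "card E \<le> card (ksets V k)" using kg_finite[OF kg_ksets[OF fV]] by (rule card_mono[rotated])
    then have "card E \<le> m1 ^ k" using card_ksets_le[OF fV, of k] m by simp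
    then have "real (card E) < real s" using m by simp
    then show False using le f0[of "card V"] by linarith
  qed
  show ?thesis
    using assms(3-)
  proof (induction "card V" arbitrary: V E s)
    case 0
    then have "m1 = card V" by simp
    then show ?case using full[OF 0(2,3)] 0 by simp
  next
    case (Suc N)
    have fV: "finite V" using kg_finite_verts[OF Suc.prems(1)] .
    have all: "{e\<in>E. e \<subseteq> V} = E" using kg_edge_subset[OF Suc.prems(1)] by blast
    show ?case
    proof (cases "\<forall>v\<in>V. d * real (card V) ^ (k - 1) \<le> card (link E v)")
      case True
      then show ?thesis using Suc.prems all by (intro exI[of _ V]) auto
    next
      case False
      then obtain v where v: "v \<in> V" "card (link E v) < d * real (card V) ^ (k - 1)" by (auto simp: not_le)
      define E' where "E' = {e\<in>E. e \<subseteq> V - {v}}"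
      have kgE': "kg k (V - {v}) E'" unfolding E'_def by (rule kg_restrict[OF Suc.prems(1)]) blast
      have cV: "card (V - {v}) = N" using Suc.hyps(2) v(1) fV by (simp add: card_Diff_singleton)
      have fE: "finite E" using kg_finite[OF Suc.prems(1)] .
      have "m1 < card V"
      proof (rule ccontr)
        assume "\<not> m1 < card V"
        then have m: "card V = m1" using Suc.prems(3) by simp
        show False using full[OF Suc.prems(1,2) m[symmetric]] Suc.prems(4) by simp
      qed
      moreover have "card V - 1 = N" using Suc.hyps(2) by simp
      ultimately have g: "f N + d * real (card V) ^ (k - 1) + 1 \<le> f (card V)" using growth[of "card V"] by simp
      have "E = E' \<union> {e\<in>E. v \<in> e}" using kg_edge_subset[OF Suc.prems(1)] by (auto simp: E'_def)
      then have "card E \<le> card E' + card (link E v)" unfolding card_link by (metis card_Un_le)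
      then have "f (card (V - {v})) + real (Suc s) \<le> card E'"
        using Suc.prems(2) g v(2) unfolding cV by simp
      moreover have "m1 \<le> card (V - {v})" "m1 + m1 ^ k < Suc s + card (V - {v})"
        using \<open>m1 < card V\<close> Suc.prems(4) Suc.hyps(2) unfolding cV by simp_all
      ultimately obtain U where U: "U \<subseteq> V - {v}" "m1 \<le> card U"
        "f (card U) + (real (Suc s + card (V - {v})) - card U) \<le> card {e\<in>E'. e \<subseteq> U}"
        "\<forall>w\<in>U. d * real (card U) ^ (k - 1) \<le> card (link {e\<in>E'. e \<subseteq> U} w)"
        using Suc.hyps(1)[OF cV[symmetric] kgE'] by blast
      have "{e\<in>E'. e \<subseteq> U} = {e\<in>E. e \<subseteq> U}" using U(1) by (auto simp: E'_def)
      moreover have "Suc s + card (V - {v}) = s + card V" using cV Suc.hyps(2) by simp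
      ultimately show ?thesis using U by (intro exI[of _ U]) auto
    qed
  qed
qed

section \<open>Copies of extensions\<close>

lemma contains_copyI:
  assumes "inj_on f (verts F)" "f ` verts F \<subseteq> verts G" "\<And>e. e \<in> edges F \<Longrightarrow> e \<subseteq> verts F \<and> f ` e \<in> edges G"
  shows "contains_copy G F"
proof -
  define H where "H = \<lparr>verts = f ` verts F, edges = (\<lambda>e. f ` e) ` edges F\<rparr>"
  have 1: "(\<lambda>e. f ` e) ` edges F \<subseteq> edges G" using assms(3) by auto
  have "f ` e \<subseteq> f ` verts F" if "e \<in> edges F" for e using assms(3)[OF that] by (intro image_mono) simp
  then have 2: "\<forall>e\<in>(\<lambda>e. f ` e) ` edges F. e \<subseteq> f ` verts F" by simp
  have "subgraph H G"
    by (simp only: subgraph_def H_def hypergraph.simps) (intro conjI assms(2) 1 2)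
  moreover have "isomorphic F H" unfolding isomorphic_def H_def using assms(1) by (auto simp: bij_betw_def)
  ultimately show ?thesis unfolding contains_copy_def by blast
qed

lemma contains_copyE:
  fixes G :: "'a hypergraph"
  assumes "contains_copy G F"
  obtains f where "inj_on f (verts F)" "f ` verts F \<subseteq> verts G" "\<forall>e\<in>edges F. f ` e \<in> edges G"
proof -
  obtain H :: "'a hypergraph" and f where H: "verts H \<subseteq> verts G" "edges H \<subseteq> edges G" and f: "bij_betw f (verts F) (verts H)"
    "edges H = (\<lambda>e. f ` e) ` edges F"
    using assms unfolding contains_copy_def subgraph_def isomorphic_def by (elim exE conjE) (rule that; assumption)
  show ?thesis by (rule that[of f]) (use H f in \<open>auto simp: bij_betw_def\<close>)
qed

text \<open>In an extension every two old vertices are covered, so a copy in a properly coloured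
  hypergraph needs a separate colour for each old vertex.\<close>

lemma Ext_free_of_coloured:
  assumes c: "c ` verts G \<subseteq> {..<p}" and E: "\<forall>e\<in>edges G. inj_on c e" and H: "p < card (verts H)"
  shows "free_of (Ext r H) G"
  unfolding free_of_def
proof
  assume "contains_copy G (Ext r H)"
  then obtain f where f: "inj_on f (verts (Ext r H))" "f ` verts (Ext r H) \<subseteq> verts G"
    "\<forall>e\<in>edges (Ext r H). f ` e \<in> edges G" by (rule contains_copyE)
  have V: "Inl a \<in> verts (Ext r H)" if "a \<in> verts H" for a using that by (simp add: Ext_def)
  have cov: "\<exists>e\<in>edges (Ext r H). Inl a \<in> e \<and> Inl b \<in> e" if ab: "a \<in> verts H" "b \<in> verts H" "a \<noteq> b" for a b
  proof (cases "\<exists>e\<in>edges H. {a, b} \<subseteq> e")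
    case True
    then obtain e where "e \<in> edges H" "a \<in> e" "b \<in> e" by auto
    then show ?thesis by (intro bexI[of _ "Inl ` e"]) (auto simp: Ext_def)
  next
    case False
    then have "{a, b} \<in> uncovered_pairs H" using ab by (auto simp: uncovered_pairs_def)
    then have "Inl ` {a, b} \<union> Inr ` ({{a, b}} \<times> {..<r - 2}) \<in> edges (Ext r H)"
      using imageI[of "{a, b}" "uncovered_pairs H" "\<lambda>P. Inl ` P \<union> Inr ` ({P} \<times> {..<r - 2})"]
      by (simp only: Ext_def hypergraph.simps Un_iff simp_thms)
    then show ?thesis by (rule bexI[rotated]) simp
  qed
  have "inj_on (\<lambda>a. c (f (Inl a))) (verts H)"
  proof (rule inj_onI, rule ccontr)
    fix a b assume ab: "a \<in> verts H" "b \<in> verts H" and eq: "c (f (Inl a)) = c (f (Inl b))" and ne: "a \<noteq> b"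
    obtain e where e: "e \<in> edges (Ext r H)" "Inl a \<in> e" "Inl b \<in> e" using cov[OF ab ne] by blast
    have "f (Inl a) = f (Inl b)"
      using E bspec[OF f(3) e(1)] e(2,3) eq by (meson image_eqI inj_onD)
    then show False using inj_onD[OF f(1)] V ab ne by blast
  qed
  moreover have "c (f (Inl a)) < p" if "a \<in> verts H" for a
    using subsetD[OF f(2) imageI[OF V[OF that]]] c by auto
  ultimately have "card (verts H) \<le> card {..<p}"
    by (intro card_inj_on_le) auto
  then show False using H by simp
qed

text \<open>Removing all edges over a non-robust pair uncovers that pair for good. So there is at
  most one removal per covered pair, and each costs few edges by
  \<open>nonrobust_codegree\<close>.\<close>

lemma robust_cleaning:
  assumes k: "2 \<le> k" and "kg k V E"
  shows "\<exists>E'\<subseteq>E. (\<forall>u v. u \<noteq> v \<longrightarrow> cov E' u v \<longrightarrow> robust N E' u v) \<and>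
    card E * card V \<le> card E' * card V + card {(u, v). u \<in> V \<and> v \<in> V \<and> cov E u v} * (N * card V ^ (k - 2))"
  using assms(2)
proof (induction "card {(u, v). u \<in> V \<and> v \<in> V \<and> cov E u v}" arbitrary: E rule: less_induct)
  case less
  have fV: "finite V" using kg_finite_verts[OF less.prems] .
  show ?case
  proof (cases "\<forall>u v. u \<noteq> v \<longrightarrow> cov E u v \<longrightarrow> robust N E u v")
    case True
    then show ?thesis by (intro exI[of _ E]) simp
  next
    case False
    then obtain u v where uv: "u \<noteq> v" "cov E u v" "\<not> robust N E u v" by blast
    define F where "F = {e\<in>E. u \<in> e \<and> v \<in> e}"
    define cp where "cp D = {(u, v). u \<in> V \<and> v \<in> V \<and> cov D u v}" for D
    have fcp: "finite (cp D)" for D by (rule finite_subset[of _ "V \<times> V"]) (use fV in \<open>auto simp: cp_def\<close>)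
    have uvV: "u \<in> V" "v \<in> V" using uv(2) kg_edge_subset[OF less.prems] by (auto simp: cov_def)
    have "(u, v) \<in> cp E" "(u, v) \<notin> cp (E - F)" using uv(2) uvV by (auto simp: cp_def cov_def F_def)
    moreover have "cp (E - F) \<subseteq> cp E" by (auto simp: cp_def cov_def)
    ultimately have "cp (E - F) \<subset> cp E" by blast
    then have lt: "card (cp (E - F)) < card (cp E)" by (rule psubset_card_mono[OF fcp])
    have kg': "kg k V (E - F)" by (rule kg_subset[OF less.prems]) blast
    have "\<exists>E'\<subseteq>E - F. (\<forall>u v. u \<noteq> v \<longrightarrow> cov E' u v \<longrightarrow> robust N E' u v) \<and>
      card (E - F) * card V \<le> card E' * card V + card (cp (E - F)) * (N * card V ^ (k - 2))"
      unfolding cp_def by (rule less.hyps[OF lt[unfolded cp_def] kg'])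
    then obtain E' where E': "E' \<subseteq> E - F" "\<forall>u v. u \<noteq> v \<longrightarrow> cov E' u v \<longrightarrow> robust N E' u v"
      "card (E - F) * card V \<le> card E' * card V + card (cp (E - F)) * (N * card V ^ (k - 2))"
      by (elim exE conjE) (rule that)
    have fE: "finite E" using kg_finite[OF less.prems] .
    have "card F * card V \<le> N * card V ^ (k - 2)"
      unfolding F_def by (rule nonrobust_codegree[OF less.prems k uv(1,3)])
    moreover have "card E = card (E - F) + card F"
      using fE card_Diff_subset[of F E] card_mono[of E F] by (auto simp: F_def)
    ultimately have "card E * card V \<le> card E' * card V + Suc (card (cp (E - F))) * (N * card V ^ (k - 2))"
      using E'(3) by (simp add: add_mult_distrib)
    also have "\<dots> \<le> card E' * card V + card (cp E) * (N * card V ^ (k - 2))"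
      using lt by (intro add_left_mono mult_right_mono) auto
    finally have "card E * card V \<le> card E' * card V + card (cp E) * (N * card V ^ (k - 2))" .
    moreover have "E' \<subseteq> E" using E'(1) by blast
    ultimately show ?thesis using E'(2) unfolding cp_def by (intro exI[of _ E'] conjI)
  qed
qed

context estree
begin

section \<open>From the extension to coloured extremal hypergraphs\<close>

lemma uncovered_pairs_expansion: "uncovered_pairs (expansion k T) = (\<lambda>P. Inl ` P) ` NP"
proof (intro equalityI subsetI)
  fix Q assume "Q \<in> uncovered_pairs (expansion k T)"
  then have Q: "Q \<subseteq> Inl ` VT \<union> Inr ` {..<k - 2}" "card Q = 2"
    and unc: "\<And>e. e \<in> ET \<Longrightarrow> \<not> Q \<subseteq> Inl ` e \<union> Inr ` {..<k - 2}"
    by (auto simp: uncovered_pairs_def expansion_def)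
  have old: "w \<in> Inl ` VT" if zw: "Q = {z, w}" for z w
  proof (rule ccontr)
    assume "w \<notin> Inl ` VT"
    then have w: "w \<in> Inr ` {..<k - 2}" using Q(1) zw by auto
    have "\<exists>e\<in>ET. z \<in> Inl ` e \<union> Inr ` {..<k - 2}"
    proof (cases "z \<in> Inl ` VT")
      case True
      then obtain x where x: "x \<in> VT" "z = Inl x" by blast
      obtain y where "{x, y} \<in> ET" using VT_incident[OF x(1)] by blast
      then show ?thesis using x by (intro bexI[of _ "{x, y}"]) simp_all
    next
      case False
      then show ?thesis using ET_ex Q(1) zw by auto
    qed
    then show False using unc w zw by auto
  qed
  obtain a b where ab: "Q = {a, b}" "a \<noteq> b" using Q(2) by (meson card_2_iff)
  obtain x y where xy: "a = Inl x" "b = Inl y" "x \<in> VT" "y \<in> VT"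
    using old[of a b] old[of b a] ab(1) by (auto simp: insert_commute)
  have "{x, y} \<notin> ET" using unc[of "{x, y}"] ab(1) xy(1,2) by auto
  then have "{x, y} \<in> NP" using xy ab(2) unfolding NP_def by blast
  then show "Q \<in> (\<lambda>P. Inl ` P) ` NP" using ab(1) xy(1,2) by (intro image_eqI[of _ _ "{x, y}"]) simp_all
next
  fix Q :: "(nat + nat) set" assume "Q \<in> (\<lambda>P. Inl ` P) ` NP"
  then obtain x y where Q: "Q = {Inl x, Inl y}" and xy: "x \<in> VT" "y \<in> VT" "x \<noteq> y" "{x, y} \<notin> ET"
    by (auto simp: NP_def)
  have "\<not> {x, y} \<subseteq> e" if "e \<in> ET" for e
  proof
    assume sub: "{x, y} \<subseteq> e"
    have "finite e" using finite_subset[OF ET_edge(1)[OF that] finite_VT] .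
    then have "{x, y} = e" using sub ET_edge(2)[OF that] xy(3) by (intro card_subset_eq) auto
    then show False using xy(4) that by simp
  qed
  then have "\<not> (\<exists>e\<in>edges (expansion k T). Q \<subseteq> e)" by (auto simp: Q expansion_def)
  then show "Q \<in> uncovered_pairs (expansion k T)"
    using xy by (simp add: uncovered_pairs_def Q) (simp add: expansion_def)
qed

text \<open>Assembles a copy of the extension from the data excluded by \<open>xfree\<close>: tree
  vertices are placed by \<open>\<phi>\<close>, the new vertices of the expansion onto
  \<open>A\<close>, those of an added edge onto the rest of \<open>e P\<close>. The intersection
  clauses of \<open>xfree\<close> make the three pieces jointly injective.\<close>

lemma xfree_of_free:
  assumes k: "2 \<le> k" and kg: "kg k (verts G) (edges G)" and free: "free_of (Ext k (expansion k T)) G"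
  shows "xfree k (edges G)"
proof (rule ccontr)
  define E where "E = edges G"
  assume "\<not> xfree k (edges G)"
  then obtain \<phi> A e where X: "emb k E \<phi> A \<and>
     (\<forall>P\<in>NP. e P \<in> E \<and> \<phi> ` P \<subseteq> e P \<and> e P \<inter> (\<phi> ` VT \<union> A) = \<phi> ` P) \<and>
     (\<forall>P\<in>NP. \<forall>Q\<in>NP. P \<noteq> Q \<longrightarrow> (e P - \<phi> ` P) \<inter> (e Q - \<phi> ` Q) = {})"
    unfolding xfree_def not_not E_def by (elim exE)
  note emb = conjunct1[OF X]
  have e: "e P \<in> E" "\<phi> ` P \<subseteq> e P" "e P \<inter> (\<phi> ` VT \<union> A) = \<phi> ` P" if "P \<in> NP" for P
    using bspec[OF conjunct1[OF conjunct2[OF X]] that] by simp_all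
  have dj: "(e P - \<phi> ` P) \<inter> (e Q - \<phi> ` Q) = {}" if "P \<in> NP" "Q \<in> NP" "P \<noteq> Q" for P Q
    using bspec[OF bspec[OF conjunct2[OF conjunct2[OF X]] that(1)] that(2)] that(3) by simp
  have inj: "inj_on \<phi> VT" and A: "finite A" "card A = k - 2" "A \<inter> \<phi> ` VT = {}"
    using emb by (simp_all add: emb_def)
  obtain h where h: "bij_betw h {..<k - 2} A"
    using ex_bij_betw_nat_finite[OF A(1)] A(2) by (auto simp: atLeast0LessThan)
  have NPs: "P \<subseteq> VT" "card P = 2" if "P \<in> NP" for P using that by (auto simp: NP_def)
  have "\<exists>g. bij_betw g {..<k - 2} (e P - \<phi> ` P)" if P: "P \<in> NP" for P
  proof (rule finite_same_card_bij)
    have fe: "finite (e P)" "card (e P) = k"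
      using kg_finite_edge[OF kg] kg_edge_card[OF kg] e(1)[OF P] by (auto simp: E_def)
    have "card (\<phi> ` P) = 2" using card_image[OF inj_on_subset[OF inj NPs(1)[OF P]]] NPs(2)[OF P] by simp
    then show "card {..<k - 2} = card (e P - \<phi> ` P)"
      using card_Diff_subset[OF _ e(2)[OF P]] fe finite_subset[OF e(2)[OF P] fe(1)] by simp
    show "finite (e P - \<phi> ` P)" using fe by simp
  qed simp
  then obtain g where g: "\<And>P. P \<in> NP \<Longrightarrow> bij_betw (g P) {..<k - 2} (e P - \<phi> ` P)" by metis
  \<comment> \<open>A new vertex of the extension is labelled by its pair as a set of
    \<open>Inl\<close> elements; the preimage under \<open>Inl\<close> recovers the pair of tree
    vertices.\<close>
  define f :: "(nat + nat) + (nat + nat) set \<times> nat \<Rightarrow> nat" where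
    "f z = (case z of Inl (Inl x) \<Rightarrow> \<phi> x | Inl (Inr i) \<Rightarrow> h i | Inr (Q, i) \<Rightarrow> g (Inl -` Q) i)" for z
  have f: "f (Inl (Inl x)) = \<phi> x" "f (Inl (Inr i)) = h i" "f (Inr (Inl ` P, i)) = g P i" for x i P
    by (simp_all add: f_def inj_vimage_image_eq)
  define X1 :: "((nat + nat) + (nat + nat) set \<times> nat) set" where "X1 = (\<lambda>x. Inl (Inl x)) ` VT"
  define X2 :: "((nat + nat) + (nat + nat) set \<times> nat) set" where "X2 = (\<lambda>i. Inl (Inr i)) ` {..<k - 2}"
  define X3 :: "((nat + nat) + (nat + nat) set \<times> nat) set" where
    "X3 = (\<lambda>(P, i). Inr (Inl ` P, i)) ` (NP \<times> {..<k - 2})"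
  have V: "verts (Ext k (expansion k T)) = X1 \<union> X2 \<union> X3"
    unfolding Ext_def uncovered_pairs_expansion by (auto simp: expansion_def X1_def X2_def X3_def)
  have im: "f ` X1 = \<phi> ` VT" "f ` X2 = A"
    using h by (simp_all add: X1_def X2_def image_image f bij_betw_def)
  have gi: "g P i \<in> e P - \<phi> ` P" if "P \<in> NP" "i < k - 2" for P i
    using bij_betwE[OF g[OF that(1)]] that(2) by simp
  have sub: "f ` X3 \<subseteq> \<Union> E" "f ` X3 \<inter> (\<phi> ` VT \<union> A) = {}"
  proof -
    have "f z \<in> \<Union> E \<and> f z \<notin> \<phi> ` VT \<union> A" if zX: "z \<in> X3" for z
    proof -
      obtain P i where z: "z = Inr (Inl ` P, i)" "P \<in> NP" "i < k - 2" using zX by (auto simp: X3_def)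
      then have "f z \<in> e P - \<phi> ` P" using gi by (simp add: f)
      then show ?thesis using e(1,3)[OF z(2)] by blast
    qed
    then show "f ` X3 \<subseteq> \<Union> E" "f ` X3 \<inter> (\<phi> ` VT \<union> A) = {}" by auto
  qed
  have i1: "inj_on f X1"
    unfolding X1_def by (rule inj_onI) (auto simp: f dest: inj_onD[OF inj])
  have i2: "inj_on f X2"
    unfolding X2_def by (rule inj_onI) (auto simp: f dest: inj_onD[OF bij_betw_imp_inj_on[OF h]])
  have i3: "inj_on f X3"
  proof (rule inj_onI)
    fix z z' assume zz: "z \<in> X3" "z' \<in> X3" and eq: "f z = f z'"
    obtain P i where z: "z = Inr (Inl ` P, i)" "P \<in> NP" "i < k - 2" using zz(1) by (auto simp: X3_def)
    obtain Q j where z': "z' = Inr (Inl ` Q, j)" "Q \<in> NP" "j < k - 2" using zz(2) by (auto simp: X3_def)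
    have eq': "g P i = g Q j" using eq z z' by (simp add: f)
    have "P = Q"
    proof (rule ccontr)
      assume "P \<noteq> Q"
      then show False using dj[OF z(2) z'(2)] gi[OF z(2,3)] gi[OF z'(2,3)] eq' by auto
    qed
    moreover have "i = j"
      using inj_onD[OF bij_betw_imp_inj_on[OF g[OF z(2)]]] eq' z z' calculation by simp
    ultimately show "z = z'" using z z' by simp
  qed
  have disj: "inj_on f (X \<union> Y)" if "inj_on f X" "inj_on f Y" "f ` X \<inter> f ` Y = {}" for X Y
    unfolding inj_on_Un using that by auto
  have "inj_on f (X1 \<union> X2 \<union> X3)"
    by (intro disj i1 i2 i3) (use im sub(2) A(3) in \<open>auto simp: image_Un\<close>)
  moreover have core: "\<phi> ` VT \<union> A \<subseteq> \<Union> E"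
  proof
    fix a assume "a \<in> \<phi> ` VT \<union> A"
    then obtain d where "d \<in> ET" "a \<in> \<phi> ` d \<union> A" using emb_core[OF emb] by blast
    then show "a \<in> \<Union> E" using emb_edge[OF emb] by blast
  qed
  moreover have "\<Union> E \<subseteq> verts G" using kg_edge_subset[OF kg] by (auto simp: E_def)
  moreover have "f ` (X1 \<union> X2 \<union> X3) \<subseteq> \<Union> E" using im sub(1) core by (simp add: image_Un)
  moreover have "d \<subseteq> verts (Ext k (expansion k T)) \<and> f ` d \<in> edges G" if "d \<in> edges (Ext k (expansion k T))" for d
  proof -
    from that consider e' where "e' \<in> ET" "d = Inl ` (Inl ` e' \<union> Inr ` {..<k - 2})"
      | P where "P \<in> NP" "d = Inl ` Inl ` P \<union> Inr ` ({Inl ` P} \<times> {..<k - 2})"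
      unfolding Ext_def uncovered_pairs_expansion by (auto simp: expansion_def)
    then show ?thesis
    proof cases
      case 1
      have "f ` d = \<phi> ` e' \<union> h ` {..<k - 2}" unfolding 1(2) image_Un image_image f ..
      also have "\<dots> = \<phi> ` e' \<union> A" using h by (simp add: bij_betw_def)
      also have "\<dots> \<in> edges G" using emb_edge[OF emb 1(1)] by (simp add: E_def)
      finally show ?thesis using 1 ET_edge(1)[OF 1(1)] by (auto simp: V X1_def X2_def)
    next
      case 2
      have "f ` d = \<phi> ` P \<union> g P ` {..<k - 2}"
        unfolding 2(2) image_Un image_image f by (auto simp: f image_iff)
      also have "\<dots> = e P" using g[OF 2(1)] e(2)[OF 2(1)] by (auto simp: bij_betw_def)
      also have "\<dots> \<in> edges G" using e(1)[OF 2(1)] by (simp add: E_def)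
      finally show ?thesis using 2 NPs(1)[OF 2(1)] by (auto simp: V X1_def X3_def)
    qed
  qed
  ultimately have "contains_copy G (Ext k (expansion k T))"
    by (intro contains_copyI[of f]) (auto simp: V)
  then show False using free by (simp add: free_of_def)
qed

lemma xfree_subset: "xfree k E \<Longrightarrow> E' \<subseteq> E \<Longrightarrow> xfree k E'"
proof (rule ccontr)
  assume xf: "xfree k E" and sub: "E' \<subseteq> E" and "\<not> xfree k E'"
  then obtain \<phi> A e where X: "emb k E' \<phi> A \<and>
     (\<forall>P\<in>NP. e P \<in> E' \<and> \<phi> ` P \<subseteq> e P \<and> e P \<inter> (\<phi> ` VT \<union> A) = \<phi> ` P) \<and>
     (\<forall>P\<in>NP. \<forall>Q\<in>NP. P \<noteq> Q \<longrightarrow> (e P - \<phi> ` P) \<inter> (e Q - \<phi> ` Q) = {})"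
    unfolding xfree_def not_not by (elim exE)
  have 1: "emb k E \<phi> A" by (rule emb_mono[OF conjunct1[OF X] sub])
  have 2: "\<forall>P\<in>NP. e P \<in> E \<and> \<phi> ` P \<subseteq> e P \<and> e P \<inter> (\<phi> ` VT \<union> A) = \<phi> ` P"
    using conjunct1[OF conjunct2[OF X]] sub by (simp add: subset_iff)
  show False
    using xf unfolding xfree_def
    by (rule notE) (intro exI conjI, rule 1, rule 2, rule conjunct2[OF conjunct2[OF X]])
qed

text \<open>When all covered pairs are robust, a copy forbidden by \<open>kfree\<close> extends
  greedily. \<open>core_contra\<close> asks for one pair with a prepared edge; the leaf and a
  non-neighbour get one that avoids the rest of the core.\<close>

lemma robust_kfree:
  assumes k: "2 \<le> k" and kg: "kg k V E" and xf: "xfree k E"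
    and rob: "\<And>u v. u \<noteq> v \<Longrightarrow> cov E u v \<Longrightarrow> robust (NN k) E u v"
  shows "kfree k E"
proof (rule ccontr)
  assume "\<not> kfree k E"
  then obtain \<phi> A where emb: "emb k E \<phi> A" and cv: "\<forall>x\<in>VT. \<forall>y\<in>VT. x \<noteq> y \<longrightarrow> cov E (\<phi> x) (\<phi> y)"
    unfolding kfree_def by metis
  have inj: "inj_on \<phi> VT" and A: "finite A" "card A = k - 2" using emb by (simp_all add: emb_def)
  have rob': "robust (NN k) E (\<phi> x) (\<phi> y)" if "x \<in> VT" "y \<in> VT" "x \<noteq> y" for x y
    by (rule rob) (use that cv inj in \<open>auto dest: inj_onD\<close>)
  obtain l y where l: "l \<in> VT" "\<And>e. e \<in> ET \<Longrightarrow> l \<in> e \<Longrightarrow> e = {l, y}" using leaf_exists by metis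
  have "\<not> VT \<subseteq> {l, y}"
  proof
    assume "VT \<subseteq> {l, y}"
    then have "t \<le> card {l, y}" unfolding t_def by (rule card_mono[rotated]) simp
    also have "\<dots> \<le> 2" by (simp add: card_insert_if)
    finally show False using t_ge by simp
  qed
  then obtain z where z: "z \<in> VT" "z \<noteq> l" "z \<noteq> y" by blast
  have lz: "{l, z} \<notin> ET" using l(2)[of "{l, z}"] z by (auto simp: doubleton_eq_iff)
  define S where "S = \<phi> ` VT \<union> A"
  have fS: "finite S" using finite_VT A(1) by (simp add: S_def)
  have "card S \<le> card (\<phi> ` VT) + card A" unfolding S_def by (rule card_Un_le)
  also have "\<dots> \<le> t + k" using A(2) card_image_le[OF finite_VT, of \<phi>] by (simp add: t_def)
  also have "\<dots> \<le> NN k" by (simp add: NN_def)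
  finally have cS: "card S \<le> NN k" .
  define Z where "Z = S - {\<phi> l, \<phi> z}"
  have "finite Z" "card Z \<le> NN k" "\<phi> l \<notin> Z" "\<phi> z \<notin> Z"
    using fS cS card_mono[OF fS, of Z] by (auto simp: Z_def)
  then have "\<exists>e\<in>E. \<phi> l \<in> e \<and> \<phi> z \<in> e \<and> e \<inter> Z = {}"
    using rob'[OF l(1) z(1) z(2)[symmetric]] unfolding robust_def by simp
  then obtain e0 where e0: "e0 \<in> E" "\<phi> l \<in> e0" "\<phi> z \<in> e0" "e0 \<inter> Z = {}"
    by (elim bexE conjE) (rule that)
  have e0S: "e0 \<inter> S = {\<phi> l, \<phi> z}" using e0 l(1) z(1) by (auto simp: Z_def S_def)
  show False
    by (rule core_contra[OF kg xf emb l(1) z(1) z(2)[symmetric] lz e0(1) e0S[unfolded S_def]], rule rob')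
qed

text \<open>Cleaning only serves to find the approximate colouring: stability colours the cleaned
  \<open>E'\<close>, and the removed edges count as errors. \<open>exact_colouring\<close> is then
  applied to the uncleaned \<open>F\<close>, whose minimum degree is intact and which is still
  \<open>xfree\<close>.\<close>

theorem extremal_coloured:
  assumes k: "2 \<le> k" and t: "4 * k\<^sup>2 + 4 \<le> t"
  obtains n0 where "\<forall>V E. kg k V E \<longrightarrow> xfree k E \<longrightarrow> n0 \<le> card V \<longrightarrow> turan (pp k) k (card V) \<le> card E \<longrightarrow>
    (\<exists>c. c ` V \<subseteq> {..<pp k} \<and> (\<forall>e\<in>E. inj_on c e))"
proof -
  obtain \<epsilon> :: real and n1 :: nat where e0: "0 < \<epsilon>" and colour: "\<forall>V E c. kg k V E \<longrightarrow> xfree k E \<longrightarrow> n1 \<le> card V \<longrightarrow>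
      (\<forall>v\<in>V. (k * lam k - \<epsilon>) * real (card V) ^ (k - 1) \<le> card (link E v)) \<longrightarrow>
      c ` V \<subseteq> {..<pp k} \<longrightarrow> card {e\<in>E. \<not> inj_on c e} \<le> \<epsilon> * real (card V) ^ k \<longrightarrow>
      (\<exists>c'. c' ` V \<subseteq> {..<pp k} \<and> (\<forall>e\<in>E. inj_on c' e))"
    by (rule exact_colouring[OF k])
  have e2: "0 < \<epsilon> / 2" using e0 by simp
  obtain \<epsilon>s :: real and n2 :: nat where es: "0 < \<epsilon>s" and st: "\<forall>V E. kg k V E \<longrightarrow> kfree k E \<longrightarrow> n2 \<le> card V \<longrightarrow>
      (lam k - \<epsilon>s) * real (card V) ^ k \<le> card E \<longrightarrow>
      (\<exists>U\<subseteq>V. card (V - U) \<le> \<epsilon> / 2 * card V \<and> (\<exists>c. c ` U \<subseteq> {..<pp k} \<and> (\<forall>e\<in>E. e \<subseteq> U \<longrightarrow> inj_on c e)))"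
    using mp[OF spec[OF stability[OF k t, unfolded stab_def], of "\<epsilon> / 2"] e2] by (elim exE conjE) (rule that)
  obtain m2 where growth: "\<forall>n>m2. turan (pp k) k (n - 1) + (k * lam k - \<epsilon>) * real n ^ (k - 1) + 1 \<le> turan (pp k) k n"
    unfolding lam_def by (rule turan_growth[OF k pp_pos e0])
  have es2: "0 < \<epsilon>s / 2" using es by simp
  obtain m3 where asymp: "\<forall>n\<ge>m3. (lam k - \<epsilon>s / 2) * real n ^ k \<le> turan (pp k) k n"
    unfolding lam_def by (rule turan_asymp[OF k pp_pos es2])
  define N where "N = real (NN k)"
  have N0: "0 \<le> N" by (simp add: N_def)
  \<comment> \<open>From \<open>m4\<close> vertices on, the cleaning loss
    \<open>N * m ^ (k - 1)\<close> is at most half of either tolerance times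
    \<open>m ^ k\<close>.\<close>
  obtain m4 :: nat where "2 * N / \<epsilon> + 2 * N / \<epsilon>s \<le> m4" using real_arch_simple by blast
  moreover have "0 \<le> 2 * N / \<epsilon>" "0 \<le> 2 * N / \<epsilon>s" using e0 es N0 by simp_all
  ultimately have m4: "2 * N / \<epsilon> \<le> m4" "2 * N / \<epsilon>s \<le> m4" by linarith+
  define m1 where "m1 = n1 + n2 + m2 + m3 + m4 + 1"
  show ?thesis
  proof (rule that[of "m1 + m1 ^ k + 1"], intro allI impI)
    fix V E assume kg: "kg k V E" and xf: "xfree k E" and n: "m1 + m1 ^ k + 1 \<le> card V"
      and big: "turan (pp k) k (card V) \<le> card E"
    have fV: "finite V" using kg_finite_verts[OF kg] .
    have tpos: "0 \<le> turan (pp k) k n" for n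
      by (rule order_trans[OF _ turan_ge]) simp
    have "\<exists>U\<subseteq>V. m1 \<le> card U \<and> turan (pp k) k (card U) + (real (0 + card V) - card U) \<le> card {e\<in>E. e \<subseteq> U} \<and>
      (\<forall>v\<in>U. (k * lam k - \<epsilon>) * real (card U) ^ (k - 1) \<le> card (link {e\<in>E. e \<subseteq> U} v))"
      by (rule descend[OF growth[rule_format] tpos kg]) (use n big in \<open>auto simp: m1_def\<close>)
    then obtain U where U: "U \<subseteq> V" "m1 \<le> card U"
      "turan (pp k) k (card U) + (real (card V) - card U) \<le> card {e\<in>E. e \<subseteq> U}"
      "\<forall>v\<in>U. (k * lam k - \<epsilon>) * real (card U) ^ (k - 1) \<le> card (link {e\<in>E. e \<subseteq> U} v)"
      by auto
    define F where "F = {e\<in>E. e \<subseteq> U}"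
    define m where "m = real (card U)"
    have fU: "finite U" using U(1) fV finite_subset by blast
    have m: "real m1 \<le> m" "1 \<le> m" using U(2) by (simp_all add: m_def m1_def)
    have kgF: "kg k U F" unfolding F_def by (rule kg_restrict[OF kg U(1)])
    have xfF: "xfree k F" by (rule xfree_subset[OF xf]) (simp add: F_def)
    have fF: "finite F" using kg_finite[OF kgF] .
    have mk: "m ^ k = m * m ^ (k - 1)" using k by (simp add: power_eq_if)
    have small: "N * m ^ (k - 1) \<le> a / 2 * m ^ k" if a: "0 < a" "2 * N / a \<le> m4" for a
    proof -
      have "2 * N / a \<le> m" using a(2) m(1) by (simp add: m1_def)
      then have "N \<le> a / 2 * m" using a(1) by (simp add: divide_le_eq mult.commute)
      then have "N * m ^ (k - 1) \<le> a / 2 * m * m ^ (k - 1)" using m(2) by (intro mult_right_mono) auto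
      then show ?thesis by (simp add: mk mult.assoc)
    qed
    obtain E' where E': "E' \<subseteq> F" "\<forall>u v. u \<noteq> v \<longrightarrow> cov E' u v \<longrightarrow> robust (NN k) E' u v"
      "card F * card U \<le> card E' * card U + card {(u, v). u \<in> U \<and> v \<in> U \<and> cov F u v} * (NN k * card U ^ (k - 2))"
      using robust_cleaning[OF k kgF, of "NN k"] by blast
    have kgE': "kg k U E'" by (rule kg_subset[OF kgF E'(1)])
    have kfE': "kfree k E'"
      by (rule robust_kfree[OF k kgE' xfree_subset[OF xfF E'(1)]]) (use E'(2) in simp)
    have loss: "real (card F) \<le> card E' + N * m ^ (k - 1)"
    proof -
      have "card {(u, v). u \<in> U \<and> v \<in> U \<and> cov F u v} \<le> card (U \<times> U)"
        by (rule card_mono) (use fU in auto)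
      then have "card {(u, v). u \<in> U \<and> v \<in> U \<and> cov F u v} * (NN k * card U ^ (k - 2))
          \<le> card U * card U * (NN k * card U ^ (k - 2))"
        by (intro mult_right_mono) (simp_all add: card_cartesian_product)
      also have "\<dots> = (NN k * card U ^ (k - 1)) * card U"
      proof -
        obtain l where "k = Suc (Suc l)" using k by (metis Suc_le_D numeral_2_eq_2 Suc_le_mono)
        then show ?thesis by simp
      qed
      finally have "card F * card U \<le> card E' * card U + NN k * card U ^ (k - 1) * card U"
        by (rule order_trans[OF E'(3) add_left_mono])
      then have "card F * card U \<le> (card E' + NN k * card U ^ (k - 1)) * card U"
        by (simp only: add_mult_distrib)
      moreover have "0 < card U" using m(2) by (simp add: m_def)
      ultimately have "card F \<le> card E' + NN k * card U ^ (k - 1)" by simp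
      then have "real (card F) \<le> real (card E' + NN k * card U ^ (k - 1))" by (simp only: of_nat_le_iff)
      then show ?thesis by (simp add: N_def m_def)
    qed
    have VU: "real (card U) \<le> card V" using card_mono[OF fV U(1)] by simp
    have dense: "(lam k - \<epsilon>s) * m ^ k \<le> card E'"
    proof -
      have "(lam k - \<epsilon>s / 2) * m ^ k \<le> turan (pp k) k (card U)"
        unfolding m_def by (rule asymp[rule_format]) (use U(2) in \<open>simp add: m1_def\<close>)
      moreover have "N * m ^ (k - 1) \<le> \<epsilon>s / 2 * m ^ k" by (rule small[OF es m4(2)])
      moreover have "(lam k - \<epsilon>s / 2) * m ^ k - \<epsilon>s / 2 * m ^ k = (lam k - \<epsilon>s) * m ^ k"
        by (simp add: algebra_simps)
      ultimately show ?thesis using loss U(3) VU unfolding F_def by linarith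
    qed
    have n2: "n2 \<le> card U" using U(2) by (simp add: m1_def)
    obtain W c where W: "W \<subseteq> U" "card (U - W) \<le> \<epsilon> / 2 * card U" "c ` W \<subseteq> {..<pp k}"
      "\<forall>e\<in>E'. e \<subseteq> W \<longrightarrow> inj_on c e"
      using st[THEN spec, THEN spec, THEN mp, OF kgE', THEN mp, OF kfE', THEN mp, OF n2, THEN mp, OF dense[unfolded m_def]]
      by (elim exE conjE) (rule that)
    define c0 where "c0 v = (if v \<in> W then c v else 0)" for v
    have c0: "c0 ` U \<subseteq> {..<pp k}" using W(3) pp_pos by (auto simp: c0_def)
    define B where "B = {f. f \<subseteq> U \<and> card f = k \<and> f \<inter> (U - W) \<noteq> {}}"
    have "{e\<in>F. \<not> inj_on c0 e} \<subseteq> (F - E') \<union> B"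
    proof
      fix e assume "e \<in> {e\<in>F. \<not> inj_on c0 e}"
      then have e: "e \<in> F" "\<not> inj_on c0 e" by simp_all
      show "e \<in> (F - E') \<union> B"
      proof (rule ccontr)
        assume no: "e \<notin> (F - E') \<union> B"
        then have "e \<in> E'" "e \<subseteq> W"
          using e(1) kg_edge_subset[OF kgF e(1)] kg_edge_card[OF kgF e(1)] by (auto simp: B_def)
        then have "inj_on c e" using W(4) by simp
        then have "inj_on c0 e" using \<open>e \<subseteq> W\<close> by (auto simp: inj_on_def c0_def subset_iff)
        then show False using e(2) by simp
      qed
    qed
    then have "card {e\<in>F. \<not> inj_on c0 e} \<le> card ((F - E') \<union> B)"
      by (rule card_mono[rotated]) (use fF fU in \<open>auto simp: B_def\<close>)
    also have "\<dots> \<le> card (F - E') + card B" by (rule card_Un_le)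
    finally have "real (card {e\<in>F. \<not> inj_on c0 e}) \<le> real (card (F - E')) + real (card B)"
      by (simp only: of_nat_add[symmetric] of_nat_le_iff)
    moreover have "real (card (F - E')) \<le> \<epsilon> / 2 * m ^ k"
    proof -
      have "card F = card (F - E') + card E'"
        using card_Diff_subset[OF finite_subset[OF E'(1) fF] E'(1)] card_mono[OF fF E'(1)] by simp
      then show ?thesis using loss small[OF e0 m4(1)] by linarith
    qed
    moreover have "real (card B) \<le> \<epsilon> / 2 * m ^ k"
    proof -
      have "card B \<le> card (U - W) * card U ^ (k - 1)" unfolding B_def by (rule card_touching[OF fU]) blast
      then have "real (card B) \<le> real (card (U - W) * card U ^ (k - 1))" by (simp only: of_nat_le_iff)
      also have "\<dots> = real (card (U - W)) * m ^ (k - 1)" by (simp add: m_def)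
      also have "\<dots> \<le> \<epsilon> / 2 * m * m ^ (k - 1)" using W(2)[folded m_def] m(2) by (intro mult_right_mono) auto
      finally show ?thesis by (simp add: mk mult.assoc)
    qed
    ultimately have few: "card {e\<in>F. \<not> inj_on c0 e} \<le> \<epsilon> * real (card U) ^ k" by (simp add: m_def)
    have n1: "n1 \<le> card U" using U(2) by (simp add: m1_def)
    obtain c' where c': "c' ` U \<subseteq> {..<pp k}" "\<forall>e\<in>F. inj_on c' e"
      using colour[THEN spec, THEN spec, THEN spec, THEN mp, OF kgF, THEN mp, OF xfF, THEN mp, OF n1, THEN mp,
          OF U(4)[folded F_def], THEN mp, OF c0, THEN mp, OF few] by (elim exE conjE) (rule that)
    have "card F \<le> turan (pp k) k (card U)" by (rule coloured_card_le(1)[OF k pp_pos kgF c'])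
    then have "card V \<le> card U" using U(3) unfolding F_def by linarith
    then have "U = V" using U(1) fV by (intro card_seteq)
    moreover have "F = E" using \<open>U = V\<close> kg_edge_subset[OF kg] by (auto simp: F_def)
    ultimately show "\<exists>c. c ` V \<subseteq> {..<pp k} \<and> (\<forall>e\<in>E. inj_on c e)" using c' by blast
  qed
qed

section \<open>The balanced blowup as the unique extremal hypergraph\<close>

lemma r_graph_kg: "r_graph k G \<longleftrightarrow> kg k (verts G) (edges G)"
  by (simp add: r_graph_def kg_def)

lemma card_verts_expansion: "2 \<le> k \<Longrightarrow> card (verts (expansion k T)) = Suc (pp k)"
proof -
  assume k: "2 \<le> k"
  have "card (verts (expansion k T)) = card (Inl ` VT :: (nat + nat) set) + card (Inr ` {..<k - 2} :: (nat + nat) set)"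
    unfolding expansion_def by (simp, rule card_Un_disjoint) (use finite_VT in auto)
  then show ?thesis using k t_ge by (simp add: card_image t_def pp_def)
qed

theorem extremal_blowup:
  assumes k: "2 \<le> k" and t: "4 * k\<^sup>2 + 4 \<le> t"
  shows "\<exists>n0. \<forall>n\<ge>n0. \<forall>K :: nat hypergraph. balanced_blowup k (pp k) n K \<longrightarrow>
    extremal k (Ext k (expansion k T)) n K \<and>
    (\<forall>G :: nat hypergraph. extremal k (Ext k (expansion k T)) n G \<longrightarrow> isomorphic G K)"
proof -
  obtain n0 where n0: "\<forall>V E. kg k V E \<longrightarrow> xfree k E \<longrightarrow> n0 \<le> card V \<longrightarrow> turan (pp k) k (card V) \<le> card E \<longrightarrow>
    (\<exists>c. c ` V \<subseteq> {..<pp k} \<and> (\<forall>e\<in>E. inj_on c e))" by (rule extremal_coloured[OF k t])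
  have kp: "k \<le> pp k" using pp_ge_k[of k] by simp
  show ?thesis
  proof (rule exI[of _ "n0 + pp k"], intro allI impI)
    fix n and K :: "nat hypergraph"
    assume n: "n0 + pp k \<le> n" and K: "balanced_blowup k (pp k) n K"
    obtain c where c: "finite (verts K)" "card (verts K) = n" "c ` verts K \<subseteq> {..<pp k}"
      "edges K = trans (verts K) c k" "balanced (pp k) (\<lambda>i. card (cls (verts K) c i))"
      by (rule balanced_blowup_trans[OF pp_pos K])
    have kgK: "kg k (verts K) (edges K)" unfolding c(4) by (rule trans_kg[OF c(1)])
    have cK: "real (card (edges K)) = turan (pp k) k n"
      unfolding c(4) card_trans[OF c(1,3)]
      by (rule turan_balanced[OF pp_pos c(5)]) (use sum_cls[OF c(1,3)] c(2) in simp)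
    have free: "free_of (Ext k (expansion k T)) K"
      by (rule Ext_free_of_coloured[OF c(3)]) (use c(4) card_verts_expansion[OF k] in \<open>auto simp: trans_def\<close>)
    have col: "\<exists>d. d ` verts H \<subseteq> {..<pp k} \<and> (\<forall>e\<in>edges H. inj_on d e)"
      if H: "r_graph k H" "card (verts H) = n" "free_of (Ext k (expansion k T)) H" "turan (pp k) k n \<le> card (edges H)"
      for H :: "nat hypergraph"
    proof -
      have kgH: "kg k (verts H) (edges H)" using H(1) by (simp add: r_graph_kg)
      have xf: "xfree k (edges H)" by (rule xfree_of_free[OF k kgH H(3)])
      have nH: "n0 \<le> card (verts H)" using n H(2) by simp
      have "turan (pp k) k (card (verts H)) \<le> card (edges H)" using H(2,4) by simp
      then show ?thesis by (rule n0[THEN spec, THEN spec, THEN mp, OF kgH, THEN mp, OF xf, THEN mp, OF nH, THEN mp])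
    qed
    have le: "real (card (edges H)) \<le> turan (pp k) k n"
      if H: "r_graph k H" "card (verts H) = n" "free_of (Ext k (expansion k T)) H" for H :: "nat hypergraph"
    proof (rule ccontr)
      assume "\<not> ?thesis"
      then have gt: "turan (pp k) k n < card (edges H)" by simp
      then obtain d where "d ` verts H \<subseteq> {..<pp k}" "\<forall>e\<in>edges H. inj_on d e" using col[OF H] by auto
      then show False using coloured_card_le(1)[OF k pp_pos H(1)[unfolded r_graph_kg]] H(2) gt by force
    qed
    have "extremal k (Ext k (expansion k T)) n K"
      unfolding extremal_def
    proof (intro conjI allI impI)
      fix H :: "nat hypergraph"
      assume "r_graph k H \<and> card (verts H) = n \<and> free_of (Ext k (expansion k T)) H"
      then have "real (card (edges H)) \<le> real (card (edges K))" using le cK by metis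
      then show "card (edges H) \<le> card (edges K)" by simp
    qed (use kgK c(2) free in \<open>simp_all add: r_graph_kg\<close>)
    moreover have "isomorphic G K" if G: "extremal k (Ext k (expansion k T)) n G" for G :: "nat hypergraph"
    proof -
      have G': "r_graph k G" "card (verts G) = n" "free_of (Ext k (expansion k T)) G"
        using G by (simp_all add: extremal_def)
      have "card (edges K) \<le> card (edges G)"
        using G kgK c(2) free by (simp add: extremal_def r_graph_kg)
      then have big: "turan (pp k) k n \<le> card (edges G)" using cK by linarith
      obtain d where d: "d ` verts G \<subseteq> {..<pp k}" "\<forall>e\<in>edges G. inj_on d e" using col[OF G' big] by blast
      have kgG: "kg k (verts G) (edges G)" using G'(1) by (simp add: r_graph_kg)
      have "edges G = trans (verts G) d k \<and> balanced (pp k) (\<lambda>i. card (cls (verts G) d i))"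
        by (rule coloured_card_le(2)[OF k pp_pos kgG d kp]) (use n G'(2) big in simp_all)
      then show ?thesis
        using trans_isomorphic[OF pp_pos kg_finite_verts[OF kgG] d(1) _ _ c(1,3,4,5)] G'(2) c(2) by simp
    qed
    ultimately show "extremal k (Ext k (expansion k T)) n K \<and>
      (\<forall>G :: nat hypergraph. extremal k (Ext k (expansion k T)) n G \<longrightarrow> isomorphic G K)" by blast
  qed
qed

end

theorem theorem1p2:
  "\<forall>r\<ge>2. \<exists>M. \<forall>T :: nat hypergraph.
     erdos_sos_tree T \<and> card (verts T) \<ge> M \<longrightarrow>
     (\<exists>n0. \<forall>n\<ge>n0. \<forall>K :: nat hypergraph.
        balanced_blowup r (card (verts T) + r - 3) n K \<longrightarrow>
        extremal r (Ext r (expansion r T)) n K \<and>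
        (\<forall>G :: nat hypergraph.
           extremal r (Ext r (expansion r T)) n G \<longrightarrow> isomorphic G K))"
proof (intro allI impI)
  fix r :: nat assume r: "2 \<le> r"
  show "\<exists>M. \<forall>T :: nat hypergraph.
     erdos_sos_tree T \<and> card (verts T) \<ge> M \<longrightarrow>
     (\<exists>n0. \<forall>n\<ge>n0. \<forall>K :: nat hypergraph.
        balanced_blowup r (card (verts T) + r - 3) n K \<longrightarrow>
        extremal r (Ext r (expansion r T)) n K \<and>
        (\<forall>G :: nat hypergraph.
           extremal r (Ext r (expansion r T)) n G \<longrightarrow> isomorphic G K))"
  \<comment> \<open>The bound that makes \<open>phi\<close> monotone in the cap for all uniformities
    from two up to \<open>r\<close>; it also gives the four vertices required by
    \<open>estree\<close>.\<close>
  proof (rule exI[of _ "4 * r\<^sup>2 + 4"], intro allI impI)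
    fix T :: "nat hypergraph"
    assume T: "erdos_sos_tree T \<and> card (verts T) \<ge> 4 * r\<^sup>2 + 4"
    interpret estree T by unfold_locales (use T in auto)
    show "\<exists>n0. \<forall>n\<ge>n0. \<forall>K :: nat hypergraph.
        balanced_blowup r (card (verts T) + r - 3) n K \<longrightarrow>
        extremal r (Ext r (expansion r T)) n K \<and>
        (\<forall>G :: nat hypergraph.
           extremal r (Ext r (expansion r T)) n G \<longrightarrow> isomorphic G K)"
      using extremal_blowup[OF r] T unfolding pp_def t_def by simp
  qed
qed

end
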